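(* Let $\mu$ be a CHG-shaped order function and $r_1:=\operatorname{ord}\mu$. The trace operator \[\mathrm{Tr}^{(r_1)}\phi:=(\mathrm{Tr}_0\phi,\mathrm{Tr}_1\phi,\dots,\mathrm{Tr}_{r_1-1}\phi),\qquad \mathrm{Tr}_j\phi(t,x'):=\partial_n^j\phi(t,x',0),\] initially defined on smooth functions, extends to a bounded linear operator \[\mathrm{Tr}^{(r_1)}:\overline{H}^\mu_\perp(G_+)\to T^\mu_\perp(G^{n-1}).\] Furthermore, it admits a bounded linear right-inverse $E^\mu:T^\mu_\perp(G^{n-1})\to\overline{H}^\mu_\perp(G_+)$.
   Context: Fix $T>0$, $n\in\mathbb{N}$. Let $\mathbb{T}=\mathbb{R}/T\mathbb{Z}$, $G=\mathbb{T}\times\mathbb{R}^n$, $G_+=\mathbb{T}\times\{x\in\mathbb{R}^n:x_n>0\}$, $G^{n-1}=\mathbb{T}\times\mathbb{R}^{n-1}$. Smooth functions here means elements of $C_c^\infty(\overline{G_+})$ (restrictions to $\overline{G_+}$ of functions in $C_c^\infty(G)$) which are purely oscillatory. Order functions and spaces. Let $o_y(\gamma):=\max\{1,y\gamma\}$ for $\gamma>0$, $y\ge0$; real constants denote constant functions of $\gamma\in(0,\infty)$. A strictly positive order function is a function $\mu(\gamma)=\max_{1\le j\le J+1}(r_j+\gamma s_j)$, where $(r_0,s_0)=(0,0),(r_1,s_1),\dots,(r_{J+1},s_{J+1})$ are the vertices, counter-clockwise, of a Newton polygon, i.e. of the convex hull of a finite nonempty set $E\subset[0,\infty)^2$ together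 with $(0,0)$ and the projections $(x,0),(0,y)$ of all $(x,y)\in E$ (if the polygon is $\{(0,0)\}$, put $J=0$, $(r_1,s_1)=(0,0)$). The polygon is determined by $\mu$, and $\operatorname{ord}\mu:=r_1$. With $\langle\tau\rangle=(1+\tau^2)^{1/2}$, $\langle\xi\rangle=(1+|\xi|^2)^{1/2}$, set $w_\mu(\tau,\xi)=\sum_{j=1}^{J+1}\langle\tau\rangle^{s_j}\langle\xi\rangle^{r_j}$. For $d\in\{n,n-1\}$, $H^\mu(\mathbb{T}\times\mathbb{R}^d)$ is the space of $f\in L^2(\mathbb{T}\times\mathbb{R}^d)$ with $\|f\|_\mu:=\|w_\mu\mathcal{F}f\|_{L^2(\frac{2\pi}{T}\mathbb{Z}\times\mathbb{R}^d)}<\infty$, $\mathcal{F}$ being the Fourier transform on $\mathbb{T}\times\mathbb{R}^d$. The subscript $\perp$ denotes the subspace of (purely oscillatory) elements with vanishing temporal mean. $\overline{H}^\mu_\perp(G_+)$ is the space of restrictions to $G_+$ of elements of $H^\mu_\perp(G)$, with the quotient norm. CHG-shaped. Let $r_1>r_2\ge0$ be integers and $s_2\ge0$ real. Set $\gamma_1^\perp:=\frac{s_2}{r_2-r_1}\le0$. The order function of the Newton polygon with vertices $(0,0),(r_1,0),(r_2,s_2),(0,s_2)$ is $\mu=(r_1-r_2)\,o_{-\gamma_1^\perp}+r_2$, and order functions of this form are called CHG-shaped; $\operatorname{ord}\mu=r_1$. Trace space. For such $\mu$ and $j\in\{0,\dots,r_1-1\}$ let \[T_j(\mu):=\begin{cases}(r_1-r_2)\,o_{-\gamma_1^\perp}+r_2-j-\tfrac12,&j\in\{0,\dots,r_2-1\},\\(r_1-j-\tfrac12)\,o_{-\gamma_1^\perp},&j\in\{r_2,\dots,r_1-1\},\end{cases}\]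 and $T^\mu_\perp(G^{n-1}):=\prod_{j=0}^{r_1-1}H^{T_j(\mu)}_\perp(G^{n-1})$. *)

theory Defs
  imports "HOL-Analysis.Analysis" "HOL-Library.Function_Algebras"
begin

section \<open>Newton polygons and order functions\<close>

text \<open>Order functions are functions of \<open>\<gamma> > 0\<close>; as total functions on the reals, only their
  values at positive arguments are ever used.\<close>

definition o_fun :: "real \<Rightarrow> real \<Rightarrow> real" where
  "o_fun y \<gamma> = max 1 (y * \<gamma>)"

definition newton_generators :: "(real \<times> real) set \<Rightarrow> (real \<times> real) set" where
  "newton_generators E = insert (0, 0) (E \<union> (\<lambda>(x, y). (x, 0)) ` E \<union> (\<lambda>(x, y). (0, y)) ` E)"

definition newton_polygon :: "(real \<times> real) set \<Rightarrow> bool" where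
  "newton_polygon P \<longleftrightarrow>
    (\<exists>E. finite E \<and> E \<noteq> {} \<and> E \<subseteq> {0..} \<times> {0..} \<and> P = convex hull (newton_generators E))"

text \<open>The vertices \<open>(r\<^sub>1, s\<^sub>1), \<dots>, (r\<^bsub>J+1\<^esub>, s\<^bsub>J+1\<^esub>)\<close>: the origin \<open>(r\<^sub>0, s\<^sub>0)\<close>, which is a vertex of
  every Newton polygon, is left out, except that the trivial polygon has \<open>(r\<^sub>1, s\<^sub>1) = (0, 0)\<close>.\<close>

definition newton_vertices :: "(real \<times> real) set \<Rightarrow> (real \<times> real) set" where
  "newton_vertices P =
    (if P = {(0, 0)} then {(0, 0)} else {v. v extreme_point_of P} - {(0, 0)})"

definition order_function_of :: "(real \<times> real) set \<Rightarrow> real \<Rightarrow> real" where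
  "order_function_of P \<gamma> = Max ((\<lambda>(r, s). r + \<gamma> * s) ` newton_vertices P)"

definition polygon_of :: "(real \<Rightarrow> real) \<Rightarrow> (real \<times> real) set" where
  "polygon_of \<mu> = (THE P. newton_polygon P \<and> (\<forall>\<gamma>>0. \<mu> \<gamma> = order_function_of P \<gamma>))"

text \<open>The order is \<open>r\<^sub>1\<close>, where \<open>(r\<^sub>1, s\<^sub>1)\<close> is the counter-clockwise successor of the origin, that is,
  the vertex \<open>v\<close> such that the polygon lies to the left of the directed line from the origin
  through \<open>v\<close>.\<close>

definition order_ord :: "(real \<Rightarrow> real) \<Rightarrow> real" where
  "order_ord \<mu> = fst (THE v. v \<in> newton_vertices (polygon_of \<mu>) \<and>
     (\<forall>w\<in>polygon_of \<mu>. 0 \<le> fst v * snd w - snd v * fst w))"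

definition chg_gamma :: "nat \<Rightarrow> nat \<Rightarrow> real \<Rightarrow> real" where
  "chg_gamma r1 r2 s2 = s2 / (real r2 - real r1)"

definition chg_order :: "nat \<Rightarrow> nat \<Rightarrow> real \<Rightarrow> real \<Rightarrow> real" where
  "chg_order r1 r2 s2 \<gamma> = (real r1 - real r2) * o_fun (- chg_gamma r1 r2 s2) \<gamma> + real r2"

definition trace_order :: "nat \<Rightarrow> nat \<Rightarrow> real \<Rightarrow> nat \<Rightarrow> real \<Rightarrow> real" where
  "trace_order r1 r2 s2 j \<gamma> =
    (if j < r2 then (real r1 - real r2) * o_fun (- chg_gamma r1 r2 s2) \<gamma> + real r2 - real j - 1/2
     else (real r1 - real j - 1/2) * o_fun (- chg_gamma r1 r2 s2) \<gamma>)"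

text \<open>A Newton polygon is determined by its order function, so that \<open>polygon_of\<close> is
  well defined.\<close>

lemma newton_polygon_basics:
  assumes "newton_polygon P"
  shows "compact P" "convex P" "(0, 0) \<in> P" "P \<subseteq> {0..} \<times> {0..}"
    "finite {v. v extreme_point_of P}"
    "\<And>x y. (x, y) \<in> P \<Longrightarrow> (x, 0) \<in> P \<and> (0, y) \<in> P"
proof -
  obtain E where E: "finite E" "E \<subseteq> {0..} \<times> {0..}" "P = convex hull (newton_generators E)"
    using assms by (auto simp: newton_polygon_def)
  have fin: "finite (newton_generators E)"
    using E(1) by (auto simp: newton_generators_def)
  show "compact P" using fin E(3) by (simp add: finite_imp_compact_convex_hull)
  show "convex P" using E(3) by simp
  show "(0, 0) \<in> P" using E(3) by (auto simp: newton_generators_def intro: hull_inc)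
  have "newton_generators E \<subseteq> {0..} \<times> {0..}"
    using E(2) by (auto simp: newton_generators_def)
  then show "P \<subseteq> {0..} \<times> {0..}"
    unfolding E(3) by (rule hull_minimal) (simp add: convex_Times)
  have "{v. v extreme_point_of P} \<subseteq> newton_generators E"
    unfolding E(3) using extreme_point_of_convex_hull by blast
  then show "finite {v. v extreme_point_of P}" using fin finite_subset by blast
  have l1: "linear (\<lambda>z::real\<times>real. (fst z, 0::real))" and l2: "linear (\<lambda>z::real\<times>real. (0::real, snd z))"
    by (auto intro!: linearI)
  have g1: "(\<lambda>z. (fst z, 0)) ` newton_generators E \<subseteq> newton_generators E"
    and g2: "(\<lambda>z. (0, snd z)) ` newton_generators E \<subseteq> newton_generators E"
    by (force simp: newton_generators_def)+
  show "(x, 0) \<in> P \<and> (0, y) \<in> P" if "(x, y) \<in> P" for x y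
  proof
    have "(\<lambda>z. (fst z, 0)) ` P \<subseteq> P"
      unfolding E(3) convex_hull_linear_image[OF l1] by (rule hull_mono[OF g1])
    then show "(x, 0) \<in> P" using that by force
    have "(\<lambda>z. (0, snd z)) ` P \<subseteq> P"
      unfolding E(3) convex_hull_linear_image[OF l2] by (rule hull_mono[OF g2])
    then show "(0, y) \<in> P" using that by force
  qed
qed

lemma newton_vertices_basics:
  assumes "newton_polygon P"
  shows "finite (newton_vertices P)" "newton_vertices P \<noteq> {}" "newton_vertices P \<subseteq> P"
    "P = convex hull (insert (0, 0) (newton_vertices P))"
proof -
  note b = newton_polygon_basics[OF assms]
  have KM: "P = convex hull {v. v extreme_point_of P}"
    using Krein_Milman_Minkowski b(1,2) by blast
  show "finite (newton_vertices P)" using b(5) by (simp add: newton_vertices_def)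
  show sub: "newton_vertices P \<subseteq> P"
    using b(3) by (auto simp: newton_vertices_def extreme_point_of_def)
  show "newton_vertices P \<noteq> {}"
  proof
    assume *: "newton_vertices P = {}"
    then have "P \<noteq> {(0, 0)}" "{v. v extreme_point_of P} \<subseteq> {(0, 0)}"
      by (auto simp: newton_vertices_def split: if_splits)
    then have "P \<subseteq> convex hull {(0, 0)}" using KM hull_mono by metis
    then show False using b(3) \<open>P \<noteq> {(0, 0)}\<close> by auto
  qed
  have "{v. v extreme_point_of P} \<subseteq> insert (0, 0) (newton_vertices P)"
    using b(3) by (auto simp: newton_vertices_def extreme_point_of_def)
  then have "P \<subseteq> convex hull (insert (0, 0) (newton_vertices P))"
    using KM hull_mono by metis
  moreover have "convex hull (insert (0, 0) (newton_vertices P)) \<subseteq> P"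
    using sub b(2,3) by (intro hull_minimal) auto
  ultimately show "P = convex hull (insert (0, 0) (newton_vertices P))" by blast
qed

lemma order_function_of_greatest:
  assumes "newton_polygon P" "0 < \<gamma>"
  shows "\<exists>v\<in>P. order_function_of P \<gamma> = fst v + \<gamma> * snd v"
    "\<And>v. v \<in> P \<Longrightarrow> fst v + \<gamma> * snd v \<le> order_function_of P \<gamma>"
proof -
  note b = newton_polygon_basics[OF assms(1)] and v = newton_vertices_basics[OF assms(1)]
  let ?f = "\<lambda>(r, s). r + \<gamma> * s :: real"
  have "order_function_of P \<gamma> \<in> ?f ` newton_vertices P"
    unfolding order_function_of_def by (rule Max_in) (use v in auto)
  then show ex: "\<exists>v\<in>P. order_function_of P \<gamma> = fst v + \<gamma> * snd v"
    using v(3) by (force simp: case_prod_beta)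
  then have nonneg: "0 \<le> order_function_of P \<gamma>" using b(4) assms(2) by force
  let ?H = "{z. (1, \<gamma>) \<bullet> z \<le> order_function_of P \<gamma>}"
  have "newton_vertices P \<subseteq> ?H"
    using v(1) by (force simp: order_function_of_def intro!: Max_ge)
  then have "insert (0, 0) (newton_vertices P) \<subseteq> ?H" using nonneg by auto
  then have "P \<subseteq> ?H"
    by (subst v(4)) (rule hull_minimal, auto intro: convex_halfspace_le)
  then show "fst v + \<gamma> * snd v \<le> order_function_of P \<gamma>" if "v \<in> P" for v
    using that by (cases v) auto
qed

lemma newton_polygon_eq_order_function:
  assumes "newton_polygon P"
  shows "P = {(x, y). 0 \<le> x \<and> 0 \<le> y \<and> (\<forall>\<gamma>>0. x + \<gamma> * y \<le> order_function_of P \<gamma>)}" (is "_ = ?R")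
proof
  note b = newton_polygon_basics[OF assms]
  show "P \<subseteq> ?R" using b(4) order_function_of_greatest(2)[OF assms] by force
  show "?R \<subseteq> P"
  proof (rule ccontr)
    assume "\<not> ?R \<subseteq> P"
    then obtain x y where xy: "0 \<le> x" "0 \<le> y" "\<And>\<gamma>. 0 < \<gamma> \<Longrightarrow> x + \<gamma> * y \<le> order_function_of P \<gamma>"
      and "(x, y) \<notin> P" by auto
    then obtain a c where ac: "inner a (x, y) < c" "\<And>z. z \<in> P \<Longrightarrow> c < inner a z"
      using separating_hyperplane_closed_point[OF b(2) compact_imp_closed[OF b(1)]] by blast
    define p q where "p = max 0 (- fst a)" and "q = max 0 (- snd a)"
    have z: "- c < p * x + q * y"
    proof -
      have "- fst a * x \<le> p * x" "- snd a * y \<le> q * y"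
        unfolding p_def q_def using xy by (intro mult_right_mono; simp)+
      then show ?thesis using ac(1) by (cases a) auto
    qed
    have w: "p * fst v + q * snd v < - c" if "v \<in> P" for v
    proof -
      obtain v1 v2 where v: "v = (v1, v2)" by force
      have "(v1, 0) \<in> P" "(0, v2) \<in> P" using b(6) that v by auto
      with that v ac(2)[of "(v1, v2)"] ac(2)[of "(v1, 0)"] ac(2)[of "(0, v2)"] ac(2)[OF b(3)]
      show ?thesis by (cases a) (auto simp: p_def q_def max_def)
    qed
    obtain B where B: "\<And>v. v \<in> P \<Longrightarrow> norm v \<le> B" and "0 < B"
      using b(1) by (meson bounded_pos compact_imp_bounded)
    define e where "e = (p * x + q * y + c) / (2 * B)"
    have e: "0 < e" using z \<open>0 < B\<close> by (simp add: e_def)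
    have pq: "0 < p + e" "0 < q + e" using e by (auto simp: p_def q_def)
    define \<gamma> where "\<gamma> = (q + e) / (p + e)"
    have "0 < \<gamma>" using pq by (simp add: \<gamma>_def)
    then obtain v where v: "v \<in> P" "order_function_of P \<gamma> = fst v + \<gamma> * snd v"
      using order_function_of_greatest(1)[OF assms] by blast
    have "\<bar>fst v\<bar> \<le> B" "\<bar>snd v\<bar> \<le> B"
      using B[OF v(1)] norm_fst_le[of "fst v" "snd v"] norm_snd_le[of "snd v" "fst v"] by auto
    then have "e * (fst v + snd v) \<le> e * (2 * B)" using e by (intro mult_left_mono) auto
    also have "\<dots> = p * x + q * y + c" using \<open>0 < B\<close> by (simp add: e_def)
    finally have "(p + e) * fst v + (q + e) * snd v < p * x + q * y"
      using w[OF v(1)] by (simp add: algebra_simps)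
    also have "\<dots> \<le> (p + e) * x + (q + e) * y" using e xy by (simp add: algebra_simps)
    finally have "((p + e) * fst v + (q + e) * snd v) / (p + e) < ((p + e) * x + (q + e) * y) / (p + e)"
      using pq by (intro divide_strict_right_mono) auto
    moreover have "((p + e) * a + (q + e) * b) / (p + e) = a + \<gamma> * b" for a b
      using pq by (simp add: \<gamma>_def divide_simps)
    ultimately have "fst v + \<gamma> * snd v < x + \<gamma> * y" by simp
    then show False using xy(3)[OF \<open>0 < \<gamma>\<close>] v(2) by simp
  qed
qed

lemma polygon_of_eqI:
  assumes "newton_polygon P" "\<And>\<gamma>. 0 < \<gamma> \<Longrightarrow> \<mu> \<gamma> = order_function_of P \<gamma>"
  shows "polygon_of \<mu> = P"
  unfolding polygon_of_def
proof (rule the_equality)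
  show "newton_polygon P \<and> (\<forall>\<gamma>>0. \<mu> \<gamma> = order_function_of P \<gamma>)" using assms by blast
  fix Q assume Q: "newton_polygon Q \<and> (\<forall>\<gamma>>0. \<mu> \<gamma> = order_function_of Q \<gamma>)"
  then have "\<forall>\<gamma>>0. order_function_of Q \<gamma> = order_function_of P \<gamma>" using assms(2) by simp
  then show "Q = P"
    using newton_polygon_eq_order_function[of Q] newton_polygon_eq_order_function[OF assms(1)] Q
    by auto
qed

lemma order_function_of_hull:
  assumes "finite E" "E \<noteq> {}" "E \<subseteq> {0..} \<times> {0..}" "0 < \<gamma>"
  shows "order_function_of (convex hull (newton_generators E)) \<gamma> = Max ((\<lambda>(r, s). r + \<gamma> * s) ` E)"
    (is "_ = ?M")
proof -
  define P where "P = convex hull (newton_generators E)"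
  have P: "newton_polygon P" using assms by (auto simp: newton_polygon_def P_def)
  have M: "r + \<gamma> * s \<le> ?M" if "(r, s) \<in> E" for r s
    using that assms(1) by (intro Max_ge) (auto intro!: image_eqI)
  have "(1, \<gamma>) \<bullet> z \<le> ?M" if "z \<in> newton_generators E" for z
  proof -
    obtain r s where rs: "(r, s) \<in> E" "fst z \<le> r" "snd z \<le> s"
    proof (cases "z = (0, 0)")
      case True
      obtain r s where "(r, s) \<in> E" using assms(2) by auto
      then show ?thesis using that True assms(3) by auto
    next
      case False
      with \<open>z \<in> newton_generators E\<close> assms(3) that show ?thesis
        by (fastforce simp: newton_generators_def)
    qed
    have "\<gamma> * snd z \<le> \<gamma> * s" using rs assms(4) by simp
    then show ?thesis using M[OF rs(1)] rs(2) by (cases z) auto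
  qed
  then have sub: "P \<subseteq> {z. (1, \<gamma>) \<bullet> z \<le> ?M}"
    unfolding P_def by (intro hull_minimal) (auto intro: convex_halfspace_le)
  obtain v where "v \<in> P" "order_function_of P \<gamma> = fst v + \<gamma> * snd v"
    using order_function_of_greatest(1)[OF P assms(4)] by blast
  then have le: "order_function_of P \<gamma> \<le> ?M" using sub by (cases v) auto
  have "?M \<in> (\<lambda>(r, s). r + \<gamma> * s) ` E" using assms by (intro Max_in) auto
  then obtain r s where "(r, s) \<in> E" "?M = r + \<gamma> * s" by auto
  moreover have "(r, s) \<in> P"
    using \<open>(r, s) \<in> E\<close> by (auto simp: P_def newton_generators_def intro: hull_inc)
  ultimately have "?M \<le> order_function_of P \<gamma>"
    using order_function_of_greatest(2)[OF P assms(4)] by fastforce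
  with le show ?thesis by (simp add: P_def)
qed

lemma polygon_of_chg_order:
  assumes "r2 < r1" "0 \<le> s2"
  shows "polygon_of (chg_order r1 r2 s2) =
    convex hull {(0, 0), (real r1, 0), (real r2, s2), (0, s2)}"
proof -
  let ?E = "{(real r1, 0), (real r2, s2)}"
  let ?Q = "convex hull {(0, 0), (real r1, 0), (real r2, s2), (0, s2)}"
  have P: "newton_polygon (convex hull (newton_generators ?E))"
    unfolding newton_polygon_def using assms by (intro exI[of _ ?E]) auto
  have "polygon_of (chg_order r1 r2 s2) = convex hull (newton_generators ?E)"
  proof (rule polygon_of_eqI[OF P])
    fix \<gamma> :: real assume "0 < \<gamma>"
    then have "order_function_of (convex hull (newton_generators ?E)) \<gamma> = max (real r1) (real r2 + \<gamma> * s2)"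
      using assms by (subst order_function_of_hull) (auto simp: max.commute)
    moreover have "(real r1 - real r2) * max 1 (s2 / (real r1 - real r2) * \<gamma>)
        = max (real r1 - real r2) (s2 * \<gamma>)"
      using assms by (simp add: max_mult_distrib_left)
    moreover have "- chg_gamma r1 r2 s2 = s2 / (real r1 - real r2)"
      by (simp add: chg_gamma_def minus_divide_right)
    ultimately show "chg_order r1 r2 s2 \<gamma> = order_function_of (convex hull (newton_generators ?E)) \<gamma>"
      by (simp add: chg_order_def o_fun_def max_def algebra_simps)
  qed
  also have "\<dots> = ?Q"
  proof
    have 0: "(0, 0) \<in> ?Q" and 1: "(real r1, 0) \<in> ?Q" by (auto intro: hull_inc)
    have "(1 - real r2 / real r1) *\<^sub>R (0, 0) + (real r2 / real r1) *\<^sub>R (real r1, 0) \<in> ?Q"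
      using assms by (intro convexD[OF convex_convex_hull 0 1]) auto
    then have "(real r2, 0) \<in> ?Q" using assms by simp
    then have "newton_generators ?E \<subseteq> ?Q"
      by (auto simp: newton_generators_def intro: hull_inc)
    then show "convex hull (newton_generators ?E) \<subseteq> ?Q" by (intro hull_minimal) auto
    show "?Q \<subseteq> convex hull (newton_generators ?E)"
      by (intro hull_mono) (auto simp: newton_generators_def)
  qed
  finally show ?thesis .
qed

lemma order_ord_chg_order:
  assumes "r2 < r1" "0 \<le> s2"
  shows "order_ord (chg_order r1 r2 s2) = real r1"
proof -
  define P where "P = convex hull {(0, 0), (real r1, 0), (real r2, s2), (0, s2)}"
  have Peq: "polygon_of (chg_order r1 r2 s2) = P"
    using polygon_of_chg_order[OF assms] by (simp add: P_def)
  have "P \<subseteq> {0..real r1} \<times> {0..}"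
    unfolding P_def using assms by (intro hull_minimal) (auto simp: convex_Times)
  then have bnd: "0 \<le> x" "x \<le> real r1" "0 \<le> y" if "(x, y) \<in> P" for x y
    using that by auto
  have in0: "(0, 0) \<in> P" and in1: "(real r1, 0) \<in> P" by (auto simp: P_def intro: hull_inc)
  have r1: "0 < real r1" using assms by simp
  have ext: "(real r1, 0) extreme_point_of P"
    unfolding extreme_point_of_def
  proof (intro conjI ballI notI in1)
    fix a b assume ab: "a \<in> P" "b \<in> P" "(real r1, 0) \<in> open_segment a b"
    obtain a1 a2 b1 b2 where [simp]: "a = (a1, a2)" "b = (b1, b2)" by force
    obtain u where u: "0 < u" "u < 1" "real r1 = (1 - u) * a1 + u * b1" "0 = (1 - u) * a2 + u * b2"
      and ne: "a \<noteq> b"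
      using ab(3) by (auto simp: in_segment)
    have "a1 \<le> r1" "b1 \<le> r1" "0 \<le> a2" "0 \<le> b2" using ab bnd by auto
    moreover have "(1 - u) * (r1 - a1) + u * (r1 - b1) = 0" using u by (simp add: algebra_simps)
    ultimately have "(1 - u) * (r1 - a1) = 0" "u * (r1 - b1) = 0" "(1 - u) * a2 = 0" "u * b2 = 0"
      using u by (smt (verit) mult_nonneg_nonneg)+
    then show False using ne u by auto
  qed
  have "(THE v. v \<in> newton_vertices P \<and> (\<forall>w\<in>P. 0 \<le> fst v * snd w - snd v * fst w)) = (real r1, 0)"
  proof (rule the_equality)
    have "P \<noteq> {(0, 0)}" using in1 r1 by auto
    then have V: "newton_vertices P = {v. v extreme_point_of P} - {(0, 0)}"
      by (simp add: newton_vertices_def)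
    show "(real r1, 0) \<in> newton_vertices P \<and>
        (\<forall>w\<in>P. 0 \<le> fst (real r1, 0::real) * snd w - snd (real r1, 0::real) * fst w)"
      using ext r1 bnd by (auto simp: V)
    fix v assume v: "v \<in> newton_vertices P \<and> (\<forall>w\<in>P. 0 \<le> fst v * snd w - snd v * fst w)"
    obtain v1 v2 where v12: "v = (v1, v2)" by force
    have vP: "(v1, v2) \<in> P" and vext: "(v1, v2) extreme_point_of P" and "v \<noteq> (0, 0)"
      using v by (auto simp: V v12 extreme_point_of_def)
    have "v2 * real r1 \<le> 0" using v in1 by (force simp: v12)
    then have "v2 = 0" using bnd(3)[OF vP] r1 by (simp add: mult_le_0_iff)
    then have v1: "0 < v1" using bnd(1)[OF vP] \<open>v \<noteq> (0, 0)\<close> v12 by auto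
    have "v1 = r1"
    proof (rule ccontr)
      assume "v1 \<noteq> r1"
      then have "v1 < r1" using bnd(2)[OF vP] by simp
      then have "(v1, 0) \<in> open_segment (0, 0) (real r1, 0)"
        using v1 r1 by (auto simp: in_segment intro!: exI[of _ "v1 / r1"])
      then show False using vext in0 in1 \<open>v2 = 0\<close> by (auto simp: extreme_point_of_def)
    qed
    then show "v = (real r1, 0)" using v12 \<open>v2 = 0\<close> by simp
  qed
  then show ?thesis by (simp add: order_ord_def Peq)
qed

lemma trace_order_eq_order_function:
  assumes "r2 < r1" "0 \<le> s2" "j < r1"
  shows "\<exists>P. newton_polygon P \<and> (\<forall>\<gamma>>0. trace_order r1 r2 s2 j \<gamma> = order_function_of P \<gamma>)"
proof -
  define g where "g = - chg_gamma r1 r2 s2"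
  have g: "g = s2 / (real r1 - real r2)" by (simp add: g_def chg_gamma_def minus_divide_right)
  then have g0: "0 \<le> g" and s2: "(real r1 - real r2) * g = s2" using assms by auto
  define E where "E = (if j < r2 then {(real r1 - real j - 1/2, 0), (real r2 - real j - 1/2, s2)}
    else {(real r1 - real j - 1/2, 0), (0, (real r1 - real j - 1/2) * g)})"
  have pos: "1 \<le> real r1 - real j" "j < r2 \<Longrightarrow> 1 \<le> real r2 - real j" using assms by auto
  have E: "finite E" "E \<noteq> {}" "E \<subseteq> {0..} \<times> {0..}"
    using assms g0 pos by (auto simp: E_def)
  have "trace_order r1 r2 s2 j \<gamma> = order_function_of (convex hull (newton_generators E)) \<gamma>"
    if "0 < \<gamma>" for \<gamma>
  proof -
    have 1: "(real r1 - real r2) * max 1 (g * \<gamma>) = max (real r1 - real r2) (s2 * \<gamma>)"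
      using assms by (simp add: max_mult_distrib_left flip: s2)
    have 2: "(real r1 - real j - 1/2) * max 1 (g * \<gamma>)
        = max (real r1 - real j - 1/2) ((real r1 - real j - 1/2) * g * \<gamma>)"
      using pos by (simp add: max_mult_distrib_left)
    show ?thesis
      unfolding order_function_of_hull[OF E that] trace_order_def o_fun_def g_def[symmetric] 1 2
      by (auto simp: E_def max_def algebra_simps)
  qed
  then show ?thesis
    using E by (intro exI[of _ "convex hull (newton_generators E)"]) (auto simp: newton_polygon_def)
qed


section \<open>Square-integrable functions on the torus times a Euclidean space\<close>

text \<open>A point of \<open>\<real>\<^sup>d\<close> is an extensional function on \<open>{..<d}\<close>, which admits \<open>d = 0\<close>; the coordinate
  \<open>x\<^sub>n\<close> of \<open>x \<in> \<real>\<^sup>n\<close> is \<open>x (n - 1)\<close>. A function on the torus of length \<open>T\<close> is a \<open>T\<close>-periodic function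
  on the reals.\<close>

type_synonym point = "real \<times> (nat \<Rightarrow> real)"

abbreviation euclid :: "nat \<Rightarrow> (nat \<Rightarrow> real) set" where
  "euclid d \<equiv> PiE {..<d} (\<lambda>_. UNIV)"

abbreviation lebesgue_euclid :: "nat \<Rightarrow> (nat \<Rightarrow> real) measure" where
  "lebesgue_euclid d \<equiv> PiM {..<d} (\<lambda>_. lborel)"

definition group_measure :: "real \<Rightarrow> nat \<Rightarrow> point measure" where
  "group_measure T d = restrict_space lborel {0..<T} \<Otimes>\<^sub>M lebesgue_euclid d"

definition dual_measure :: "real \<Rightarrow> nat \<Rightarrow> point measure" where
  "dual_measure T d = count_space (range (\<lambda>k::int. 2 * pi / T * of_int k)) \<Otimes>\<^sub>M lebesgue_euclid d"

definition square_integrable :: "'a measure \<Rightarrow> ('a \<Rightarrow> complex) \<Rightarrow> bool" where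
  "square_integrable M f \<longleftrightarrow> f \<in> borel_measurable M \<and> integrable M (\<lambda>z. (cmod (f z))\<^sup>2)"

definition l2_norm :: "'a measure \<Rightarrow> ('a \<Rightarrow> complex) \<Rightarrow> real" where
  "l2_norm M f = sqrt (\<integral>z. (cmod (f z))\<^sup>2 \<partial>M)"

definition time_periodic :: "real \<Rightarrow> nat \<Rightarrow> (point \<Rightarrow> complex) \<Rightarrow> bool" where
  "time_periodic T d f \<longleftrightarrow> (\<forall>t. \<forall>x\<in>euclid d. f (t + T, x) = f (t, x))"

definition group_L2 :: "real \<Rightarrow> nat \<Rightarrow> (point \<Rightarrow> complex) set" where
  "group_L2 T d = {f. time_periodic T d f \<and> square_integrable (group_measure T d) f}"


section \<open>Fourier transform\<close>

definition fourier_integral :: "real \<Rightarrow> nat \<Rightarrow> (point \<Rightarrow> complex) \<Rightarrow> point \<Rightarrow> complex" where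
  "fourier_integral T d f = (\<lambda>(\<tau>, \<xi>).
     of_real (1 / T) * (\<integral>z. f z * cis (- (\<tau> * fst z + (\<Sum>i<d. \<xi> i * snd z i))) \<partial>group_measure T d))"

definition truncate :: "nat \<Rightarrow> real \<Rightarrow> (point \<Rightarrow> complex) \<Rightarrow> point \<Rightarrow> complex" where
  "truncate d R f = (\<lambda>z. if \<forall>i<d. \<bar>snd z i\<bar> \<le> R then f z else 0)"

text \<open>The continuous extension of the Fourier integral from \<open>L\<^sup>1 \<inter> L\<^sup>2\<close> to \<open>L\<^sup>2\<close> (Plancherel), obtained
  as the \<open>L\<^sup>2\<close> limit of the transforms of the truncated functions. It is determined up to null
  sets. The \<open>L\<^sup>2\<close> distances are written with the nonnegative integral, since the Bochner integral
  of a non-integrable function is \<open>0\<close>.\<close>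

definition fourier :: "real \<Rightarrow> nat \<Rightarrow> (point \<Rightarrow> complex) \<Rightarrow> point \<Rightarrow> complex" where
  "fourier T d f = (SOME g. square_integrable (dual_measure T d) g \<and>
     (\<lambda>k. \<integral>\<^sup>+z. ennreal ((cmod (fourier_integral T d (truncate d (real k) f) z - g z))\<^sup>2)
            \<partial>dual_measure T d) \<longlonglongrightarrow> 0)"


section \<open>Sobolev spaces\<close>

text \<open>Elements of the spaces below are representatives: two of them denote the same element iff they
  agree almost everywhere (on the half space, for functions there), and the norms are seminorms on
  representatives.\<close>

definition order_weight :: "nat \<Rightarrow> (real \<Rightarrow> real) \<Rightarrow> point \<Rightarrow> real" where
  "order_weight d \<mu> = (\<lambda>(\<tau>, \<xi>). \<Sum>(r, s)\<in>newton_vertices (polygon_of \<mu>).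
     sqrt (1 + \<tau>\<^sup>2) powr s * sqrt (1 + (\<Sum>i<d. (\<xi> i)\<^sup>2)) powr r)"

definition weighted_fourier :: "real \<Rightarrow> nat \<Rightarrow> (real \<Rightarrow> real) \<Rightarrow> (point \<Rightarrow> complex) \<Rightarrow> point \<Rightarrow> complex"
  where "weighted_fourier T d \<mu> f = (\<lambda>z. of_real (order_weight d \<mu> z) * fourier T d f z)"

definition sobolev :: "real \<Rightarrow> nat \<Rightarrow> (real \<Rightarrow> real) \<Rightarrow> (point \<Rightarrow> complex) set" where
  "sobolev T d \<mu> =
    {f \<in> group_L2 T d. square_integrable (dual_measure T d) (weighted_fourier T d \<mu> f)}"

definition sobolev_norm :: "real \<Rightarrow> nat \<Rightarrow> (real \<Rightarrow> real) \<Rightarrow> (point \<Rightarrow> complex) \<Rightarrow> real" where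
  "sobolev_norm T d \<mu> f = l2_norm (dual_measure T d) (weighted_fourier T d \<mu> f)"

definition sobolev_osc :: "real \<Rightarrow> nat \<Rightarrow> (real \<Rightarrow> real) \<Rightarrow> (point \<Rightarrow> complex) set" where
  "sobolev_osc T d \<mu> =
    {f \<in> sobolev T d \<mu>. AE x in lebesgue_euclid d. (LBINT t:{0..<T}. f (t, x)) = 0}"

definition half_space_eq :: "real \<Rightarrow> nat \<Rightarrow> (point \<Rightarrow> complex) \<Rightarrow> (point \<Rightarrow> complex) \<Rightarrow> bool" where
  "half_space_eq T n u f \<longleftrightarrow> (AE z in group_measure T n. 0 < snd z (n - 1) \<longrightarrow> u z = f z)"

text \<open>A function on the half space is given by a total function whose values elsewhere are
  irrelevant.\<close>

definition half_sobolev_osc :: "real \<Rightarrow> nat \<Rightarrow> (real \<Rightarrow> real) \<Rightarrow> (point \<Rightarrow> complex) set" where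
  "half_sobolev_osc T n \<mu> = {u. \<exists>f\<in>sobolev_osc T n \<mu>. half_space_eq T n u f}"

definition half_sobolev_norm :: "real \<Rightarrow> nat \<Rightarrow> (real \<Rightarrow> real) \<Rightarrow> (point \<Rightarrow> complex) \<Rightarrow> real" where
  "half_sobolev_norm T n \<mu> u =
    Inf (sobolev_norm T n \<mu> ` {f \<in> sobolev_osc T n \<mu>. half_space_eq T n u f})"

definition trace_space :: "real \<Rightarrow> nat \<Rightarrow> nat \<Rightarrow> nat \<Rightarrow> real \<Rightarrow> (nat \<Rightarrow> point \<Rightarrow> complex) set" where
  "trace_space T n r1 r2 s2 =
    {g. \<forall>j<r1. g j \<in> sobolev_osc T (n - 1) (trace_order r1 r2 s2 j)}"

definition trace_norm :: "real \<Rightarrow> nat \<Rightarrow> nat \<Rightarrow> nat \<Rightarrow> real \<Rightarrow> (nat \<Rightarrow> point \<Rightarrow> complex) \<Rightarrow> real" where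
  "trace_norm T n r1 r2 s2 g = (\<Sum>j<r1. sobolev_norm T (n - 1) (trace_order r1 r2 s2 j) (g j))"


section \<open>Smooth functions and their normal derivatives\<close>

definition time_deriv :: "(point \<Rightarrow> complex) \<Rightarrow> point \<Rightarrow> complex" where
  "time_deriv f = (\<lambda>(t, x). vector_derivative (\<lambda>s. f (s, x)) (at t))"

definition space_deriv :: "nat \<Rightarrow> (point \<Rightarrow> complex) \<Rightarrow> point \<Rightarrow> complex" where
  "space_deriv i f = (\<lambda>(t, x). vector_derivative (\<lambda>s. f (t, x(i := s))) (at (x i)))"

primrec k_smooth :: "nat \<Rightarrow> nat \<Rightarrow> (point \<Rightarrow> complex) \<Rightarrow> bool" where
  "k_smooth d 0 f \<longleftrightarrow> continuous_on (UNIV \<times> euclid d) f"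
| "k_smooth d (Suc k) f \<longleftrightarrow> continuous_on (UNIV \<times> euclid d) f \<and>
    (\<forall>t. \<forall>x\<in>euclid d. (\<lambda>s. f (s, x)) differentiable (at t) \<and>
      (\<forall>i<d. (\<lambda>s. f (t, x(i := s))) differentiable (at (x i)))) \<and>
    k_smooth d k (time_deriv f) \<and> (\<forall>i<d. k_smooth d k (space_deriv i f))"

definition test_functions :: "real \<Rightarrow> nat \<Rightarrow> (point \<Rightarrow> complex) set" where
  "test_functions T d = {f. time_periodic T d f \<and> (\<forall>k. k_smooth d k f) \<and>
     (\<exists>R. \<forall>t. \<forall>x\<in>euclid d. (\<exists>i<d. R < \<bar>x i\<bar>) \<longrightarrow> f (t, x) = 0)}"

text \<open>A smooth function on the closed half space is represented by any of its extensions in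
  \<open>test_functions\<close>; oscillation is required on the closed half space only.\<close>

definition half_test_functions_osc :: "real \<Rightarrow> nat \<Rightarrow> (point \<Rightarrow> complex) set" where
  "half_test_functions_osc T n = {f \<in> test_functions T n.
     \<forall>x\<in>euclid n. 0 \<le> x (n - 1) \<longrightarrow> (LBINT t:{0..<T}. f (t, x)) = 0}"

definition normal_trace :: "nat \<Rightarrow> nat \<Rightarrow> (point \<Rightarrow> complex) \<Rightarrow> point \<Rightarrow> complex" where
  "normal_trace n j f = (\<lambda>(t, x'). (space_deriv (n - 1) ^^ j) f (t, x'(n - 1 := 0)))"


section \<open>Bounded linear operators\<close>

class complex_scale =
  fixes cscale :: "complex \<Rightarrow> 'a \<Rightarrow> 'a"

instantiation complex :: complex_scale
begin
definition "cscale c (z :: complex) = c * z"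
instance ..
end

instantiation "fun" :: (type, complex_scale) complex_scale
begin
definition "cscale c f = (\<lambda>x. cscale c (f x))"
instance ..
end

text \<open>A bounded complex-linear operator between the normed spaces of classes of \<open>V\<close> modulo \<open>p = 0\<close>
  and of \<open>W\<close> modulo \<open>q = 0\<close>, given on representatives. By boundedness and linearity it respects
  the equivalences.\<close>

definition bounded_linear_mod ::
  "'a set \<Rightarrow> ('a \<Rightarrow> real) \<Rightarrow> 'b set \<Rightarrow> ('b \<Rightarrow> real) \<Rightarrow>
   ('a::{ab_group_add, complex_scale} \<Rightarrow> 'b::{ab_group_add, complex_scale}) \<Rightarrow> bool" where
  "bounded_linear_mod V p W q A \<longleftrightarrow>
    A ` V \<subseteq> W \<and>
    (\<forall>u\<in>V. \<forall>v\<in>V. q (A (u + v) - (A u + A v)) = 0) \<and>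
    (\<forall>c. \<forall>u\<in>V. q (A (cscale c u) - cscale c (A u)) = 0) \<and>
    (\<exists>C. \<forall>u\<in>V. q (A u) \<le> C * p u)"

end

theory Submission
  imports Defs "HOL-Probability.Characteristic_Functions" "HOL-Probability.Sinc_Integral"
begin

text \<open>For fixed \<open>\<tau>\<close> and \<open>\<xi>'\<close>, the transform of the \<open>j\<close>-th trace is the moment
  \<open>1/(2\<pi>) \<integral> (i\<eta>)\<^sup>j F(\<tau>, \<xi>', \<eta>) d\<eta>\<close> of the transform \<open>F\<close> in the normal frequency \<open>\<eta>\<close>. The weights of \<open>H\<^sup>\<mu>\<close> and
  of the trace spaces are such that, with a suitable width \<open>K = K\<^sub>j(\<tau>, \<xi>')\<close>, the squared quotient of the trace
  weight times \<open>\<bar>\<eta>\<bar>\<^sup>j\<close> by the weight of \<open>H\<^sup>\<mu>\<close> is dominated by the Poisson kernel \<open>K/(K\<^sup>2 + \<eta>\<^sup>2)\<close>, whose integral is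
  \<open>\<pi>\<close>; so the Cauchy-Schwarz inequality bounds the moments. They depend on the restriction to the half space only: if
  \<open>f\<close> vanishes for \<open>x\<^sub>n > 0\<close>, then \<open>F\<close> is orthogonal to the transforms of the indicators of intervals in
  \<open>(0, \<infinity>)\<close>, and difference quotients of these approximate the derivatives of the Dirac measure at \<open>0\<close>. A right
  inverse multiplies the transform of \<open>g\<^sub>j\<close> by \<open>K\<^bsup>-j-1\<^esup> \<kappa>\<^sub>j(\<eta>/K)\<close>, where the \<open>\<kappa>\<^sub>j\<close> are bounded, have compact
  support, and are dual to the moments of order below \<open>r\<^sub>1\<close>.\<close>

text \<open>The transform of the definitions is a choice of an L2 limit, so Plancherel on the
  product group carries the whole argument. It is built from the circle and the line by tensor
  products, in both directions, because surjectivity is what produces traces and extensions as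
  functions. Elements are representatives and both operators are obtained by choice; linearity and
  the right-inverse identity are therefore proved for transforms and carried back by Plancherel. The
  width is dictated by the weight. Beyond the tangential frequency B the weight grows in \<eta> like
  \<eta>^r2 while \<eta> stays below the time scale, and like \<eta>^r1 afterwards. Hence the square
  of \<eta>^j over the weight has its mass near |\<eta>| = B if j < r2, and near the larger of B and
  the time scale if j \<ge> r2; this is the case distinction in the trace orders. The \<kappa>_j may
  be discontinuous, since the weighted norms see only the size of a symbol; a support of length K
  costs exactly what the normalisation K^(-j-1) gains.\<close>

abbreviation L2 :: "'a measure \<Rightarrow> ('a \<Rightarrow> complex) \<Rightarrow> bool" where
  "L2 \<equiv> square_integrable"

text \<open>Valued in \<open>ennreal\<close>, so that it makes sense before square integrability is
  known; its finiteness is the usual proof of membership in L2.\<close>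

abbreviation energy :: "'a measure \<Rightarrow> ('a \<Rightarrow> complex) \<Rightarrow> ennreal" where
  "energy M f \<equiv> \<integral>\<^sup>+z. ennreal ((cmod (f z))\<^sup>2) \<partial>M"

abbreviation weighted :: "('a \<Rightarrow> real) \<Rightarrow> ('a \<Rightarrow> complex) \<Rightarrow> 'a \<Rightarrow> complex" (infixl \<open>\<odot>\<close> 70) where
  "w \<odot> F \<equiv> \<lambda>z. of_real (w z) * F z"

section \<open>Square-integrable functions\<close>

lemma L2D [measurable_dest]:
  "L2 M f \<Longrightarrow> f \<in> borel_measurable M"
  by (simp add: square_integrable_def)

lemma L2_integrable:
  "L2 M f \<Longrightarrow> integrable M (\<lambda>z. (cmod (f z))\<^sup>2)"
  by (simp add: square_integrable_def)

lemma L2_iff_nn: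
  assumes [measurable]: "f \<in> borel_measurable M"
  shows "L2 M f \<longleftrightarrow> energy M f < \<infinity>"
  by (simp add: square_integrable_def integrable_iff_bounded)

lemma l2_norm_nonneg [simp]: "0 \<le> l2_norm M f"
  by (simp add: l2_norm_def)

lemma l2_norm_sq: "(l2_norm M f)\<^sup>2 = (\<integral>z. (cmod (f z))\<^sup>2 \<partial>M)"
  by (simp add: l2_norm_def)

lemma nn_integral_l2:
  assumes "L2 M f"
  shows "energy M f = ennreal ((l2_norm M f)\<^sup>2)"
  using L2_integrable[OF assms] by (simp add: l2_norm_sq nn_integral_eq_integral)

lemma l2_normI:
  assumes [measurable]: "f \<in> borel_measurable M"
    and "energy M f = ennreal (r\<^sup>2)" "0 \<le> r"
  shows "L2 M f" "l2_norm M f = r"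
proof -
  show s: "L2 M f" using assms by (simp add: L2_iff_nn)
  have "(l2_norm M f)\<^sup>2 = r\<^sup>2" using nn_integral_l2[OF s] assms by simp
  then show "l2_norm M f = r" using assms(3) by simp
qed

text \<open>One energy estimate yields membership and the norm bound together; most of the L2
  estimates below end here.\<close>

lemma l2_norm_leI:
  assumes [measurable]: "f \<in> borel_measurable M"
    and le: "energy M f \<le> ennreal (r\<^sup>2)" and r: "0 \<le> r"
  shows "L2 M f" "l2_norm M f \<le> r"
proof -
  show s: "L2 M f" using le by (auto simp: L2_iff_nn intro: le_less_trans)
  have "(l2_norm M f)\<^sup>2 \<le> r\<^sup>2" using nn_integral_l2[OF s] le by simp
  then show "l2_norm M f \<le> r" using r by (rule power2_le_imp_le)
qed

lemma l2_norm_cong_AE: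
  assumes "f \<in> borel_measurable M" "g \<in> borel_measurable M" "AE z in M. f z = g z"
  shows "l2_norm M f = l2_norm M g"
  unfolding l2_norm_def using assms by (intro arg_cong[of _ _ sqrt] integral_cong_AE) auto

lemma L2_cong_AE:
  assumes "L2 M f" "g \<in> borel_measurable M" "AE z in M. f z = g z"
  shows "L2 M g"
proof -
  have "integrable M (\<lambda>z. (cmod (g z))\<^sup>2)"
    by (rule integrable_cong_AE_imp[OF L2_integrable[OF assms(1)]]) (use assms in auto)
  then show ?thesis using assms by (simp add: square_integrable_def)
qed

lemma L2_cong:
  assumes "\<And>z. z \<in> space M \<Longrightarrow> f z = g z"
  shows "L2 M f \<longleftrightarrow> L2 M g"
  unfolding square_integrable_def
  using measurable_cong[of M f g borel] Bochner_Integration.integrable_cong[OF refl, of M "\<lambda>z. (cmod (f z))\<^sup>2" "\<lambda>z. (cmod (g z))\<^sup>2"] assms by auto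

lemma l2_norm_cong:
  assumes "\<And>z. z \<in> space M \<Longrightarrow> f z = g z"
  shows "l2_norm M f = l2_norm M g"
  unfolding l2_norm_def using assms by (intro arg_cong[of _ _ sqrt] Bochner_Integration.integral_cong) auto

lemma L2_bound:
  assumes "L2 M g" "f \<in> borel_measurable M" "AE z in M. cmod (f z) \<le> C * cmod (g z)"
  shows "L2 M f" "l2_norm M f \<le> \<bar>C\<bar> * l2_norm M g"
proof -
  note [measurable] = assms(2) L2D[OF assms(1)]
  have "energy M f \<le> (\<integral>\<^sup>+z. ennreal (C\<^sup>2) * ennreal ((cmod (g z))\<^sup>2) \<partial>M)"
    using assms(3)
  proof (intro nn_integral_mono_AE, eventually_elim)
    case (elim z)
    then have "(cmod (f z))\<^sup>2 \<le> (C * cmod (g z))\<^sup>2" by (intro power_mono) auto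
    then show ?case by (simp add: power_mult_distrib flip: ennreal_mult)
  qed
  also have "\<dots> = ennreal (C\<^sup>2) * ennreal ((l2_norm M g)\<^sup>2)"
    by (simp add: nn_integral_cmult nn_integral_l2[OF assms(1)])
  also have "\<dots> = ennreal ((\<bar>C\<bar> * l2_norm M g)\<^sup>2)" by (simp add: power_mult_distrib flip: ennreal_mult)
  finally have *: "energy M f \<le> ennreal ((\<bar>C\<bar> * l2_norm M g)\<^sup>2)" .
  show "L2 M f" "l2_norm M f \<le> \<bar>C\<bar> * l2_norm M g"
    by (rule l2_norm_leI[OF assms(2) *]; simp)+
qed

lemma L2_mono:
  assumes "L2 M g" "f \<in> borel_measurable M" "AE z in M. cmod (f z) \<le> cmod (g z)"
  shows "L2 M f" "l2_norm M f \<le> l2_norm M g"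
  using L2_bound[of M g f 1] assms by auto

lemma L2_zero [simp]: "L2 M (\<lambda>z. 0)"
  by (simp add: square_integrable_def)

lemma l2_norm_zero [simp]: "l2_norm M (\<lambda>z. 0) = 0"
  by (simp add: l2_norm_def)

lemma L2_cmult [simp, intro]:
  assumes "L2 M f"
  shows "L2 M (\<lambda>z. c * f z)"
  by (rule L2_bound[OF assms, of _ "cmod c"]) (use assms in \<open>auto simp: norm_mult\<close>)

lemma l2_norm_cmult: "l2_norm M (\<lambda>z. c * f z) = cmod c * l2_norm M f"
  by (simp add: l2_norm_def norm_mult power_mult_distrib real_sqrt_mult)

lemma L2_mult_integrable:
  assumes "L2 M f" "L2 M g"
  shows "integrable M (\<lambda>z. f z * g z)"
proof (rule Bochner_Integration.integrable_bound)
  show "integrable M (\<lambda>z. (cmod (f z))\<^sup>2 + (cmod (g z))\<^sup>2)"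
    using assms by (simp add: square_integrable_def)
  show "(\<lambda>z. f z * g z) \<in> borel_measurable M" using assms by measurable
  have "x * y \<le> x\<^sup>2 + y\<^sup>2" if "0 \<le> x" "0 \<le> y" for x y :: real
    using sum_squares_bound[of x y] mult_nonneg_nonneg[OF that] by linarith
  then show "AE z in M. norm (f z * g z) \<le> norm ((cmod (f z))\<^sup>2 + (cmod (g z))\<^sup>2)"
    by (auto simp: norm_mult)
qed

lemma borel_measurable_cnj [measurable (raw)]:
  "f \<in> borel_measurable M \<Longrightarrow> (\<lambda>z. cnj (f z)) \<in> borel_measurable M"
  by (rule measurable_compose[OF _ borel_measurable_continuous_onI]) (auto intro: continuous_intros)

lemma L2_cnj [simp]: "L2 M (\<lambda>z. cnj (f z)) \<longleftrightarrow> L2 M f"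
proof -
  have "L2 M (\<lambda>z. cnj (f z))" if "L2 M f" for f
    by (rule L2_mono[OF that]) (use that in auto)
  from this[of f] this[of "\<lambda>z. cnj (f z)"] show ?thesis by auto
qed

lemma l2_norm_cnj [simp]: "l2_norm M (\<lambda>z. cnj (f z)) = l2_norm M f"
  by (simp add: l2_norm_def)

lemma l2_cauchy_schwarz_abs:
  assumes "L2 M f" "L2 M g"
  shows "(\<integral>z. cmod (f z) * cmod (g z) \<partial>M) \<le> l2_norm M f * l2_norm M g"
proof -
  note [measurable] = L2D[OF assms(1)] L2D[OF assms(2)]
  let ?I = "\<integral>z. cmod (f z) * cmod (g z) \<partial>M"
  have i: "integrable M (\<lambda>z. cmod (f z) * cmod (g z))"
    using integrable_norm[OF L2_mult_integrable[OF assms]] by (simp add: norm_mult)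
  have I: "(\<integral>\<^sup>+z. ennreal (cmod (f z)) * ennreal (cmod (g z)) \<partial>M) = ennreal ?I"
    using nn_integral_eq_integral[OF i] by (simp add: ennreal_mult)
  have "(ennreal ?I)\<^sup>2 \<le> ennreal ((l2_norm M f)\<^sup>2) * ennreal ((l2_norm M g)\<^sup>2)"
    using Cauchy_Schwarz_nn_integral[of "\<lambda>z. ennreal (cmod (f z))" M "\<lambda>z. ennreal (cmod (g z))"]
    by (simp add: I ennreal_power nn_integral_l2 assms)
  moreover have "0 \<le> ?I" by (intro integral_nonneg_AE) auto
  ultimately have "?I\<^sup>2 \<le> (l2_norm M f * l2_norm M g)\<^sup>2"
    by (simp add: ennreal_power power_mult_distrib flip: ennreal_mult)
  then show ?thesis by (rule power2_le_imp_le) simp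
qed

lemma l2_cauchy_schwarz:
  assumes "L2 M f" "L2 M g"
  shows "cmod (\<integral>z. f z * g z \<partial>M) \<le> l2_norm M f * l2_norm M g"
proof -
  have "cmod (\<integral>z. f z * g z \<partial>M) \<le> (\<integral>z. cmod (f z * g z) \<partial>M)" by (rule integral_norm_bound)
  also have "\<dots> \<le> l2_norm M f * l2_norm M g" using l2_cauchy_schwarz_abs[OF assms] by (simp add: norm_mult)
  finally show ?thesis .
qed

lemma L2_add [simp, intro]:
  assumes "L2 M f" "L2 M g"
  shows "L2 M (\<lambda>z. f z + g z)"
proof -
  have i: "integrable M (\<lambda>z. 2 * (cmod (f z))\<^sup>2 + 2 * (cmod (g z))\<^sup>2)"
    using assms by (simp add: square_integrable_def)
  have b: "(cmod (a + b))\<^sup>2 \<le> 2 * (cmod a)\<^sup>2 + 2 * (cmod b)\<^sup>2" for a b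
  proof -
    have "(cmod (a + b))\<^sup>2 \<le> (cmod a + cmod b)\<^sup>2" by (intro power_mono norm_triangle_ineq) auto
    also have "\<dots> \<le> 2 * (cmod a)\<^sup>2 + 2 * (cmod b)\<^sup>2"
      using sum_squares_bound[of "cmod a" "cmod b"] by (simp add: power2_sum)
    finally show ?thesis .
  qed
  have "integrable M (\<lambda>z. (cmod (f z + g z))\<^sup>2)"
    by (rule Bochner_Integration.integrable_bound[OF i])
      (use assms b in \<open>auto simp: abs_of_nonneg intro!: borel_measurable_power borel_measurable_norm\<close>)
  moreover have "(\<lambda>z. f z + g z) \<in> borel_measurable M" using assms by measurable
  ultimately show ?thesis by (simp add: square_integrable_def)
qed

text \<open>Minkowski from Cauchy-Schwarz: for h = f + g one has |h|^2 \<le> |h| |f| + |h| |g|, and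
  one factor, the norm of h, is cancelled after integration.\<close>

lemma l2_norm_triangle:
  assumes "L2 M f" "L2 M g"
  shows "l2_norm M (\<lambda>z. f z + g z) \<le> l2_norm M f + l2_norm M g"
proof -
  let ?h = "\<lambda>z. f z + g z"
  note [measurable] = L2D[OF assms(1)] L2D[OF assms(2)]
  have h: "L2 M ?h" using assms by simp
  have i: "integrable M (\<lambda>z. cmod (?h z) * cmod (f z))" "integrable M (\<lambda>z. cmod (?h z) * cmod (g z))"
    using integrable_norm[OF L2_mult_integrable[OF h assms(1)]]
      integrable_norm[OF L2_mult_integrable[OF h assms(2)]] by (simp_all add: norm_mult)
  have "(l2_norm M ?h)\<^sup>2 = (\<integral>z. (cmod (?h z))\<^sup>2 \<partial>M)" by (simp add: l2_norm_sq)
  also have "\<dots> \<le> (\<integral>z. cmod (?h z) * cmod (f z) + cmod (?h z) * cmod (g z) \<partial>M)"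
    using i L2_integrable[OF h]
    by (intro integral_mono Bochner_Integration.integrable_add)
      (auto simp: power2_eq_square mult_left_mono norm_triangle_ineq simp flip: distrib_left)
  also have "\<dots> \<le> l2_norm M ?h * (l2_norm M f + l2_norm M g)"
    using i l2_cauchy_schwarz_abs[OF h assms(1)] l2_cauchy_schwarz_abs[OF h assms(2)]
    by (simp add: distrib_left)
  finally have *: "l2_norm M ?h * l2_norm M ?h \<le> l2_norm M ?h * (l2_norm M f + l2_norm M g)"
    by (simp add: power2_eq_square)
  show ?thesis
  proof (cases "l2_norm M ?h = 0")
    case False
    then have "0 < l2_norm M ?h" using l2_norm_nonneg[of M ?h] by linarith
    then show ?thesis using * by simp
  qed simp
qed

lemma L2_diff [simp, intro]:
  assumes "L2 M f" "L2 M g"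
  shows "L2 M (\<lambda>z. f z - g z)"
  using L2_add[OF assms(1) L2_cmult[OF assms(2), of "-1"]] by simp

lemma L2_sum [simp, intro]:
  "(\<And>i. i \<in> I \<Longrightarrow> L2 M (f i)) \<Longrightarrow> L2 M (\<lambda>z. \<Sum>i\<in>I. f i z)"
  by (induction I rule: infinite_finite_induct) auto

lemma l2_norm_sum:
  "finite I \<Longrightarrow> (\<And>i. i \<in> I \<Longrightarrow> L2 M (f i)) \<Longrightarrow>
    l2_norm M (\<lambda>z. \<Sum>i\<in>I. f i z) \<le> (\<Sum>i\<in>I. l2_norm M (f i))"
  by (induction I rule: finite_induct) (auto intro!: order_trans[OF l2_norm_triangle])

lemma l2_norm_minus_commute: "l2_norm M (\<lambda>z. f z - g z) = l2_norm M (\<lambda>z. g z - f z)"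
  by (simp add: l2_norm_def norm_minus_commute)

lemma l2_norm_triangle_diff:
  assumes "L2 M f" "L2 M g" "L2 M h"
  shows "l2_norm M (\<lambda>z. f z - h z) \<le> l2_norm M (\<lambda>z. f z - g z) + l2_norm M (\<lambda>z. g z - h z)"
  using l2_norm_triangle[of M "\<lambda>z. f z - g z" "\<lambda>z. g z - h z"] assms by simp

lemma l2_norm_diff_abs:
  assumes "L2 M f" "L2 M g"
  shows "\<bar>l2_norm M f - l2_norm M g\<bar> \<le> l2_norm M (\<lambda>z. f z - g z)"
  using l2_norm_triangle_diff[OF assms(1) assms(2), of "\<lambda>_. 0"]
    l2_norm_triangle_diff[OF assms(2) assms(1), of "\<lambda>_. 0"] l2_norm_minus_commute[of M f g] by auto

lemma l2_norm_eq_0_iff: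
  assumes "L2 M f"
  shows "l2_norm M f = 0 \<longleftrightarrow> (AE z in M. f z = 0)"
proof -
  have "l2_norm M f = 0 \<longleftrightarrow> (\<integral>z. (cmod (f z))\<^sup>2 \<partial>M) = 0" by (simp add: l2_norm_def)
  also have "\<dots> \<longleftrightarrow> (AE z in M. (cmod (f z))\<^sup>2 = 0)"
    by (rule integral_nonneg_eq_0_iff_AE[OF L2_integrable[OF assms]]) auto
  finally show ?thesis by simp
qed

lemma l2_norm_tendsto:
  assumes "\<And>i. L2 M (s i)" "L2 M f"
    and "(\<lambda>i. l2_norm M (\<lambda>z. s i z - f z)) \<longlonglongrightarrow> 0"
  shows "(\<lambda>i. l2_norm M (s i)) \<longlonglongrightarrow> l2_norm M f"
proof -
  have "(\<lambda>i. l2_norm M (s i) - l2_norm M f) \<longlonglongrightarrow> 0"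
    by (rule Lim_null_comparison[OF _ assms(3)]) (use l2_norm_diff_abs[OF assms(1,2)] in auto)
  then show ?thesis by (simp add: LIM_zero_iff)
qed

lemma l2_limit_unique:
  assumes "\<And>i. L2 M (s i)" "L2 M f" "L2 M g"
    and "(\<lambda>i. l2_norm M (\<lambda>z. s i z - f z)) \<longlonglongrightarrow> 0" "(\<lambda>i. l2_norm M (\<lambda>z. s i z - g z)) \<longlonglongrightarrow> 0"
  shows "AE z in M. f z = g z"
proof -
  have "(\<lambda>i. l2_norm M (\<lambda>z. s i z - f z) + l2_norm M (\<lambda>z. s i z - g z)) \<longlonglongrightarrow> 0"
    using tendsto_add[OF assms(4,5)] by simp
  moreover have "l2_norm M (\<lambda>z. f z - g z) \<le> l2_norm M (\<lambda>z. s i z - f z) + l2_norm M (\<lambda>z. s i z - g z)" for i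
    using l2_norm_triangle_diff[OF assms(2) assms(1) assms(3), of i] l2_norm_minus_commute[of M f "s i"] by simp
  ultimately have "l2_norm M (\<lambda>z. f z - g z) \<le> 0"
    by (intro tendsto_lowerbound[OF _ _ sequentially_bot]) auto
  then have "l2_norm M (\<lambda>z. f z - g z) = 0" using l2_norm_nonneg[of M "\<lambda>z. f z - g z"] by linarith
  then show ?thesis using l2_norm_eq_0_iff[of M "\<lambda>z. f z - g z"] assms(2,3) by simp
qed

lemma l2_dominated_convergence:
  assumes f: "f \<in> borel_measurable M" and s: "\<And>i. s i \<in> borel_measurable M"
    and g: "L2 M g"
    and lim: "AE z in M. (\<lambda>i. s i z) \<longlonglongrightarrow> f z"
    and bnd: "\<And>i. AE z in M. cmod (s i z - f z) \<le> cmod (g z)"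
  shows "(\<lambda>i. l2_norm M (\<lambda>z. s i z - f z)) \<longlonglongrightarrow> 0"
proof -
  have "(\<lambda>i. \<integral>z. (cmod (s i z - f z))\<^sup>2 \<partial>M) \<longlonglongrightarrow> (\<integral>z. 0 \<partial>M)"
  proof (rule integral_dominated_convergence)
    show "integrable M (\<lambda>z. (cmod (g z))\<^sup>2)" using g by (rule L2_integrable)
    show "AE z in M. (\<lambda>i. (cmod (s i z - f z))\<^sup>2) \<longlonglongrightarrow> 0"
      using lim
    proof eventually_elim
      case (elim z)
      then have "(\<lambda>i. (cmod (s i z - f z))\<^sup>2) \<longlonglongrightarrow> (cmod (f z - f z))\<^sup>2" by (intro tendsto_intros)
      then show ?case by simp
    qed
    show "AE z in M. norm ((cmod (s i z - f z))\<^sup>2) \<le> (cmod (g z))\<^sup>2" for i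
      using bnd[of i] by eventually_elim (auto intro: power_mono)
  qed (use f s in auto)
  then show ?thesis using tendsto_real_sqrt by (fastforce simp: l2_norm_def)
qed

text \<open>Riesz-Fischer by the classical route: a rapidly Cauchy subsequence converges almost
  everywhere, and Fatou's lemma makes its pointwise limit the L2 limit of the full sequence.\<close>

lemma l2_complete:
  assumes s: "\<And>i. L2 M (s i)"
    and cauchy: "\<And>e. 0 < e \<Longrightarrow> \<exists>N. \<forall>i\<ge>N. \<forall>j\<ge>N. l2_norm M (\<lambda>z. s i z - s j z) < e"
  obtains g where "L2 M g" "(\<lambda>i. l2_norm M (\<lambda>z. s i z - g z)) \<longlonglongrightarrow> 0"
proof -
  note [measurable] = L2D[OF s]
  have "\<exists>r. \<forall>n. (\<forall>i\<ge>r n. \<forall>j\<ge> r n. l2_norm M (\<lambda>z. s i z - s j z) < (1/2) ^ n) \<and> r n < r (Suc n)"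
  proof (intro dependent_nat_choice)
    show "\<exists>x. \<forall>i\<ge>x. \<forall>j\<ge>x. l2_norm M (\<lambda>z. s i z - s j z) < (1/2) ^ 0" using cauchy by simp
    fix x n
    obtain N where "\<forall>i\<ge>N. \<forall>j\<ge>N. l2_norm M (\<lambda>z. s i z - s j z) < (1/2) ^ Suc n"
      using cauchy[of "(1/2) ^ Suc n"] by auto
    then show "\<exists>y. (\<forall>i\<ge>y. \<forall>j\<ge>y. l2_norm M (\<lambda>z. s i z - s j z) < (1/2) ^ Suc n) \<and> x < y"
      by (intro exI[of _ "max N (Suc x)"]) auto
  qed
  then obtain r where r: "\<And>n i j. r n \<le> i \<Longrightarrow> r n \<le> j \<Longrightarrow> l2_norm M (\<lambda>z. s i z - s j z) < (1/2) ^ n"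
    and rs: "\<And>n. r n < r (Suc n)" by blast
  have mono: "strict_mono r" using rs by (simp add: strict_mono_Suc_iff)
  \<comment> \<open>The increments have energy at most 4^-n. Weighted by 2^n the energies still have
    a finite sum, so almost everywhere |d n|^2 is at most a constant times 2^-n, and the increments
    are summable.\<close>
  define d where "d n z = s (r (Suc n)) z - s (r n) z" for n z
  have [measurable]: "d n \<in> borel_measurable M" for n unfolding d_def by measurable
  have dn: "energy M (d n) \<le> ennreal ((1/4) ^ n)" for n
  proof -
    have "L2 M (d n)" unfolding d_def using s by auto
    then have "energy M (d n) = ennreal ((l2_norm M (d n))\<^sup>2)" by (rule nn_integral_l2)
    also have "(l2_norm M (d n))\<^sup>2 \<le> ((1/2) ^ n)\<^sup>2"
      unfolding d_def by (intro power_mono less_imp_le r l2_norm_nonneg order_refl less_imp_le[OF rs])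
    also have "((1/2::real) ^ n)\<^sup>2 = (1/4) ^ n" by (simp add: power_mult[symmetric] mult.commute[of n] power_mult power_divide)
    finally show ?thesis by (simp add: ennreal_leI)
  qed
  have "(\<integral>\<^sup>+z. (\<Sum>n. ennreal (2 ^ n) * ennreal ((cmod (d n z))\<^sup>2)) \<partial>M)
      = (\<Sum>n. ennreal (2 ^ n) * energy M (d n))"
    by (subst nn_integral_suminf) (simp_all add: nn_integral_cmult)
  also have "\<dots> \<le> (\<Sum>n. ennreal (2 ^ n) * ennreal ((1/4) ^ n))"
    by (intro suminf_le mult_left_mono dn) auto
  also have "\<dots> = (\<Sum>n. ennreal ((1/2) ^ n))"
    by (simp add: ennreal_mult[symmetric] power_mult_distrib[symmetric] del: ennreal_power)
  also have "\<dots> < \<infinity>" by (simp add: suminf_ennreal2 summable_geometric del: ennreal_power)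
  finally have "AE z in M. (\<Sum>n. ennreal (2 ^ n) * ennreal ((cmod (d n z))\<^sup>2)) \<noteq> \<infinity>"
    by (intro nn_integral_noteq_infinite) auto
  then have conv: "AE z in M. convergent (\<lambda>n. s (r n) z)"
  proof eventually_elim
    case (elim z)
    define K where "K = enn2real (\<Sum>n. ennreal (2 ^ n) * ennreal ((cmod (d n z))\<^sup>2))"
    have "ennreal (2 ^ n) * ennreal ((cmod (d n z))\<^sup>2) \<le> ennreal K" for n
      using elim sum_le_suminf[of "\<lambda>n. ennreal (2 ^ n) * ennreal ((cmod (d n z))\<^sup>2)" "{n}"]
      by (simp add: K_def less_top)
    moreover have "0 \<le> K" by (simp add: K_def)
    ultimately have "2 ^ n * (cmod (d n z))\<^sup>2 \<le> K" for n
      by (simp add: ennreal_mult[symmetric] del: ennreal_power)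
    then have "(cmod (d n z))\<^sup>2 \<le> K * (1/2) ^ n" for n
      by (simp add: field_simps power_divide)
    then have b: "cmod (d n z) \<le> sqrt K * (sqrt (1/2)) ^ n" for n
      by (metis real_le_rsqrt real_sqrt_mult real_sqrt_power)
    have sm: "summable (\<lambda>n. sqrt K * (sqrt (1/2)) ^ n)" by (intro summable_mult summable_geometric) (auto simp: real_sqrt_divide)
    have "summable (\<lambda>n. d n z)" by (rule summable_comparison_test'[OF sm, of 0]) (rule b)
    then have "convergent (\<lambda>n. \<Sum>i<n. d i z)" by (simp add: summable_iff_convergent)
    moreover have "(\<Sum>i<n. d i z) = s (r n) z - s (r 0) z" for n
      unfolding d_def by (rule sum_lessThan_telescope)
    ultimately have "convergent (\<lambda>n. s (r n) z - s (r 0) z)" by simp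
    from convergent_add[OF this convergent_const[of "s (r 0) z"]] show ?case by simp
  qed
  define g where "g z = lim (\<lambda>n. s (r n) z)" for z
  have [measurable]: "g \<in> borel_measurable M" unfolding g_def by measurable
  have gl: "AE z in M. (\<lambda>n. s (r n) z) \<longlonglongrightarrow> g z"
    using conv by eventually_elim (simp add: g_def convergent_LIMSEQ_iff)
  \<comment> \<open>Fatou along the subsequence: a bound on the distances from \<open>s i\<close> to
    all late terms passes on to the distance from \<open>s i\<close> to the limit.\<close>
  have est: "L2 M (\<lambda>z. s i z - g z)" "l2_norm M (\<lambda>z. s i z - g z) \<le> e"
    if e: "0 < e" and N: "\<And>j. N \<le> j \<Longrightarrow> l2_norm M (\<lambda>z. s i z - s j z) \<le> e" for i N e
  proof -
    have "energy M (\<lambda>z. s i z - g z)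
        = (\<integral>\<^sup>+z. liminf (\<lambda>n. ennreal ((cmod (s i z - s (r n) z))\<^sup>2)) \<partial>M)"
      using gl
    proof (intro nn_integral_cong_AE, eventually_elim)
      case (elim z)
      then have "(\<lambda>n. ennreal ((cmod (s i z - s (r n) z))\<^sup>2)) \<longlonglongrightarrow> ennreal ((cmod (s i z - g z))\<^sup>2)"
        by (intro tendsto_intros tendsto_ennrealI)
      then show ?case by (rule lim_imp_Liminf[OF sequentially_bot, symmetric])
    qed
    also have "\<dots> \<le> liminf (\<lambda>n. \<integral>\<^sup>+z. ennreal ((cmod (s i z - s (r n) z))\<^sup>2) \<partial>M)"
      by (intro nn_integral_liminf) auto
    also have "\<dots> \<le> liminf (\<lambda>n. ennreal (e\<^sup>2))"
    proof (rule Liminf_mono)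
      show "\<forall>\<^sub>F n in sequentially. energy M (\<lambda>z. s i z - s (r n) z) \<le> ennreal (e\<^sup>2)"
        using eventually_ge_at_top[of N]
      proof eventually_elim
        case (elim n)
        then have "N \<le> r n" using seq_suble[OF mono, of n] by linarith
        then have "(l2_norm M (\<lambda>z. s i z - s (r n) z))\<^sup>2 \<le> e\<^sup>2" using N by (intro power_mono) auto
        then show ?case using s by (subst nn_integral_l2) (auto intro: ennreal_leI)
      qed
    qed
    also have "\<dots> = ennreal (e\<^sup>2)" by (simp add: Liminf_const)
    finally have *: "energy M (\<lambda>z. s i z - g z) \<le> ennreal (e\<^sup>2)" .
    show "L2 M (\<lambda>z. s i z - g z)" "l2_norm M (\<lambda>z. s i z - g z) \<le> e"
      by (rule l2_norm_leI[OF _ *]; use e in \<open>simp; measurable\<close>)+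
  qed
  obtain N where N: "\<forall>i\<ge>N. \<forall>j\<ge>N. l2_norm M (\<lambda>z. s i z - s j z) < 1" using cauchy[of 1] by auto
  have "L2 M (\<lambda>z. s N z - g z)" by (rule est(1)[of 1 N]) (use N in \<open>auto intro: less_imp_le\<close>)
  from L2_diff[OF s[of N] this] have g: "L2 M g" by simp
  have "(\<lambda>i. l2_norm M (\<lambda>z. s i z - g z)) \<longlonglongrightarrow> 0"
  proof (rule LIMSEQ_I)
    fix e :: real assume e: "0 < e"
    then obtain N where N: "\<forall>i\<ge>N. \<forall>j\<ge>N. l2_norm M (\<lambda>z. s i z - s j z) < e/2" using cauchy[of "e/2"] by auto
    have "l2_norm M (\<lambda>z. s i z - g z) \<le> e/2" if "N \<le> i" for i
      by (rule est(2)[of "e/2" N]) (use N that e in \<open>simp_all add: less_imp_le\<close>)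
    then show "\<exists>no. \<forall>n\<ge>no. norm (l2_norm M (\<lambda>z. s n z - g z) - 0) < e"
      using e by (intro exI[of _ N]) (auto intro: le_less_trans[of _ "e/2"])
  qed
  with g that show ?thesis by blast
qed

text \<open>The difference of the pairings splits into the pairing of s - f with t and that of f
  with t - g; the norms of t converge, so Cauchy-Schwarz makes both small.\<close>

lemma l2_inner_tendsto:
  assumes "\<And>i. L2 M (s i)" "L2 M f"
    and "\<And>i. L2 M (t i)" "L2 M g"
    and "(\<lambda>i. l2_norm M (\<lambda>z. s i z - f z)) \<longlonglongrightarrow> 0" "(\<lambda>i. l2_norm M (\<lambda>z. t i z - g z)) \<longlonglongrightarrow> 0"
  shows "(\<lambda>i. \<integral>z. s i z * cnj (t i z) \<partial>M) \<longlonglongrightarrow> (\<integral>z. f z * cnj (g z) \<partial>M)"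
proof -
  have i: "integrable M (\<lambda>z. a z * cnj (b z))" if "L2 M a" "L2 M b" for a b
    using L2_mult_integrable[of M a "\<lambda>z. cnj (b z)"] that by simp
  have cs: "cmod (\<integral>z. a z * cnj (b z) \<partial>M) \<le> l2_norm M a * l2_norm M b"
    if "L2 M a" "L2 M b" for a b
    using l2_cauchy_schwarz[of M a "\<lambda>z. cnj (b z)"] that by simp
  have b: "norm ((\<integral>z. s n z * cnj (t n z) \<partial>M) - (\<integral>z. f z * cnj (g z) \<partial>M))
     \<le> l2_norm M (\<lambda>z. s n z - f z) * l2_norm M (t n) + l2_norm M f * l2_norm M (\<lambda>z. t n z - g z)" for n
  proof -
    have "(\<integral>z. s n z * cnj (t n z) \<partial>M) - (\<integral>z. f z * cnj (g z) \<partial>M)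
        = (\<integral>z. (s n z - f z) * cnj (t n z) \<partial>M) + (\<integral>z. f z * cnj (t n z - g z) \<partial>M)"
      using i[OF assms(1)[of n] assms(3)[of n]] i[OF assms(2) assms(3)[of n]] i[OF assms(2,4)]
      by (simp add: algebra_simps)
    then show ?thesis
      using cs[OF L2_diff[OF assms(1)[of n] assms(2)] assms(3)[of n]]
        cs[OF assms(2) L2_diff[OF assms(3)[of n] assms(4)]]
      by (simp add: norm_triangle_mono)
  qed
  have "(\<lambda>n. l2_norm M (\<lambda>z. s n z - f z) * l2_norm M (t n) + l2_norm M f * l2_norm M (\<lambda>z. t n z - g z)) \<longlonglongrightarrow> 0"
    using tendsto_add[OF tendsto_mult[OF assms(5) l2_norm_tendsto[OF assms(3,4,6)]]
      tendsto_mult[OF tendsto_const[of "l2_norm M f"] assms(6)]] by simp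
  then have "(\<lambda>n. (\<integral>z. s n z * cnj (t n z) \<partial>M) - (\<integral>z. f z * cnj (g z) \<partial>M)) \<longlonglongrightarrow> 0"
    by (rule Lim_null_comparison[OF always_eventually[OF allI[OF b]]])
  then show ?thesis by (simp add: LIM_zero_iff)
qed

section \<open>Plancherel pairs\<close>

definition kernel_transform :: "'a measure \<Rightarrow> ('a \<Rightarrow> 'b \<Rightarrow> complex) \<Rightarrow> ('a \<Rightarrow> complex) \<Rightarrow> 'b \<Rightarrow> complex" where
  "kernel_transform M e f y = (\<integral>x. f x * e x y \<partial>M)"

text \<open>Stated with energies on the intersection of L1 and L2, where the integral converges;
  square integrability of the transform is then part of the conclusion. The constant is that of the
  unnormalised kernel: 2 pi for the line, T for the circle.\<close>

definition l2_isometric :: "'a measure \<Rightarrow> 'b measure \<Rightarrow> ('a \<Rightarrow> 'b \<Rightarrow> complex) \<Rightarrow> real \<Rightarrow> bool" where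
  "l2_isometric M N e c \<longleftrightarrow> (\<forall>f. integrable M f \<longrightarrow> L2 M f \<longrightarrow>
    (energy N (kernel_transform M e f))
      = ennreal c * energy M f)"

text \<open>Graph of the continuous extension to L2, with approximants that are integrable. A
  relation fits because transforms are determined only up to null sets: pairs can be combined and
  altered on null sets without choosing representatives.\<close>

definition l2_transform :: "'a measure \<Rightarrow> 'b measure \<Rightarrow> ('a \<Rightarrow> 'b \<Rightarrow> complex) \<Rightarrow>
    ('a \<Rightarrow> complex) \<Rightarrow> ('b \<Rightarrow> complex) \<Rightarrow> bool" where
  "l2_transform M N e f g \<longleftrightarrow> L2 M f \<and> L2 N g \<and>
    (\<exists>s. (\<forall>k. integrable M (s k) \<and> L2 M (s k)) \<and>
      (\<lambda>k. l2_norm M (\<lambda>x. s k x - f x)) \<longlonglongrightarrow> 0 \<and>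
      (\<lambda>k. l2_norm N (\<lambda>y. kernel_transform M e (s k) y - g y)) \<longlonglongrightarrow> 0)"

text \<open>Abstract form of the characters. Joint measurability and the bound 1 suffice to
  transform integrable functions and to apply Fubini to a pair of them.\<close>

locale bounded_kernel = M: sigma_finite_measure M + N: sigma_finite_measure N
  for M :: "'a measure" and N :: "'b measure" +
  fixes e :: "'a \<Rightarrow> 'b \<Rightarrow> complex"
  assumes kernel_measurable: "(\<lambda>(x, y). e x y) \<in> borel_measurable (M \<Otimes>\<^sub>M N)"
    and kernel_bound: "cmod (e x y) \<le> 1"
begin

sublocale pair_sigma_finite M N ..

lemma kernel_measurable_swap [measurable]: "(\<lambda>(y, x). e x y) \<in> borel_measurable (N \<Otimes>\<^sub>M M)"
  using measurable_pair_swap[OF kernel_measurable] by simp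

lemmas kernel_measurable' [measurable] = kernel_measurable

lemma kernel_transform_measurable [measurable]:
  assumes [measurable]: "f \<in> borel_measurable M"
  shows "kernel_transform M e f \<in> borel_measurable N"
  unfolding kernel_transform_def by measurable

lemma kernel_measurable1: "y \<in> space N \<Longrightarrow> (\<lambda>x. e x y) \<in> borel_measurable M"
  by measurable

lemma kernel_transform_integrable:
  assumes "integrable M f" "y \<in> space N"
  shows "integrable M (\<lambda>x. f x * e x y)"
proof (rule Bochner_Integration.integrable_bound[OF assms(1)])
  have [measurable]: "f \<in> borel_measurable M" using assms by auto
  show "(\<lambda>x. f x * e x y) \<in> borel_measurable M" using kernel_measurable1[OF assms(2)] by measurable
  show "AE x in M. norm (f x * e x y) \<le> norm (f x)"
    using kernel_bound by (auto simp: norm_mult mult_left_le)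
qed

lemma kernel_transform_add:
  assumes "integrable M f" "integrable M g" "y \<in> space N"
  shows "kernel_transform M e (\<lambda>x. f x + g x) y = kernel_transform M e f y + kernel_transform M e g y"
  unfolding kernel_transform_def
  using kernel_transform_integrable assms by (simp add: distrib_right)

lemma kernel_transform_diff:
  assumes "integrable M f" "integrable M g" "y \<in> space N"
  shows "kernel_transform M e (\<lambda>x. f x - g x) y = kernel_transform M e f y - kernel_transform M e g y"
  unfolding kernel_transform_def
  using kernel_transform_integrable assms by (simp add: left_diff_distrib)

lemma kernel_transform_cmult: "kernel_transform M e (\<lambda>x. a * f x) y = a * kernel_transform M e f y"
  unfolding kernel_transform_def by (simp add: mult.assoc)

lemma kernel_dual: "bounded_kernel N M (\<lambda>y x. cnj (e x y))"
proof unfold_locales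
  have "(\<lambda>z. cnj (case z of (y, x) \<Rightarrow> e x y)) \<in> borel_measurable (N \<Otimes>\<^sub>M M)"
    using kernel_measurable_swap by measurable
  then show "(\<lambda>(y, x). cnj (e x y)) \<in> borel_measurable (N \<Otimes>\<^sub>M M)" by (simp add: case_prod_beta)
qed (use kernel_bound in auto)

text \<open>Fubini, with |f(x)| |g(y)| as integrable majorant because the kernel is bounded by
  1.\<close>

lemma kernel_transform_adjoint:
  assumes f: "integrable M f" and g: "integrable N g"
  shows "(\<integral>y. kernel_transform M e f y * cnj (g y) \<partial>N)
    = (\<integral>x. f x * cnj (kernel_transform N (\<lambda>y x. cnj (e x y)) g x) \<partial>M)"
proof -
  have [measurable]: "f \<in> borel_measurable M" "g \<in> borel_measurable N" using f g by auto
  have fg: "integrable (M \<Otimes>\<^sub>M N) (\<lambda>(x, y). f x * cnj (g y))"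
  proof (rule Fubini_integrable)
    show "(\<lambda>(x, y). f x * cnj (g y)) \<in> borel_measurable (M \<Otimes>\<^sub>M N)" by measurable
    show "integrable M (\<lambda>x. \<integral>y. norm (case (x, y) of (x, y) \<Rightarrow> f x * cnj (g y)) \<partial>N)"
      using f by (simp add: norm_mult)
    show "AE x in M. integrable N (\<lambda>y. case (x, y) of (x, y) \<Rightarrow> f x * cnj (g y))"
      using g by simp
  qed
  have "integrable (M \<Otimes>\<^sub>M N) (\<lambda>(x, y). f x * e x y * cnj (g y))"
    by (rule Bochner_Integration.integrable_bound[OF fg])
      (use kernel_bound in \<open>auto simp: norm_mult mult_left_le mult_right_mono\<close>)
  from Fubini_integral[OF this]
  have "(\<integral>y. (\<integral>x. f x * e x y * cnj (g y) \<partial>M) \<partial>N) = (\<integral>x. (\<integral>y. f x * e x y * cnj (g y) \<partial>N) \<partial>M)" .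
  moreover have "(\<integral>y. f x * e x y * cnj (g y) \<partial>N) = f x * cnj (kernel_transform N (\<lambda>y x. cnj (e x y)) g x)" for x
    unfolding kernel_transform_def Bochner_Integration.integral_cnj[symmetric]
    by (simp add: mult.assoc mult.commute[of "e x _"])
  ultimately show ?thesis by (simp add: kernel_transform_def)
qed

end

lemma bounded_kernel_product:
  assumes "bounded_kernel M1 N1 e1" "bounded_kernel M2 N2 e2"
  shows "bounded_kernel (M1 \<Otimes>\<^sub>M M2) (N1 \<Otimes>\<^sub>M N2) (\<lambda>(x1, x2) (y1, y2). e1 x1 y1 * e2 x2 y2)"
proof -
  interpret A: bounded_kernel M1 N1 e1 by fact
  interpret B: bounded_kernel M2 N2 e2 by fact
  interpret P: pair_sigma_finite M1 M2 ..
  interpret Q: pair_sigma_finite N1 N2 ..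
  note [measurable] = A.kernel_measurable B.kernel_measurable
  have "(\<lambda>z. (\<lambda>(x, y). e1 x y) (fst (fst z), fst (snd z)) * (\<lambda>(x, y). e2 x y) (snd (fst z), snd (snd z)))
      \<in> borel_measurable ((M1 \<Otimes>\<^sub>M M2) \<Otimes>\<^sub>M (N1 \<Otimes>\<^sub>M N2))"
    by (intro borel_measurable_times measurable_compose[OF _ A.kernel_measurable]
        measurable_compose[OF _ B.kernel_measurable]) measurable
  moreover have "cmod ((\<lambda>(x1, x2) (y1, y2). e1 x1 y1 * e2 x2 y2) x y) \<le> 1" for x y
    using mult_mono[OF A.kernel_bound[of "fst x" "fst y"] B.kernel_bound[of "snd x" "snd y"]]
    by (simp add: case_prod_beta' norm_mult)
  ultimately show ?thesis
    using P.sigma_finite_measure_axioms Q.sigma_finite_measure_axioms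
    by (intro bounded_kernel.intro bounded_kernel_axioms.intro) (simp_all add: case_prod_beta')
qed

text \<open>The transform is taken one factor at a time. For almost every \<open>x2\<close> the
  transform in the first variable is isometric, Tonelli exchanges the order, and for almost every
  \<open>y1\<close> the transform in the second variable is isometric.\<close>

lemma l2_isometric_product:
  fixes M1 :: "'a measure" and N1 :: "'b measure" and M2 :: "'c measure" and N2 :: "'d measure"
  assumes k1: "bounded_kernel M1 N1 e1" and k2: "bounded_kernel M2 N2 e2"
    and i1: "l2_isometric M1 N1 e1 c1" and i2: "l2_isometric M2 N2 e2 c2" and c: "0 \<le> c1" "0 \<le> c2"
  shows "l2_isometric (M1 \<Otimes>\<^sub>M M2) (N1 \<Otimes>\<^sub>M N2) (\<lambda>(x1, x2) (y1, y2). e1 x1 y1 * e2 x2 y2) (c1 * c2)"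
  unfolding l2_isometric_def
proof (intro allI impI)
  interpret A: bounded_kernel M1 N1 e1 by fact
  interpret B: bounded_kernel M2 N2 e2 by fact
  interpret P: pair_sigma_finite M1 M2 ..
  interpret Q: pair_sigma_finite N1 N2 ..
  interpret R: pair_sigma_finite N1 M2 ..
  fix f :: "'a \<times> 'c \<Rightarrow> complex"
  assume f: "integrable (M1 \<Otimes>\<^sub>M M2) f" and f2: "L2 (M1 \<Otimes>\<^sub>M M2) f"
  let ?e = "\<lambda>(x1, x2) (y1, y2). e1 x1 y1 * e2 x2 y2"
  note [measurable] = L2D[OF f2] A.kernel_measurable B.kernel_measurable
  define g where "g y1 x2 = (\<integral>x1. f (x1, x2) * e1 x1 y1 \<partial>M1)" for y1 x2
  have g_meas [measurable]: "(\<lambda>(y1, x2). g y1 x2) \<in> borel_measurable (N1 \<Otimes>\<^sub>M M2)"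
    unfolding g_def by measurable
  have "AE x2 in M2. integrable M1 (\<lambda>x1. f (x1, x2))"
    using P.AE_integrable_snd[of "\<lambda>x y. f (x, y)"] f by simp
  moreover have "AE x2 in M2. integrable M1 (\<lambda>x1. (cmod (f (x1, x2)))\<^sup>2)"
    using P.AE_integrable_snd[of "\<lambda>x y. (cmod (f (x, y)))\<^sup>2"] L2_integrable[OF f2]
    by (simp add: case_prod_beta')
  ultimately have 1: "AE x2 in M2. energy N1 (\<lambda>y1. g y1 x2)
      = ennreal c1 * energy M1 (\<lambda>x1. f (x1, x2))"
    using AE_space
  proof eventually_elim
    case (elim x2)
    then have "L2 M1 (\<lambda>x1. f (x1, x2))" by (auto simp: square_integrable_def)
    then show ?case using i1 elim unfolding l2_isometric_def kernel_transform_def g_def by blast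
  qed
  have "(\<integral>\<^sup>+y1. energy M2 (g y1) \<partial>N1)
      = (\<integral>\<^sup>+x2. energy N1 (\<lambda>y1. g y1 x2) \<partial>M2)"
    by (rule R.Fubini'[symmetric]) simp
  also have "\<dots> = (\<integral>\<^sup>+x2. ennreal c1 * energy M1 (\<lambda>x1. f (x1, x2)) \<partial>M2)"
    by (rule nn_integral_cong_AE[OF 1])
  also have "\<dots> = ennreal c1 * energy (M1 \<Otimes>\<^sub>M M2) f"
    using P.nn_integral_snd[of "\<lambda>z. ennreal ((cmod (f z))\<^sup>2)"] by (simp add: nn_integral_cmult)
  finally have 2: "(\<integral>\<^sup>+y1. energy M2 (g y1) \<partial>N1)
      = ennreal c1 * energy (M1 \<Otimes>\<^sub>M M2) f" .
  also have "\<dots> < \<infinity>" by (simp add: nn_integral_l2[OF f2] ennreal_mult_less_top)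
  \<comment> \<open>The partial transform \<open>g y1\<close> is integrable for every
    \<open>y1\<close> but square integrable only for almost every one; the finite total energy
    supplies the latter.\<close>
  finally have fin: "AE y1 in N1. energy M2 (g y1) \<noteq> \<infinity>"
    by (intro nn_integral_noteq_infinite) (simp_all add: less_top)
  have fe: "integrable (M1 \<Otimes>\<^sub>M M2) (\<lambda>(x1, x2). f (x1, x2) * e1 x1 y1)" if "y1 \<in> space N1" for y1
  proof (rule Bochner_Integration.integrable_bound[OF f])
    show "(\<lambda>(x1, x2). f (x1, x2) * e1 x1 y1) \<in> borel_measurable (M1 \<Otimes>\<^sub>M M2)"
      using A.kernel_measurable1[OF that] by measurable
    show "AE x in M1 \<Otimes>\<^sub>M M2. norm (case x of (x1, x2) \<Rightarrow> f (x1, x2) * e1 x1 y1) \<le> norm (f x)"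
      using A.kernel_bound by (auto simp: norm_mult mult_left_le)
  qed
  have g1: "integrable M2 (g y1)" if "y1 \<in> space N1" for y1
    using P.integrable_snd[OF fe[OF that]] unfolding g_def .
  have kt: "kernel_transform (M1 \<Otimes>\<^sub>M M2) ?e f (y1, y2) = kernel_transform M2 e2 (g y1) y2"
    if y: "y1 \<in> space N1" "y2 \<in> space N2" for y1 y2
  proof -
    have "integrable (M1 \<Otimes>\<^sub>M M2) (\<lambda>(x1, x2). f (x1, x2) * e1 x1 y1 * e2 x2 y2)"
    proof (rule Bochner_Integration.integrable_bound[OF fe[OF y(1)]])
      show "(\<lambda>(x1, x2). f (x1, x2) * e1 x1 y1 * e2 x2 y2) \<in> borel_measurable (M1 \<Otimes>\<^sub>M M2)"
        using A.kernel_measurable1[OF y(1)] B.kernel_measurable1[OF y(2)] by measurable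
      show "AE x in M1 \<Otimes>\<^sub>M M2. norm (case x of (x1, x2) \<Rightarrow> f (x1, x2) * e1 x1 y1 * e2 x2 y2)
          \<le> norm (case x of (x1, x2) \<Rightarrow> f (x1, x2) * e1 x1 y1)"
        using B.kernel_bound by (auto simp: norm_mult mult_left_le)
    qed
    from P.integral_snd[OF this]
    have "(\<integral>x2. (\<integral>x1. f (x1, x2) * e1 x1 y1 * e2 x2 y2 \<partial>M1) \<partial>M2) = kernel_transform (M1 \<Otimes>\<^sub>M M2) ?e f (y1, y2)"
      unfolding kernel_transform_def by (simp add: case_prod_beta' mult.assoc)
    then show ?thesis by (simp add: kernel_transform_def g_def)
  qed
  interpret E: bounded_kernel "M1 \<Otimes>\<^sub>M M2" "N1 \<Otimes>\<^sub>M N2" ?e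
    by (rule bounded_kernel_product[OF k1 k2])
  have [measurable]: "kernel_transform (M1 \<Otimes>\<^sub>M M2) ?e f \<in> borel_measurable (N1 \<Otimes>\<^sub>M N2)"
    by (rule E.kernel_transform_measurable[OF L2D[OF f2]])
  have inner: "energy N2 (\<lambda>y2. kernel_transform M2 e2 (g y1) y2)
      = ennreal c2 * energy M2 (g y1)"
    if y1: "y1 \<in> space N1" and fin: "energy M2 (g y1) \<noteq> \<infinity>" for y1
  proof -
    have "L2 M2 (g y1)"
      using L2_iff_nn[OF borel_measurable_integrable[OF g1[OF y1]]] fin by (simp add: less_top)
    with i2[unfolded l2_isometric_def, rule_format, OF g1[OF y1]] show ?thesis by simp
  qed
  have "energy (N1 \<Otimes>\<^sub>M N2) (\<lambda>y. kernel_transform (M1 \<Otimes>\<^sub>M M2) ?e f y)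
      = (\<integral>\<^sup>+y1. energy N2 (\<lambda>y2. kernel_transform (M1 \<Otimes>\<^sub>M M2) ?e f (y1, y2)) \<partial>N1)"
    by (rule B.N.nn_integral_fst[symmetric]) measurable
  also have "\<dots> = (\<integral>\<^sup>+y1. energy N2 (\<lambda>y2. kernel_transform M2 e2 (g y1) y2) \<partial>N1)"
    by (intro nn_integral_cong) (simp only: kt)
  also have "\<dots> = (\<integral>\<^sup>+y1. ennreal c2 * energy M2 (g y1) \<partial>N1)"
    using fin AE_space by (intro nn_integral_cong_AE, eventually_elim) (rule inner)
  also have "\<dots> = ennreal c2 * (ennreal c1 * energy (M1 \<Otimes>\<^sub>M M2) f)"
    by (subst 2[symmetric], rule nn_integral_cmult) measurable
  finally show "energy (N1 \<Otimes>\<^sub>M N2) (\<lambda>y. kernel_transform (M1 \<Otimes>\<^sub>M M2) ?e f y)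
      = ennreal (c1 * c2) * energy (M1 \<Otimes>\<^sub>M M2) f"
    using c by (simp add: ennreal_mult ac_simps)
qed

text \<open>Transport along measure-preserving maps. It identifies a point together with one more
  coordinate with a point of the next dimension, and dimension 0 with the circle alone.\<close>

lemma l2_isometric_distr:
  assumes k: "bounded_kernel M' N' e'"
    and p [measurable]: "\<phi> \<in> measurable M M'" and q [measurable]: "\<psi> \<in> measurable N N'"
    and M': "distr M M' \<phi> = M'" and N': "distr N N' \<psi> = N'"
    and e: "\<And>x y. x \<in> space M \<Longrightarrow> y \<in> space N \<Longrightarrow> e' (\<phi> x) (\<psi> y) = e x y"
    and i: "l2_isometric M N e c"
  shows "l2_isometric M' N' e' c"
  unfolding l2_isometric_def
proof (intro allI impI)
  interpret K: bounded_kernel M' N' e' by fact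
  fix f assume f: "integrable M' f" and f2: "L2 M' f"
  note [measurable] = L2D[OF f2]
  have fi: "integrable M (\<lambda>x. f (\<phi> x))"
    using f integrable_distr_eq[OF p, of f] M' by simp
  have fs: "L2 M (\<lambda>x. f (\<phi> x))"
    using L2_integrable[OF f2] integrable_distr_eq[OF p, of "\<lambda>x. (cmod (f x))\<^sup>2"] M'
    by (simp add: square_integrable_def)
  have kt: "kernel_transform M' e' f (\<psi> y) = kernel_transform M e (\<lambda>x. f (\<phi> x)) y" if "y \<in> space N" for y
  proof -
    have "\<psi> y \<in> space N'" using q that by (rule measurable_space)
    then have [measurable]: "(\<lambda>x. f x * e' x (\<psi> y)) \<in> borel_measurable M'"
      using K.kernel_measurable1 by auto
    have "kernel_transform M' e' f (\<psi> y) = (\<integral>x. f x * e' x (\<psi> y) \<partial>distr M M' \<phi>)"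
      by (simp add: kernel_transform_def M')
    also have "\<dots> = (\<integral>x. f (\<phi> x) * e' (\<phi> x) (\<psi> y) \<partial>M)" by (rule integral_distr) measurable
    also have "\<dots> = kernel_transform M e (\<lambda>x. f (\<phi> x)) y"
      unfolding kernel_transform_def using e that by (intro Bochner_Integration.integral_cong) auto
    finally show ?thesis .
  qed
  have "energy (distr N N' \<psi>) (kernel_transform M' e' f)
      = energy N (\<lambda>y. kernel_transform M' e' f (\<psi> y))"
    by (rule nn_integral_distr) measurable
  also have "\<dots> = energy N (\<lambda>y. kernel_transform M e (\<lambda>x. f (\<phi> x)) y)"
    using kt by (intro nn_integral_cong) simp
  also have "\<dots> = ennreal c * energy M (\<lambda>x. f (\<phi> x))"
    using i fi fs unfolding l2_isometric_def by blast
  also have "\<dots> = ennreal c * energy (distr M M' \<phi>) f"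
    by (subst nn_integral_distr) auto
  finally show "energy (N') (kernel_transform M' e' f)
      = ennreal c * energy (M') f"
    by (simp add: M' N')
qed

text \<open>The isometry is demanded in both directions. One direction gives an injective transform
  on L2; the other makes the adjoint a transform of the same kind, from which inversion and
  surjectivity follow.\<close>

locale fourier_pair = bounded_kernel M N e for M :: "'a measure" and N :: "'b measure" and e +
  fixes c :: real
  assumes c_pos: "0 < c"
    and isometric: "l2_isometric M N e c"
    and isometric': "l2_isometric N M (\<lambda>y x. cnj (e x y)) c"
begin

lemma fourier_pair_dual: "fourier_pair N M (\<lambda>y x. cnj (e x y)) c"
  using kernel_dual c_pos isometric isometric'
  by (intro fourier_pair.intro) (simp_all add: fourier_pair_axioms_def)

lemma kernel_transform_L2:
  assumes "integrable M f" "L2 M f"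
  shows "L2 N (kernel_transform M e f)"
    "l2_norm N (kernel_transform M e f) = sqrt c * l2_norm M f"
proof -
  have [measurable]: "f \<in> borel_measurable M" using assms by auto
  have "energy N (kernel_transform M e f) = ennreal c * ennreal ((l2_norm M f)\<^sup>2)"
    using isometric assms unfolding l2_isometric_def by (simp add: nn_integral_l2)
  also have "\<dots> = ennreal ((sqrt c * l2_norm M f)\<^sup>2)"
    using c_pos by (simp add: power_mult_distrib flip: ennreal_mult)
  finally have *: "energy N (kernel_transform M e f) = ennreal ((sqrt c * l2_norm M f)\<^sup>2)" .
  show "L2 N (kernel_transform M e f)"
    "l2_norm N (kernel_transform M e f) = sqrt c * l2_norm M f"
    by (rule l2_normI[OF _ *]; use c_pos in simp)+
qed

lemma l2_transformD:
  assumes "l2_transform M N e f g"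
  shows "L2 M f" "L2 N g"
  using assms by (auto simp: l2_transform_def)

lemma l2_transform_L1:
  assumes "integrable M f" "L2 M f"
  shows "l2_transform M N e f (kernel_transform M e f)"
  unfolding l2_transform_def using assms kernel_transform_L2
  by (intro conjI exI[of _ "\<lambda>_. f"]) auto

lemma l2_transform_norm:
  assumes "l2_transform M N e f g"
  shows "l2_norm N g = sqrt c * l2_norm M f"
proof -
  obtain s where s: "\<And>k. integrable M (s k)" "\<And>k. L2 M (s k)"
    "(\<lambda>k. l2_norm M (\<lambda>x. s k x - f x)) \<longlonglongrightarrow> 0"
    "(\<lambda>k. l2_norm N (\<lambda>y. kernel_transform M e (s k) y - g y)) \<longlonglongrightarrow> 0"
    using assms unfolding l2_transform_def by blast
  note fg = l2_transformD[OF assms]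
  have "(\<lambda>k. l2_norm N (kernel_transform M e (s k))) \<longlonglongrightarrow> l2_norm N g"
    using kernel_transform_L2(1)[OF s(1,2)] fg(2) s(4) by (rule l2_norm_tendsto)
  moreover have "(\<lambda>k. sqrt c * l2_norm M (s k)) \<longlonglongrightarrow> sqrt c * l2_norm M f"
    by (intro tendsto_mult tendsto_const l2_norm_tendsto s fg)
  ultimately show ?thesis
    using LIMSEQ_unique kernel_transform_L2(2)[OF s(1,2)] by auto
qed

lemma l2_transform_lincomb:
  assumes "l2_transform M N e f g" "l2_transform M N e f' g'"
  shows "l2_transform M N e (\<lambda>x. f x + a * f' x) (\<lambda>y. g y + a * g' y)"
proof -
  obtain s where s: "\<And>k. integrable M (s k)" "\<And>k. L2 M (s k)"
    "(\<lambda>k. l2_norm M (\<lambda>x. s k x - f x)) \<longlonglongrightarrow> 0"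
    "(\<lambda>k. l2_norm N (\<lambda>y. kernel_transform M e (s k) y - g y)) \<longlonglongrightarrow> 0"
    using assms(1) unfolding l2_transform_def by blast
  obtain t where t: "\<And>k. integrable M (t k)" "\<And>k. L2 M (t k)"
    "(\<lambda>k. l2_norm M (\<lambda>x. t k x - f' x)) \<longlonglongrightarrow> 0"
    "(\<lambda>k. l2_norm N (\<lambda>y. kernel_transform M e (t k) y - g' y)) \<longlonglongrightarrow> 0"
    using assms(2) unfolding l2_transform_def by blast
  note fg = l2_transformD[OF assms(1)] l2_transformD[OF assms(2)]
  have est: "l2_norm L (\<lambda>x. p x + a * p' x - (q x + a * q' x))
      \<le> l2_norm L (\<lambda>x. p x - q x) + cmod a * l2_norm L (\<lambda>x. p' x - q' x)"
    if "L2 L p" "L2 L q" "L2 L p'" "L2 L q'"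
    for L :: "'z measure" and p p' q q'
  proof -
    have eq: "(\<lambda>x. p x + a * p' x - (q x + a * q' x)) = (\<lambda>x. (p x - q x) + a * (p' x - q' x))"
      by (simp add: fun_eq_iff algebra_simps)
    show ?thesis
      using l2_norm_triangle[of L "\<lambda>x. p x - q x" "\<lambda>x. a * (p' x - q' x)"] that
      unfolding eq l2_norm_cmult[of L a "\<lambda>x. p' x - q' x"] by simp
  qed
  have lim: "(\<lambda>k. u k + cmod a * v k) \<longlonglongrightarrow> 0" if "u \<longlonglongrightarrow> 0" "v \<longlonglongrightarrow> 0" for u v :: "nat \<Rightarrow> real"
    using tendsto_add[OF that(1) tendsto_mult_right_zero[OF that(2)]] by simp
  have K: "kernel_transform M e (\<lambda>x. s k x + a * t k x) y
      = kernel_transform M e (s k) y + a * kernel_transform M e (t k) y" if "y \<in> space N" for k y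
    using kernel_transform_add[of "s k" "\<lambda>x. a * t k x" y] s t that by (simp add: kernel_transform_cmult)
  note ks = kernel_transform_L2(1)[OF s(1,2)] and kt = kernel_transform_L2(1)[OF t(1,2)]
  show ?thesis
    unfolding l2_transform_def
  proof (intro conjI exI[of _ "\<lambda>k x. s k x + a * t k x"] allI)
    show "(\<lambda>k. l2_norm M (\<lambda>x. s k x + a * t k x - (f x + a * f' x))) \<longlonglongrightarrow> 0"
      using est[OF s(2) fg(1) t(2) fg(3)]
      by (intro Lim_null_comparison[OF _ lim[OF s(3) t(3)]] always_eventually allI) simp
    have "l2_norm N (\<lambda>y. kernel_transform M e (\<lambda>x. s k x + a * t k x) y - (g y + a * g' y))
        = l2_norm N (\<lambda>y. kernel_transform M e (s k) y + a * kernel_transform M e (t k) y - (g y + a * g' y))" for k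
      using K by (intro l2_norm_cong) simp
    then show "(\<lambda>k. l2_norm N (\<lambda>y. kernel_transform M e (\<lambda>x. s k x + a * t k x) y - (g y + a * g' y))) \<longlonglongrightarrow> 0"
      using est[OF ks fg(2) kt fg(4)]
      by (intro Lim_null_comparison[OF _ lim[OF s(4) t(4)]] always_eventually allI) simp
  qed (use fg s t in auto)
qed

lemma l2_transform_diff:
  assumes "l2_transform M N e f g" "l2_transform M N e f' g'"
  shows "l2_transform M N e (\<lambda>x. f x - f' x) (\<lambda>y. g y - g' y)"
  using l2_transform_lincomb[OF assms, of "-1"] by simp

lemma l2_transform_zero: "l2_transform M N e (\<lambda>_. 0) (\<lambda>_. 0)"
proof -
  have "kernel_transform M e (\<lambda>_. 0) = (\<lambda>_. 0)" by (rule ext) (simp add: kernel_transform_def)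
  then show ?thesis using l2_transform_L1[of "\<lambda>_. 0"] by simp
qed

lemma l2_transform_cmult:
  assumes "l2_transform M N e f g"
  shows "l2_transform M N e (\<lambda>x. a * f x) (\<lambda>y. a * g y)"
  using l2_transform_lincomb[OF l2_transform_zero assms, of a] by simp

lemma l2_transform_unique:
  assumes "l2_transform M N e f g" "l2_transform M N e f' g'" "AE x in M. f x = f' x"
  shows "AE y in N. g y = g' y"
proof -
  note d = l2_transform_diff[OF assms(1,2)]
  have "l2_norm M (\<lambda>x. f x - f' x) = 0"
    using l2_norm_eq_0_iff[OF l2_transformD(1)[OF d]] assms(3) by simp
  then have "l2_norm N (\<lambda>y. g y - g' y) = 0" using l2_transform_norm[OF d] by simp
  then show ?thesis using l2_norm_eq_0_iff[OF l2_transformD(2)[OF d]] by simp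
qed

lemma l2_transform_inj:
  assumes "l2_transform M N e f g" "l2_transform M N e f' g'" "AE y in N. g y = g' y"
  shows "AE x in M. f x = f' x"
proof -
  note d = l2_transform_diff[OF assms(1,2)]
  have "l2_norm N (\<lambda>y. g y - g' y) = 0"
    using l2_norm_eq_0_iff[OF l2_transformD(2)[OF d]] assms(3) by simp
  then have "l2_norm M (\<lambda>x. f x - f' x) = 0" using l2_transform_norm[OF d] c_pos by simp
  then show ?thesis using l2_norm_eq_0_iff[OF l2_transformD(1)[OF d]] by simp
qed

lemma l2_transform_cong:
  assumes ft: "l2_transform M N e f g" and f': "f' \<in> borel_measurable M" and g': "g' \<in> borel_measurable N"
    and f: "AE x in M. f x = f' x" and g: "AE y in N. g y = g' y"
  shows "l2_transform M N e f' g'"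
proof -
  obtain s where s: "\<And>k. integrable M (s k)" "\<And>k. L2 M (s k)"
    "(\<lambda>k. l2_norm M (\<lambda>x. s k x - f x)) \<longlonglongrightarrow> 0"
    "(\<lambda>k. l2_norm N (\<lambda>y. kernel_transform M e (s k) y - g y)) \<longlonglongrightarrow> 0"
    using ft unfolding l2_transform_def by blast
  note fg = l2_transformD[OF ft]
  note [measurable] = L2D[OF s(2)] fg[THEN L2D] f' g'
  have "l2_norm M (\<lambda>x. s k x - f x) = l2_norm M (\<lambda>x. s k x - f' x)" for k
    by (rule l2_norm_cong_AE; (measurable; fail)?) (use f in auto)
  moreover have "l2_norm N (\<lambda>y. kernel_transform M e (s k) y - g y)
      = l2_norm N (\<lambda>y. kernel_transform M e (s k) y - g' y)" for k
    by (rule l2_norm_cong_AE; (measurable; fail)?) (use g in auto)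
  moreover have "L2 M f'" "L2 N g'"
    using fg f g f' g' by (auto intro: L2_cong_AE)
  ultimately show ?thesis unfolding l2_transform_def using s by (intro conjI exI[of _ s]) auto
qed

lemma l2_transform_tendsto:
  assumes "l2_transform M N e f g"
    and t: "\<And>k. integrable M (t k)" "\<And>k. L2 M (t k)"
    and lim: "(\<lambda>k. l2_norm M (\<lambda>x. t k x - f x)) \<longlonglongrightarrow> 0"
  shows "(\<lambda>k. l2_norm N (\<lambda>y. kernel_transform M e (t k) y - g y)) \<longlonglongrightarrow> 0"
  unfolding l2_transform_norm[OF l2_transform_diff[OF l2_transform_L1[OF t] assms(1)]]
  by (rule tendsto_mult_right_zero[OF lim])

text \<open>The indicator of a set of finite measure lies in L2, so its product with
  \<open>f\<close> is integrable by Cauchy-Schwarz.\<close>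

lemma L2_truncations:
  assumes f: "L2 M f"
  obtains A where "\<And>k. A k \<in> sets M" "\<And>k. integrable M (\<lambda>x. indicator (A k) x * f x)"
    "\<And>k. L2 M (\<lambda>x. indicator (A k) x * f x)"
    "(\<lambda>k. l2_norm M (\<lambda>x. indicator (A k) x * f x - f x)) \<longlonglongrightarrow> 0"
proof -
  obtain A :: "nat \<Rightarrow> 'a set" where A: "range A \<subseteq> sets M" "(\<Union>i. A i) = space M" "\<And>i. emeasure M (A i) \<noteq> \<infinity>" "incseq A"
    using M.sigma_finite_incseq by blast
  have [measurable]: "A k \<in> sets M" for k using A(1) by auto
  note [measurable] = L2D[OF f]
  have ind: "L2 M (\<lambda>x. indicator (A k) x)" for k
  proof -
    have "integrable M (indicator (A k) :: 'a \<Rightarrow> real)"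
      using A(3)[of k] by (simp add: integrable_indicator_iff less_top)
    moreover have "(cmod (indicator (A k) x))\<^sup>2 = indicator (A k) x" for x by (auto simp: indicator_def)
    ultimately show ?thesis by (simp add: square_integrable_def)
  qed
  have s: "L2 M (\<lambda>x. indicator (A k) x * f x)" for k
    by (rule L2_mono[OF f]) (auto simp: indicator_def)
  have "(\<lambda>k. l2_norm M (\<lambda>x. indicator (A k) x * f x - f x)) \<longlonglongrightarrow> 0"
  proof (rule l2_dominated_convergence[OF _ _ f])
    show "AE x in M. (\<lambda>k. indicator (A k) x * f x) \<longlonglongrightarrow> f x"
    proof (rule AE_I2)
      fix x assume "x \<in> space M"
      then obtain i where "x \<in> A i" using A(2) by auto
      then have "x \<in> A k" if "i \<le> k" for k using A(4) that by (auto simp: incseq_def)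
      then have "eventually (\<lambda>k. indicator (A k) x * f x = f x) sequentially"
        by (intro eventually_sequentiallyI[of i]) simp
      then show "(\<lambda>k. indicator (A k) x * f x) \<longlonglongrightarrow> f x" by (rule tendsto_eventually)
    qed
  qed (auto simp: indicator_def)
  with that[of A] s L2_mult_integrable[OF ind f] show ?thesis by simp
qed

text \<open>Truncations to sets of finite measure lie in L1 and in L2; by the isometry their
  transforms form a Cauchy sequence.\<close>

lemma l2_transform_exists:
  assumes f: "L2 M f"
  obtains g where "l2_transform M N e f g"
proof -
  obtain A where "\<And>k. A k \<in> sets M" and A: "\<And>k. integrable M (\<lambda>x. indicator (A k) x * f x)"
    "\<And>k. L2 M (\<lambda>x. indicator (A k) x * f x)"
    "(\<lambda>k. l2_norm M (\<lambda>x. indicator (A k) x * f x - f x)) \<longlonglongrightarrow> 0"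
    by (rule L2_truncations[OF f]) (rule that)
  define t where "t k x = indicator (A k) x * f x" for k x
  have t: "integrable M (t k)" "L2 M (t k)" for k
    unfolding t_def using A by auto
  have lim: "(\<lambda>k. l2_norm M (\<lambda>x. t k x - f x)) \<longlonglongrightarrow> 0" unfolding t_def by (rule A(3))
  have d: "l2_norm N (\<lambda>y. kernel_transform M e (t i) y - kernel_transform M e (t j) y)
      = sqrt c * l2_norm M (\<lambda>x. t i x - t j x)" for i j
    by (rule l2_transform_norm[OF l2_transform_diff[OF l2_transform_L1[OF t] l2_transform_L1[OF t]]])
  obtain g where g: "L2 N g" "(\<lambda>i. l2_norm N (\<lambda>y. kernel_transform M e (t i) y - g y)) \<longlonglongrightarrow> 0"
  proof (rule l2_complete[of N "\<lambda>i. kernel_transform M e (t i)"])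
    fix r :: real assume r: "0 < r"
    then have "0 < r / (2 * sqrt c)" using c_pos by simp
    from LIMSEQ_D[OF lim this] obtain n where n: "\<And>k. n \<le> k \<Longrightarrow> l2_norm M (\<lambda>x. t k x - f x) < r / (2 * sqrt c)"
      by auto
    have "l2_norm N (\<lambda>y. kernel_transform M e (t i) y - kernel_transform M e (t j) y) < r"
      if "n \<le> i" "n \<le> j" for i j
    proof -
      have "l2_norm M (\<lambda>x. t i x - t j x) < r / (2 * sqrt c) + r / (2 * sqrt c)"
        using l2_norm_triangle_diff[OF t(2) f t(2), of i j] l2_norm_minus_commute[of M f "t j"]
          n[OF that(1)] n[OF that(2)] by linarith
      then have "sqrt c * l2_norm M (\<lambda>x. t i x - t j x) < sqrt c * (r / (2 * sqrt c) + r / (2 * sqrt c))"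
        using c_pos by (intro mult_strict_left_mono) auto
      then show ?thesis unfolding d using c_pos by (simp add: field_simps)
    qed
    then show "\<exists>n. \<forall>i\<ge>n. \<forall>j\<ge>n. l2_norm N (\<lambda>y. kernel_transform M e (t i) y - kernel_transform M e (t j) y) < r"
      by blast
  qed (use kernel_transform_L2 t in auto)
  then have "l2_transform M N e f g"
    unfolding l2_transform_def using f t lim by blast
  with that show ?thesis by blast
qed

text \<open>Both pairings are continuous in L2, so the identity for integrable functions passes to
  the limit along approximants of \<open>f\<close> and of \<open>g'\<close>.\<close>

lemma l2_transform_adjoint:
  assumes "l2_transform M N e f g" "l2_transform N M (\<lambda>y x. cnj (e x y)) g' f'"
  shows "(\<integral>y. g y * cnj (g' y) \<partial>N) = (\<integral>x. f x * cnj (f' x) \<partial>M)"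
proof -
  interpret D: fourier_pair N M "\<lambda>y x. cnj (e x y)" c by (rule fourier_pair_dual)
  obtain s where s: "\<And>k. integrable M (s k)" "\<And>k. L2 M (s k)"
    "(\<lambda>k. l2_norm M (\<lambda>x. s k x - f x)) \<longlonglongrightarrow> 0"
    "(\<lambda>k. l2_norm N (\<lambda>y. kernel_transform M e (s k) y - g y)) \<longlonglongrightarrow> 0"
    using assms(1) unfolding l2_transform_def by blast
  obtain t where t: "\<And>k. integrable N (t k)" "\<And>k. L2 N (t k)"
    "(\<lambda>k. l2_norm N (\<lambda>x. t k x - g' x)) \<longlonglongrightarrow> 0"
    "(\<lambda>k. l2_norm M (\<lambda>y. kernel_transform N (\<lambda>y x. cnj (e x y)) (t k) y - f' y)) \<longlonglongrightarrow> 0"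
    using assms(2) unfolding l2_transform_def by blast
  note fg = l2_transformD[OF assms(1)] D.l2_transformD[OF assms(2)]
  note ks = kernel_transform_L2(1)[OF s(1,2)] and kt = D.kernel_transform_L2(1)[OF t(1,2)]
  have "(\<lambda>k. \<integral>y. kernel_transform M e (s k) y * cnj (t k y) \<partial>N) \<longlonglongrightarrow> (\<integral>y. g y * cnj (g' y) \<partial>N)"
    by (rule l2_inner_tendsto[OF ks fg(2) t(2) fg(3) s(4) t(3)])
  moreover have "(\<lambda>k. \<integral>x. s k x * cnj (kernel_transform N (\<lambda>y x. cnj (e x y)) (t k) x) \<partial>M) \<longlonglongrightarrow> (\<integral>x. f x * cnj (f' x) \<partial>M)"
    by (rule l2_inner_tendsto[OF s(2) fg(1) kt fg(4) s(3) t(4)])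
  ultimately show ?thesis
    using LIMSEQ_unique kernel_transform_adjoint[OF s(1) t(1)] by auto
qed

text \<open>If \<open>h\<close> is the dual transform of \<open>g\<close>, adjointness makes the
  pairing of f with h equal to \<parallel>g\<parallel>^2 = c \<parallel>f\<parallel>^2, and the two
  isometries give \<parallel>h\<parallel>^2 = c^2 \<parallel>f\<parallel>^2. Expanding \<parallel>h
  - c f\<parallel>^2 then leaves 0.\<close>

lemma l2_transform_inverse:
  assumes "l2_transform M N e f g"
  shows "l2_transform N M (\<lambda>y x. cnj (e x y)) g (\<lambda>x. of_real c * f x)"
proof -
  interpret D: fourier_pair N M "\<lambda>y x. cnj (e x y)" c by (rule fourier_pair_dual)
  note fg = l2_transformD[OF assms]
  obtain h where h: "l2_transform N M (\<lambda>y x. cnj (e x y)) g h" using D.l2_transform_exists[OF fg(2)] .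
  note h2 = D.l2_transformD(2)[OF h]
  have sq: "(\<integral>x. a x * cnj (a x) \<partial>L) = of_real ((l2_norm L a)\<^sup>2)" for L :: "'z measure" and a
    by (simp add: l2_norm_sq complex_norm_square[symmetric] del: of_real_power)
  have i: "integrable M (\<lambda>x. a x * cnj (b x))" if "L2 M a" "L2 M b" for a b
    using L2_mult_integrable[of M a "\<lambda>z. cnj (b z)"] that by simp
  have 1: "(\<integral>x. f x * cnj (h x) \<partial>M) = of_real (c * (l2_norm M f)\<^sup>2)"
    using l2_transform_adjoint[OF assms h] l2_transform_norm[OF assms] c_pos by (simp add: sq power_mult_distrib)
  have 2: "(\<integral>x. h x * cnj (f x) \<partial>M) = of_real (c * (l2_norm M f)\<^sup>2)"
    using arg_cong[OF 1, of cnj] by (simp flip: Bochner_Integration.integral_cnj add: mult.commute)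
  have 3: "(l2_norm M h)\<^sup>2 = c\<^sup>2 * (l2_norm M f)\<^sup>2"
    using l2_transform_norm[OF assms] D.l2_transform_norm[OF h] c_pos by (simp add: power_mult_distrib power2_eq_square)
  let ?d = "\<lambda>x. h x - of_real c * f x"
  have "complex_of_real ((l2_norm M ?d)\<^sup>2) = (\<integral>x. ?d x * cnj (?d x) \<partial>M)" by (rule sq[symmetric])
  also have "\<dots> = (\<integral>x. (h x * cnj (h x) - of_real c * (h x * cnj (f x)))
      - (of_real c * (f x * cnj (h x)) - of_real (c\<^sup>2) * (f x * cnj (f x))) \<partial>M)"
    by (rule Bochner_Integration.integral_cong) (simp_all add: algebra_simps power2_eq_square)
  also have "\<dots> = ((\<integral>x. h x * cnj (h x) \<partial>M) - of_real c * (\<integral>x. h x * cnj (f x) \<partial>M))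
      - (of_real c * (\<integral>x. f x * cnj (h x) \<partial>M) - of_real (c\<^sup>2) * (\<integral>x. f x * cnj (f x) \<partial>M))"
    using i[OF h2 h2] i[OF h2 fg(1)] i[OF fg(1) h2] i[OF fg(1) fg(1)] by simp
  also have "\<dots> = 0" unfolding 1 2 sq 3 by (simp add: power2_eq_square algebra_simps)
  finally have "l2_norm M ?d = 0" by simp
  then have "AE x in M. h x = of_real c * f x"
    using l2_norm_eq_0_iff[of M ?d] h2 fg by simp
  with h2 fg show ?thesis by (intro D.l2_transform_cong[OF h]) auto
qed

lemma l2_transform_surj:
  assumes g: "L2 N g"
  obtains f where "l2_transform M N e f g"
proof -
  interpret D: fourier_pair N M "\<lambda>y x. cnj (e x y)" c by (rule fourier_pair_dual)
  obtain h where h: "l2_transform N M (\<lambda>y x. cnj (e x y)) g h" using D.l2_transform_exists[OF g] .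
  have "l2_transform M N e h (\<lambda>y. of_real c * g y)" using D.l2_transform_inverse[OF h] by simp
  from l2_transform_cmult[OF this, of "of_real (1 / c)"] c_pos
  have "l2_transform M N e (\<lambda>x. of_real (1 / c) * h x) g" by simp
  with that show ?thesis by blast
qed

lemma l2_transform_parseval:
  assumes "l2_transform M N e f g" "l2_transform M N e f' g'"
  shows "(\<integral>y. g y * cnj (g' y) \<partial>N) = of_real c * (\<integral>x. f x * cnj (f' x) \<partial>M)"
  using l2_transform_adjoint[OF assms(1) l2_transform_inverse[OF assms(2)]] by (simp add: mult.left_commute)

end

section \<open>Plancherel on the line\<close>

text \<open>Half of a Plancherel pair: the inequality is known for all functions, so equality can be
  established on a small class and spread by density, see \<open>l2_isometricI\<close>.\<close>

locale bessel_kernel = bounded_kernel M N e for M :: "'a measure" and N :: "'b measure" and e +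
  fixes c :: real
  assumes c_nonneg: "0 \<le> c"
    and bessel: "\<And>f. integrable M f \<Longrightarrow> L2 M f \<Longrightarrow>
      L2 N (kernel_transform M e f) \<and>
      l2_norm N (kernel_transform M e f) \<le> sqrt c * l2_norm M f"
begin

definition tight :: "('a \<Rightarrow> complex) \<Rightarrow> bool" where
  "tight f \<longleftrightarrow> integrable M f \<and> L2 M f \<and>
    l2_norm N (kernel_transform M e f) = sqrt c * l2_norm M f"

lemma l2_norm_kernel_transform_diff:
  assumes "integrable M f" "integrable M g"
  shows "l2_norm N (\<lambda>y. kernel_transform M e f y - kernel_transform M e g y)
    = l2_norm N (kernel_transform M e (\<lambda>x. f x - g x))"
  using kernel_transform_diff[OF assms] by (intro l2_norm_cong) simp

lemma tight_limit:
  assumes s: "\<And>k. tight (s k)" and f: "integrable M f" "L2 M f"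
    and lim: "(\<lambda>k. l2_norm M (\<lambda>x. s k x - f x)) \<longlonglongrightarrow> 0"
  shows "tight f"
proof -
  have si: "integrable M (s k)" "L2 M (s k)"
    "l2_norm N (kernel_transform M e (s k)) = sqrt c * l2_norm M (s k)" for k
    using s[of k] by (auto simp: tight_def)
  have b: "norm (l2_norm N (\<lambda>y. kernel_transform M e (s k) y - kernel_transform M e f y))
      \<le> sqrt c * l2_norm M (\<lambda>x. s k x - f x)" for k
    unfolding l2_norm_kernel_transform_diff[OF si(1) f(1)]
    using bessel[of "\<lambda>x. s k x - f x"] si f by simp
  have "(\<lambda>k. l2_norm N (\<lambda>y. kernel_transform M e (s k) y - kernel_transform M e f y)) \<longlonglongrightarrow> 0"
    by (rule Lim_null_comparison[OF always_eventually[OF allI[OF b]] tendsto_mult_right_zero[OF lim]])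
  then have "(\<lambda>k. l2_norm N (kernel_transform M e (s k))) \<longlonglongrightarrow> l2_norm N (kernel_transform M e f)"
    using bessel si f by (intro l2_norm_tendsto) auto
  moreover have "(\<lambda>k. l2_norm N (kernel_transform M e (s k))) \<longlonglongrightarrow> sqrt c * l2_norm M f"
    unfolding si(3) by (intro tendsto_mult tendsto_const l2_norm_tendsto si f lim)
  ultimately show ?thesis using LIMSEQ_unique f by (auto simp: tight_def)
qed

lemma parallelogram:
  assumes "L2 L f" "L2 L g"
  shows "(l2_norm L (\<lambda>x. f x + g x))\<^sup>2 + (l2_norm L (\<lambda>x. f x - g x))\<^sup>2
    = 2 * (l2_norm L f)\<^sup>2 + 2 * (l2_norm L g)\<^sup>2"
proof -
  have *: "(cmod (a + b))\<^sup>2 + (cmod (a - b))\<^sup>2 = 2 * (cmod a)\<^sup>2 + 2 * (cmod b)\<^sup>2" for a b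
    unfolding cmod_power2 by (simp add: power2_eq_square algebra_simps)
  note i = L2_integrable
  have "(\<integral>x. (cmod (f x + g x))\<^sup>2 \<partial>L) + (\<integral>x. (cmod (f x - g x))\<^sup>2 \<partial>L)
      = (\<integral>x. (cmod (f x + g x))\<^sup>2 + (cmod (f x - g x))\<^sup>2 \<partial>L)"
    using i[OF L2_add[OF assms]] i[OF L2_diff[OF assms]] by simp
  then show ?thesis
    unfolding l2_norm_sq * using i[OF assms(1)] i[OF assms(2)] by simp
qed

text \<open>The defect \<open>c \<parallel>f\<parallel>\<^sup>2 - \<parallel>F f\<parallel>\<^sup>2\<close> is nonnegative and satisfies the parallelogram law, so its zero
  set is closed under addition.\<close>

lemma tight_add:
  assumes "tight f" "tight g"
  shows "tight (\<lambda>x. f x + g x)"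
proof -
  have fg: "integrable M f" "L2 M f" "integrable M g" "L2 M g"
    and eq: "l2_norm N (kernel_transform M e f) = sqrt c * l2_norm M f"
      "l2_norm N (kernel_transform M e g) = sqrt c * l2_norm M g"
    using assms by (auto simp: tight_def)
  let ?a = "l2_norm N (kernel_transform M e (\<lambda>x. f x + g x))"
  let ?b = "l2_norm N (kernel_transform M e (\<lambda>x. f x - g x))"
  let ?p = "l2_norm M (\<lambda>x. f x + g x)" and ?q = "l2_norm M (\<lambda>x. f x - g x)"
  have le: "?a \<le> sqrt c * ?p" "?b \<le> sqrt c * ?q"
    using bessel[of "\<lambda>x. f x + g x"] bessel[of "\<lambda>x. f x - g x"] fg by auto
  have A: "?a = l2_norm N (\<lambda>y. kernel_transform M e f y + kernel_transform M e g y)"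
    using kernel_transform_add fg by (intro l2_norm_cong) auto
  have B: "?b = l2_norm N (\<lambda>y. kernel_transform M e f y - kernel_transform M e g y)"
    using kernel_transform_diff fg by (intro l2_norm_cong) auto
  have "?a\<^sup>2 + ?b\<^sup>2 = 2 * (l2_norm N (kernel_transform M e f))\<^sup>2 + 2 * (l2_norm N (kernel_transform M e g))\<^sup>2"
    unfolding A B using bessel fg by (intro parallelogram) auto
  also have "\<dots> = c * (2 * (l2_norm M f)\<^sup>2 + 2 * (l2_norm M g)\<^sup>2)"
    unfolding eq using c_nonneg by (simp add: power_mult_distrib algebra_simps)
  also have "\<dots> = c * (?p\<^sup>2 + ?q\<^sup>2)" using parallelogram[OF fg(2,4)] by simp
  also have "\<dots> = (sqrt c * ?p)\<^sup>2 + (sqrt c * ?q)\<^sup>2"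
    using c_nonneg by (simp add: power_mult_distrib algebra_simps)
  finally have sum: "?a\<^sup>2 + ?b\<^sup>2 = (sqrt c * ?p)\<^sup>2 + (sqrt c * ?q)\<^sup>2" .
  have "?b\<^sup>2 \<le> (sqrt c * ?q)\<^sup>2" by (rule power_mono[OF le(2)]) simp
  with sum have "(sqrt c * ?p)\<^sup>2 \<le> ?a\<^sup>2" by linarith
  then have "sqrt c * ?p \<le> ?a" by (rule power2_le_imp_le) simp
  with le(1) fg show ?thesis by (auto simp: tight_def)
qed

lemma tight_cmult:
  assumes "tight f"
  shows "tight (\<lambda>x. a * f x)"
proof -
  have "l2_norm N (kernel_transform M e (\<lambda>x. a * f x)) = cmod a * l2_norm N (kernel_transform M e f)"
    unfolding l2_norm_cmult[symmetric] by (intro l2_norm_cong) (simp add: kernel_transform_cmult)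
  then show ?thesis using assms by (auto simp: tight_def l2_norm_cmult)
qed

text \<open>The functions with equality are stable under multiples, sums and L2 limits, so
  indicators give simple functions and these give all the others.\<close>

lemma l2_isometricI:
  assumes ind: "\<And>A. A \<in> sets M \<Longrightarrow> emeasure M A < \<infinity> \<Longrightarrow> tight (indicator A)"
  shows "l2_isometric M N e c"
  unfolding l2_isometric_def
proof (intro allI impI)
  fix f assume f: "integrable M f" "L2 M f"
  obtain s where s: "\<And>i. simple_function M (s i)" "\<And>i. emeasure M {y \<in> space M. s i y \<noteq> 0} \<noteq> \<infinity>"
    "\<And>x. x \<in> space M \<Longrightarrow> (\<lambda>i. s i x) \<longlonglongrightarrow> f x"
    "\<And>x i. x \<in> space M \<Longrightarrow> norm (s i x) \<le> 2 * norm (f x)"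
    by (rule integrable_implies_simple_function_sequence[OF f(1)]) (rule that)
  have "tight (s i)" for i
    using s(1)[of i] s(2)[of i]
  proof (induction rule: integrable_simple_function_induct)
    case (cong f g)
    note eq = cong(5)
    have "integrable M f \<longleftrightarrow> integrable M g" "L2 M f \<longleftrightarrow> L2 M g"
      "l2_norm M f = l2_norm M g"
      by (rule Bochner_Integration.integrable_cong[OF refl eq] L2_cong[OF eq] l2_norm_cong[OF eq]; assumption)+
    moreover have "kernel_transform M e f = kernel_transform M e g"
      unfolding kernel_transform_def
      by (rule ext, rule Bochner_Integration.integral_cong[OF refl]) (simp only: eq)
    ultimately show ?case using cong(6) by (simp only: tight_def)
  next
    case (indicator A y)
    have "(\<lambda>x. indicator A x *\<^sub>R y) = (\<lambda>x. y * indicator A x)" by (auto simp: indicator_def)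
    then show ?case using tight_cmult[OF ind[OF indicator], of y] by simp
  next
    case (add f g)
    then show ?case by (intro tight_add)
  qed
  moreover have "(\<lambda>k. l2_norm M (\<lambda>x. s k x - f x)) \<longlonglongrightarrow> 0"
  proof (rule l2_dominated_convergence)
    \<comment> \<open>The simple functions are bounded by 2 |f|, hence their distance to
      \<open>f\<close> by 3 |f|.\<close>
    show "L2 M (\<lambda>x. 3 * f x)" using f by simp
    show "AE z in M. (\<lambda>i. s i z) \<longlonglongrightarrow> f z" using s(3) by simp
    show "AE z in M. cmod (s i z - f z) \<le> cmod (3 * f z)" for i
    proof (rule AE_I2)
      fix z assume "z \<in> space M"
      from s(4)[OF this, of i] norm_triangle_ineq4[of "s i z" "f z"]
      show "cmod (s i z - f z) \<le> cmod (3 * f z)" by (simp add: norm_mult)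
    qed
    show "s i \<in> borel_measurable M" for i by (rule borel_measurable_simple_function[OF s(1)])
  qed (use f in auto)
  ultimately have t: "tight f" using tight_limit f by blast
  have "ennreal ((l2_norm N (kernel_transform M e f))\<^sup>2) = ennreal c * ennreal ((l2_norm M f)\<^sup>2)"
    using t c_nonneg by (simp add: tight_def power_mult_distrib ennreal_mult)
  then show "energy N (kernel_transform M e f)
      = ennreal c * energy M f"
    using bessel[OF f] by (simp add: nn_integral_l2 f(2))
qed

end

section \<open>Gaussian summation and the autocorrelation on the line\<close>

abbreviation line_kernel :: "real \<Rightarrow> real \<Rightarrow> complex" where
  "line_kernel \<equiv> \<lambda>x y. cis (- (y * x))"

abbreviation line_transform :: "(real \<Rightarrow> complex) \<Rightarrow> real \<Rightarrow> complex" where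
  "line_transform \<equiv> kernel_transform lborel line_kernel"

lemma borel_measurable_cis [measurable (raw)]:
  "f \<in> borel_measurable M \<Longrightarrow> (\<lambda>x. cis (f x)) \<in> borel_measurable M"
  by (rule measurable_compose[OF _ borel_measurable_continuous_onI]) (auto intro: continuous_intros continuous_on_cis)

interpretation line: bounded_kernel lborel lborel line_kernel
  by (intro bounded_kernel.intro lborel.sigma_finite_measure_axioms bounded_kernel_axioms.intro) auto

lemma gauss_density_eq: "exp (- (s\<^sup>2) / 2) = sqrt (2 * pi) * std_normal_density s"
  by (simp add: std_normal_density_def)

lemma integrable_gauss: "integrable lborel std_normal_density"
  by simp

lemma gauss_characteristic:
  "(\<integral>s. of_real (std_normal_density s) * cis (s * u) \<partial>lborel) = of_real (exp (- (u\<^sup>2) / 2))"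
proof -
  have "char std_normal_distribution u = of_real (exp (- (u\<^sup>2) / 2))"
    using fun_cong[OF char_std_normal_distribution, of u] by simp
  moreover have "char std_normal_distribution u = (\<integral>s. std_normal_density s *\<^sub>R iexp (u * s) \<partial>lborel)"
    unfolding char_def by (subst integral_density) auto
  moreover have "std_normal_density s *\<^sub>R iexp (u * s) = of_real (std_normal_density s) * cis (s * u)" for s
    by (simp add: cis_conv_exp scaleR_conv_of_real mult.commute)
  ultimately show ?thesis by simp
qed

text \<open>The Gaussian cut-off of width 1/\<epsilon> transforms into 2 pi times the normal density
  of width \<epsilon>, an approximate identity. After rescaling this is the characteristic function
  of the standard normal law.\<close>

lemma gauss_transform:
  assumes "0 < \<epsilon>"
  shows "(\<integral>y. cis (- (y * x)) * of_real (exp (- ((\<epsilon> * y)\<^sup>2) / 2)) \<partial>lborel)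
    = of_real (2 * pi / \<epsilon> * std_normal_density (x / \<epsilon>))"
proof -
  have "(\<integral>y. cis (- (y * x)) * of_real (exp (- ((\<epsilon> * y)\<^sup>2) / 2)) \<partial>lborel)
      = (1 / \<epsilon>) *\<^sub>R (\<integral>s. cis (- (s / \<epsilon> * x)) * of_real (exp (- (s\<^sup>2) / 2)) \<partial>lborel)"
    using assms by (subst lborel_integral_real_affine[of "1 / \<epsilon>" _ 0]) simp_all
  also have "(\<integral>s. cis (- (s / \<epsilon> * x)) * of_real (exp (- (s\<^sup>2) / 2)) \<partial>lborel)
      = (\<integral>s. of_real (sqrt (2 * pi)) * (of_real (std_normal_density s) * cis (s * (- (x / \<epsilon>)))) \<partial>lborel)"
    unfolding gauss_density_eq by (intro Bochner_Integration.integral_cong) (auto simp: mult_ac)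
  also have "\<dots> = of_real (sqrt (2 * pi) * exp (- ((x / \<epsilon>)\<^sup>2) / 2))"
    unfolding integral_mult_right_zero gauss_characteristic by simp
  also have "sqrt (2 * pi) * exp (- ((x / \<epsilon>)\<^sup>2) / 2) = 2 * pi * std_normal_density (x / \<epsilon>)"
    unfolding gauss_density_eq by simp
  finally show ?thesis by (simp add: scaleR_conv_of_real)
qed

text \<open>Moving the Gaussian across by Fubini replaces the cut-off inversion integral at 0 by an
  average of \<open>f\<close> at scale \<epsilon> around 0. It serves twice: with an autocorrelation
  for Plancherel on the line, and with a partial transform for the traces of smooth
  functions.\<close>

lemma gauss_inversion:
  fixes f :: "real \<Rightarrow> complex"
  assumes f: "integrable lborel f" and e: "0 < \<epsilon>"
  shows "(\<integral>y. line_transform f y * of_real (exp (- ((\<epsilon> * y)\<^sup>2) / 2)) \<partial>lborel)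
    = 2 * pi * (\<integral>z. f (\<epsilon> * z) * of_real (std_normal_density z) \<partial>lborel)"
proof -
  define G where "G y = exp (- ((\<epsilon> * y)\<^sup>2) / 2)" for y
  have G: "integrable lborel G"
    using lborel_integrable_real_affine[OF integrable_gauss, of \<epsilon> 0] e
    unfolding G_def gauss_density_eq by simp
  have [measurable]: "f \<in> borel_measurable borel" "G \<in> borel_measurable borel" using f G by auto
  have "integrable (lborel \<Otimes>\<^sub>M lborel) (\<lambda>(x, y). f x * (cis (- (y * x)) * of_real (G y)))"
  proof (rule lborel_pair.Fubini_integrable)
    show "integrable lborel (\<lambda>x. \<integral>y. norm (case (x, y) of (x, y) \<Rightarrow> f x * (cis (- (y * x)) * of_real (G y))) \<partial>lborel)"
      using f by (simp add: norm_mult)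
    show "AE x in lborel. integrable lborel (\<lambda>y. case (x, y) of (x, y) \<Rightarrow> f x * (cis (- (y * x)) * of_real (G y)))"
    proof (rule AE_I2)
      fix x
      have "integrable lborel (\<lambda>y. cis (- (y * x)) * of_real (G y))"
        by (rule Bochner_Integration.integrable_bound[OF G]) (auto simp: norm_mult)
      then show "integrable lborel (\<lambda>y. case (x, y) of (x, y) \<Rightarrow> f x * (cis (- (y * x)) * of_real (G y)))" by simp
    qed
  qed measurable
  from lborel_pair.Fubini_integral[OF this]
  have "(\<integral>y. (\<integral>x. f x * (cis (- (y * x)) * of_real (G y)) \<partial>lborel) \<partial>lborel)
      = (\<integral>x. (\<integral>y. f x * (cis (- (y * x)) * of_real (G y)) \<partial>lborel) \<partial>lborel)" .
  also have "\<dots> = (\<integral>x. f x * of_real (2 * pi / \<epsilon> * std_normal_density (x / \<epsilon>)) \<partial>lborel)"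
    unfolding integral_mult_right_zero G_def gauss_transform[OF e] ..
  also have "\<dots> = \<epsilon> *\<^sub>R (\<integral>z. f (\<epsilon> * z) * of_real (2 * pi / \<epsilon> * std_normal_density z) \<partial>lborel)"
    using e by (subst lborel_integral_real_affine[of \<epsilon> _ 0]) simp_all
  also have "(\<integral>z. f (\<epsilon> * z) * of_real (2 * pi / \<epsilon> * std_normal_density z) \<partial>lborel)
      = (\<integral>z. of_real (2 * pi / \<epsilon>) * (f (\<epsilon> * z) * of_real (std_normal_density z)) \<partial>lborel)"
    by (simp add: mult_ac)
  also have "\<epsilon> *\<^sub>R \<dots> = 2 * pi * (\<integral>z. f (\<epsilon> * z) * of_real (std_normal_density z) \<partial>lborel)"
    unfolding integral_mult_right_zero using e by (simp add: scaleR_conv_of_real)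
  also have "(\<integral>y. (\<integral>x. f x * (cis (- (y * x)) * of_real (G y)) \<partial>lborel) \<partial>lborel)
      = (\<integral>y. line_transform f y * of_real (G y) \<partial>lborel)"
    unfolding kernel_transform_def by (simp flip: mult.assoc)
  finally show ?thesis unfolding G_def .
qed

text \<open>Its transform is the squared modulus of that of f, and its value at 0 is the squared
  norm of f; Gaussian inversion at 0 thus becomes an energy identity.\<close>

definition autocorrelation :: "(real \<Rightarrow> complex) \<Rightarrow> real \<Rightarrow> complex" where
  "autocorrelation f u = (\<integral>x. cnj (f x) * f (x + u) \<partial>lborel)"

lemma l2_norm_translate: "l2_norm lborel (\<lambda>x. f (x + u)) = l2_norm lborel f" for f :: "real \<Rightarrow> complex"
  unfolding l2_norm_def
  by (subst (2) lborel_integral_real_affine[of 1 _ u]) (simp_all add: add.commute)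

lemma L2_translate:
  assumes f: "L2 lborel (f :: real \<Rightarrow> complex)"
  shows "L2 lborel (\<lambda>x. f (x + u))"
proof -
  have [measurable]: "f \<in> borel_measurable borel" using L2D[OF f] by simp
  have "integrable lborel (\<lambda>x. (cmod (f (u + 1 * x)))\<^sup>2)"
    by (rule lborel_integrable_real_affine[OF L2_integrable[OF f]]) simp
  then show ?thesis by (simp add: square_integrable_def add.commute)
qed

lemma autocorrelation_bound:
  assumes f: "L2 lborel f"
  shows "cmod (autocorrelation f u) \<le> (l2_norm lborel f)\<^sup>2"
  using l2_cauchy_schwarz[of lborel "\<lambda>x. cnj (f x)" "\<lambda>x. f (x + u)"] f L2_translate[OF f, of u]
  by (simp add: autocorrelation_def l2_norm_translate power2_eq_square)

text \<open>Convolution theorem for \<open>f\<close> and its reflected conjugate: after the shift by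
  \<open>x\<close> the double integral factors into the transform of \<open>f\<close> and its
  conjugate.\<close>

lemma autocorrelation_transform:
  assumes f: "integrable lborel f"
  shows "integrable lborel (autocorrelation f)"
    "line_transform (autocorrelation f) y
      = of_real ((cmod (line_transform f y))\<^sup>2)"
proof -
  have [measurable]: "f \<in> borel_measurable borel" using f by auto
  have sh: "(\<integral>u. g (x + u) \<partial>lborel) = (\<integral>u. g u \<partial>lborel)" for x :: real and g :: "real \<Rightarrow> 'z::{banach, second_countable_topology}"
    by (subst (2) lborel_integral_real_affine[of 1 _ x]) simp_all
  have shi: "integrable lborel (\<lambda>u. f (x + u))" for x
    using lborel_integrable_real_affine[OF f, of 1 x] by simp
  have i: "integrable (lborel \<Otimes>\<^sub>M lborel) (\<lambda>(x, u). cnj (f x) * f (x + u))"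
  proof (rule lborel_pair.Fubini_integrable)
    show "integrable lborel (\<lambda>x. \<integral>u. norm (case (x, u) of (x, u) \<Rightarrow> cnj (f x) * f (x + u)) \<partial>lborel)"
      using f sh[of "\<lambda>u. cmod (f u)"] by (simp add: norm_mult)
  qed (use shi in auto)
  show 1: "integrable lborel (autocorrelation f)"
    unfolding autocorrelation_def using lborel_pair.integrable_snd[OF i] .
  have inner: "(\<integral>u. cnj (f x) * f (x + u) * cis (- (y * u)) \<partial>lborel)
      = cnj (f x * cis (- (y * x))) * line_transform f y" for x
  proof -
    have "cnj (f x) * f (x + u) * cis (- (y * u)) = cnj (f x) * cis (y * x) * (f (x + u) * cis (- (y * (x + u))))" for u
    proof -
      have "cis (- (y * u)) = cis (y * x) * cis (- (y * (x + u)))" by (simp add: cis_mult algebra_simps)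
      then show ?thesis by simp
    qed
    then have "(\<integral>u. cnj (f x) * f (x + u) * cis (- (y * u)) \<partial>lborel)
        = cnj (f x) * cis (y * x) * (\<integral>u. f (x + u) * cis (- (y * (x + u))) \<partial>lborel)"
      by (simp only: integral_mult_right_zero)
    also have "\<dots> = cnj (f x) * cis (y * x) * (\<integral>u. f u * cis (- (y * u)) \<partial>lborel)"
      using sh[of "\<lambda>v. f v * cis (- (y * v))" x] by simp
    finally show ?thesis by (simp add: kernel_transform_def cis_cnj)
  qed
  have "integrable (lborel \<Otimes>\<^sub>M lborel) (\<lambda>(x, u). cnj (f x) * f (x + u) * cis (- (y * u)))"
    by (rule Bochner_Integration.integrable_bound[OF i]) (auto simp: norm_mult)
  from lborel_pair.Fubini_integral[OF this]
  have "(\<integral>u. (\<integral>x. cnj (f x) * f (x + u) * cis (- (y * u)) \<partial>lborel) \<partial>lborel)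
      = (\<integral>x. (\<integral>u. cnj (f x) * f (x + u) * cis (- (y * u)) \<partial>lborel) \<partial>lborel)" .
  also have "\<dots> = (\<integral>x. cnj (f x * cis (- (y * x))) * line_transform f y \<partial>lborel)"
    by (simp only: inner)
  also have "\<dots> = cnj (line_transform f y) * line_transform f y"
    unfolding kernel_transform_def integral_mult_left_zero Bochner_Integration.integral_cnj ..
  also have "\<dots> = of_real ((cmod (line_transform f y))\<^sup>2)"
    by (simp only: complex_norm_square mult.commute)
  finally show "line_transform (autocorrelation f) y
      = of_real ((cmod (line_transform f y))\<^sup>2)"
    by (simp add: kernel_transform_def[of _ _ "autocorrelation f"] autocorrelation_def)
qed

lemma gauss_energy:
  assumes f: "integrable lborel f" and e: "0 < \<epsilon>"
  shows "integrable lborel (\<lambda>y. (cmod (line_transform f y))\<^sup>2 * exp (- ((\<epsilon> * y)\<^sup>2) / 2))"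
    "complex_of_real (\<integral>y. (cmod (line_transform f y))\<^sup>2 * exp (- ((\<epsilon> * y)\<^sup>2) / 2) \<partial>lborel)
      = 2 * pi * (\<integral>z. autocorrelation f (\<epsilon> * z) * of_real (std_normal_density z) \<partial>lborel)"
proof -
  have [measurable]: "f \<in> borel_measurable borel" using f by auto
  have [measurable]: "line_transform f \<in> borel_measurable borel"
    using line.kernel_transform_measurable[of f] by simp
  have G: "integrable lborel (\<lambda>y. exp (- ((\<epsilon> * y)\<^sup>2) / 2))"
    using lborel_integrable_real_affine[OF integrable_gauss, of \<epsilon> 0] e
    unfolding gauss_density_eq by simp
  have b: "cmod (line_transform f y) \<le> (\<integral>x. cmod (f x) \<partial>lborel)" for y
    unfolding kernel_transform_def
    using integral_norm_bound[of lborel "\<lambda>x. f x * cis (- (y * x))"] by (simp add: norm_mult)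
  show "integrable lborel (\<lambda>y. (cmod (line_transform f y))\<^sup>2 * exp (- ((\<epsilon> * y)\<^sup>2) / 2))"
    by (rule Bochner_Integration.integrable_bound[OF integrable_mult_right[OF G, of "(\<integral>x. cmod (f x) \<partial>lborel)\<^sup>2"]])
      (auto intro!: mult_right_mono power_mono b AE_I2)
  show "complex_of_real (\<integral>y. (cmod (line_transform f y))\<^sup>2 * exp (- ((\<epsilon> * y)\<^sup>2) / 2) \<partial>lborel)
      = 2 * pi * (\<integral>z. autocorrelation f (\<epsilon> * z) * of_real (std_normal_density z) \<partial>lborel)"
    unfolding gauss_inversion[OF autocorrelation_transform(1)[OF f] e, symmetric] autocorrelation_transform(2)[OF f]
    by (subst integral_complex_of_real[symmetric]) (simp only: of_real_mult)
qed

lemma tendsto_inverse_Suc_mult: "(\<lambda>n. 1 / real (Suc n) * z) \<longlonglongrightarrow> 0"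
  using tendsto_mult_left_zero[OF LIMSEQ_Suc[OF lim_1_over_n], of z] by simp

lemma gauss_tendsto_1: "(\<lambda>n. exp (- ((1 / real (Suc n) * y)\<^sup>2) / 2)) \<longlonglongrightarrow> 1"
proof -
  have "(\<lambda>n. exp (- ((1 / real (Suc n) * y)\<^sup>2) / 2)) \<longlonglongrightarrow> exp (- (0\<^sup>2) / 2)"
    by (intro tendsto_exp tendsto_divide tendsto_minus tendsto_power tendsto_inverse_Suc_mult tendsto_const) simp
  then show ?thesis by simp
qed

text \<open>The Gaussian energies are averages of the autocorrelation against a probability density,
  and Cauchy-Schwarz bounds the autocorrelation by the squared norm of f. Fatou's lemma, which
  removes the cut-off, preserves only this upper bound.\<close>

lemma line_bessel:
  assumes f: "integrable lborel f" "L2 lborel f"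
  shows "L2 lborel (line_transform f)"
    "l2_norm lborel (line_transform f) \<le> sqrt (2 * pi) * l2_norm lborel f"
proof -
  let ?F = "line_transform f"
  let ?G = "\<lambda>n y. exp (- ((1 / real (Suc n) * y)\<^sup>2) / 2)"
  have [measurable]: "f \<in> borel_measurable borel" using f by auto
  have [measurable]: "?F \<in> borel_measurable borel"
    using line.kernel_transform_measurable[of f] by simp
  have bnd: "(\<integral>y. (cmod (?F y))\<^sup>2 * ?G n y \<partial>lborel) \<le> 2 * pi * (l2_norm lborel f)\<^sup>2" for n
  proof -
    have "(\<integral>y. (cmod (?F y))\<^sup>2 * ?G n y \<partial>lborel) \<le> cmod (complex_of_real (\<integral>y. (cmod (?F y))\<^sup>2 * ?G n y \<partial>lborel))"
      by simp
    also have "\<dots> = 2 * pi * cmod (\<integral>z. autocorrelation f (1 / real (Suc n) * z) * of_real (std_normal_density z) \<partial>lborel)"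
      using gauss_energy(2)[OF f(1), of "1 / real (Suc n)"] by (simp add: norm_mult)
    also have "cmod (\<integral>z. autocorrelation f (1 / real (Suc n) * z) * of_real (std_normal_density z) \<partial>lborel)
        \<le> (\<integral>z. (l2_norm lborel f)\<^sup>2 * std_normal_density z \<partial>lborel)"
    proof (rule order_trans[OF integral_norm_bound integral_mono])
      show "integrable lborel (\<lambda>z. cmod (autocorrelation f (1 / real (Suc n) * z) * of_real (std_normal_density z)))"
        using lborel_integrable_real_affine[OF autocorrelation_transform(1)[OF f(1)], of "1 / real (Suc n)" 0]
          autocorrelation_bound[OF f(2)]
        by (intro integrable_norm Bochner_Integration.integrable_bound[OF integrable_mult_right[OF integrable_gauss, of "(l2_norm lborel f)\<^sup>2"]])
          (auto simp: norm_mult intro!: mult_right_mono)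
      show "norm (autocorrelation f (1 / real (Suc n) * z) * of_real (std_normal_density z))
          \<le> (l2_norm lborel f)\<^sup>2 * std_normal_density z" for z
        using autocorrelation_bound[OF f(2)] by (auto simp: norm_mult intro!: mult_right_mono)
    qed auto
    finally show ?thesis by (simp add: mult_left_mono)
  qed
  have "energy lborel ?F = (\<integral>\<^sup>+y. liminf (\<lambda>n. ennreal ((cmod (?F y))\<^sup>2 * ?G n y)) \<partial>lborel)"
  proof (rule nn_integral_cong)
    fix y
    have "(\<lambda>n. ennreal ((cmod (?F y))\<^sup>2 * ?G n y)) \<longlonglongrightarrow> ennreal ((cmod (?F y))\<^sup>2 * 1)"
      by (intro tendsto_ennrealI tendsto_mult tendsto_const gauss_tendsto_1)
    from lim_imp_Liminf[OF sequentially_bot this]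
    show "ennreal ((cmod (?F y))\<^sup>2) = liminf (\<lambda>n. ennreal ((cmod (?F y))\<^sup>2 * ?G n y))"
      by simp
  qed
  also have "\<dots> \<le> liminf (\<lambda>n. \<integral>\<^sup>+y. ennreal ((cmod (?F y))\<^sup>2 * ?G n y) \<partial>lborel)"
    by (intro nn_integral_liminf) auto
  also have "\<dots> \<le> liminf (\<lambda>n. ennreal (2 * pi * (l2_norm lborel f)\<^sup>2))"
  proof (rule Liminf_mono[OF always_eventually[OF allI]])
    fix n
    have "(\<integral>\<^sup>+y. ennreal ((cmod (?F y))\<^sup>2 * ?G n y) \<partial>lborel) = ennreal (\<integral>y. (cmod (?F y))\<^sup>2 * ?G n y \<partial>lborel)"
      by (rule nn_integral_eq_integral[OF gauss_energy(1)[OF f(1)]]) auto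
    then show "(\<integral>\<^sup>+y. ennreal ((cmod (?F y))\<^sup>2 * ?G n y) \<partial>lborel) \<le> ennreal (2 * pi * (l2_norm lborel f)\<^sup>2)"
      using bnd[of n] by (simp only: ennreal_leI)
  qed
  also have "\<dots> = ennreal ((sqrt (2 * pi) * l2_norm lborel f)\<^sup>2)"
    by (simp add: Liminf_const power_mult_distrib)
  finally have *: "energy lborel ?F \<le> ennreal ((sqrt (2 * pi) * l2_norm lborel f)\<^sup>2)" .
  show "L2 lborel ?F" "l2_norm lborel ?F \<le> sqrt (2 * pi) * l2_norm lborel f"
    by (rule l2_norm_leI[OF _ *]; simp)+
qed

interpretation line: bessel_kernel lborel lborel line_kernel "2 * pi"
proof (intro bessel_kernel.intro bessel_kernel_axioms.intro line.bounded_kernel_axioms conjI)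
  fix f :: "real \<Rightarrow> complex" assume "integrable lborel f" "L2 lborel f"
  note f = this
  show "L2 lborel (line_transform f)" by (rule line_bessel(1)[OF f])
  show "l2_norm lborel (line_transform f) \<le> sqrt (2 * pi) * l2_norm lborel f"
    by (rule line_bessel(2)[OF f])
next
  show "0 \<le> 2 * pi" by simp
qed

lemma indicator_L1_L2:
  assumes [measurable]: "A \<in> sets M" and "emeasure M A < \<infinity>"
  shows "integrable M (indicator A :: _ \<Rightarrow> complex)" "L2 M (indicator A)"
    "(l2_norm M (indicator A))\<^sup>2 = measure M A"
    "(\<integral>x. indicator A x \<partial>M) = complex_of_real (measure M A)"
proof -
  have c: "(indicator A :: _ \<Rightarrow> complex) = (\<lambda>x. of_real (indicator A x))"
    by (rule ext) (simp split: split_indicator)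
  have *: "(cmod (indicator A x))\<^sup>2 = indicator A x" for x by (simp split: split_indicator)
  have r: "integrable M (indicator A :: _ \<Rightarrow> real)"
    using assms by (simp add: integrable_indicator_iff)
  show "integrable M (indicator A :: _ \<Rightarrow> complex)"
    by (subst c) (rule integrable_of_real[OF r])
  have "(indicator A :: _ \<Rightarrow> complex) \<in> borel_measurable M" by measurable
  then show "L2 M (indicator A)" unfolding square_integrable_def * using r by blast
  show "(\<integral>x. indicator A x \<partial>M) = complex_of_real (measure M A)"
    by (subst c, subst integral_complex_of_real) simp
  show "(l2_norm M (indicator A))\<^sup>2 = measure M A" unfolding l2_norm_sq * by simp
qed

text \<open>A point of an open set stays in it under small shifts, so the autocorrelation of the
  indicator converges to the measure of \<open>U\<close> as the shift tends to 0. By dominated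
  convergence the Gaussian energies then tend to 2 pi times this measure, and as each of them is at
  most the full energy, this gives the missing lower bound.\<close>

lemma line_tight_open:
  assumes U: "open U" "emeasure lborel U < \<infinity>"
  shows "line.tight (indicator U)"
proof -
  let ?F = "line_transform (indicator U)"
  let ?G = "\<lambda>n y. exp (- ((1 / real (Suc n) * y)\<^sup>2) / 2)"
  have [measurable]: "U \<in> sets borel" using U by auto
  have u: "integrable lborel (indicator U :: real \<Rightarrow> complex)" "L2 lborel (indicator U)"
    "(l2_norm lborel (indicator U))\<^sup>2 = measure lborel U"
    "(\<integral>x. indicator U x \<partial>lborel) = complex_of_real (measure lborel U)"
    using indicator_L1_L2[of U lborel] U by auto
  have [measurable]: "autocorrelation (indicator U) \<in> borel_measurable borel"
    using autocorrelation_transform(1)[OF u(1)] by auto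
  have a: "(\<lambda>n. autocorrelation (indicator U) (1 / real (Suc n) * z)) \<longlonglongrightarrow> of_real (measure lborel U)" for z
  proof -
    have "(\<lambda>n. \<integral>x. cnj (indicator U x) * indicator U (x + 1 / real (Suc n) * z) \<partial>lborel)
        \<longlonglongrightarrow> (\<integral>x. indicator U x \<partial>lborel)"
    proof (rule integral_dominated_convergence)
      show "integrable lborel (indicator U :: real \<Rightarrow> real)" using U by simp
      show "AE x in lborel. (\<lambda>n. cnj (indicator U x) * indicator U (x + 1 / real (Suc n) * z)) \<longlonglongrightarrow> (indicator U x :: complex)"
      proof (rule AE_I2)
        fix x
        show "(\<lambda>n. cnj (indicator U x) * indicator U (x + 1 / real (Suc n) * z)) \<longlonglongrightarrow> (indicator U x :: complex)"
        proof (cases "x \<in> U")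
          case True
          have "(\<lambda>n. x + 1 / real (Suc n) * z) \<longlonglongrightarrow> x + 0"
            by (intro tendsto_add tendsto_const tendsto_inverse_Suc_mult)
          then have "eventually (\<lambda>n. x + 1 / real (Suc n) * z \<in> U) sequentially"
            using True U(1) by (intro topological_tendstoD) auto
          then have "eventually (\<lambda>n. cnj (indicator U x) * indicator U (x + 1 / real (Suc n) * z) = (indicator U x :: complex)) sequentially"
            by eventually_elim (use True in auto)
          then show ?thesis by (rule tendsto_eventually)
        qed simp
      qed
      show "AE x in lborel. norm (cnj (indicator U x) * indicator U (x + 1 / real (Suc n) * z) :: complex) \<le> indicator U x" for n
        by (auto simp: indicator_def)
    qed measurable
    then show ?thesis unfolding autocorrelation_def u(4) .
  qed
  have "(\<lambda>n. \<integral>z. autocorrelation (indicator U) (1 / real (Suc n) * z) * of_real (std_normal_density z) \<partial>lborel)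
      \<longlonglongrightarrow> (\<integral>z. of_real (measure lborel U) * of_real (std_normal_density z) \<partial>lborel)"
  proof (rule integral_dominated_convergence)
    show "integrable lborel (\<lambda>z. measure lborel U * std_normal_density z)"
      by (rule integrable_mult_right[OF integrable_gauss])
    show "AE z in lborel. (\<lambda>n. autocorrelation (indicator U) (1 / real (Suc n) * z) * of_real (std_normal_density z))
        \<longlonglongrightarrow> of_real (measure lborel U) * of_real (std_normal_density z)"
      by (intro AE_I2 tendsto_mult a tendsto_const)
    show "AE z in lborel. norm (autocorrelation (indicator U) (1 / real (Suc n) * z) * of_real (std_normal_density z))
        \<le> measure lborel U * std_normal_density z" for n
      using autocorrelation_bound[OF u(2)] unfolding u(3)
      by (auto simp: norm_mult intro!: mult_right_mono)
  qed measurable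
  also have "(\<integral>z. complex_of_real (measure lborel U) * of_real (std_normal_density z) \<partial>lborel) = of_real (measure lborel U)"
    by (simp flip: of_real_mult)
  finally have "(\<lambda>n. 2 * pi * (\<integral>z. autocorrelation (indicator U) (1 / real (Suc n) * z) * of_real (std_normal_density z) \<partial>lborel))
      \<longlonglongrightarrow> 2 * pi * complex_of_real (measure lborel U)"
    by (intro tendsto_mult tendsto_const)
  then have "(\<lambda>n. complex_of_real (\<integral>y. (cmod (?F y))\<^sup>2 * ?G n y \<partial>lborel)) \<longlonglongrightarrow> of_real (2 * pi * measure lborel U)"
    by (subst gauss_energy(2)[OF u(1)]) simp_all
  then have lim: "(\<lambda>n. \<integral>y. (cmod (?F y))\<^sup>2 * ?G n y \<partial>lborel) \<longlonglongrightarrow> 2 * pi * measure lborel U"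
    unfolding tendsto_of_real_iff .
  have "(\<integral>y. (cmod (?F y))\<^sup>2 * ?G n y \<partial>lborel) \<le> (l2_norm lborel ?F)\<^sup>2" for n
    unfolding l2_norm_sq
    by (intro integral_mono gauss_energy(1)[OF u(1)] L2_integrable line_bessel u)
      (auto simp: mult_left_le)
  then have "2 * pi * measure lborel U \<le> (l2_norm lborel ?F)\<^sup>2"
    by (intro LIMSEQ_le_const2[OF lim]) auto
  then have "(sqrt (2 * pi) * l2_norm lborel (indicator U))\<^sup>2 \<le> (l2_norm lborel ?F)\<^sup>2"
    by (simp add: power_mult_distrib u(3))
  then have "sqrt (2 * pi) * l2_norm lborel (indicator U) \<le> l2_norm lborel ?F"
    by (rule power2_le_imp_le) simp
  with line_bessel(2)[OF u(1,2)] u show ?thesis by (auto simp: line.tight_def)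
qed

text \<open>Outer regularity approximates a set of finite measure in L2 by open sets containing it,
  and equality is closed under such limits.\<close>

lemma line_isometric: "l2_isometric lborel lborel line_kernel (2 * pi)"
proof (rule line.l2_isometricI)
  fix A :: "real set" assume A: "A \<in> sets lborel" "emeasure lborel A < \<infinity>"
  have [measurable]: "A \<in> sets borel" using A by simp
  have "\<exists>U. open U \<and> A \<subseteq> U \<and> emeasure lborel (U - A) < ennreal (1 / real (Suc n))" for n
  proof -
    obtain U where "open U" "A \<subseteq> U" "emeasure lborel (U - A) < ennreal (1 / real (Suc n))"
      by (rule outer_regular_lborel[of A "1 / real (Suc n)"]) auto
    then show ?thesis by blast
  qed
  then obtain U where U: "\<And>n. open (U n)" "\<And>n. A \<subseteq> U n" "\<And>n. emeasure lborel (U n - A) < ennreal (1 / real (Suc n))"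
    by metis
  have [measurable]: "U n \<in> sets borel" for n using U by auto
  have fin: "emeasure lborel (U n) < \<infinity>" for n
  proof -
    have "emeasure lborel (U n) \<le> emeasure lborel A + emeasure lborel (U n - A)"
      using U(2)[of n] emeasure_subadditive[of A lborel "U n - A"] by (simp add: Un_absorb1)
    also have "\<dots> < \<infinity>" using A(2) U(3)[of n] by (auto simp: less_top[symmetric])
    finally show ?thesis .
  qed
  show "line.tight (indicator A)"
  proof (rule line.tight_limit[of "\<lambda>n. indicator (U n)"])
    show "line.tight (indicator (U n))" for n by (rule line_tight_open[OF U(1) fin])
    show "integrable lborel (indicator A :: real \<Rightarrow> complex)" "L2 lborel (indicator A)"
      using indicator_L1_L2[OF A] by auto
    have fd: "emeasure lborel (U n - A) < \<infinity>" for n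
      using U(3)[of n] by (auto intro: less_trans)
    have eq: "l2_norm lborel (\<lambda>x. indicator (U n) x - indicator A x) = sqrt (measure lborel (U n - A))" for n
    proof -
      have "(\<lambda>x. indicator (U n) x - indicator A x) = (indicator (U n - A) :: real \<Rightarrow> complex)"
        using U(2)[of n] by (auto simp: fun_eq_iff split: split_indicator)
      then show ?thesis using indicator_L1_L2(3)[of "U n - A" lborel] fd[of n]
        by (simp add: real_sqrt_unique)
    qed
    have le: "measure lborel (U n - A) \<le> 1 / real (Suc n)" for n
      using U(3)[of n] fd[of n] by (simp add: emeasure_eq_ennreal_measure ennreal_less_iff less_imp_le)
    have "(\<lambda>n. measure lborel (U n - A)) \<longlonglongrightarrow> 0"
      by (rule tendsto_sandwich[OF _ _ tendsto_const LIMSEQ_Suc[OF lim_1_over_n]]) (use le in auto)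
    from tendsto_real_sqrt[OF this]
    show "(\<lambda>n. l2_norm lborel (\<lambda>x. indicator (U n) x - indicator A x)) \<longlonglongrightarrow> 0" unfolding eq by simp
  qed
qed

text \<open>Conjugating both the function and its transform turns the dual kernel into the original
  one.\<close>

lemma line_isometric_dual: "l2_isometric lborel lborel (\<lambda>y x. cnj (line_kernel x y)) (2 * pi)"
proof -
  have eq: "kernel_transform lborel (\<lambda>y x. cnj (line_kernel x y)) f y = cnj (line_transform (\<lambda>x. cnj (f x)) y)" for f y
    unfolding kernel_transform_def Bochner_Integration.integral_cnj[symmetric] by (simp add: mult.commute)
  show ?thesis
    unfolding l2_isometric_def eq complex_mod_cnj
  proof (intro allI impI)
    fix f :: "real \<Rightarrow> complex" assume "integrable lborel f" "L2 lborel f"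
    then show "energy lborel (\<lambda>x. line_transform (\<lambda>x. cnj (f x)) x)
        = ennreal (2 * pi) * energy lborel f"
      using line_isometric[unfolded l2_isometric_def, rule_format, of "\<lambda>x. cnj (f x)"] by simp
  qed
qed

interpretation line: fourier_pair lborel lborel line_kernel "2 * pi"
  by (intro fourier_pair.intro fourier_pair_axioms.intro line.bounded_kernel_axioms
      line_isometric line_isometric_dual) simp

section \<open>Plancherel on the circle\<close>

abbreviation circle :: "real \<Rightarrow> real measure" where
  "circle T \<equiv> restrict_space lborel {0..<T}"

abbreviation frequencies :: "real \<Rightarrow> real set" where
  "frequencies T \<equiv> range (\<lambda>k::int. 2 * pi / T * of_int k)"

lemma circle_measurable: "f \<in> borel_measurable borel \<Longrightarrow> f \<in> borel_measurable (circle T)"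
  by (rule measurable_restrict_space1) simp

lemma circle_cis_measurable [simp]:
  "(\<lambda>x. cis (k * x)) \<in> borel_measurable (circle T)"
  "(\<lambda>x. cis (- (k * x))) \<in> borel_measurable (circle T)"
  by (rule circle_measurable; measurable)+

lemma finite_measure_circle: "finite_measure (circle T)"
  by (rule finite_measureI, cases "0 \<le> T") (simp_all add: emeasure_restrict_space space_restrict_space)

lemma sigma_finite_circle: "sigma_finite_measure (circle T)"
  using finite_measure_circle by (simp add: finite_measure_def)

lemma sigma_finite_frequencies: "sigma_finite_measure (count_space (frequencies T))"
  by (intro sigma_finite_measure_count_space_countable) auto

lemma circle_bounded_kernel: "bounded_kernel (circle T) (count_space (frequencies T)) line_kernel"
proof (intro bounded_kernel.intro bounded_kernel_axioms.intro sigma_finite_circle sigma_finite_frequencies)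
  have "(\<lambda>z. cis (- ((\<lambda>x. x) (snd z) * (\<lambda>x. x) (fst z))))
      \<in> borel_measurable (circle T \<Otimes>\<^sub>M count_space (frequencies T))"
    by (intro borel_measurable_cis borel_measurable_uminus borel_measurable_times
        measurable_compose[OF measurable_snd] measurable_compose[OF measurable_fst] circle_measurable) auto
  then show "(\<lambda>(x, y). cis (- (y * x))) \<in> borel_measurable (circle T \<Otimes>\<^sub>M count_space (frequencies T))"
    by (simp add: case_prod_beta')
qed simp

lemma integral_circle:
  "(\<integral>x. f x \<partial>circle T) = (\<integral>x. indicator {0..<T} x *\<^sub>R f x \<partial>lborel)"
  for f :: "real \<Rightarrow> 'a::{banach, second_countable_topology}"
  by (subst integral_restrict_space) simp_all

lemma circle_orthogonal:
  assumes T: "0 < T" and k: "k \<in> frequencies T"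
  shows "(\<integral>x. cis (k * x) \<partial>circle T) = (if k = 0 then of_real T else 0)"
proof -
  have "(\<integral>x. cis (k * x) \<partial>circle T) = (\<integral>x. indicator {0..<T} x *\<^sub>R cis (k * x) \<partial>lborel)"
    by (rule integral_circle)
  \<comment> \<open>The fundamental theorem of calculus is applied on the closed interval; the
    endpoint \<open>T\<close> is a null set.\<close>
  also have "\<dots> = (\<integral>x. indicator {0..T} x *\<^sub>R cis (k * x) \<partial>lborel)"
  proof (rule integral_cong_AE)
    show "AE x in lborel. indicator {0..<T} x *\<^sub>R cis (k * x) = indicator {0..T} x *\<^sub>R cis (k * x)"
      using AE_lborel_singleton[of T] by eventually_elim (auto simp: indicator_def)
  qed measurable
  also have "\<dots> = (if k = 0 then of_real T else 0)"
  proof (cases "k = 0")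
    case True
    have "(\<integral>x. indicator {0..T} x *\<^sub>R cis (k * x) \<partial>lborel) = of_real T - of_real 0"
      by (rule integral_FTC_atLeastAtMost[where F="\<lambda>x. of_real x"])
        (use T True in \<open>auto intro!: derivative_eq_intros continuous_intros\<close>)
    then show ?thesis using True by simp
  next
    case False
    obtain m :: int where m: "k = 2 * pi / T * of_int m" using k by auto
    have "(\<integral>x. indicator {0..T} x *\<^sub>R cis (k * x) \<partial>lborel)
        = cis (k * T) / (\<i> * of_real k) - cis (k * 0) / (\<i> * of_real k)"
    proof (rule integral_FTC_atLeastAtMost[where F="\<lambda>x. cis (k * x) / (\<i> * of_real k)"])
      fix x
      have "((\<lambda>x. cis (k * x)) has_vector_derivative \<i> * of_real k * cis (k * x)) (at x within {0..T})"
      proof -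
        have "((\<lambda>z. exp (\<i> * of_real k * z)) has_field_derivative \<i> * of_real k * exp (\<i> * of_real k * of_real x))
            (at (of_real x))"
          by (auto intro!: derivative_eq_intros)
        from has_vector_derivative_real_field[OF this] show ?thesis by (simp add: cis_conv_exp mult.assoc)
      qed
      from has_vector_derivative_divide[OF this, of "\<i> * of_real k"]
      show "((\<lambda>x. cis (k * x) / (\<i> * of_real k)) has_vector_derivative cis (k * x)) (at x within {0..T})"
        using False by simp
    qed (use T in \<open>auto intro!: continuous_intros continuous_on_cis\<close>)
    moreover have "cis (k * T) = 1"
    proof -
      have "k * T = of_int m * (2 * pi)" using T by (simp add: m)
      then show ?thesis using cis_multiple_2pi[of "of_int m"] by (simp add: mult.commute)
    qed
    ultimately show ?thesis using False by simp
  qed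
  finally show ?thesis .
qed

lemma frequencies_diff: "a \<in> frequencies T \<Longrightarrow> b \<in> frequencies T \<Longrightarrow> a - b \<in> frequencies T"
proof -
  assume "a \<in> frequencies T" "b \<in> frequencies T"
  then obtain k l :: int where "a = 2 * pi / T * of_int k" "b = 2 * pi / T * of_int l" by blast
  then have "a - b = 2 * pi / T * of_int (k - l)" by (simp add: right_diff_distrib diff_divide_distrib)
  then show ?thesis by blast
qed

lemma infinite_frequencies: "0 < T \<Longrightarrow> infinite (frequencies T)"
  by (subst finite_image_iff) (auto simp: inj_on_def infinite_UNIV_char_0)

text \<open>An enumeration of \<open>S\<close> turns the integral into a series, which is the
  supremum of its finite partial sums.\<close>

lemma nn_integral_count_space_le:
  fixes g :: "'a \<Rightarrow> real"
  assumes S: "countable S" "infinite S" and g: "\<And>x. 0 \<le> g x" and C: "0 \<le> C"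
    and le: "\<And>K. finite K \<Longrightarrow> K \<subseteq> S \<Longrightarrow> sum g K \<le> C"
  shows "(\<integral>\<^sup>+x. ennreal (g x) \<partial>count_space S) \<le> ennreal C"
proof -
  have bij: "bij_betw (from_nat_into S) UNIV S" using S by (rule bij_betw_from_nat_into)
  have "(\<integral>\<^sup>+x. ennreal (g x) \<partial>count_space S) = (\<Sum>n. ennreal (g (from_nat_into S n)))"
    using nn_integral_bij_count_space[OF bij, of "\<lambda>x. ennreal (g x)"] by (simp add: nn_integral_count_space_nat)
  also have "\<dots> \<le> ennreal C"
  proof (subst suminf_eq_SUP, rule SUP_least)
    fix n
    have "sum g (from_nat_into S ` {..<n}) \<le> C"
      using bij by (intro le) (auto simp: bij_betw_def)
    also have "sum g (from_nat_into S ` {..<n}) = (\<Sum>i<n. g (from_nat_into S i))"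
      using sum.reindex[of "from_nat_into S" "{..<n}" g] inj_on_subset[of "from_nat_into S" UNIV "{..<n}"] bij
      by (simp add: bij_betw_def o_def)
    finally show "(\<Sum>i<n. ennreal (g (from_nat_into S i))) \<le> ennreal C"
      using g C by (simp add: ennreal_leI)
  qed
  finally show ?thesis .
qed

text \<open>Pair f with the trigonometric polynomial p whose coefficients are the values of its own
  transform on finitely many frequencies. With S the sum of their squared moduli, the pairing of f
  with p is S, orthogonality gives \<parallel>p\<parallel>^2 = T S, and Cauchy-Schwarz yields S
  \<le> T \<parallel>f\<parallel>^2.\<close>

lemma circle_bessel:
  assumes T: "0 < T" and f: "integrable (circle T) f" "L2 (circle T) f"
  shows "L2 (count_space (frequencies T)) (kernel_transform (circle T) line_kernel f)"
    "l2_norm (count_space (frequencies T)) (kernel_transform (circle T) line_kernel f)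
      \<le> sqrt T * l2_norm (circle T) f"
proof -
  interpret K: bounded_kernel "circle T" "count_space (frequencies T)" line_kernel
    by (rule circle_bounded_kernel)
  interpret fm: finite_measure "circle T" by (rule finite_measure_circle)
  let ?M = "circle T"
  define F where "F = kernel_transform ?M line_kernel f"
  have le: "(\<Sum>k\<in>K. (cmod (F k))\<^sup>2) \<le> (sqrt T * l2_norm ?M f)\<^sup>2" if K: "finite K" "K \<subseteq> frequencies T" for K
  proof -
    define S where "S = (\<Sum>k\<in>K. (cmod (F k))\<^sup>2)"
    have S0: "0 \<le> S" by (auto simp: S_def intro: sum_nonneg)
    define p where "p t = (\<Sum>k\<in>K. F k * cis (k * t))" for t
    have cis2: "L2 ?M (\<lambda>t. cis (k * t))" for k
      using fm.integrable_const_bound[of _ 1] by (simp add: square_integrable_def)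
    then have p2: "L2 ?M p" unfolding p_def by auto
    have ci: "integrable ?M (\<lambda>x. cis (a * x))" for a
      by (rule fm.integrable_const_bound[of _ 1]) auto
    have ic: "integrable ?M (\<lambda>x. f x * (cnj (F k) * cis (- (k * x))))" if "k \<in> K" for k
      using integrable_mult_right[OF K.kernel_transform_integrable[OF f(1), of k], of "cnj (F k)"] K(2) that
      by (auto simp: mult_ac)
    have "(\<integral>x. f x * cnj (p x) \<partial>?M) = (\<integral>x. (\<Sum>k\<in>K. f x * (cnj (F k) * cis (- (k * x)))) \<partial>?M)"
      by (simp add: p_def sum_distrib_left cis_cnj)
    also have "\<dots> = (\<Sum>k\<in>K. (\<integral>x. cnj (F k) * (f x * cis (- (k * x))) \<partial>?M))"
      using ic by (subst Bochner_Integration.integral_sum) (simp_all add: mult_ac)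
    also have "\<dots> = (\<Sum>k\<in>K. cnj (F k) * F k)"
      by (simp add: F_def kernel_transform_def)
    also have "\<dots> = of_real S"
      unfolding S_def of_real_sum complex_norm_square by (simp add: mult.commute)
    finally have 1: "(\<integral>x. f x * cnj (p x) \<partial>?M) = of_real S" .
    have "of_real ((l2_norm ?M p)\<^sup>2) = (\<integral>x. p x * cnj (p x) \<partial>?M)"
      by (simp add: l2_norm_sq complex_norm_square[symmetric] del: of_real_power)
    also have "\<dots> = (\<integral>x. (\<Sum>k\<in>K. \<Sum>l\<in>K. F k * cnj (F l) * cis ((k - l) * x)) \<partial>?M)"
    proof (rule Bochner_Integration.integral_cong[OF refl])
      fix x
      have "cis ((k - l) * x) = cis (k * x) * cis (- (l * x))" for k l
        by (simp add: cis_mult left_diff_distrib)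
      then show "p x * cnj (p x) = (\<Sum>k\<in>K. \<Sum>l\<in>K. F k * cnj (F l) * cis ((k - l) * x))"
        by (simp add: p_def sum_product cis_cnj mult_ac)
    qed
    also have "\<dots> = (\<Sum>k\<in>K. \<Sum>l\<in>K. F k * cnj (F l) * (\<integral>x. cis ((k - l) * x) \<partial>?M))"
      using ci by (simp add: Bochner_Integration.integral_sum)
    also have "\<dots> = (\<Sum>k\<in>K. \<Sum>l\<in>K. if k = l then F k * cnj (F l) * of_real T else 0)"
      using K(2) by (intro sum.cong refl) (subst circle_orthogonal[OF T frequencies_diff]; auto)
    also have "\<dots> = (\<Sum>k\<in>K. of_real ((cmod (F k))\<^sup>2) * of_real T)"
      using K(1) by (simp add: sum.delta complex_norm_square del: of_real_power)
    also have "\<dots> = of_real (T * S)"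
      unfolding S_def of_real_mult of_real_sum by (simp add: sum_distrib_left mult.commute)
    finally have 2: "(l2_norm ?M p)\<^sup>2 = T * S" by (simp only: of_real_eq_iff)
    have "S = cmod (of_real S)" using S0 by simp
    also have "\<dots> \<le> l2_norm ?M f * l2_norm ?M p"
      unfolding 1[symmetric] using l2_cauchy_schwarz[of ?M f "\<lambda>x. cnj (p x)"] f(2) p2 by simp
    finally have "S\<^sup>2 \<le> (l2_norm ?M f * l2_norm ?M p)\<^sup>2" using S0 by (intro power_mono)
    then have 3: "S * S \<le> (l2_norm ?M f)\<^sup>2 * T * S"
      unfolding power_mult_distrib 2 power2_eq_square[of S] by (simp add: mult.assoc)
    have "S \<le> (l2_norm ?M f)\<^sup>2 * T"
    proof (cases "S = 0")
      case True then show ?thesis using T by simp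
    next
      case False
      then have "0 < S" using S0 by simp
      then show ?thesis using 3 by simp
    qed
    then show ?thesis using T by (simp add: S_def power_mult_distrib mult.commute)
  qed
  have *: "energy (count_space (frequencies T)) F \<le> ennreal ((sqrt T * l2_norm ?M f)\<^sup>2)"
    by (rule nn_integral_count_space_le[OF _ infinite_frequencies[OF T] _ _ le]) auto
  show "L2 (count_space (frequencies T)) F"
    "l2_norm (count_space (frequencies T)) F \<le> sqrt T * l2_norm ?M f"
    by (rule l2_norm_leI[OF _ *]; use T in simp)+
qed

lemma circle_bessel_kernel:
  assumes "0 < T"
  shows "bessel_kernel (circle T) (count_space (frequencies T)) line_kernel T"
  using assms circle_bessel[OF assms]
  by (intro bessel_kernel.intro bessel_kernel_axioms.intro circle_bounded_kernel conjI) simp_all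

lemma AE_lborel_interval:
  fixes a b :: real
  assumes "AE x in lborel. P x" "a < b"
  obtains x where "a < x" "x < b" "P x"
proof (rule ccontr)
  assume *: "\<not> thesis"
  obtain N where N: "{x. \<not> P x} \<subseteq> N" "N \<in> null_sets lborel"
    using assms(1) by (auto elim!: AE_E simp: null_sets_def)
  have "{a<..<b} \<subseteq> N"
  proof
    fix x assume x: "x \<in> {a<..<b}"
    show "x \<in> N"
    proof (rule ccontr)
      assume "x \<notin> N"
      then have "P x" using N(1) by blast
      with x that[of x] * show False by simp
    qed
  qed
  then have "{a<..<b} \<in> null_sets lborel" using N(2) null_sets_subset by (metis borel_open open_greaterThanLessThan sets_lborel)
  then show False using assms(2) by (simp add: null_sets_def)
qed

text \<open>Plancherel on the line, applied to \<open>f\<close> extended by zero, shows that Bessel's inequality on the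
  circle is an equality for almost every modulation \<open>f(t) cis(-\<theta> t)\<close>; then let \<open>\<theta> \<rightarrow> 0\<close>.\<close>

lemma circle_isometric:
  assumes T: "0 < T"
  shows "l2_isometric (circle T) (count_space (frequencies T)) line_kernel T"
proof -
  let ?M = "circle T" and ?N = "count_space (frequencies T)"
  interpret K: bessel_kernel ?M ?N line_kernel T by (rule circle_bessel_kernel[OF T])
  interpret fm: finite_measure ?M by (rule finite_measure_circle)
  interpret P: pair_sigma_finite ?N lborel ..
  have tight: "K.tight f" if f: "integrable ?M f" "L2 ?M f" for f
  proof -
    note [measurable] = L2D[OF f(2)]
    define \<delta> where "\<delta> = 2 * pi / T"
    have \<delta>: "0 < \<delta>" using T by (simp add: \<delta>_def)
    define g where "g t = indicator {0..<T} t *\<^sub>R f t" for t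
    have g: "integrable lborel g" "L2 lborel g" "(l2_norm lborel g)\<^sup>2 = (l2_norm ?M f)\<^sup>2"
    proof -
      show gi: "integrable lborel g"
        unfolding g_def using f(1) by (subst (asm) integrable_restrict_space) simp_all
      have eq: "(cmod (g t))\<^sup>2 = indicator {0..<T} t *\<^sub>R (cmod (f t))\<^sup>2" for t by (simp add: g_def indicator_def)
      have "integrable lborel (\<lambda>t. (cmod (g t))\<^sup>2)"
        unfolding eq using L2_integrable[OF f(2)] by (subst (asm) integrable_restrict_space) simp_all
      then show "L2 lborel g" using gi by (simp add: square_integrable_def)
      show "(l2_norm lborel g)\<^sup>2 = (l2_norm ?M f)\<^sup>2"
        unfolding l2_norm_sq eq by (rule integral_circle[symmetric])
    qed
    have [measurable]: "g \<in> borel_measurable borel" using g(1) by auto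
    define F where "F = line_transform g"
    have [measurable]: "F \<in> borel_measurable borel"
      unfolding F_def using line.kernel_transform_measurable[of g] by simp
    define fm where "fm \<theta> t = f t * cis (- (\<theta> * t))" for \<theta> t
    have fm: "integrable ?M (fm \<theta>)" "L2 ?M (fm \<theta>)" "l2_norm ?M (fm \<theta>) = l2_norm ?M f" for \<theta>
    proof -
      have m: "fm \<theta> \<in> borel_measurable ?M"
        unfolding fm_def by (intro borel_measurable_times L2D[OF f(2)] circle_cis_measurable)
      show "integrable ?M (fm \<theta>)"
        by (rule Bochner_Integration.integrable_bound[OF f(1) m]) (simp add: fm_def norm_mult)
      show "L2 ?M (fm \<theta>)"
        by (rule L2_mono[OF f(2) m]) (simp add: fm_def norm_mult)
      show "l2_norm ?M (fm \<theta>) = l2_norm ?M f" by (simp add: l2_norm_def fm_def norm_mult)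
    qed
    \<comment> \<open>The transform of the modulated function samples that of the extension by zero
      at the frequencies shifted by \<theta>.\<close>
    have Fk: "F (k + \<theta>) = kernel_transform ?M line_kernel (fm \<theta>) k" for k \<theta>
    proof -
      have "kernel_transform ?M line_kernel (fm \<theta>) k
          = (\<integral>x. indicator {0..<T} x *\<^sub>R (f x * cis (- (\<theta> * x)) * cis (- (k * x))) \<partial>lborel)"
        unfolding kernel_transform_def fm_def by (rule integral_circle)
      also have "\<dots> = F (k + \<theta>)"
        unfolding F_def kernel_transform_def g_def
        by (intro Bochner_Integration.integral_cong) (simp_all add: mult.assoc cis_mult algebra_simps)
      finally show ?thesis by simp
    qed
    define S where "S \<theta> = energy ?N (\<lambda>k. F (k + \<theta>))" for \<theta>
    define B where "B = T * (l2_norm ?M f)\<^sup>2"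
    have B0: "0 \<le> B" using T by (simp add: B_def)
    have S_le: "S \<theta> \<le> ennreal B" for \<theta>
    proof -
      have "S \<theta> = ennreal ((l2_norm ?N (kernel_transform ?M line_kernel (fm \<theta>)))\<^sup>2)"
        unfolding S_def Fk using K.bessel[OF fm(1,2)] by (intro nn_integral_l2) simp
      also have "\<dots> \<le> ennreal ((sqrt T * l2_norm ?M (fm \<theta>))\<^sup>2)"
        using K.bessel[OF fm(1,2)] by (intro ennreal_leI power_mono) auto
      also have "\<dots> = ennreal B" using T by (simp add: B_def fm(3) power_mult_distrib)
      finally show ?thesis .
    qed
    have Fm: "(\<lambda>z. ennreal ((cmod (F (fst z + snd z)))\<^sup>2) * indicator {0..<\<delta>} (snd z)) \<in> borel_measurable (?N \<Otimes>\<^sub>M lborel)"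
    proof -
      have [measurable]: "(\<lambda>z. fst z) \<in> borel_measurable (?N \<Otimes>\<^sub>M lborel)"
        by (rule measurable_compose[OF measurable_fst]) simp
      show ?thesis by measurable
    qed
    have Fm': "(\<lambda>z. ennreal ((cmod (F (snd z)))\<^sup>2) * indicator {0..<\<delta>} (snd z - fst z)) \<in> borel_measurable (?N \<Otimes>\<^sub>M lborel)"
    proof -
      have [measurable]: "(\<lambda>z. fst z) \<in> borel_measurable (?N \<Otimes>\<^sub>M lborel)"
        by (rule measurable_compose[OF measurable_fst]) simp
      show ?thesis by measurable
    qed
    have Sm [measurable]: "S \<in> borel_measurable borel"
    proof -
      have [measurable]: "(\<lambda>z. snd z) \<in> borel_measurable (lborel \<Otimes>\<^sub>M ?N)"
        by (rule measurable_compose[OF measurable_snd]) simp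
      have "(\<lambda>\<theta>. \<integral>\<^sup>+k. ennreal ((cmod (F (k + \<theta>)))\<^sup>2) \<partial>?N) \<in> borel_measurable lborel"
        by (intro sigma_finite_measure.borel_measurable_nn_integral[OF sigma_finite_frequencies]) measurable
      then show ?thesis by (simp add: S_def[abs_def])
    qed
    have "(\<integral>\<^sup>+\<theta>. S \<theta> * indicator {0..<\<delta>} \<theta> \<partial>lborel)
        = (\<integral>\<^sup>+\<theta>. (\<integral>\<^sup>+k. ennreal ((cmod (F (k + \<theta>)))\<^sup>2) * indicator {0..<\<delta>} \<theta> \<partial>?N) \<partial>lborel)"
      unfolding S_def by (intro nn_integral_cong nn_integral_multc[symmetric]) simp
    also have "\<dots> = (\<integral>\<^sup>+k. (\<integral>\<^sup>+\<theta>. ennreal ((cmod (F (k + \<theta>)))\<^sup>2) * indicator {0..<\<delta>} \<theta> \<partial>lborel) \<partial>?N)"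
      using P.Fubini[OF Fm] by simp
    also have "\<dots> = (\<integral>\<^sup>+k. (\<integral>\<^sup>+y. ennreal ((cmod (F y))\<^sup>2) * indicator {0..<\<delta>} (y - k) \<partial>lborel) \<partial>?N)"
    proof (rule nn_integral_cong)
      fix k
      have "(\<lambda>y. ennreal ((cmod (F y))\<^sup>2) * indicator {0..<\<delta>} (y - k)) \<in> borel_measurable borel" by measurable
      from nn_integral_real_affine[OF this, of 1 k]
      show "(\<integral>\<^sup>+\<theta>. ennreal ((cmod (F (k + \<theta>)))\<^sup>2) * indicator {0..<\<delta>} \<theta> \<partial>lborel)
          = (\<integral>\<^sup>+y. ennreal ((cmod (F y))\<^sup>2) * indicator {0..<\<delta>} (y - k) \<partial>lborel)" by simp
    qed
    also have "\<dots> = (\<integral>\<^sup>+y. (\<integral>\<^sup>+k. ennreal ((cmod (F y))\<^sup>2) * indicator {0..<\<delta>} (y - k) \<partial>?N) \<partial>lborel)"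
      using P.Fubini[OF Fm'] by simp
    also have "\<dots> = energy lborel F"
    proof (rule nn_integral_cong)
      fix y :: real
      \<comment> \<open>Each \<open>y\<close> lies in exactly one translate
        \<open>k + [0, \<delta>)\<close> with \<open>k\<close> a frequency, so integrating over the
        shift and summing over \<open>k\<close> amounts to integrating over the line.\<close>
      define k0 where "k0 = \<delta> * of_int \<lfloor>y / \<delta>\<rfloor>"
      have k0: "k0 \<in> frequencies T" by (auto simp: k0_def \<delta>_def)
      have "indicator {0..<\<delta>} (y - k) = (indicator {k0} k :: ennreal)" if kf: "k \<in> frequencies T" for k
      proof -
        obtain m :: int where "k = 2 * pi / T * of_int m" using kf by blast
        then have m: "k = \<delta> * of_int m" by (simp add: \<delta>_def)
        have "y - k \<in> {0..<\<delta>} \<longleftrightarrow> of_int m \<le> y / \<delta> \<and> y / \<delta> < of_int m + 1"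
        proof -
          have "0 \<le> y - k \<longleftrightarrow> of_int m \<le> y / \<delta>" unfolding m using \<delta> by (simp add: pos_le_divide_eq mult.commute)
          moreover have "y - k < \<delta> \<longleftrightarrow> y / \<delta> < of_int m + 1"
            unfolding m using \<delta> by (simp add: pos_divide_less_eq distrib_right) (simp add: algebra_simps)
          ultimately show ?thesis by simp
        qed
        also have "\<dots> \<longleftrightarrow> \<lfloor>y / \<delta>\<rfloor> = m" by (simp add: floor_eq_iff)
        also have "\<dots> \<longleftrightarrow> k = k0" using \<delta> by (auto simp: m k0_def)
        finally show ?thesis by (auto simp: indicator_def)
      qed
      then have "(\<integral>\<^sup>+k. ennreal ((cmod (F y))\<^sup>2) * indicator {0..<\<delta>} (y - k) \<partial>?N)
          = (\<integral>\<^sup>+k. ennreal ((cmod (F y))\<^sup>2) * indicator {k0} k \<partial>?N)"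
        by (intro nn_integral_cong) (simp only: space_count_space)
      also have "\<dots> = ennreal ((cmod (F y))\<^sup>2)"
        using k0 by (subst nn_integral_cmult_indicator) auto
      finally show "(\<integral>\<^sup>+k. ennreal ((cmod (F y))\<^sup>2) * indicator {0..<\<delta>} (y - k) \<partial>?N) = ennreal ((cmod (F y))\<^sup>2)" .
    qed
    also have "\<dots> = ennreal (2 * pi) * ennreal ((l2_norm lborel g)\<^sup>2)"
      using line_isometric g(1,2) unfolding l2_isometric_def F_def by (simp add: nn_integral_l2)
    also have "\<dots> = ennreal (B * \<delta>)"
      using T by (simp add: g(3) B_def \<delta>_def flip: ennreal_mult)
    finally have SB: "(\<integral>\<^sup>+\<theta>. S \<theta> * indicator {0..<\<delta>} \<theta> \<partial>lborel) = ennreal (B * \<delta>)" .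
    \<comment> \<open>The mean of \<open>S\<close> over \<open>[0, \<delta>)\<close> equals its
      upper bound \<open>B\<close>, hence \<open>S = B\<close> almost everywhere there.\<close>
    have "(\<integral>\<^sup>+\<theta>. ennreal B * indicator {0..<\<delta>} \<theta> - S \<theta> * indicator {0..<\<delta>} \<theta> \<partial>lborel)
        = (\<integral>\<^sup>+\<theta>. ennreal B * indicator {0..<\<delta>} \<theta> \<partial>lborel) - (\<integral>\<^sup>+\<theta>. S \<theta> * indicator {0..<\<delta>} \<theta> \<partial>lborel)"
      by (intro nn_integral_diff) (use SB S_le in \<open>auto intro!: mult_right_mono\<close>)
    also have "\<dots> = 0"
      unfolding SB using \<delta> B0 by (subst nn_integral_cmult_indicator) (auto simp flip: ennreal_mult)
    finally have "AE \<theta> in lborel. ennreal B * indicator {0..<\<delta>} \<theta> - S \<theta> * indicator {0..<\<delta>} \<theta> = 0"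
      by (subst (asm) nn_integral_0_iff_AE) auto
    then have AE: "AE \<theta> in lborel. \<theta> \<in> {0..<\<delta>} \<longrightarrow> S \<theta> = ennreal B"
    proof eventually_elim
      case (elim \<theta>)
      show ?case
      proof
        assume "\<theta> \<in> {0..<\<delta>}"
        then have "ennreal B - S \<theta> = 0" using elim by simp
        then have "ennreal B \<le> S \<theta>" using ennreal_minus_eq_0 by blast
        with S_le[of \<theta>] show "S \<theta> = ennreal B" by simp
      qed
    qed
    \<comment> \<open>A set of full measure has points arbitrarily close to 0; the shift 0 itself is
      reached only by the limit.\<close>
    have "\<exists>\<theta>. 0 < \<theta> \<and> \<theta> < 1 / real (Suc n) \<and> S \<theta> = ennreal B" for n
    proof -
      have "0 < min \<delta> (1 / real (Suc n))" using \<delta> by simp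
      from AE_lborel_interval[OF AE this] obtain \<theta> where "0 < \<theta>" "\<theta> < min \<delta> (1 / real (Suc n))"
        "\<theta> \<in> {0..<\<delta>} \<longrightarrow> S \<theta> = ennreal B" by blast
      then show ?thesis by (intro exI[of _ \<theta>]) auto
    qed
    then obtain \<theta> where \<theta>: "\<And>n. 0 < \<theta> n" "\<And>n. \<theta> n < 1 / real (Suc n)" "\<And>n. S (\<theta> n) = ennreal B" by metis
    have \<theta>0: "\<theta> \<longlonglongrightarrow> 0"
      by (rule tendsto_sandwich[OF _ _ tendsto_const LIMSEQ_Suc[OF lim_1_over_n]])
        (simp_all add: less_imp_le[OF \<theta>(1)] less_imp_le[OF \<theta>(2)] del: of_nat_Suc)
    have ts: "K.tight (fm (\<theta> n))" for n
    proof -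
      let ?F = "kernel_transform ?M line_kernel (fm (\<theta> n))"
      have "ennreal ((l2_norm ?N ?F)\<^sup>2) = S (\<theta> n)"
        unfolding S_def Fk using K.bessel[OF fm(1,2)] by (intro nn_integral_l2[symmetric]) simp
      then have "(l2_norm ?N ?F)\<^sup>2 = (sqrt T * l2_norm ?M (fm (\<theta> n)))\<^sup>2"
        using B0 T by (simp add: \<theta>(3) B_def fm(3) power_mult_distrib)
      then have "l2_norm ?N ?F = sqrt T * l2_norm ?M (fm (\<theta> n))"
        using T by simp
      then show ?thesis using fm(1,2)[of "\<theta> n"] unfolding K.tight_def by blast
    qed
    have "(\<lambda>n. l2_norm ?M (\<lambda>x. fm (\<theta> n) x - f x)) \<longlonglongrightarrow> 0"
    proof (rule l2_dominated_convergence)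
      show "L2 ?M (\<lambda>x. 2 * f x)" using f by simp
      show "AE x in ?M. (\<lambda>n. fm (\<theta> n) x) \<longlonglongrightarrow> f x"
      proof (rule AE_I2)
        fix x
        have "(\<lambda>n. f x * cis (- (\<theta> n * x))) \<longlonglongrightarrow> f x * cis (- (0 * x))"
          by (intro tendsto_mult tendsto_const tendsto_cis tendsto_minus \<theta>0)
        then show "(\<lambda>n. fm (\<theta> n) x) \<longlonglongrightarrow> f x" by (simp add: fm_def)
      qed
      show "AE x in ?M. cmod (fm (\<theta> n) x - f x) \<le> cmod (2 * f x)" for n
      proof (rule AE_I2)
        fix x
        show "cmod (fm (\<theta> n) x - f x) \<le> cmod (2 * f x)"
          using norm_triangle_ineq4[of "fm (\<theta> n) x" "f x"] by (simp add: fm_def norm_mult)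
      qed
    qed (use fm f in auto)
    then show ?thesis by (rule K.tight_limit[OF ts f])
  qed
  show ?thesis by (rule K.l2_isometricI) (rule tight; rule indicator_L1_L2; assumption)
qed

text \<open>Let \<open>h\<close> be the trigonometric series with coefficients \<open>a\<close>.
  Orthogonality, applied through the adjoint identity, returns T a as its transform, so the isometry
  of the circle reads T^2 \<parallel>a\<parallel>^2 = T \<parallel>h\<parallel>^2.\<close>

lemma circle_isometric_dual:
  assumes T: "0 < T"
  shows "l2_isometric (count_space (frequencies T)) (circle T) (\<lambda>y x. cnj (line_kernel x y)) T"
  unfolding l2_isometric_def
proof (intro allI impI)
  let ?M = "circle T" and ?N = "count_space (frequencies T)"
  interpret K: bounded_kernel ?M ?N line_kernel by (rule circle_bounded_kernel)
  interpret D: bounded_kernel ?N ?M "\<lambda>y x. cnj (line_kernel x y)" by (rule K.kernel_dual)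
  interpret fm: finite_measure ?M by (rule finite_measure_circle)
  fix a assume a: "integrable ?N a" "L2 ?N a"
  define h where "h = kernel_transform ?N (\<lambda>y x. cnj (line_kernel x y)) a"
  have [measurable]: "h \<in> borel_measurable ?M" unfolding h_def using a by (intro D.kernel_transform_measurable) auto
  have hb: "cmod (h x) \<le> (\<integral>y. cmod (a y) \<partial>?N)" for x
    unfolding h_def kernel_transform_def
    using integral_norm_bound[of ?N "\<lambda>y. a y * cnj (line_kernel x y)"] by (simp add: norm_mult)
  have h1: "integrable ?M h" by (rule fm.integrable_const_bound[of _ "\<integral>y. cmod (a y) \<partial>?N"]) (use hb in auto)
  have "integrable ?M (\<lambda>x. (cmod (h x))\<^sup>2)"
    by (rule fm.integrable_const_bound[of _ "(\<integral>y. cmod (a y) \<partial>?N)\<^sup>2"]) (use hb in \<open>auto intro!: power_mono\<close>)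
  then have h2: "L2 ?M h" by (simp add: square_integrable_def)
  have kh: "kernel_transform ?M line_kernel h k = of_real T * a k" if k: "k \<in> frequencies T" for k
  proof -
    have ci: "integrable ?M (\<lambda>x. cis (k * x))" by (rule fm.integrable_const_bound[of _ 1]) auto
    have kc: "kernel_transform ?M line_kernel (\<lambda>x. cis (k * x)) y = (if y = k then of_real T else 0)"
      if "y \<in> frequencies T" for y
    proof -
      have "kernel_transform ?M line_kernel (\<lambda>x. cis (k * x)) y = (\<integral>x. cis ((k - y) * x) \<partial>?M)"
        unfolding kernel_transform_def by (simp add: cis_mult left_diff_distrib)
      then show ?thesis using circle_orthogonal[OF T frequencies_diff[OF k that]] by auto
    qed
    have "cnj (kernel_transform ?M line_kernel h k) = (\<integral>x. cis (k * x) * cnj (h x) \<partial>?M)"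
      unfolding kernel_transform_def Bochner_Integration.integral_cnj[symmetric] by (simp add: cis_cnj mult.commute)
    also have "\<dots> = (\<integral>y. kernel_transform ?M line_kernel (\<lambda>x. cis (k * x)) y * cnj (a y) \<partial>?N)"
      unfolding h_def by (rule K.kernel_transform_adjoint[OF ci a(1), symmetric])
    also have "\<dots> = (\<integral>y. (if y = k then of_real T * cnj (a k) else 0) \<partial>?N)"
      by (intro Bochner_Integration.integral_cong) (auto simp: kc)
    also have "\<dots> = of_real T * cnj (a k)"
    proof -
      have "{y \<in> frequencies T. (if y = k then of_real T * cnj (a k) else 0) \<noteq> 0} \<subseteq> {k}" by (auto split: if_splits)
      then have fin: "finite {y \<in> frequencies T. (if y = k then of_real T * cnj (a k) else 0) \<noteq> 0}"
        by (rule finite_subset) simp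
      show ?thesis
        by (subst lebesgue_integral_count_space_finite_support[OF fin])
          (use k in \<open>auto simp: sum.If_cases if_distrib\<close>)
    qed
    finally have "cnj (kernel_transform ?M line_kernel h k) = of_real T * cnj (a k)" .
    from arg_cong[OF this, of cnj] show ?thesis by simp
  qed
  have "energy ?N (kernel_transform ?M line_kernel h) = ennreal T * energy ?M h"
    using circle_isometric[OF T] h1 h2 unfolding l2_isometric_def by blast
  also have "energy ?N (kernel_transform ?M line_kernel h)
      = (\<integral>\<^sup>+k. ennreal (T * T) * ennreal ((cmod (a k))\<^sup>2) \<partial>?N)"
  proof (rule nn_integral_cong)
    fix k assume "k \<in> space ?N"
    then have "kernel_transform ?M line_kernel h k = of_real T * a k" using kh by (simp only: space_count_space)
    then have "(cmod (kernel_transform ?M line_kernel h k))\<^sup>2 = (T * T) * (cmod (a k))\<^sup>2"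
      by (simp only: norm_mult power_mult_distrib norm_of_real power2_abs power2_eq_square[of T])
    then show "ennreal ((cmod (kernel_transform ?M line_kernel h k))\<^sup>2) = ennreal (T * T) * ennreal ((cmod (a k))\<^sup>2)"
      by (simp only: ennreal_mult zero_le_power2 zero_le_square)
  qed
  also have "\<dots> = ennreal T * (ennreal T * energy ?N a)"
    using T by (subst nn_integral_cmult) (auto simp: ennreal_mult mult.assoc)
  finally show "energy ?M h = ennreal T * energy ?N a"
    using T ennreal_mult_cancel_left[of "ennreal T"] by simp
qed

section \<open>Plancherel on the product group\<close>

lemma extend_measurable:
  "(\<lambda>(z, y). (fst z, (snd z)(d := y))) \<in> (A \<Otimes>\<^sub>M lebesgue_euclid d) \<Otimes>\<^sub>M lborel \<rightarrow>\<^sub>M A \<Otimes>\<^sub>M lebesgue_euclid (Suc d)"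
proof -
  have ins: "{..<Suc d} = insert d {..<d}" by auto
  have "(\<lambda>p. (fst (fst p), (snd (fst p))(d := snd p)))
      \<in> (A \<Otimes>\<^sub>M lebesgue_euclid d) \<Otimes>\<^sub>M lborel \<rightarrow>\<^sub>M A \<Otimes>\<^sub>M lebesgue_euclid (Suc d)"
  proof (rule measurable_Pair)
    have 1: "(\<lambda>(f, y). f(d := y)) \<in> lebesgue_euclid d \<Otimes>\<^sub>M lborel \<rightarrow>\<^sub>M PiM (insert d {..<d}) (\<lambda>_. lborel)"
      by (rule measurable_add_dim)
    have 2: "(\<lambda>p. (snd (fst p), snd p)) \<in> (A \<Otimes>\<^sub>M lebesgue_euclid d) \<Otimes>\<^sub>M lborel \<rightarrow>\<^sub>M lebesgue_euclid d \<Otimes>\<^sub>M lborel"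
      by measurable
    from measurable_compose[OF 2 1]
    show "(\<lambda>p. (snd (fst p))(d := snd p)) \<in> (A \<Otimes>\<^sub>M lebesgue_euclid d) \<Otimes>\<^sub>M lborel \<rightarrow>\<^sub>M lebesgue_euclid (Suc d)"
      unfolding ins by simp
  qed measurable
  then show ?thesis by (simp add: case_prod_beta')
qed

text \<open>Appending the coordinate \<open>d\<close> is measure preserving. Inductions on the
  dimension, and later the splitting off of the normal frequency, can therefore treat the last
  coordinate as a separate line.\<close>

lemma distr_pair_insert:
  assumes A: "sigma_finite_measure A"
  shows "distr ((A \<Otimes>\<^sub>M lebesgue_euclid d) \<Otimes>\<^sub>M lborel) (A \<Otimes>\<^sub>M lebesgue_euclid (Suc d))
      (\<lambda>(z, y). (fst z, (snd z)(d := y))) = A \<Otimes>\<^sub>M lebesgue_euclid (Suc d)"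
proof -
  interpret A: sigma_finite_measure A by fact
  interpret L: product_sigma_finite "\<lambda>_::nat. lborel :: real measure" ..
  interpret Ld: sigma_finite_measure "lebesgue_euclid d" by (rule L.sigma_finite) simp
  interpret LSd: sigma_finite_measure "lebesgue_euclid (Suc d)" by (rule L.sigma_finite) simp
  interpret AL: pair_sigma_finite A "lebesgue_euclid d" ..
  have ins: "{..<Suc d} = insert d {..<d}" by auto
  let ?f = "\<lambda>(z, y). (fst z, (snd z)(d := y))"
  note fm = extend_measurable[of d A]
  show ?thesis
  proof (rule measure_eqI)
    fix B assume "B \<in> sets (distr ((A \<Otimes>\<^sub>M lebesgue_euclid d) \<Otimes>\<^sub>M lborel) (A \<Otimes>\<^sub>M lebesgue_euclid (Suc d)) ?f)"
    then have B [measurable]: "B \<in> sets (A \<Otimes>\<^sub>M lebesgue_euclid (Suc d))" by simp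
    have Bm: "indicator B \<in> borel_measurable (A \<Otimes>\<^sub>M lebesgue_euclid (Suc d))" by (rule borel_measurable_indicator[OF B])
    have Bf: "(\<lambda>p. indicator B (?f p) :: ennreal) \<in> borel_measurable ((A \<Otimes>\<^sub>M lebesgue_euclid d) \<Otimes>\<^sub>M lborel)"
      by (rule measurable_compose[OF fm Bm])
    have Bf': "(\<lambda>z. \<integral>\<^sup>+y. indicator B (?f (z, y)) \<partial>lborel) \<in> borel_measurable (A \<Otimes>\<^sub>M lebesgue_euclid d)"
      by (rule lborel.borel_measurable_nn_integral_fst[OF Bf])
    have "emeasure (distr ((A \<Otimes>\<^sub>M lebesgue_euclid d) \<Otimes>\<^sub>M lborel) (A \<Otimes>\<^sub>M lebesgue_euclid (Suc d)) ?f) B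
        = (\<integral>\<^sup>+p. indicator B p \<partial>distr ((A \<Otimes>\<^sub>M lebesgue_euclid d) \<Otimes>\<^sub>M lborel) (A \<Otimes>\<^sub>M lebesgue_euclid (Suc d)) ?f)"
      using B by simp
    also have "\<dots> = (\<integral>\<^sup>+p. indicator B (?f p) \<partial>((A \<Otimes>\<^sub>M lebesgue_euclid d) \<Otimes>\<^sub>M lborel))"
      by (rule nn_integral_distr[OF fm]) (use Bm in simp)
    also have "\<dots> = (\<integral>\<^sup>+z. (\<integral>\<^sup>+y. indicator B (?f (z, y)) \<partial>lborel) \<partial>(A \<Otimes>\<^sub>M lebesgue_euclid d))"
      by (rule lborel.nn_integral_fst[OF Bf, symmetric])
    also have "\<dots> = (\<integral>\<^sup>+a. (\<integral>\<^sup>+x. (\<integral>\<^sup>+y. indicator B (a, x(d := y)) \<partial>lborel) \<partial>lebesgue_euclid d) \<partial>A)"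
      using Ld.nn_integral_fst[OF Bf', symmetric] by simp
    also have "\<dots> = (\<integral>\<^sup>+a. (\<integral>\<^sup>+x. indicator B (a, x) \<partial>lebesgue_euclid (Suc d)) \<partial>A)"
    proof (rule nn_integral_cong)
      fix a assume a: "a \<in> space A"
      have "(\<lambda>x. indicator B (a, x) :: ennreal) \<in> borel_measurable (PiM (insert d {..<d}) (\<lambda>_. lborel))"
        unfolding ins[symmetric] by (rule measurable_compose[OF measurable_Pair1'[OF a] Bm])
      from L.product_nn_integral_insert[OF _ _ this]
      show "(\<integral>\<^sup>+x. (\<integral>\<^sup>+y. indicator B (a, x(d := y)) \<partial>lborel) \<partial>lebesgue_euclid d)
          = (\<integral>\<^sup>+x. indicator B (a, x) \<partial>lebesgue_euclid (Suc d))"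
        unfolding ins by simp
    qed
    also have "\<dots> = (\<integral>\<^sup>+z. indicator B z \<partial>(A \<Otimes>\<^sub>M lebesgue_euclid (Suc d)))"
      using LSd.nn_integral_fst[OF Bm] by simp
    also have "\<dots> = emeasure (A \<Otimes>\<^sub>M lebesgue_euclid (Suc d)) B" by simp
    finally show "emeasure (distr ((A \<Otimes>\<^sub>M lebesgue_euclid d) \<Otimes>\<^sub>M lborel) (A \<Otimes>\<^sub>M lebesgue_euclid (Suc d)) ?f) B
        = emeasure (A \<Otimes>\<^sub>M lebesgue_euclid (Suc d)) B" .
  qed simp
qed

definition group_kernel :: "nat \<Rightarrow> point \<Rightarrow> point \<Rightarrow> complex" where
  "group_kernel d z \<zeta> = cis (- (fst \<zeta> * fst z + (\<Sum>i<d. snd \<zeta> i * snd z i)))"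

lemma sigma_finite_lebesgue_euclid: "sigma_finite_measure (lebesgue_euclid d)"
proof -
  interpret L: product_sigma_finite "\<lambda>_::nat. lborel :: real measure" ..
  show ?thesis by (rule L.sigma_finite) simp
qed

lemma sigma_finite_group_measure: "sigma_finite_measure (group_measure T d)"
proof -
  interpret A: sigma_finite_measure "circle T" by (rule sigma_finite_circle)
  interpret B: sigma_finite_measure "lebesgue_euclid d" by (rule sigma_finite_lebesgue_euclid)
  interpret P: pair_sigma_finite "circle T" "lebesgue_euclid d" ..
  show ?thesis unfolding group_measure_def by (rule P.sigma_finite_measure_axioms)
qed

lemma sigma_finite_dual_measure: "sigma_finite_measure (dual_measure T d)"
proof -
  interpret A: sigma_finite_measure "count_space (frequencies T)" by (rule sigma_finite_frequencies)
  interpret B: sigma_finite_measure "lebesgue_euclid d" by (rule sigma_finite_lebesgue_euclid)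
  interpret P: pair_sigma_finite "count_space (frequencies T)" "lebesgue_euclid d" ..
  show ?thesis unfolding dual_measure_def by (rule P.sigma_finite_measure_axioms)
qed

lemma dual_measure_fst_measurable: "fst \<in> borel_measurable (dual_measure T d)"
  unfolding dual_measure_def by (rule measurable_compose[OF measurable_fst]) simp

lemma group_measure_fst_measurable: "fst \<in> borel_measurable (group_measure T d)"
  unfolding group_measure_def by (rule measurable_compose[OF measurable_fst]) (simp add: circle_measurable)

lemma dual_measure_coord_measurable: "i < d \<Longrightarrow> (\<lambda>z. snd z i) \<in> borel_measurable (dual_measure T d)"
  unfolding dual_measure_def by measurable

lemma group_measure_coord_measurable: "i < d \<Longrightarrow> (\<lambda>z. snd z i) \<in> borel_measurable (group_measure T d)"
  unfolding group_measure_def by measurable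

lemma group_bounded_kernel: "bounded_kernel (group_measure T d) (dual_measure T d) (group_kernel d)"
proof (intro bounded_kernel.intro bounded_kernel_axioms.intro sigma_finite_group_measure sigma_finite_dual_measure)
  have "(\<lambda>p. cis (- (fst (snd p) * fst (fst p) + (\<Sum>i<d. snd (snd p) i * snd (fst p) i))))
      \<in> borel_measurable (group_measure T d \<Otimes>\<^sub>M dual_measure T d)"
    by (intro borel_measurable_cis borel_measurable_uminus borel_measurable_add borel_measurable_times
        borel_measurable_sum
        measurable_compose[OF measurable_snd dual_measure_fst_measurable]
        measurable_compose[OF measurable_fst group_measure_fst_measurable]
        measurable_compose[OF measurable_snd dual_measure_coord_measurable]
        measurable_compose[OF measurable_fst group_measure_coord_measurable]) auto
  then show "(\<lambda>(x, y). group_kernel d x y) \<in> borel_measurable (group_measure T d \<Otimes>\<^sub>M dual_measure T d)"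
    by (simp add: case_prod_beta' group_kernel_def)
qed (simp add: group_kernel_def)

text \<open>\<open>euclid 0\<close> consists of the single function
  \<open>\<lambda>_. undefined\<close>, of mass 1.\<close>

lemma distr_group_measure_0:
  assumes "sigma_finite_measure A"
  shows "distr A (A \<Otimes>\<^sub>M lebesgue_euclid 0) (\<lambda>t. (t, \<lambda>_. undefined)) = A \<Otimes>\<^sub>M lebesgue_euclid 0"
proof (rule measure_eqI)
  interpret A: sigma_finite_measure A by fact
  interpret L: sigma_finite_measure "lebesgue_euclid 0" by (rule sigma_finite_lebesgue_euclid)
  have m: "(\<lambda>t. (t, \<lambda>_. undefined)) \<in> A \<rightarrow>\<^sub>M A \<Otimes>\<^sub>M lebesgue_euclid 0"
    by (rule measurable_Pair2') simp
  fix B assume "B \<in> sets (distr A (A \<Otimes>\<^sub>M lebesgue_euclid 0) (\<lambda>t. (t, \<lambda>_. undefined)))"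
  then have B: "B \<in> sets (A \<Otimes>\<^sub>M lebesgue_euclid 0)" by simp
  have Bm: "indicator B \<in> borel_measurable (A \<Otimes>\<^sub>M lebesgue_euclid 0)" by (rule borel_measurable_indicator[OF B])
  have "emeasure (distr A (A \<Otimes>\<^sub>M lebesgue_euclid 0) (\<lambda>t. (t, \<lambda>_. undefined))) B
      = (\<integral>\<^sup>+p. indicator B p \<partial>distr A (A \<Otimes>\<^sub>M lebesgue_euclid 0) (\<lambda>t. (t, \<lambda>_. undefined)))"
    using B by simp
  also have "\<dots> = (\<integral>\<^sup>+t. indicator B (t, \<lambda>_. undefined) \<partial>A)"
    by (rule nn_integral_distr[OF m]) (use Bm in simp)
  also have "\<dots> = (\<integral>\<^sup>+t. (\<integral>\<^sup>+x. indicator B (t, x) \<partial>lebesgue_euclid 0) \<partial>A)"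
    by (simp add: PiM_empty nn_integral_count_space_finite)
  also have "\<dots> = (\<integral>\<^sup>+p. indicator B p \<partial>(A \<Otimes>\<^sub>M lebesgue_euclid 0))" by (rule L.nn_integral_fst[OF Bm])
  also have "\<dots> = emeasure (A \<Otimes>\<^sub>M lebesgue_euclid 0) B" using B by simp
  finally show "emeasure (distr A (A \<Otimes>\<^sub>M lebesgue_euclid 0) (\<lambda>t. (t, \<lambda>_. undefined))) B
      = emeasure (A \<Otimes>\<^sub>M lebesgue_euclid 0) B" .
qed simp

lemma group_kernel_Suc:
  "group_kernel (Suc d) (fst z, (snd z)(d := x)) (fst \<zeta>, (snd \<zeta>)(d := y))
    = group_kernel d z \<zeta> * line_kernel x y"
proof -
  have "(\<Sum>i<d. ((snd \<zeta>)(d := y)) i * ((snd z)(d := x)) i) = (\<Sum>i<d. snd \<zeta> i * snd z i)"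
    by (rule sum.cong) auto
  then show ?thesis by (simp add: group_kernel_def cis_mult algebra_simps)
qed

lemma distr_group_measure_Suc:
  "distr (group_measure T d \<Otimes>\<^sub>M lborel) (group_measure T (Suc d)) (\<lambda>(z, y). (fst z, (snd z)(d := y)))
    = group_measure T (Suc d)"
  unfolding group_measure_def by (rule distr_pair_insert[OF sigma_finite_circle])

lemma distr_dual_measure_Suc:
  "distr (dual_measure T d \<Otimes>\<^sub>M lborel) (dual_measure T (Suc d)) (\<lambda>(z, y). (fst z, (snd z)(d := y)))
    = dual_measure T (Suc d)"
  unfolding dual_measure_def by (rule distr_pair_insert[OF sigma_finite_frequencies])

text \<open>Induction on the dimension, starting from the circle and adding one line at a time. Both
  isometries are carried along, and each line contributes a factor 2 pi to the constant.\<close>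

lemma group_fourier_pair:
  assumes T: "0 < T"
  shows "fourier_pair (group_measure T d) (dual_measure T d) (group_kernel d) (T * (2 * pi) ^ d)"
proof -
  have pos: "0 < T * (2 * pi) ^ d" for d using T by simp
  have "l2_isometric (group_measure T d) (dual_measure T d) (group_kernel d) (T * (2 * pi) ^ d)
    \<and> l2_isometric (dual_measure T d) (group_measure T d) (\<lambda>y x. cnj (group_kernel d x y)) (T * (2 * pi) ^ d)"
  proof (induction d)
    case 0
    have m: "(\<lambda>t. (t, \<lambda>_. undefined)) \<in> A \<rightarrow>\<^sub>M A \<Otimes>\<^sub>M lebesgue_euclid 0" for A :: "real measure"
      by (rule measurable_Pair2') simp
    have m1: "(\<lambda>t. (t, \<lambda>_. undefined)) \<in> circle T \<rightarrow>\<^sub>M group_measure T 0"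
      unfolding group_measure_def by (rule m)
    have m2: "(\<lambda>t. (t, \<lambda>_. undefined)) \<in> count_space (frequencies T) \<rightarrow>\<^sub>M dual_measure T 0"
      unfolding dual_measure_def by (rule m)
    have d1: "distr (circle T) (group_measure T 0) (\<lambda>t. (t, \<lambda>_. undefined)) = group_measure T 0"
      unfolding group_measure_def by (rule distr_group_measure_0[OF sigma_finite_circle])
    have d2: "distr (count_space (frequencies T)) (dual_measure T 0) (\<lambda>t. (t, \<lambda>_. undefined)) = dual_measure T 0"
      unfolding dual_measure_def by (rule distr_group_measure_0[OF sigma_finite_frequencies])
    have "l2_isometric (group_measure T 0) (dual_measure T 0) (group_kernel 0) T"
      by (rule l2_isometric_distr[OF group_bounded_kernel m1 m2 d1 d2 _ circle_isometric[OF T]])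
        (simp add: group_kernel_def)
    moreover have "l2_isometric (dual_measure T 0) (group_measure T 0) (\<lambda>y x. cnj (group_kernel 0 x y)) T"
      by (rule l2_isometric_distr[OF bounded_kernel.kernel_dual[OF group_bounded_kernel] m2 m1 d2 d1 _ circle_isometric_dual[OF T]])
        (simp add: group_kernel_def)
    ultimately show ?case by simp
  next
    case (Suc d)
    have c: "T * (2 * pi) ^ d * (2 * pi) = T * (2 * pi) ^ Suc d" by simp
    let ?f = "\<lambda>(z :: point, y). (fst z, (snd z)(d := y))"
    have m1: "?f \<in> group_measure T d \<Otimes>\<^sub>M lborel \<rightarrow>\<^sub>M group_measure T (Suc d)"
      unfolding group_measure_def by (rule extend_measurable)
    have m2: "?f \<in> dual_measure T d \<Otimes>\<^sub>M lborel \<rightarrow>\<^sub>M dual_measure T (Suc d)"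
      unfolding dual_measure_def by (rule extend_measurable)
    note d = distr_group_measure_Suc[of T d] distr_dual_measure_Suc[of T d]
    have k: "group_kernel (Suc d) (?f x) (?f y)
        = (\<lambda>(x1, x2) (y1, y2). group_kernel d x1 y1 * line_kernel x2 y2) x y" for x y
      using group_kernel_Suc[of d "fst x" "snd x" "fst y" "snd y"] by (simp add: case_prod_beta')
    have k': "cnj (group_kernel (Suc d) (?f x) (?f y))
        = (\<lambda>(y1, y2) (x1, x2). cnj (group_kernel d x1 y1) * cnj (line_kernel x2 y2)) y x" for x y
      unfolding k by (simp add: case_prod_beta')
    have nn: "0 \<le> T * (2 * pi) ^ d" "0 \<le> 2 * pi" using T by auto
    have "l2_isometric (group_measure T (Suc d)) (dual_measure T (Suc d)) (group_kernel (Suc d)) (T * (2 * pi) ^ d * (2 * pi))"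
      by (rule l2_isometric_distr[OF group_bounded_kernel m1 m2 d k
          l2_isometric_product[OF group_bounded_kernel line.bounded_kernel_axioms conjunct1[OF Suc.IH] line_isometric nn]])
    moreover have "l2_isometric (dual_measure T (Suc d)) (group_measure T (Suc d))
        (\<lambda>y x. cnj (group_kernel (Suc d) x y)) (T * (2 * pi) ^ d * (2 * pi))"
      by (rule l2_isometric_distr[OF bounded_kernel.kernel_dual[OF group_bounded_kernel] m2 m1 d(2,1) k'
          l2_isometric_product[OF bounded_kernel.kernel_dual[OF group_bounded_kernel] line.kernel_dual
            conjunct2[OF Suc.IH] line_isometric_dual nn]])
    ultimately show ?case unfolding c by blast
  qed
  then show ?thesis
    using pos by (intro fourier_pair.intro fourier_pair_axioms.intro group_bounded_kernel) auto
qed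

section \<open>The Fourier transform of periodic functions\<close>

text \<open>Links the nonnegative integral in the definition of \<open>fourier\<close> to the norm
  used in this development.\<close>

lemma l2_tendsto_iff_nn:
  assumes "\<And>k. L2 M (s k)" "L2 M g"
  shows "(\<lambda>k. \<integral>\<^sup>+z. ennreal ((cmod (s k z - g z))\<^sup>2) \<partial>M) \<longlonglongrightarrow> 0 \<longleftrightarrow> (\<lambda>k. l2_norm M (\<lambda>z. s k z - g z)) \<longlonglongrightarrow> 0"
    (is "?L \<longleftrightarrow> ?R")
proof -
  have eq: "energy M (\<lambda>z. s k z - g z) = ennreal ((l2_norm M (\<lambda>z. s k z - g z))\<^sup>2)" for k
    using assms by (intro nn_integral_l2) simp
  show ?thesis
  proof
    assume ?L
    then have "(\<lambda>k. ennreal ((l2_norm M (\<lambda>z. s k z - g z))\<^sup>2)) \<longlonglongrightarrow> ennreal 0" unfolding eq by simp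
    then have "(\<lambda>k. (l2_norm M (\<lambda>z. s k z - g z))\<^sup>2) \<longlonglongrightarrow> 0" by (subst (asm) tendsto_ennreal_iff) auto
    from tendsto_real_sqrt[OF this] show ?R by simp
  next
    assume ?R
    from tendsto_power[OF this, of 2] have "(\<lambda>k. (l2_norm M (\<lambda>z. s k z - g z))\<^sup>2) \<longlonglongrightarrow> 0" by simp
    from tendsto_ennrealI[OF this] show ?L unfolding eq by simp
  qed
qed

locale periodic =
  fixes T :: real
  assumes T_pos: "0 < T"
begin

abbreviation Gm :: "nat \<Rightarrow> point measure" where "Gm \<equiv> group_measure T"
abbreviation Dm :: "nat \<Rightarrow> point measure" where "Dm \<equiv> dual_measure T"

abbreviation kt :: "nat \<Rightarrow> (point \<Rightarrow> complex) \<Rightarrow> point \<Rightarrow> complex" where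
  "kt n \<equiv> kernel_transform (Gm n) (group_kernel n)"

sublocale G: fourier_pair "Gm d" "Dm d" "group_kernel d" "T * (2 * pi) ^ d" for d
  by (rule group_fourier_pair[OF T_pos])

abbreviation ft :: "nat \<Rightarrow> (point \<Rightarrow> complex) \<Rightarrow> (point \<Rightarrow> complex) \<Rightarrow> bool" where
  "ft d \<equiv> l2_transform (Gm d) (Dm d) (group_kernel d)"

lemma fourier_integral_eq:
  "fourier_integral T d f z = of_real (1 / T) * kt d f z"
  by (cases z) (simp add: fourier_integral_def kernel_transform_def group_kernel_def)

lemma space_group_measure: "space (Gm d) = {0..<T} \<times> euclid d"
  by (simp add: group_measure_def space_pair_measure space_restrict_space space_PiM)

lemma space_dual_measure: "space (Dm d) = frequencies T \<times> euclid d"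
  by (simp add: dual_measure_def space_pair_measure space_PiM)

lemma cube_finite:
  "{0..<T} \<times> (PiE {..<d} (\<lambda>_. {-R..R})) \<in> sets (Gm d)"
  "emeasure (Gm d) ({0..<T} \<times> (PiE {..<d} (\<lambda>_. {-R..R}))) < \<infinity>"
proof -
  interpret L: product_sigma_finite "\<lambda>_::nat. lborel :: real measure" ..
  interpret Ld: sigma_finite_measure "lebesgue_euclid d" by (rule sigma_finite_lebesgue_euclid)
  have 1: "{0..<T} \<in> sets (circle T)" by (simp add: sets_restrict_space_iff)
  have 2: "PiE {..<d} (\<lambda>_. {-R..R}) \<in> sets (lebesgue_euclid d)" by (intro sets_PiM_I_finite) auto
  from 1 2 show "{0..<T} \<times> (PiE {..<d} (\<lambda>_. {-R..R})) \<in> sets (Gm d)"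
    unfolding group_measure_def by (rule pair_measureI)
  have "emeasure (Gm d) ({0..<T} \<times> (PiE {..<d} (\<lambda>_. {-R..R})))
      = emeasure (circle T) {0..<T} * emeasure (lebesgue_euclid d) (PiE {..<d} (\<lambda>_. {-R..R}))"
    unfolding group_measure_def by (rule Ld.emeasure_pair_measure_Times[OF 1 2])
  also have "emeasure (circle T) {0..<T} = ennreal T"
    using T_pos by (subst emeasure_restrict_space) auto
  also have "emeasure (lebesgue_euclid d) (PiE {..<d} (\<lambda>_. {-R..R})) = (\<Prod>i<d. emeasure lborel {-R..R})"
    by (rule L.emeasure_PiM) auto
  also have "ennreal T * (\<Prod>i<d. emeasure lborel {-R..R}) < \<infinity>"
    by (cases "0 \<le> R") (simp_all add: ennreal_mult_less_top ennreal_power power_0_left)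
  finally show "emeasure (Gm d) ({0..<T} \<times> (PiE {..<d} (\<lambda>_. {-R..R}))) < \<infinity>" .
qed

lemma truncate_eq:
  assumes "z \<in> space (Gm d)"
  shows "truncate d R f z = indicator ({0..<T} \<times> (PiE {..<d} (\<lambda>_. {-R..R}))) z * f z"
proof -
  have "z \<in> {0..<T} \<times> (PiE {..<d} (\<lambda>_. {-R..R})) \<longleftrightarrow> (\<forall>i<d. \<bar>snd z i\<bar> \<le> R)"
    using assms by (cases z) (auto simp: space_group_measure PiE_iff abs_le_iff minus_le_iff)
  then show ?thesis by (simp add: truncate_def indicator_def)
qed

text \<open>On the space of the measure, truncation is multiplication by the indicator of a box of
  finite measure; this indicator lies in L2, which makes the product integrable.\<close>

lemma truncate_facts:
  assumes f: "L2 (Gm d) f"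
  shows "integrable (Gm d) (truncate d R f)" "L2 (Gm d) (truncate d R f)"
    "(\<lambda>k. l2_norm (Gm d) (\<lambda>z. truncate d (real k) f z - f z)) \<longlonglongrightarrow> 0"
proof -
  let ?M = "Gm d"
  let ?A = "\<lambda>R. {0..<T} \<times> (PiE {..<d} (\<lambda>_. {-R..R}))"
  have i: "L2 ?M (indicator (?A R))" for R
    by (rule indicator_L1_L2(2)[OF cube_finite])
  have eq: "z \<in> space ?M \<Longrightarrow> truncate d R f z = indicator (?A R) z * f z" for R z by (rule truncate_eq)
  have Im: "(\<lambda>z. indicator (?A R) z * f z) \<in> borel_measurable ?M" for R
    using i[of R] f by (intro borel_measurable_times) auto
  have m: "truncate d R f \<in> borel_measurable ?M" for R
    using Im[of R] measurable_cong[of ?M "truncate d R f" "\<lambda>z. indicator (?A R) z * f z" borel] eq by blast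
  show "integrable ?M (truncate d R f)"
    using L2_mult_integrable[OF i f] by (subst Bochner_Integration.integrable_cong[OF refl eq])
  show "L2 ?M (truncate d R f)"
    by (rule L2_mono[OF f m]) (simp add: truncate_def)
  show "(\<lambda>k. l2_norm ?M (\<lambda>z. truncate d (real k) f z - f z)) \<longlonglongrightarrow> 0"
  proof (rule l2_dominated_convergence[OF L2D[OF f] m f])
    show "AE z in ?M. (\<lambda>k. truncate d (real k) f z) \<longlonglongrightarrow> f z"
    proof (rule AE_I2)
      fix z :: point
      obtain K :: nat where K: "(\<Sum>i<d. \<bar>snd z i\<bar>) \<le> real K" using real_arch_simple by blast
      have "truncate d (real k) f z = f z" if "K \<le> k" for k
      proof -
        have "\<bar>snd z i\<bar> \<le> real k" if "i < d" for i
          using member_le_sum[of i "{..<d}" "\<lambda>i. \<bar>snd z i\<bar>"] K \<open>K \<le> k\<close> that by simp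
        then show ?thesis by (simp add: truncate_def)
      qed
      then show "(\<lambda>k. truncate d (real k) f z) \<longlonglongrightarrow> f z"
        by (intro tendsto_eventually eventually_sequentiallyI[of K])
    qed
    show "AE z in ?M. cmod (truncate d (real i) f z - f z) \<le> cmod (f z)" for i
      by (simp add: truncate_def)
  qed
qed

text \<open>The choice in \<open>fourier\<close> is made from a nonempty set, since 1/T times the L2
  transform is a limit of the truncated integrals; uniqueness of L2 limits identifies whatever is
  chosen with it. The factor \<open>T\<close> undoes the normalisation of
  \<open>fourier_integral\<close>.\<close>

lemma ft_fourier:
  assumes f: "L2 (Gm d) f"
  shows "L2 (Dm d) (fourier T d f)" "ft d f (\<lambda>z. of_real T * fourier T d f z)"
proof -
  let ?M = "Gm d" and ?N = "Dm d"
  obtain g where g: "ft d f g" using G.l2_transform_exists[OF f] .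
  note g2 = G.l2_transformD(2)[OF g]
  let ?K = "\<lambda>k. kernel_transform ?M (group_kernel d) (truncate d (real k) f)"
  have K2: "L2 ?N (?K k)" for k
    by (rule G.kernel_transform_L2(1)[OF truncate_facts(1,2)[OF f]])
  have lim: "(\<lambda>k. l2_norm ?N (\<lambda>z. ?K k z - g z)) \<longlonglongrightarrow> 0"
    by (rule G.l2_transform_tendsto[OF g truncate_facts(1,2)[OF f] truncate_facts(3)[OF f]])
  define P where "P h \<longleftrightarrow> L2 ?N h \<and>
     (\<lambda>k. \<integral>\<^sup>+z. ennreal ((cmod (fourier_integral T d (truncate d (real k) f) z - h z))\<^sup>2) \<partial>?N) \<longlonglongrightarrow> 0" for h
  define u where "u = complex_of_real (1 / T)"
  have fi: "L2 ?N (\<lambda>z. u * ?K k z)" for k by (rule L2_cmult[OF K2])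
  have ug: "L2 ?N (\<lambda>z. u * g z)" by (rule L2_cmult[OF g2])
  have sc: "l2_norm ?N (\<lambda>z. u * ?K k z - u * g z) = cmod u * l2_norm ?N (\<lambda>z. ?K k z - g z)" for k
    unfolding l2_norm_cmult[symmetric] by (simp only: right_diff_distrib)
  have ul: "(\<lambda>k. l2_norm ?N (\<lambda>z. u * ?K k z - u * g z)) \<longlonglongrightarrow> 0"
    unfolding sc by (rule tendsto_mult_right_zero[OF lim])
  have feq: "fourier_integral T d (truncate d (real k) f) z = u * ?K k z" for k z
    by (simp only: fourier_integral_eq u_def)
  have "P (\<lambda>z. u * g z)"
    unfolding P_def feq by (rule conjI[OF ug l2_tendsto_iff_nn[OF fi ug, THEN iffD2, OF ul]])
  then have "P (SOME h. P h)" by (rule someI[of P])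
  moreover have "fourier T d f = (SOME h. P h)" by (simp only: fourier_def P_def)
  ultimately have "P (fourier T d f)" by simp
  then have h: "L2 ?N (fourier T d f)"
    and hl: "(\<lambda>k. \<integral>\<^sup>+z. ennreal ((cmod (u * ?K k z - fourier T d f z))\<^sup>2) \<partial>?N) \<longlonglongrightarrow> 0"
    unfolding P_def feq by blast+
  show "L2 ?N (fourier T d f)" by (rule h)
  have "AE z in ?N. fourier T d f z = u * g z"
    by (rule l2_limit_unique[OF fi h ug l2_tendsto_iff_nn[OF fi h, THEN iffD1, OF hl] ul])
  then have AE: "AE z in ?N. g z = of_real T * fourier T d f z"
    by eventually_elim (use T_pos in \<open>simp add: u_def\<close>)
  show "ft d f (\<lambda>z. of_real T * fourier T d f z)"
    by (rule G.l2_transform_cong[OF g L2D[OF f] L2D[OF L2_cmult[OF h]] _ AE]) simp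
qed

lemma fourier_eqI:
  assumes "ft d f (\<lambda>z. of_real T * g z)"
  shows "AE z in Dm d. fourier T d f z = g z"
proof -
  have "AE z in Dm d. of_real T * fourier T d f z = of_real T * g z"
    by (rule G.l2_transform_unique[OF ft_fourier(2)[OF G.l2_transformD(1)[OF assms]] assms]) simp
  then show ?thesis by eventually_elim (use T_pos in simp)
qed

lemma fourier_inj:
  assumes f: "L2 (Gm d) f" and g: "L2 (Gm d) g"
    and AE: "AE z in Dm d. fourier T d f z = fourier T d g z"
  shows "AE z in Gm d. f z = g z"
proof (rule G.l2_transform_inj[OF ft_fourier(2)[OF f] ft_fourier(2)[OF g]])
  show "AE z in Dm d. of_real T * fourier T d f z = of_real T * fourier T d g z"
    using AE by eventually_elim simp
qed

lemma fourier_lincomb: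
  assumes f: "L2 (Gm d) f" and g: "L2 (Gm d) g"
  shows "AE z in Dm d. fourier T d (\<lambda>z. f z + a * g z) z = fourier T d f z + a * fourier T d g z"
proof (rule fourier_eqI)
  have "(\<lambda>z. of_real T * (fourier T d f z + a * fourier T d g z))
      = (\<lambda>z. of_real T * fourier T d f z + a * (of_real T * fourier T d g z))"
    by (simp add: algebra_simps)
  then show "ft d (\<lambda>z. f z + a * g z) (\<lambda>z. of_real T * (fourier T d f z + a * fourier T d g z))"
    using G.l2_transform_lincomb[OF ft_fourier(2)[OF f] ft_fourier(2)[OF g], of a] by simp
qed

lemma fourier_L1:
  assumes "integrable (Gm d) f" "L2 (Gm d) f"
  shows "AE z in Dm d. fourier T d f z = fourier_integral T d f z"
proof (rule fourier_eqI)
  have "(\<lambda>z. of_real T * fourier_integral T d f z) = kt d f"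
    using T_pos by (simp add: fourier_integral_eq fun_eq_iff)
  then show "ft d f (\<lambda>z. of_real T * fourier_integral T d f z)"
    using G.l2_transform_L1[OF assms] by simp
qed

text \<open>Inversion determines a function only for times in [0, T), whereas
  \<open>group_L2\<close> asks for periodicity over all of the reals.\<close>

definition periodize :: "(point \<Rightarrow> complex) \<Rightarrow> point \<Rightarrow> complex" where
  "periodize f z = f (fst z - T * of_int \<lfloor>fst z / T\<rfloor>, snd z)"

lemma periodize_periodic: "time_periodic T d (periodize f)"
proof -
  have "\<lfloor>(t + T) / T\<rfloor> = \<lfloor>t / T\<rfloor> + 1" for t using T_pos by (simp add: add_divide_distrib)
  then show ?thesis by (simp add: time_periodic_def periodize_def algebra_simps)
qed

lemma periodize_eq:
  assumes "z \<in> space (Gm d)"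
  shows "periodize f z = f z"
proof -
  have "fst z \<in> {0..<T}" using assms unfolding space_group_measure mem_Times_iff by (rule conjunct1)
  then have "0 \<le> fst z / T" "fst z / T < 1" using T_pos by simp_all
  then have "\<lfloor>fst z / T\<rfloor> = 0" by (intro floor_unique) simp_all
  then show ?thesis by (simp add: periodize_def)
qed

lemma fourier_surj:
  assumes g: "L2 (Dm d) g"
  obtains f where "f \<in> group_L2 T d" "AE z in Dm d. fourier T d f z = g z"
proof -
  obtain f where f: "ft d f (\<lambda>z. of_real T * g z)"
    using G.l2_transform_surj[OF L2_cmult[OF g]] .
  have f2: "L2 (Gm d) f" by (rule G.l2_transformD(1)[OF f])
  have p2: "L2 (Gm d) (periodize f)"
    using f2 L2_cong[of "Gm d" "periodize f" f] periodize_eq by blast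
  have "ft d (periodize f) (\<lambda>z. of_real T * g z)"
    by (rule G.l2_transform_cong[OF f L2D[OF p2]]) (use g periodize_eq in \<open>auto intro!: AE_I2\<close>)
  from fourier_eqI[OF this] p2 periodize_periodic that show ?thesis by (auto simp: group_L2_def)
qed

text \<open>The constant is T (2 pi)^d, divided by T^2 for the two normalisations 1/T.\<close>

lemma fourier_parseval:
  assumes f: "L2 (Gm d) f" and g: "L2 (Gm d) g"
  shows "(\<integral>z. fourier T d f z * cnj (fourier T d g z) \<partial>Dm d)
    = of_real ((2 * pi) ^ d / T) * (\<integral>z. f z * cnj (g z) \<partial>Gm d)"
proof -
  have "of_real (T * T) * (\<integral>z. fourier T d f z * cnj (fourier T d g z) \<partial>Dm d)
      = (\<integral>z. (of_real T * fourier T d f z) * cnj (of_real T * fourier T d g z) \<partial>Dm d)"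
  proof -
    have "(of_real T * fourier T d f z) * cnj (of_real T * fourier T d g z)
        = of_real (T * T) * (fourier T d f z * cnj (fourier T d g z))" for z by (simp add: mult_ac)
    then show ?thesis by (simp only: integral_mult_right_zero)
  qed
  also have "\<dots> = of_real (T * (2 * pi) ^ d) * (\<integral>z. f z * cnj (g z) \<partial>Gm d)"
    by (rule G.l2_transform_parseval[OF ft_fourier(2)[OF f] ft_fourier(2)[OF g]])
  finally show ?thesis using T_pos by (simp add: field_simps)
qed

text \<open>Kept as a function on the whole group, constant in time, so that it has a transform
  which can be compared with that of \<open>f\<close>.\<close>

definition time_mean :: "(point \<Rightarrow> complex) \<Rightarrow> point \<Rightarrow> complex" where
  "time_mean f z = of_real (1 / T) * (\<integral>t. f (t, snd z) \<partial>circle T)"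

lemma time_mean_measurable:
  assumes "f \<in> borel_measurable (Gm d)"
  shows "(\<lambda>x. time_mean f (t, x)) \<in> borel_measurable (lebesgue_euclid d)"
    "time_mean f \<in> borel_measurable (Gm d)"
proof -
  interpret C: sigma_finite_measure "circle T" by (rule sigma_finite_circle)
  have fm: "f \<in> borel_measurable (circle T \<Otimes>\<^sub>M lebesgue_euclid d)" using assms by (simp add: group_measure_def)
  have "(\<lambda>p. f (snd p, fst p)) \<in> borel_measurable (lebesgue_euclid d \<Otimes>\<^sub>M circle T)"
    using measurable_compose[OF measurable_pair_swap' fm] by (simp add: case_prod_beta')
  then have "(\<lambda>x. \<integral>t. f (t, x) \<partial>circle T) \<in> borel_measurable (lebesgue_euclid d)"
    by (intro C.borel_measurable_lebesgue_integral) (simp add: case_prod_beta')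
  then show m: "(\<lambda>x. time_mean f (t, x)) \<in> borel_measurable (lebesgue_euclid d)" for t
    unfolding time_mean_def by simp
  have "(\<lambda>z. time_mean f (undefined, snd z)) \<in> borel_measurable (Gm d)"
    unfolding group_measure_def by (rule measurable_compose[OF measurable_snd m])
  then show "time_mean f \<in> borel_measurable (Gm d)" by (simp add: time_mean_def[abs_def])
qed

lemma nn_integral_group:
  assumes "h \<in> borel_measurable (Gm d)"
  shows "(\<integral>\<^sup>+z. h z \<partial>Gm d) = (\<integral>\<^sup>+x. (\<integral>\<^sup>+t. h (t, x) \<partial>circle T) \<partial>lebesgue_euclid d)"
proof -
  interpret A: sigma_finite_measure "circle T" by (rule sigma_finite_circle)
  interpret B: sigma_finite_measure "lebesgue_euclid d" by (rule sigma_finite_lebesgue_euclid)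
  interpret P: pair_sigma_finite "circle T" "lebesgue_euclid d" ..
  show ?thesis
    using P.nn_integral_snd[of h] assms by (simp add: group_measure_def)
qed

lemma emeasure_circle: "emeasure (circle T) (space (circle T)) = ennreal T"
  using T_pos by (simp add: emeasure_restrict_space space_restrict_space)

lemma nn_integral_time_mean:
  assumes "f \<in> borel_measurable (Gm d)"
  shows "energy (Gm d) (time_mean f)
    = ennreal T * energy (lebesgue_euclid d) (\<lambda>x. time_mean f (0, x))"
proof -
  note [measurable] = time_mean_measurable[OF assms]
  have mm: "(\<lambda>z. ennreal ((cmod (time_mean f z))\<^sup>2)) \<in> borel_measurable (Gm d)"
    using time_mean_measurable(2)[OF assms] by simp
  have "energy (Gm d) (time_mean f)
      = (\<integral>\<^sup>+x. energy (circle T) (\<lambda>t. time_mean f (0, x)) \<partial>lebesgue_euclid d)"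
    unfolding nn_integral_group[OF mm] by (intro nn_integral_cong) (simp add: time_mean_def)
  also have "\<dots> = (\<integral>\<^sup>+x. ennreal T * ennreal ((cmod (time_mean f (0, x)))\<^sup>2) \<partial>lebesgue_euclid d)"
    by (simp only: nn_integral_const emeasure_circle mult.commute)
  finally show ?thesis by (simp add: nn_integral_cmult)
qed

text \<open>Cauchy-Schwarz against the constant 1 on the circle: T times the squared mean is at most
  the energy of the time section. The energy may be infinite, so the inequality holds for every
  \<open>x\<close> without an exceptional set.\<close>

lemma time_mean_L2:
  assumes f: "L2 (Gm d) f"
  shows "L2 (Gm d) (time_mean f)"
    "l2_norm (Gm d) (time_mean f) \<le> l2_norm (Gm d) f"
proof -
  note [measurable] = L2D[OF f] time_mean_measurable[OF L2D[OF f]]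
  have fx: "(\<lambda>t. f (t, x)) \<in> borel_measurable (circle T)" if "x \<in> space (lebesgue_euclid d)" for x
    using measurable_compose[OF measurable_Pair2'[OF that], of f "circle T" borel] L2D[OF f]
    by (simp add: group_measure_def)
  have b: "ennreal T * ennreal ((cmod (time_mean f (0, x)))\<^sup>2) \<le> energy (circle T) (\<lambda>t. f (t, x))"
    if x: "x \<in> space (lebesgue_euclid d)" for x
  proof -
    note [measurable] = fx[OF x]
    define I where "I = energy (circle T) (\<lambda>t. f (t, x))"
    have 1: "ennreal (cmod (\<integral>t. f (t, x) \<partial>circle T)) \<le> (\<integral>\<^sup>+t. ennreal (cmod (f (t, x))) * 1 \<partial>circle T)"
      using integral_norm_bound_ennreal[of "circle T" "\<lambda>t. f (t, x)"]
      by (cases "integrable (circle T) (\<lambda>t. f (t, x))") (auto simp: not_integrable_integral_eq)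
    have "(ennreal (cmod (\<integral>t. f (t, x) \<partial>circle T)))\<^sup>2 \<le> (\<integral>\<^sup>+t. ennreal (cmod (f (t, x))) * 1 \<partial>circle T)\<^sup>2"
      by (rule power_mono[OF 1]) simp
    also have "\<dots> \<le> (\<integral>\<^sup>+t. (ennreal (cmod (f (t, x))))\<^sup>2 \<partial>circle T) * (\<integral>\<^sup>+t. 1\<^sup>2 \<partial>circle T)"
      by (rule Cauchy_Schwarz_nn_integral) auto
    also have "\<dots> = I * ennreal T"
      by (simp only: I_def ennreal_power norm_ge_zero power_one nn_integral_const emeasure_circle mult_1)
    finally have 2: "ennreal ((cmod (\<integral>t. f (t, x) \<partial>circle T))\<^sup>2) \<le> I * ennreal T"
      by (simp add: ennreal_power)
    have "ennreal T * ennreal ((cmod (time_mean f (0, x)))\<^sup>2)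
        = ennreal (1 / T) * ennreal ((cmod (\<integral>t. f (t, x) \<partial>circle T))\<^sup>2)"
      using T_pos by (simp add: time_mean_def norm_mult power_mult_distrib power2_eq_square norm_divide flip: ennreal_mult)
    also have "\<dots> \<le> ennreal (1 / T) * (I * ennreal T)" by (rule mult_left_mono[OF 2]) simp
    also have "\<dots> = I * (ennreal T * ennreal (1 / T))" by (simp add: ac_simps)
    also have "ennreal T * ennreal (1 / T) = 1" using T_pos by (simp flip: ennreal_mult)
    finally show ?thesis by (simp add: I_def)
  qed
  have "energy (Gm d) (time_mean f)
      = (\<integral>\<^sup>+x. ennreal T * ennreal ((cmod (time_mean f (0, x)))\<^sup>2) \<partial>lebesgue_euclid d)"
    by (simp add: nn_integral_time_mean nn_integral_cmult)
  also have "\<dots> \<le> (\<integral>\<^sup>+x. energy (circle T) (\<lambda>t. f (t, x)) \<partial>lebesgue_euclid d)"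
    by (rule nn_integral_mono) (rule b)
  also have "\<dots> = energy (Gm d) f"
    by (rule nn_integral_group[symmetric]) simp
  also have "\<dots> = ennreal ((l2_norm (Gm d) f)\<^sup>2)" by (rule nn_integral_l2[OF f])
  finally have *: "energy (Gm d) (time_mean f) \<le> ennreal ((l2_norm (Gm d) f)\<^sup>2)" .
  show "L2 (Gm d) (time_mean f)"
    "l2_norm (Gm d) (time_mean f) \<le> l2_norm (Gm d) f"
    by (rule l2_norm_leI[OF _ *]; simp)+
qed

text \<open>By orthogonality a function constant in time pairs with a character only at the time
  frequency 0; there Fubini gives the transform of \<open>f\<close> itself.\<close>

lemma time_mean_L1:
  assumes f: "integrable (Gm d) f"
  shows "integrable (Gm d) (time_mean f)"
    "\<zeta> \<in> space (Dm d) \<Longrightarrow> kt d (time_mean f) \<zeta>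
      = (if fst \<zeta> = 0 then kt d f \<zeta> else 0)"
proof -
  interpret A: sigma_finite_measure "circle T" by (rule sigma_finite_circle)
  interpret fm: finite_measure "circle T" by (rule finite_measure_circle)
  interpret B: sigma_finite_measure "lebesgue_euclid d" by (rule sigma_finite_lebesgue_euclid)
  interpret P: pair_sigma_finite "circle T" "lebesgue_euclid d" ..
  have f': "integrable (circle T \<Otimes>\<^sub>M lebesgue_euclid d) (\<lambda>(t, x). f (t, x))"
    using f by (simp add: group_measure_def)
  have mi: "integrable (lebesgue_euclid d) (\<lambda>x. \<integral>t. f (t, x) \<partial>circle T)" by (rule P.integrable_snd[OF f'])
  have ti: "integrable (lebesgue_euclid d) (\<lambda>x. time_mean f (t, x))" for t
    unfolding time_mean_def using mi by simp
  have prod: "integrable (circle T \<Otimes>\<^sub>M lebesgue_euclid d) (\<lambda>(t, x). c t * h x)"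
    if c: "c \<in> borel_measurable (circle T)" "\<And>t. cmod (c t) \<le> 1" and h: "integrable (lebesgue_euclid d) h" for c :: "real \<Rightarrow> complex" and h
  proof -
    note [measurable] = c(1) borel_measurable_integrable[OF h]
    have ci: "integrable (circle T) c" by (rule fm.integrable_const_bound[of _ 1]) (use c in auto)
    show ?thesis
    proof (rule P.Fubini_integrable)
      show "integrable (circle T) (\<lambda>t. \<integral>x. norm (case (t, x) of (t, x) \<Rightarrow> c t * h x) \<partial>lebesgue_euclid d)"
        using ci by (simp add: norm_mult)
      show "AE t in circle T. integrable (lebesgue_euclid d) (\<lambda>x. case (t, x) of (t, x) \<Rightarrow> c t * h x)"
        using h by simp
    qed measurable
  qed
  have "integrable (Gm d) (\<lambda>(t, x). 1 * time_mean f (0, x))"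
    unfolding group_measure_def by (rule prod[OF _ _ ti]) auto
  moreover have "(\<lambda>(t, x). 1 * time_mean f (0, x)) = time_mean f" by (auto simp: time_mean_def)
  ultimately show "integrable (Gm d) (time_mean f)" by simp
  assume \<zeta>: "\<zeta> \<in> space (Dm d)"
  obtain \<tau> \<xi> where z: "\<zeta> = (\<tau>, \<xi>)" by force
  have \<tau>: "\<tau> \<in> frequencies T" using \<zeta> by (auto simp: z space_dual_measure)
  define c where "c x = cis (- (\<Sum>i<d. \<xi> i * x i))" for x :: "nat \<Rightarrow> real"
  have cm: "c \<in> borel_measurable (lebesgue_euclid d)" unfolding c_def by measurable
  have hc: "integrable (lebesgue_euclid d) (\<lambda>x. time_mean f (0, x) * c x)"
    by (rule Bochner_Integration.integrable_bound[OF ti[of 0]])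
      (use cm ti[of 0] in \<open>auto simp: norm_mult c_def\<close>)
  have gk: "group_kernel d (t, x) \<zeta> = cis (- (\<tau> * t)) * c x" for t x
    by (simp add: group_kernel_def z c_def cis_mult)
  have "kt d (time_mean f) \<zeta>
      = (\<integral>z. (\<lambda>(t, x). cis (- (\<tau> * t)) * (time_mean f (0, x) * c x)) z \<partial>(circle T \<Otimes>\<^sub>M lebesgue_euclid d))"
    unfolding kernel_transform_def group_measure_def
    by (intro Bochner_Integration.integral_cong refl) (auto simp: gk time_mean_def)
  also have "\<dots> = (\<integral>x. (\<integral>t. cis (- (\<tau> * t)) * (time_mean f (0, x) * c x) \<partial>circle T) \<partial>lebesgue_euclid d)"
    by (rule P.integral_snd[symmetric, OF prod[OF _ _ hc]]) auto
  also have "\<dots> = (\<integral>x. (if \<tau> = 0 then of_real T else 0) * (time_mean f (0, x) * c x) \<partial>lebesgue_euclid d)"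
  proof -
    have "- \<tau> \<in> frequencies T"
    proof -
      obtain k :: int where "\<tau> = 2 * pi / T * of_int k" using \<tau> by blast
      then have "- \<tau> = 2 * pi / T * of_int (- k)" by simp
      then show ?thesis by blast
    qed
    from circle_orthogonal[OF T_pos this]
    have "(\<integral>t. cis (- (\<tau> * t)) \<partial>circle T) = (if \<tau> = 0 then of_real T else 0)" by simp
    then show ?thesis by (simp only: integral_mult_left_zero)
  qed
  also have "\<dots> = (if \<tau> = 0 then (\<integral>x. (\<integral>t. f (t, x) * c x \<partial>circle T) \<partial>lebesgue_euclid d) else 0)"
  proof -
    have "of_real T * (time_mean f (0, x) * c x) = (\<integral>t. f (t, x) * c x \<partial>circle T)" for x
      using T_pos by (simp add: time_mean_def)
    then show ?thesis
      by (cases "\<tau> = 0") (simp_all only: simp_thms if_True if_False mult_zero_left Bochner_Integration.integral_zero)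
  qed
  also have "(\<integral>x. (\<integral>t. f (t, x) * c x \<partial>circle T) \<partial>lebesgue_euclid d)
      = (\<integral>z. (\<lambda>(t, x). f (t, x) * c x) z \<partial>(circle T \<Otimes>\<^sub>M lebesgue_euclid d))"
  proof (rule P.integral_snd)
    show "integrable (circle T \<Otimes>\<^sub>M lebesgue_euclid d) (\<lambda>(t, x). f (t, x) * c x)"
      by (rule Bochner_Integration.integrable_bound[OF f'])
        (use f' cm in \<open>auto simp: norm_mult c_def case_prod_beta'\<close>)
  qed
  finally have fin: "kt d (time_mean f) \<zeta>
      = (if \<tau> = 0 then (\<integral>z. (\<lambda>(t, x). f (t, x) * c x) z \<partial>(circle T \<Otimes>\<^sub>M lebesgue_euclid d)) else 0)" .
  have \<tau>0: "kt d f \<zeta>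
      = (\<integral>z. (\<lambda>(t, x). f (t, x) * c x) z \<partial>(circle T \<Otimes>\<^sub>M lebesgue_euclid d))" if "\<tau> = 0"
  proof -
    have "group_kernel d y \<zeta> = c (snd y)" for y using gk[of "fst y" "snd y"] that by simp
    then show ?thesis by (simp add: kernel_transform_def group_measure_def case_prod_beta')
  qed
  have "fst \<zeta> = \<tau>" by (simp add: z)
  then show "kt d (time_mean f) \<zeta>
      = (if fst \<zeta> = 0 then kt d f \<zeta> else 0)"
    using fin \<tau>0 by (cases "\<tau> = 0") (simp_all only: simp_thms if_True if_False)
qed

text \<open>Taking the mean and restricting to \<tau> = 0 are both contractions in L2, so the
  identity passes from integrable approximants to their limits.\<close>

lemma ft_time_mean:
  assumes ft: "ft d f g"
  shows "ft d (time_mean f) (\<lambda>\<zeta>. if fst \<zeta> = 0 then g \<zeta> else 0)"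
proof -
  let ?M = "Gm d" and ?N = "Dm d"
  let ?R = "\<lambda>g \<zeta>. if fst \<zeta> = (0::real) then g \<zeta> else (0::complex)"
  obtain s where s: "\<And>k. integrable ?M (s k)" "\<And>k. L2 ?M (s k)"
    "(\<lambda>k. l2_norm ?M (\<lambda>x. s k x - f x)) \<longlonglongrightarrow> 0"
    "(\<lambda>k. l2_norm ?N (\<lambda>y. kernel_transform ?M (group_kernel d) (s k) y - g y)) \<longlonglongrightarrow> 0"
    using ft unfolding l2_transform_def by blast
  note fg = G.l2_transformD[OF ft]
  let ?K = "\<lambda>k. kernel_transform ?M (group_kernel d) (s k)"
  have K: "L2 ?N (?K k)" for k by (rule G.kernel_transform_L2(1)[OF s(1,2)])
  have Rm: "?R h \<in> borel_measurable ?N" if "h \<in> borel_measurable ?N" for h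
    using that dual_measure_fst_measurable[of T d] by measurable
  have R2: "L2 ?N (?R h)" "l2_norm ?N (?R h) \<le> l2_norm ?N h" if "L2 ?N h" for h
    by (rule L2_mono[OF that Rm]; use that in auto)+
  \<comment> \<open>The mean is additive only where the time sections are integrable, which is the
    case for almost every \<open>x\<close>.\<close>
  have md: "AE z in ?M. time_mean (s k) z - time_mean f z = time_mean (\<lambda>z. s k z - f z) z" for k
  proof -
    have ae: "AE x in lebesgue_euclid d. integrable (circle T) (\<lambda>t. h (t, x))" if h: "L2 ?M h" for h
    proof -
      interpret A: sigma_finite_measure "circle T" by (rule sigma_finite_circle)
      interpret fm: finite_measure "circle T" by (rule finite_measure_circle)
      interpret B: sigma_finite_measure "lebesgue_euclid d" by (rule sigma_finite_lebesgue_euclid)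
      interpret P: pair_sigma_finite "circle T" "lebesgue_euclid d" ..
      have "AE x in lebesgue_euclid d. integrable (circle T) (\<lambda>t. (cmod (h (t, x)))\<^sup>2)"
        using P.AE_integrable_snd[of "\<lambda>t x. (cmod (h (t, x)))\<^sup>2"] L2_integrable[OF h]
        by (simp add: group_measure_def case_prod_beta')
      then show ?thesis using AE_space
      proof eventually_elim
        case (elim x)
        have m: "(\<lambda>t. h (t, x)) \<in> borel_measurable (circle T)"
          using measurable_compose[OF measurable_Pair2'[OF elim(2)], of h "circle T" borel] L2D[OF h]
          by (simp add: group_measure_def)
        then have 2: "L2 (circle T) (\<lambda>t. h (t, x))" using elim by (simp add: square_integrable_def)
        have "L2 (circle T) (\<lambda>t. 1)"
          unfolding square_integrable_def using fm.integrable_const_bound[of "\<lambda>_. 1 :: real" 1] by simp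
        from L2_mult_integrable[OF 2 this] show ?case by simp
      qed
    qed
    have "AE x in lebesgue_euclid d. \<forall>t. time_mean (s k) (t, x) - time_mean f (t, x) = time_mean (\<lambda>z. s k z - f z) (t, x)"
      using ae[OF s(2)[of k]] ae[OF fg(1)]
      by eventually_elim (simp add: time_mean_def right_diff_distrib)
    moreover interpret A: sigma_finite_measure "circle T" by (rule sigma_finite_circle)
    interpret B: sigma_finite_measure "lebesgue_euclid d" by (rule sigma_finite_lebesgue_euclid)
    interpret P: pair_sigma_finite "lebesgue_euclid d" "circle T" ..
    obtain N where N: "N \<in> null_sets (lebesgue_euclid d)"
      "{x \<in> space (lebesgue_euclid d). \<not> (\<forall>t. time_mean (s k) (t, x) - time_mean f (t, x) = time_mean (\<lambda>z. s k z - f z) (t, x))} \<subseteq> N"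
      using calculation by (auto elim!: AE_E simp: null_sets_def)
    have "space (circle T) \<times> N \<in> null_sets (circle T \<Otimes>\<^sub>M lebesgue_euclid d)"
      by (intro B.times_in_null_sets2 N sets.top)
    then show ?thesis unfolding group_measure_def
      by (rule AE_I') (use N(2) in \<open>auto simp: space_pair_measure\<close>)
  qed
  show ?thesis
    unfolding l2_transform_def
  proof (intro conjI exI[of _ "\<lambda>k. time_mean (s k)"] allI)
    show "L2 ?M (time_mean f)" by (rule time_mean_L2(1)[OF fg(1)])
    show "L2 ?N (?R g)" by (rule R2(1)[OF fg(2)])
    show "integrable ?M (time_mean (s k))" "L2 ?M (time_mean (s k))" for k
      by (rule time_mean_L1(1)[OF s(1)] time_mean_L2(1)[OF s(2)])+
    have b: "norm (l2_norm ?M (\<lambda>x. time_mean (s k) x - time_mean f x)) \<le> l2_norm ?M (\<lambda>x. s k x - f x)" for k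
    proof -
      have "l2_norm ?M (\<lambda>x. time_mean (s k) x - time_mean f x) = l2_norm ?M (time_mean (\<lambda>z. s k z - f z))"
        using time_mean_L2(1)[OF s(2)[of k]] time_mean_L2(1)[OF fg(1)]
          time_mean_L2(1)[OF L2_diff[OF s(2)[of k] fg(1)]]
        by (intro l2_norm_cong_AE[OF _ _ md]) (auto intro!: borel_measurable_diff)
      then show ?thesis using time_mean_L2(2)[OF L2_diff[OF s(2)[of k] fg(1)]] by simp
    qed
    show "(\<lambda>k. l2_norm ?M (\<lambda>x. time_mean (s k) x - time_mean f x)) \<longlonglongrightarrow> 0"
      by (rule Lim_null_comparison[OF always_eventually[OF allI[OF b]] s(3)])
    have b': "norm (l2_norm ?N (\<lambda>y. kernel_transform ?M (group_kernel d) (time_mean (s k)) y - ?R g y))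
        \<le> l2_norm ?N (\<lambda>y. ?K k y - g y)" for k
    proof -
      have "l2_norm ?N (\<lambda>y. kernel_transform ?M (group_kernel d) (time_mean (s k)) y - ?R g y)
          = l2_norm ?N (?R (\<lambda>y. ?K k y - g y))"
        using time_mean_L1(2)[OF s(1)[of k]] by (intro l2_norm_cong) simp
      then show ?thesis using R2(2)[OF L2_diff[OF K[of k] fg(2)]] by simp
    qed
    show "(\<lambda>k. l2_norm ?N (\<lambda>y. kernel_transform ?M (group_kernel d) (time_mean (s k)) y - ?R g y)) \<longlonglongrightarrow> 0"
      by (rule Lim_null_comparison[OF always_eventually[OF allI[OF b']] s(4)])
  qed
qed

lemma fourier_time_mean:
  assumes f: "L2 (Gm d) f"
  shows "AE z in Dm d. fourier T d (time_mean f) z = (if fst z = 0 then fourier T d f z else 0)"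
proof (rule fourier_eqI)
  have "(\<lambda>z. of_real T * (if fst z = 0 then fourier T d f z else 0)) = (\<lambda>z. if fst z = 0 then of_real T * fourier T d f z else 0)"
    by auto
  then show "ft d (time_mean f) (\<lambda>z. of_real T * (if fst z = 0 then fourier T d f z else 0))"
    using ft_time_mean[OF ft_fourier(2)[OF f]] by simp
qed

text \<open>The transform of the time mean is that of \<open>f\<close> at \<tau> = 0 and vanishes
  elsewhere, so Plancherel equates the two conditions. The time frequencies carry counting measure,
  hence \<tau> = 0 is not a null set and the right-hand side is a genuine condition.\<close>

lemma oscillation_iff:
  assumes f: "L2 (Gm d) f"
  shows "(AE x in lebesgue_euclid d. (LBINT t:{0..<T}. f (t, x)) = 0) \<longleftrightarrow>
    (AE z in Dm d. fst z = 0 \<longrightarrow> fourier T d f z = 0)" (is "?L \<longleftrightarrow> ?R")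
proof -
  note m2 = time_mean_L2(1)[OF f]
  have m: "(LBINT t:{0..<T}. f (t, x)) = of_real T * time_mean f (0, x)" for x
    using T_pos by (simp add: set_lebesgue_integral_def integral_circle time_mean_def)
  have "?L \<longleftrightarrow> (AE x in lebesgue_euclid d. ennreal ((cmod (time_mean f (0, x)))\<^sup>2) = 0)"
    unfolding m using T_pos by simp
  also have "\<dots> \<longleftrightarrow> energy (lebesgue_euclid d) (\<lambda>x. time_mean f (0, x)) = 0"
    using time_mean_measurable(1)[OF L2D[OF f]] by (intro nn_integral_0_iff_AE[symmetric]) simp
  also have "\<dots> \<longleftrightarrow> energy (Gm d) (time_mean f) = 0"
    unfolding nn_integral_time_mean[OF L2D[OF f]] using T_pos by simp
  also have "\<dots> \<longleftrightarrow> l2_norm (Gm d) (time_mean f) = 0"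
    unfolding nn_integral_l2[OF m2] by simp
  also have "\<dots> \<longleftrightarrow> l2_norm (Dm d) (\<lambda>z. of_real T * fourier T d (time_mean f) z) = 0"
    using G.l2_transform_norm[OF ft_fourier(2)[OF m2]] T_pos by simp
  also have "\<dots> \<longleftrightarrow> (AE z in Dm d. of_real T * fourier T d (time_mean f) z = 0)"
    by (rule l2_norm_eq_0_iff) (simp add: ft_fourier(1)[OF m2])
  also have "\<dots> \<longleftrightarrow> (AE z in Dm d. fourier T d (time_mean f) z = 0)" using T_pos by simp
  also have "\<dots> \<longleftrightarrow> ?R"
  proof
    assume "AE z in Dm d. fourier T d (time_mean f) z = 0"
    with fourier_time_mean[OF f] show ?R by eventually_elim (auto split: if_splits)
  next
    assume ?R
    with fourier_time_mean[OF f] show "AE z in Dm d. fourier T d (time_mean f) z = 0"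
      by eventually_elim (auto split: if_splits)
  qed
  finally show ?thesis .
qed

end

section \<open>Weights of CHG shape\<close>

definition jap_time :: "real \<Rightarrow> real" where
  "jap_time \<tau> = sqrt (1 + \<tau>\<^sup>2)"

definition jap_space :: "nat \<Rightarrow> (nat \<Rightarrow> real) \<Rightarrow> real" where
  "jap_space d \<xi> = sqrt (1 + (\<Sum>i<d. (\<xi> i)\<^sup>2))"

lemma jap_ge_1: "1 \<le> jap_time \<tau>" "1 \<le> jap_space d \<xi>"
  by (simp_all add: jap_time_def jap_space_def sum_nonneg)

lemma order_weight_eq:
  "order_weight d \<mu> z = (\<Sum>(r, s)\<in>newton_vertices (polygon_of \<mu>). jap_time (fst z) powr s * jap_space d (snd z) powr r)"
  by (simp add: order_weight_def jap_time_def jap_space_def case_prod_beta')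

lemma jap_time_measurable: "(\<lambda>z. jap_time (fst z)) \<in> borel_measurable (dual_measure T d)"
  unfolding jap_time_def
  by (intro measurable_compose[OF _ borel_measurable_sqrt] borel_measurable_add borel_measurable_const
      borel_measurable_power dual_measure_fst_measurable)

lemma jap_space_measurable: "e \<le> d \<Longrightarrow> (\<lambda>z. jap_space e (snd z)) \<in> borel_measurable (dual_measure T d)"
  unfolding jap_space_def
  by (intro measurable_compose[OF _ borel_measurable_sqrt] borel_measurable_add borel_measurable_const
      borel_measurable_sum borel_measurable_power dual_measure_coord_measurable) auto

lemma order_weight_measurable: "order_weight d \<mu> \<in> borel_measurable (dual_measure T d)"
proof -
  have "(\<lambda>z. jap_time (fst z) powr s * jap_space d (snd z) powr r) \<in> borel_measurable (dual_measure T d)" for r s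
  proof -
    note [measurable] = jap_time_measurable jap_space_measurable[OF order_refl]
    show ?thesis by measurable
  qed
  then show ?thesis
    by (subst order_weight_eq[abs_def]) (auto intro!: borel_measurable_sum simp: case_prod_beta')
qed

text \<open>Allows the weight to be estimated from any finite generating set of the polygon, without
  finding the vertices. The logarithm of a monomial is linear in its exponent, so the vertices
  control all points of the polygon. Conversely each vertex lies coordinatewise below a point of
  \<open>E\<close>, and both bases are at least 1.\<close>

lemma order_weight_bounds:
  fixes E :: "(real \<times> real) set"
  assumes E: "finite E" "E \<noteq> {}" "E \<subseteq> {0..} \<times> {0..}"
    and \<mu>: "\<And>\<gamma>. 0 < \<gamma> \<Longrightarrow> \<mu> \<gamma> = Max ((\<lambda>(r, s). r + \<gamma> * s) ` E)"
  shows "\<And>(z :: point) r s. (r, s) \<in> E \<Longrightarrow> jap_time (fst z) powr s * jap_space d (snd z) powr r \<le> order_weight d \<mu> z"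
    "\<exists>C>0. \<forall>z :: point. order_weight d \<mu> z \<le> C * (\<Sum>(r, s)\<in>E. jap_time (fst z) powr s * jap_space d (snd z) powr r)"
proof -
  define P where "P = convex hull (newton_generators E)"
  have P: "newton_polygon P" using E by (auto simp: newton_polygon_def P_def)
  have PE: "polygon_of \<mu> = P"
    by (rule polygon_of_eqI[OF P]) (simp add: \<mu> P_def order_function_of_hull[OF E])
  define V where "V = newton_vertices P"
  note V = newton_vertices_basics[OF P, folded V_def]
  define m where "m z v = jap_time (fst z) powr snd v * jap_space d (snd z) powr fst v" for z :: point and v :: "real \<times> real"
  have ow: "order_weight d \<mu> z = (\<Sum>v\<in>V. m z v)" for z :: point
    by (simp add: order_weight_eq PE V_def m_def case_prod_beta')
  have m_pos: "0 < m z v" for z :: point and v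
    using jap_ge_1(1)[of "fst z"] jap_ge_1(2)[of d "snd z"] by (simp add: m_def)
  have m_exp: "m z v = exp ((ln (jap_space d (snd z)), ln (jap_time (fst z))) \<bullet> v)" for z :: point and v
    using jap_ge_1(1)[of "fst z"] jap_ge_1(2)[of d "snd z"]
    by (cases v) (simp add: m_def powr_def exp_add mult.commute)
  have m_mono: "m z v \<le> m z w" if "fst v \<le> fst w" "snd v \<le> snd w" for z :: point and v w
    unfolding m_def using that jap_ge_1(1)[of "fst z"] jap_ge_1(2)[of d "snd z"]
    by (intro mult_mono powr_mono) auto
  have vpos: "0 \<le> fst v" "0 \<le> snd v" if "v \<in> V" for v
    using that V(3) newton_polygon_basics(4)[OF P] by auto
  have ow1: "1 \<le> order_weight d \<mu> z" for z :: point
  proof -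
    obtain v where v: "v \<in> V" using V(2) by auto
    have "1 \<le> m z v" using m_mono[of "(0, 0)" v z] vpos[OF v] jap_ge_1(1)[of "fst z"] jap_ge_1(2)[of d "snd z"]
      by (simp add: m_def)
    also have "\<dots> \<le> order_weight d \<mu> z"
      unfolding ow by (rule member_le_sum[OF v less_imp_le[OF m_pos] V(1)])
    finally show ?thesis .
  qed
  show "jap_time (fst z) powr s * jap_space d (snd z) powr r \<le> order_weight d \<mu> z" if e: "(r, s) \<in> E" for z :: point and r s
  proof -
    \<comment> \<open>The exponents whose monomial is at most the weight are cut out by one linear
      inequality; they include the vertices and the origin, hence the whole polygon.\<close>
    let ?H = "{v. (ln (jap_space d (snd z)), ln (jap_time (fst z))) \<bullet> v \<le> ln (order_weight d \<mu> z)}"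
    have "V \<subseteq> ?H"
    proof
      fix v assume v: "v \<in> V"
      have "m z v \<le> order_weight d \<mu> z"
        unfolding ow by (rule member_le_sum[OF v less_imp_le[OF m_pos] V(1)])
      then have "ln (m z v) \<le> ln (order_weight d \<mu> z)"
        using m_pos[of z v] ow1[of z] by (subst ln_le_cancel_iff) auto
      then show "v \<in> ?H" by (simp only: m_exp ln_exp mem_Collect_eq)
    qed
    moreover have "(0, 0) \<in> ?H" using ow1[of z] by simp
    ultimately have "insert (0, 0) V \<subseteq> ?H" by (intro insert_subsetI)
    then have "convex hull (insert (0, 0) V) \<subseteq> ?H" by (intro hull_minimal convex_halfspace_le)
    then have "P \<subseteq> ?H" by (simp only: V(4)[symmetric])
    moreover have "(r, s) \<in> P" unfolding P_def using e by (intro hull_inc) (auto simp: newton_generators_def)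
    ultimately have "(ln (jap_space d (snd z)), ln (jap_time (fst z))) \<bullet> (r, s) \<le> ln (order_weight d \<mu> z)" by blast
    then have "exp ((ln (jap_space d (snd z)), ln (jap_time (fst z))) \<bullet> (r, s)) \<le> exp (ln (order_weight d \<mu> z))"
      by (simp only: exp_le_cancel_iff)
    then have "m z (r, s) \<le> order_weight d \<mu> z" using ow1[of z] by (simp only: m_exp) simp
    then show ?thesis by (simp add: m_def)
  qed
  \<comment> \<open>A vertex is extreme, hence one of the generators: a point of \<open>E\<close>,
    one of its projections to the axes, or the origin.\<close>
  have bnd: "m z v \<le> (\<Sum>e\<in>E. m z e)" if v: "v \<in> V" for z :: point and v
  proof -
    have "v \<in> newton_generators E"
    proof (cases "P = {(0, 0)}")
      case True
      then show ?thesis using v by (simp add: V_def newton_vertices_def newton_generators_def)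
    next
      case False
      then have "v extreme_point_of P" using v by (simp add: V_def newton_vertices_def)
      then show ?thesis unfolding P_def by (rule extreme_point_of_convex_hull)
    qed
    then obtain e where e: "e \<in> E" "fst v \<le> fst e" "snd v \<le> snd e"
      using E(2,3) unfolding newton_generators_def by fastforce
    have "m z v \<le> m z e" by (rule m_mono[OF e(2,3)])
    also have "\<dots> \<le> (\<Sum>e\<in>E. m z e)" by (rule member_le_sum[OF e(1) less_imp_le[OF m_pos] E(1)])
    finally show ?thesis .
  qed
  show "\<exists>C>0. \<forall>z :: point. order_weight d \<mu> z \<le> C * (\<Sum>(r, s)\<in>E. jap_time (fst z) powr s * jap_space d (snd z) powr r)"
  proof (intro exI conjI allI)
    show "0 < real (card V)" using V(1,2) by (simp add: card_gt_0_iff)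
    fix z :: point
    have "order_weight d \<mu> z \<le> real (card V) * (\<Sum>e\<in>E. m z e)"
      unfolding ow by (rule sum_bounded_above[OF bnd])
    then show "order_weight d \<mu> z \<le> real (card V) * (\<Sum>(r, s)\<in>E. jap_time (fst z) powr s * jap_space d (snd z) powr r)"
      by (simp add: m_def case_prod_beta')
  qed
qed

text \<open>Appends the normal variable as coordinate \<open>d\<close>, which is the coordinate
  \<open>n - 1\<close> of the definitions for \<open>n = Suc d\<close>.\<close>

definition extend :: "nat \<Rightarrow> point \<Rightarrow> real \<Rightarrow> point" where
  "extend d z \<eta> = (fst z, (snd z)(d := \<eta>))"

locale chg_shape =
  fixes r1 r2 :: nat and s2 :: real
  assumes r21: "r2 < r1" and s2: "0 \<le> s2"
begin

text \<open>The time weight to the power -\<open>chg_gamma\<close>: the value of the space weight at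
  which the monomials of the vertices (r1, 0) and (r2, s2) balance.\<close>

definition time_scale :: "real \<Rightarrow> real" where
  "time_scale \<tau> = jap_time \<tau> powr (s2 / (real r1 - real r2))"

lemma time_scale_ge_1: "1 \<le> time_scale \<tau>"
  unfolding time_scale_def using jap_ge_1(1)[of \<tau>] r21 s2 by (intro ge_one_powr_ge_zero) auto

lemma time_scale_power: "time_scale \<tau> ^ (r1 - r2) = jap_time \<tau> powr s2"
proof -
  have "time_scale \<tau> ^ (r1 - r2) = time_scale \<tau> powr real (r1 - r2)"
    using time_scale_ge_1[of \<tau>] by (subst powr_realpow) auto
  also have "\<dots> = jap_time \<tau> powr s2" using r21 by (simp add: time_scale_def powr_powr of_nat_diff)
  finally show ?thesis .
qed

text \<open>Factored form of the larger of the monomials of (r1, 0) and (r2, s2). In contrast to the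
  sum over the vertices, it can be compared factor by factor once the normal frequency is split
  off.\<close>

definition chg_weight :: "nat \<Rightarrow> point \<Rightarrow> real" where
  "chg_weight d z = jap_space d (snd z) ^ r2 * (max (time_scale (fst z)) (jap_space d (snd z))) ^ (r1 - r2)"

text \<open>Up to constants, the weight \<open>chg_weight (Suc d)\<close> at normal frequency K,
  divided by K to the power j + 1/2, where K is the width \<open>concentration d j z\<close>
  below.\<close>

definition trace_weight :: "nat \<Rightarrow> nat \<Rightarrow> point \<Rightarrow> real" where
  "trace_weight d j z = (if j < r2
    then jap_space d (snd z) powr (real r2 - real j - 1/2) * (max (time_scale (fst z)) (jap_space d (snd z))) ^ (r1 - r2)
    else max (time_scale (fst z)) (jap_space d (snd z)) powr (real r1 - real j - 1/2))"

lemma max_power: "(max a b) ^ k = max (a ^ k) (b ^ k)" if "0 \<le> a" "0 \<le> b" for a b :: real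
proof (cases "a \<le> b")
  case True
  then have "a ^ k \<le> b ^ k" using that by (intro power_mono)
  then show ?thesis using True by (simp add: max_def)
next
  case False
  then have "b ^ k \<le> a ^ k" using that by (intro power_mono) auto
  then show ?thesis using False by (auto simp: max_def)
qed

lemma max_powr: "(max a b) powr p = max (a powr p) (b powr p)" if "0 \<le> a" "0 \<le> b" "0 \<le> p" for a b p :: real
proof (cases "a \<le> b")
  case True
  then have "a powr p \<le> b powr p" using that by (intro powr_mono2)
  then show ?thesis using True by (simp add: max_def)
next
  case False
  then have "b powr p \<le> a powr p" using that by (intro powr_mono2) auto
  then show ?thesis using False by (auto simp: max_def)
qed

lemma chg_order_Max: "0 < \<gamma> \<Longrightarrow> chg_order r1 r2 s2 \<gamma> = Max ((\<lambda>(r, s). r + \<gamma> * s) ` {(real r1, 0), (real r2, s2)})"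
proof -
  have 1: "(real r1 - real r2) * max 1 (s2 / (real r1 - real r2) * \<gamma>) = max (real r1 - real r2) (s2 * \<gamma>)"
    using r21 by (simp add: max_mult_distrib_left)
  have 2: "- chg_gamma r1 r2 s2 = s2 / (real r1 - real r2)" by (simp add: chg_gamma_def minus_divide_right)
  show ?thesis unfolding chg_order_def o_fun_def 1 2 by (simp add: max_def algebra_simps)
qed

text \<open>The sum of two nonnegative monomials and their maximum differ by a factor of at most
  2.\<close>

lemma chg_weight_equiv:
  "\<exists>C>0. \<forall>z. chg_weight d z \<le> order_weight d (chg_order r1 r2 s2) z \<and>
    order_weight d (chg_order r1 r2 s2) z \<le> C * chg_weight d z"
proof -
  let ?E = "{(real r1, 0), (real r2, s2)}" and ?\<mu> = "chg_order r1 r2 s2"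
  have E: "finite ?E" "?E \<noteq> {}" "?E \<subseteq> {0..} \<times> {0..}" using s2 by auto
  note b = order_weight_bounds[where d=d, OF E chg_order_Max]
  obtain C where C: "0 < C" "\<And>z :: point. order_weight d ?\<mu> z \<le> C * (\<Sum>(r, s)\<in>?E. jap_time (fst z) powr s * jap_space d (snd z) powr r)"
    using b(2) by blast
  have w: "chg_weight d z = max (jap_space d (snd z) powr real r1) (jap_time (fst z) powr s2 * jap_space d (snd z) powr real r2)" for z :: point
  proof -
    have J: "0 < jap_space d (snd z)" using jap_ge_1(2)[of d "snd z"] by linarith
    have "chg_weight d z = jap_space d (snd z) ^ r2 * max (jap_time (fst z) powr s2) (jap_space d (snd z) ^ (r1 - r2))"
      using time_scale_ge_1[of "fst z"] J by (simp add: chg_weight_def max_power time_scale_power)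
    also have "\<dots> = max (jap_space d (snd z) ^ r2 * jap_time (fst z) powr s2) (jap_space d (snd z) ^ r2 * jap_space d (snd z) ^ (r1 - r2))"
      using J by (simp add: max_mult_distrib_left)
    also have "jap_space d (snd z) ^ r2 * jap_space d (snd z) ^ (r1 - r2) = jap_space d (snd z) powr real r1"
      using r21 J by (simp add: powr_realpow flip: power_add)
    finally show ?thesis using J by (simp add: powr_realpow max.commute mult.commute)
  qed
  show ?thesis
  proof (intro exI[of _ "C * 2"] conjI allI)
    show "0 < C * 2" using C by simp
    fix z :: point
    have J: "0 < jap_time (fst z)" using jap_ge_1(1)[of "fst z"] by linarith
    show "chg_weight d z \<le> order_weight d ?\<mu> z"
      unfolding w using b(1)[of "real r1" 0 z] b(1)[of "real r2" s2 z] J by simp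
    have "(\<Sum>(r, s)\<in>?E. jap_time (fst z) powr s * jap_space d (snd z) powr r)
        = jap_space d (snd z) powr real r1 + jap_time (fst z) powr s2 * jap_space d (snd z) powr real r2"
      using r21 J by simp
    also have "\<dots> \<le> 2 * chg_weight d z" unfolding w by linarith
    finally have "C * (\<Sum>(r, s)\<in>?E. jap_time (fst z) powr s * jap_space d (snd z) powr r) \<le> C * (2 * chg_weight d z)"
      using C(1) by (intro mult_left_mono) auto
    then show "order_weight d ?\<mu> z \<le> C * 2 * chg_weight d z" using C(2)[of z] by linarith
  qed
qed

lemma trace_weight_equiv:
  assumes j: "j < r1"
  shows "\<exists>C>0. \<forall>z. trace_weight d j z \<le> order_weight d (trace_order r1 r2 s2 j) z \<and>
    order_weight d (trace_order r1 r2 s2 j) z \<le> C * trace_weight d j z"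
proof -
  let ?\<mu> = "trace_order r1 r2 s2 j"
  define g where "g = s2 / (real r1 - real r2)"
  have g2: "- chg_gamma r1 r2 s2 = g" by (simp add: g_def chg_gamma_def minus_divide_right)
  have g0: "0 \<le> g" and gs: "(real r1 - real r2) * g = s2" using r21 s2 by (auto simp: g_def)
  define p where "p = real r1 - real j - 1/2"
  have p: "0 < p" using j by (simp add: p_def)
  \<comment> \<open>The exponents are read off from the two arguments of the maximum in
    \<open>trace_order\<close>. They generate its polygon without having to be its vertices; for
    \<open>s2 = 0\<close> the two sets differ.\<close>
  define E where "E = (if j < r2 then {(p, 0), (real r2 - real j - 1/2, s2)} else {(p, 0), (0, p * g)})"
  have q: "j < r2 \<Longrightarrow> 0 \<le> real r2 - real j - 1/2" by simp
  have E: "finite E" "E \<noteq> {}" "E \<subseteq> {0..} \<times> {0..}"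
    using s2 p g0 q by (auto simp: E_def)
  have \<mu>: "?\<mu> \<gamma> = Max ((\<lambda>(r, s). r + \<gamma> * s) ` E)" if "0 < \<gamma>" for \<gamma>
  proof -
    have 1: "(real r1 - real r2) * max 1 (g * \<gamma>) = max (real r1 - real r2) (s2 * \<gamma>)"
      using r21 by (simp add: max_mult_distrib_left flip: gs)
    have 2: "p * max 1 (g * \<gamma>) = max p (p * g * \<gamma>)" using p by (simp add: max_mult_distrib_left)
    show ?thesis
      unfolding trace_order_def o_fun_def g2 1 p_def[symmetric] 2
      by (auto simp: E_def max_def algebra_simps p_def)
  qed
  note b = order_weight_bounds[where d=d, OF E \<mu>]
  obtain C where C: "0 < C" "\<And>z :: point. order_weight d ?\<mu> z \<le> C * (\<Sum>(r, s)\<in>E. jap_time (fst z) powr s * jap_space d (snd z) powr r)"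
    using b(2) by blast
  have w: "\<exists>x y. trace_weight d j z = max x y \<and> (\<Sum>(r, s)\<in>E. jap_time (fst z) powr s * jap_space d (snd z) powr r) \<le> x + y
      \<and> x \<le> order_weight d ?\<mu> z \<and> y \<le> order_weight d ?\<mu> z" for z :: point
  proof -
    define a where "a = jap_time (fst z)"
    define B where "B = jap_space d (snd z)"
    have aB: "0 < a" "0 < B" using jap_ge_1(1)[of "fst z"] jap_ge_1(2)[of d "snd z"] by (auto simp: a_def B_def)
    note b' = b(1)[of _ _ z, folded a_def B_def]
    show ?thesis
    proof (cases "j < r2")
      case True
      let ?q = "real r2 - real j - 1/2"
      have "trace_weight d j z = B powr ?q * max (a powr s2) (B ^ (r1 - r2))"
        using time_scale_ge_1[of "fst z"] aB True
        by (simp add: trace_weight_def max_power time_scale_power B_def a_def)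
      also have "\<dots> = max (B powr ?q * a powr s2) (B powr ?q * B ^ (r1 - r2))"
        by (simp add: max_mult_distrib_left)
      also have "B powr ?q * B ^ (r1 - r2) = B powr p"
      proof -
        have "?q + real (r1 - r2) = p" using r21 by (simp add: p_def of_nat_diff)
        then show ?thesis using aB by (simp add: powr_add[symmetric] flip: powr_realpow)
      qed
      finally have 1: "trace_weight d j z = max (B powr ?q * a powr s2) (B powr p)" .
      have "p \<noteq> ?q" using r21 by (simp add: p_def)
      then have "(\<Sum>(r, s)\<in>E. a powr s * B powr r) = B powr p + a powr s2 * B powr ?q"
        using True aB by (simp add: E_def)
      moreover have "B powr ?q * a powr s2 \<le> order_weight d ?\<mu> z" "B powr p \<le> order_weight d ?\<mu> z"
        using b'[of ?q s2] b'[of p 0] True aB by (auto simp: E_def mult.commute)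
      ultimately show ?thesis using 1 unfolding a_def[symmetric] B_def[symmetric]
        by (intro exI[of _ "B powr ?q * a powr s2"] exI[of _ "B powr p"]) (simp add: mult.commute)
    next
      case False
      have "trace_weight d j z = max (time_scale (fst z) powr p) (B powr p)"
        using time_scale_ge_1[of "fst z"] aB False p
        by (simp add: trace_weight_def max_powr B_def p_def)
      moreover have "time_scale (fst z) powr p = a powr (p * g)"
        by (simp add: time_scale_def a_def powr_powr g_def mult.commute)
      ultimately have 1: "trace_weight d j z = max (a powr (p * g)) (B powr p)" by simp
      have "p \<noteq> 0" using p by simp
      then have "(\<Sum>(r, s)\<in>E. a powr s * B powr r) = B powr p + a powr (p * g)"
        using False aB by (simp add: E_def)
      moreover have "a powr (p * g) \<le> order_weight d ?\<mu> z" "B powr p \<le> order_weight d ?\<mu> z"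
        using b'[of 0 "p * g"] b'[of p 0] False aB by (auto simp: E_def)
      ultimately show ?thesis using 1 unfolding a_def[symmetric] B_def[symmetric]
        by (intro exI[of _ "a powr (p * g)"] exI[of _ "B powr p"]) simp
    qed
  qed
  show ?thesis
  proof (intro exI[of _ "C * 2"] conjI allI)
    show "0 < C * 2" using C by simp
    fix z :: point
    obtain x y where xy: "trace_weight d j z = max x y"
      "(\<Sum>(r, s)\<in>E. jap_time (fst z) powr s * jap_space d (snd z) powr r) \<le> x + y"
      "x \<le> order_weight d ?\<mu> z" "y \<le> order_weight d ?\<mu> z" using w by blast
    show "trace_weight d j z \<le> order_weight d ?\<mu> z" using xy by simp
    have "(\<Sum>(r, s)\<in>E. jap_time (fst z) powr s * jap_space d (snd z) powr r) \<le> 2 * trace_weight d j z"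
      using xy(1,2) by linarith
    then have "C * (\<Sum>(r, s)\<in>E. jap_time (fst z) powr s * jap_space d (snd z) powr r) \<le> C * (2 * trace_weight d j z)"
      using C(1) by (intro mult_left_mono) auto
    then show "order_weight d ?\<mu> z \<le> C * 2 * trace_weight d j z" using C(2)[of z] by linarith
  qed
qed

section \<open>The width in the normal frequency, and the two pointwise comparisons of
  weights\<close>

definition radius :: "nat \<Rightarrow> point \<Rightarrow> real" where
  "radius d z = max (time_scale (fst z)) (jap_space d (snd z))"

definition concentration :: "nat \<Rightarrow> nat \<Rightarrow> point \<Rightarrow> real" where
  "concentration d j z = (if j < r2 then jap_space d (snd z) else radius d z)"

lemma concentration_ge_1: "1 \<le> concentration d j z"
  using jap_ge_1(2)[of d "snd z"] by (simp add: concentration_def radius_def le_max_iff_disj)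

text \<open>Squaring turns the half-integer exponents of the trace orders into odd natural ones, so
  the comparisons of weights become comparisons of polynomials.\<close>

lemma trace_weight_sq:
  assumes "j < r1"
  shows "(trace_weight d j z)\<^sup>2 = (if j < r2
    then jap_space d (snd z) ^ (2 * (r2 - j) - 1) * radius d z ^ (2 * (r1 - r2))
    else radius d z ^ (2 * (r1 - j) - 1))"
proof -
  have pw: "(x powr (real a - 1/2))\<^sup>2 = x ^ (2 * a - 1)" if "0 < x" "0 < a" for x :: real and a :: nat
  proof -
    have "(x powr (real a - 1/2))\<^sup>2 = x powr (real a - 1/2 + (real a - 1/2))"
      unfolding power2_eq_square by (rule powr_add[symmetric])
    also have "real a - 1/2 + (real a - 1/2) = real (2 * a - 1)" using that by (simp add: of_nat_diff)
    finally show ?thesis using that by (simp only: powr_realpow)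
  qed
  have B: "0 < jap_space d (snd z)" "0 < radius d z"
    using jap_ge_1(2)[of d "snd z"] by (auto simp: radius_def)
  show ?thesis
  proof (cases "j < r2")
    case True
    then have "real r2 - real j - 1/2 = real (r2 - j) - 1/2" by (simp add: of_nat_diff)
    then show ?thesis using True pw[OF B(1), of "r2 - j"]
      by (simp add: trace_weight_def power_mult_distrib radius_def[symmetric] mult.commute[of 2] power_mult)
  next
    case False
    then have "real r1 - real j - 1/2 = real (r1 - j) - 1/2" using assms by (simp add: of_nat_diff)
    then show ?thesis using False assms pw[OF B(2), of "r1 - j"]
      by (simp add: trace_weight_def radius_def[symmetric])
  qed
qed

text \<open>The normal frequency enters the weight only through the square of the space weight, to
  which it contributes \<eta>^2.\<close>

lemma chg_weight_insert_sq:
  "(chg_weight (Suc d) (extend d z \<eta>))\<^sup>2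
    = ((jap_space d (snd z))\<^sup>2 + \<eta>\<^sup>2) ^ r2 * (max ((time_scale (fst z))\<^sup>2) ((jap_space d (snd z))\<^sup>2 + \<eta>\<^sup>2)) ^ (r1 - r2)"
proof -
  have s: "(\<Sum>i<d. (((snd z)(d := \<eta>)) i)\<^sup>2) = (\<Sum>i<d. (snd z i)\<^sup>2)" by (rule sum.cong) auto
  have J: "(jap_space (Suc d) ((snd z)(d := \<eta>)))\<^sup>2 = (jap_space d (snd z))\<^sup>2 + \<eta>\<^sup>2"
    using s by (simp add: jap_space_def sum_nonneg add_nonneg_nonneg)
  have "(chg_weight (Suc d) (extend d z \<eta>))\<^sup>2
      = ((jap_space (Suc d) ((snd z)(d := \<eta>)))\<^sup>2) ^ r2
        * ((max (time_scale (fst z)) (jap_space (Suc d) ((snd z)(d := \<eta>))))\<^sup>2) ^ (r1 - r2)"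
    by (simp add: chg_weight_def extend_def power_mult_distrib power_mult[symmetric] mult.commute)
  moreover have "(max (time_scale (fst z)) (jap_space (Suc d) ((snd z)(d := \<eta>))))\<^sup>2
      = max ((time_scale (fst z))\<^sup>2) ((jap_space (Suc d) ((snd z)(d := \<eta>)))\<^sup>2)"
    using time_scale_ge_1[of "fst z"] jap_ge_1(2)[of "Suc d" "(snd z)(d := \<eta>)"] by (intro max_power) auto
  ultimately show ?thesis by (simp only: J)
qed

text \<open>After multiplication by \<open>K\<^sup>2 + \<eta>\<^sup>2\<close> both sides are
  products with matching numbers of factors, and each \<eta>^2, B^2 or M^2 is estimated by B^2 +
  \<eta>^2 or M^2 + \<eta>^2. The constant 2^(r1-r2) is the price for replacing the maximum in the
  weight by a sum.\<close>

lemma trace_pointwise_bound: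
  fixes d j :: nat and z :: point and \<eta> :: real
  assumes j: "j < r1"
  defines "K \<equiv> concentration d j z"
  shows "\<eta> ^ (2 * j) * (trace_weight d j z)\<^sup>2
    \<le> 2 ^ (r1 - r2) * (K / (K\<^sup>2 + \<eta>\<^sup>2)) * (chg_weight (Suc d) (extend d z \<eta>))\<^sup>2"
proof -
  define A B M k where "A = time_scale (fst z)" and "B = jap_space d (snd z)" and "M = radius d z" and "k = r1 - r2"
  have AB: "1 \<le> A" "1 \<le> B" using time_scale_ge_1 jap_ge_1(2) by (auto simp: A_def B_def)
  have M: "M = max A B" by (simp add: M_def radius_def A_def B_def)
  have M1: "1 \<le> M" using AB M by simp
  have K1: "1 \<le> K" using concentration_ge_1 by (simp add: K_def)
  have c: "(chg_weight (Suc d) (extend d z \<eta>))\<^sup>2 = (B\<^sup>2 + \<eta>\<^sup>2) ^ r2 * (max (A\<^sup>2) (B\<^sup>2 + \<eta>\<^sup>2)) ^ k"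
    unfolding A_def B_def k_def by (rule chg_weight_insert_sq)
  \<comment> \<open>\<open>M\<close> is \<open>A\<close> or \<open>B\<close>, so both M^2 and
    \<eta>^2 are at most the maximum on the right.\<close>
  have half: "M\<^sup>2 + \<eta>\<^sup>2 \<le> 2 * max (A\<^sup>2) (B\<^sup>2 + \<eta>\<^sup>2)"
  proof -
    define X where "X = max (A\<^sup>2) (B\<^sup>2 + \<eta>\<^sup>2)"
    have "A\<^sup>2 \<le> X" "B\<^sup>2 + \<eta>\<^sup>2 \<le> X" "0 \<le> B\<^sup>2" "0 \<le> \<eta>\<^sup>2" by (simp_all add: X_def)
    moreover have "M\<^sup>2 = A\<^sup>2 \<or> M\<^sup>2 = B\<^sup>2" unfolding M by (auto simp: max_def)
    ultimately show ?thesis unfolding X_def[symmetric] by linarith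
  qed
  have "(M\<^sup>2 + \<eta>\<^sup>2) ^ k \<le> (2 * max (A\<^sup>2) (B\<^sup>2 + \<eta>\<^sup>2)) ^ k" by (rule power_mono[OF half]) simp
  then have cw: "(B\<^sup>2 + \<eta>\<^sup>2) ^ r2 * (M\<^sup>2 + \<eta>\<^sup>2) ^ k \<le> 2 ^ k * (chg_weight (Suc d) (extend d z \<eta>))\<^sup>2"
    unfolding c power_mult_distrib by (simp add: mult.left_commute[of "2 ^ k"] mult_left_mono)
  have pB: "(\<eta>\<^sup>2) ^ i \<le> (B\<^sup>2 + \<eta>\<^sup>2) ^ i" "(B\<^sup>2) ^ i \<le> (B\<^sup>2 + \<eta>\<^sup>2) ^ i"
    "(M\<^sup>2) ^ i \<le> (M\<^sup>2 + \<eta>\<^sup>2) ^ i" "(\<eta>\<^sup>2) ^ i \<le> (M\<^sup>2 + \<eta>\<^sup>2) ^ i" for i :: nat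
    by (rule power_mono; simp)+
  have main: "\<eta> ^ (2 * j) * (trace_weight d j z)\<^sup>2 * (K\<^sup>2 + \<eta>\<^sup>2) \<le> K * ((B\<^sup>2 + \<eta>\<^sup>2) ^ r2 * (M\<^sup>2 + \<eta>\<^sup>2) ^ k)"
  proof (cases "j < r2")
    case True
    then have K: "K = B" by (simp add: K_def concentration_def B_def)
    \<comment> \<open>The exponent \<open>r2 = j + l + 1\<close> is used up by j factors \<eta>^2, l
      factors B^2 and the Poisson denominator, which is B^2 + \<eta>^2 in this case.\<close>
    obtain l where l: "r2 = Suc (j + l)" using True less_imp_Suc_add by blast
    have tw: "(trace_weight d j z)\<^sup>2 = B * (B\<^sup>2) ^ l * (M\<^sup>2) ^ k"
      using trace_weight_sq[OF j, of d z] True by (simp add: l B_def M_def k_def power_mult[symmetric])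
    have "\<eta> ^ (2 * j) * (trace_weight d j z)\<^sup>2 * (K\<^sup>2 + \<eta>\<^sup>2)
        = B * ((\<eta>\<^sup>2) ^ j * (B\<^sup>2) ^ l * (B\<^sup>2 + \<eta>\<^sup>2) * (M\<^sup>2) ^ k)"
      unfolding tw K by (simp add: power_mult)
    also have "\<dots> \<le> B * ((B\<^sup>2 + \<eta>\<^sup>2) ^ j * (B\<^sup>2 + \<eta>\<^sup>2) ^ l * (B\<^sup>2 + \<eta>\<^sup>2) * (M\<^sup>2 + \<eta>\<^sup>2) ^ k)"
      using AB M1 by (intro mult_left_mono mult_mono pB mult_nonneg_nonneg zero_le_power[OF zero_le_power2] add_nonneg_nonneg zero_le_power2) auto
    also have "\<dots> = K * ((B\<^sup>2 + \<eta>\<^sup>2) ^ r2 * (M\<^sup>2 + \<eta>\<^sup>2) ^ k)"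
      by (simp add: K l power_add mult_ac)
    finally show ?thesis .
  next
    case False
    then have K: "K = M" by (simp add: K_def concentration_def M_def)
    obtain l where l: "r1 = Suc (j + l)" using j less_imp_Suc_add by blast
    have tw: "(trace_weight d j z)\<^sup>2 = M * (M\<^sup>2) ^ l"
      using trace_weight_sq[OF j, of d z] False by (simp add: l M_def power_mult[symmetric])
    \<comment> \<open>Of the j factors \<eta>^2, r2 are absorbed by B^2 + \<eta>^2 and the remaining
      i by M^2 + \<eta>^2. Together with l factors M^2 and the Poisson denominator the latter fill
      the exponent \<open>k = i + l + 1\<close>.\<close>
    obtain i where i: "j = r2 + i" using False le_Suc_ex not_less by blast
    have k: "k = i + l + 1" by (simp add: k_def l i)
    have "\<eta> ^ (2 * j) * (trace_weight d j z)\<^sup>2 * (K\<^sup>2 + \<eta>\<^sup>2)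
        = M * ((\<eta>\<^sup>2) ^ r2 * ((\<eta>\<^sup>2) ^ i * (M\<^sup>2) ^ l * (M\<^sup>2 + \<eta>\<^sup>2)))"
    proof -
      have "\<eta> ^ (2 * j) = (\<eta>\<^sup>2) ^ r2 * (\<eta>\<^sup>2) ^ i" by (simp only: power_mult i power_add)
      then show ?thesis by (simp only: tw K mult_ac)
    qed
    also have "\<dots> \<le> M * ((B\<^sup>2 + \<eta>\<^sup>2) ^ r2 * ((M\<^sup>2 + \<eta>\<^sup>2) ^ i * (M\<^sup>2 + \<eta>\<^sup>2) ^ l * (M\<^sup>2 + \<eta>\<^sup>2)))"
      using M1 by (intro mult_left_mono mult_mono pB mult_nonneg_nonneg zero_le_power[OF zero_le_power2] add_nonneg_nonneg zero_le_power2) auto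
    also have "\<dots> = K * ((B\<^sup>2 + \<eta>\<^sup>2) ^ r2 * (M\<^sup>2 + \<eta>\<^sup>2) ^ k)"
      by (simp add: K k power_add mult_ac)
    finally show ?thesis .
  qed
  also have "\<dots> \<le> K * (2 ^ k * (chg_weight (Suc d) (extend d z \<eta>))\<^sup>2)"
    using K1 by (intro mult_left_mono cw) simp
  finally have fin: "\<eta> ^ (2 * j) * (trace_weight d j z)\<^sup>2 * (K\<^sup>2 + \<eta>\<^sup>2)
      \<le> K * (2 ^ k * (chg_weight (Suc d) (extend d z \<eta>))\<^sup>2)" .
  have "0 < K\<^sup>2 + \<eta>\<^sup>2" using K1 by (intro add_pos_nonneg) auto
  with fin have "\<eta> ^ (2 * j) * (trace_weight d j z)\<^sup>2
      \<le> K * (2 ^ k * (chg_weight (Suc d) (extend d z \<eta>))\<^sup>2) / (K\<^sup>2 + \<eta>\<^sup>2)"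
    by (simp only: pos_le_divide_eq)
  also have "\<dots> = 2 ^ k * (K / (K\<^sup>2 + \<eta>\<^sup>2)) * (chg_weight (Suc d) (extend d z \<eta>))\<^sup>2" by simp
  finally show ?thesis by (simp add: k_def)
qed

text \<open>Converse estimate on the support of the extension: for \<eta> up to K L, each factor of
  the weight exceeds B^2 or M^2 by a factor of at most 1 + L^2. The power K^(2j+1) will cancel
  against the squared normalisation K^(-2j-2) and the length K L of the support.\<close>

lemma extension_pointwise_bound:
  fixes d j :: nat and z :: point and \<eta> L :: real
  assumes j: "j < r1" and \<eta>: "0 \<le> \<eta>" "\<eta> \<le> concentration d j z * L"
  defines "K \<equiv> concentration d j z"
  shows "(chg_weight (Suc d) (extend d z \<eta>))\<^sup>2 \<le> (1 + L\<^sup>2) ^ r1 * K ^ (2 * j + 1) * (trace_weight d j z)\<^sup>2"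
proof -
  define A B M k where "A = time_scale (fst z)" and "B = jap_space d (snd z)" and "M = radius d z" and "k = r1 - r2"
  have AB: "1 \<le> A" "1 \<le> B" using time_scale_ge_1 jap_ge_1(2) by (auto simp: A_def B_def)
  have M: "M = max A B" by (simp add: M_def radius_def A_def B_def)
  have M1: "1 \<le> M" "A \<le> M" "B \<le> M" using AB M by auto
  have K: "1 \<le> K" "K \<le> M" using M1 concentration_ge_1 by (auto simp: K_def concentration_def M_def B_def)
  have c: "(chg_weight (Suc d) (extend d z \<eta>))\<^sup>2 = (B\<^sup>2 + \<eta>\<^sup>2) ^ r2 * (max (A\<^sup>2) (B\<^sup>2 + \<eta>\<^sup>2)) ^ k"
    unfolding A_def B_def k_def by (rule chg_weight_insert_sq)
  have r1k: "r1 = r2 + k" using r21 by (simp add: k_def)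
  have \<eta>2: "\<eta>\<^sup>2 \<le> K\<^sup>2 * L\<^sup>2" using power_mono[OF \<eta>(2,1), of 2] by (simp add: K_def power_mult_distrib)
  have B2: "B\<^sup>2 \<le> M\<^sup>2" "A\<^sup>2 \<le> M\<^sup>2" "K\<^sup>2 \<le> M\<^sup>2" using M1 AB K by (auto intro!: power_mono)
  have "K\<^sup>2 * L\<^sup>2 \<le> M\<^sup>2 * L\<^sup>2" using B2(3) by (rule mult_right_mono) simp
  then have b1: "B\<^sup>2 + \<eta>\<^sup>2 \<le> M\<^sup>2 * (1 + L\<^sup>2)" using \<eta>2 B2(1) by (simp add: distrib_left)
  have "M\<^sup>2 \<le> M\<^sup>2 * (1 + L\<^sup>2)" by (simp add: distrib_left)
  then have b2: "max (A\<^sup>2) (B\<^sup>2 + \<eta>\<^sup>2) \<le> M\<^sup>2 * (1 + L\<^sup>2)" using b1 B2(2) by simp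
  show ?thesis
  proof (cases "j < r2")
    case True
    then have KB: "K = B" by (simp add: K_def concentration_def B_def)
    then have b0: "B\<^sup>2 + \<eta>\<^sup>2 \<le> B\<^sup>2 * (1 + L\<^sup>2)" using \<eta>2 by (simp add: distrib_left)
    obtain l where l: "r2 = Suc (j + l)" using True less_imp_Suc_add by blast
    have tw: "(trace_weight d j z)\<^sup>2 = B * (B\<^sup>2) ^ l * (M\<^sup>2) ^ k"
      using trace_weight_sq[OF j, of d z] True by (simp add: l B_def M_def k_def power_mult[symmetric])
    have "(B\<^sup>2 + \<eta>\<^sup>2) ^ r2 * (max (A\<^sup>2) (B\<^sup>2 + \<eta>\<^sup>2)) ^ k \<le> (B\<^sup>2 * (1 + L\<^sup>2)) ^ r2 * (M\<^sup>2 * (1 + L\<^sup>2)) ^ k"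
      by (intro mult_mono power_mono b0 b2 zero_le_power) (auto simp: le_max_iff_disj)
    also have "\<dots> = (1 + L\<^sup>2) ^ r1 * ((B\<^sup>2) ^ r2 * (M\<^sup>2) ^ k)"
      by (simp add: power_mult_distrib r1k power_add mult_ac)
    also have "(B\<^sup>2) ^ r2 * (M\<^sup>2) ^ k = K ^ (2 * j + 1) * (trace_weight d j z)\<^sup>2"
    proof -
      have "(B\<^sup>2) ^ r2 = B ^ (2 * j + 1) * (B * (B\<^sup>2) ^ l)"
        unfolding l by (simp add: power_mult power_add power2_eq_square power_mult_distrib mult_ac)
      then show ?thesis by (simp only: tw KB mult_ac)
    qed
    finally show ?thesis unfolding c by (simp only: mult.assoc)
  next
    case False
    then have KM: "K = M" by (simp add: K_def concentration_def M_def)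
    obtain l where l: "r1 = Suc (j + l)" using j less_imp_Suc_add by blast
    have tw: "(trace_weight d j z)\<^sup>2 = M * (M\<^sup>2) ^ l"
      using trace_weight_sq[OF j, of d z] False by (simp add: l M_def power_mult[symmetric])
    have "(B\<^sup>2 + \<eta>\<^sup>2) ^ r2 * (max (A\<^sup>2) (B\<^sup>2 + \<eta>\<^sup>2)) ^ k \<le> (M\<^sup>2 * (1 + L\<^sup>2)) ^ r2 * (M\<^sup>2 * (1 + L\<^sup>2)) ^ k"
      by (intro mult_mono power_mono b1 b2 zero_le_power) (auto simp: le_max_iff_disj)
    also have "\<dots> = (1 + L\<^sup>2) ^ r1 * (M\<^sup>2) ^ r1"
      by (simp add: power_mult_distrib r1k power_add mult_ac)
    also have "(M\<^sup>2) ^ r1 = K ^ (2 * j + 1) * (trace_weight d j z)\<^sup>2"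
    proof -
      have "(M\<^sup>2) ^ r1 = M ^ (2 * j + 1) * (M * (M\<^sup>2) ^ l)"
        unfolding l by (simp add: power_mult power_add power2_eq_square power_mult_distrib mult_ac)
      then show ?thesis by (simp only: tw KM mult_ac)
    qed
    finally show ?thesis unfolding c by (simp only: mult.assoc)
  qed
qed

end

section \<open>Slices in the normal frequency\<close>

context periodic
begin

lemma slice_measurable: "(\<lambda>(z, \<eta>). extend d z \<eta>) \<in> Dm d \<Otimes>\<^sub>M lborel \<rightarrow>\<^sub>M Dm (Suc d)"
  unfolding extend_def dual_measure_def by (rule extend_measurable)

lemma slice_compose_measurable:
  assumes "h \<in> measurable (Dm (Suc d)) L"
  shows "(\<lambda>(z, \<eta>). h (extend d z \<eta>)) \<in> measurable (Dm d \<Otimes>\<^sub>M lborel) L"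
  using measurable_compose[OF slice_measurable assms] by (simp add: case_prod_beta')

lemma slice_inner_measurable:
  assumes "h \<in> measurable (Dm (Suc d)) L" "z \<in> space (Dm d)"
  shows "(\<lambda>\<eta>. h (extend d z \<eta>)) \<in> measurable lborel L"
  using measurable_compose[OF measurable_Pair1'[OF assms(2)] slice_compose_measurable[OF assms(1)]] by simp

lemma distr_slice:
  "distr (Dm d \<Otimes>\<^sub>M lborel) (Dm (Suc d)) (\<lambda>(z, \<eta>). extend d z \<eta>) = Dm (Suc d)"
  unfolding extend_def by (rule distr_dual_measure_Suc)

lemma nn_integral_slice:
  assumes h: "h \<in> borel_measurable (Dm (Suc d))"
  shows "(\<integral>\<^sup>+z. h z \<partial>Dm (Suc d)) = (\<integral>\<^sup>+z. (\<integral>\<^sup>+\<eta>. h (extend d z \<eta>) \<partial>lborel) \<partial>Dm d)"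
proof -
  have "(\<integral>\<^sup>+z. h z \<partial>Dm (Suc d))
      = (\<integral>\<^sup>+z. h z \<partial>distr (Dm d \<Otimes>\<^sub>M lborel) (Dm (Suc d)) (\<lambda>(z, \<eta>). extend d z \<eta>))"
    by (simp only: distr_slice)
  also have "\<dots> = (\<integral>\<^sup>+p. h ((\<lambda>(z, \<eta>). extend d z \<eta>) p) \<partial>(Dm d \<Otimes>\<^sub>M lborel))"
    by (rule nn_integral_distr[OF slice_measurable]) (use h in simp)
  also have "\<dots> = (\<integral>\<^sup>+z. (\<integral>\<^sup>+\<eta>. h (extend d z \<eta>) \<partial>lborel) \<partial>Dm d)"
    using lborel.nn_integral_fst[OF slice_compose_measurable[OF h]] by (simp add: case_prod_beta')
  finally show ?thesis .
qed

lemma pair_sigma_finite_slice: "pair_sigma_finite (Dm d) lborel"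
proof -
  interpret D: sigma_finite_measure "Dm d" by (rule sigma_finite_dual_measure)
  show ?thesis ..
qed

lemma AE_slice:
  assumes "AE \<zeta> in Dm (Suc d). P \<zeta>"
  shows "AE z in Dm d. AE \<eta> in lborel. P (extend d z \<eta>)"
proof -
  interpret P: pair_sigma_finite "Dm d" lborel by (rule pair_sigma_finite_slice)
  have "AE \<zeta> in distr (Dm d \<Otimes>\<^sub>M lborel) (Dm (Suc d)) (\<lambda>(z, \<eta>). extend d z \<eta>). P \<zeta>"
    using assms by (simp only: distr_slice)
  from AE_distrD[OF slice_measurable this]
  have "AE p in Dm d \<Otimes>\<^sub>M lborel. P ((\<lambda>(z, \<eta>). extend d z \<eta>) p)" .
  from P.AE_pair[OF this] show ?thesis by simp
qed

lemma integral_slice: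
  fixes h :: "point \<Rightarrow> complex"
  assumes h: "integrable (Dm (Suc d)) h"
  shows "(\<integral>z. h z \<partial>Dm (Suc d)) = (\<integral>z. (\<integral>\<eta>. h (extend d z \<eta>) \<partial>lborel) \<partial>Dm d)"
proof -
  interpret P: pair_sigma_finite "Dm d" lborel by (rule pair_sigma_finite_slice)
  have m: "h \<in> borel_measurable (Dm (Suc d))" using h by auto
  have i: "integrable (Dm d \<Otimes>\<^sub>M lborel) (\<lambda>(z, \<eta>). h (extend d z \<eta>))"
    using h integrable_distr_eq[OF slice_measurable m] unfolding distr_slice by (simp add: case_prod_beta')
  have "(\<integral>z. h z \<partial>Dm (Suc d)) = (\<integral>p. h ((\<lambda>(z, \<eta>). extend d z \<eta>) p) \<partial>(Dm d \<Otimes>\<^sub>M lborel))"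
    using integral_distr[OF slice_measurable m] by (simp only: distr_slice)
  also have "\<dots> = (\<integral>p. (\<lambda>(z, \<eta>). h (extend d z \<eta>)) p \<partial>(Dm d \<Otimes>\<^sub>M lborel))"
    by (simp add: case_prod_beta')
  also have "\<dots> = (\<integral>z. (\<integral>\<eta>. h (extend d z \<eta>) \<partial>lborel) \<partial>Dm d)"
    by (rule P.integral_fst[symmetric, OF i])
  finally show ?thesis .
qed

text \<open>The inverse of \<open>extend\<close>, by which functions of the tangential frequencies
  become functions on the larger dual group.\<close>

lemma slice_parts_measurable:
  "(\<lambda>\<zeta>. (fst \<zeta>, restrict (snd \<zeta>) {..<d})) \<in> Dm (Suc d) \<rightarrow>\<^sub>M Dm d"
  "(\<lambda>\<zeta>. snd \<zeta> d) \<in> borel_measurable (Dm (Suc d))"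
proof -
  have "(\<lambda>f. restrict f {..<d}) \<in> lebesgue_euclid (Suc d) \<rightarrow>\<^sub>M lebesgue_euclid d"
    by (rule measurable_restrict_subset) auto
  then show "(\<lambda>\<zeta>. (fst \<zeta>, restrict (snd \<zeta>) {..<d})) \<in> Dm (Suc d) \<rightarrow>\<^sub>M Dm d"
    unfolding dual_measure_def by (intro measurable_Pair measurable_fst measurable_compose[OF measurable_snd])
  show "(\<lambda>\<zeta>. snd \<zeta> d) \<in> borel_measurable (Dm (Suc d))"
    by (rule dual_measure_coord_measurable) simp
qed

lemma slice_parts:
  assumes "z \<in> space (Dm d)"
  shows "fst (extend d z \<eta>) = fst z" "snd (extend d z \<eta>) d = \<eta>"
    "(fst (extend d z \<eta>), restrict (snd (extend d z \<eta>)) {..<d}) = z"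
proof -
  have "restrict ((snd z)(d := \<eta>)) {..<d} = snd z"
  proof
    fix i
    have "snd z \<in> euclid d" using assms unfolding space_dual_measure mem_Times_iff by (rule conjunct2)
    then show "restrict ((snd z)(d := \<eta>)) {..<d} i = snd z i"
      using PiE_arb[of "snd z" "{..<d}" "\<lambda>_. UNIV" i] by (cases "i < d") simp_all
  qed
  then show "(fst (extend d z \<eta>), restrict (snd (extend d z \<eta>)) {..<d}) = z"
    by (simp add: extend_def)
qed (simp_all add: extend_def)

lemma slice_square_integrable:
  assumes "L2 (Dm (Suc d)) F"
  shows "AE z in Dm d. L2 lborel (\<lambda>\<eta>. F (extend d z \<eta>))"
    "(\<integral>\<^sup>+z. energy lborel (\<lambda>\<eta>. F (extend d z \<eta>)) \<partial>Dm d)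
      = ennreal ((l2_norm (Dm (Suc d)) F)\<^sup>2)"
proof -
  note Fm = L2D[OF assms]
  have m: "(\<lambda>\<zeta>. ennreal ((cmod (F \<zeta>))\<^sup>2)) \<in> borel_measurable (Dm (Suc d))"
    using Fm by measurable
  show eq: "(\<integral>\<^sup>+z. energy lborel (\<lambda>\<eta>. F (extend d z \<eta>)) \<partial>Dm d)
      = ennreal ((l2_norm (Dm (Suc d)) F)\<^sup>2)"
    using nn_integral_slice[OF m] nn_integral_l2[OF assms] by simp
  have "(\<lambda>p. (\<lambda>(z, \<eta>). ennreal ((cmod (F (extend d z \<eta>)))\<^sup>2)) p) \<in> borel_measurable (Dm d \<Otimes>\<^sub>M lborel)"
    using slice_compose_measurable[OF m] by simp
  from lborel.borel_measurable_nn_integral_fst[OF this]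
  have "(\<lambda>z. \<integral>\<^sup>+\<eta>. ennreal ((cmod (F (extend d z \<eta>)))\<^sup>2) \<partial>lborel) \<in> borel_measurable (Dm d)"
    by simp
  from nn_integral_noteq_infinite[OF this]
  have "AE z in Dm d. energy lborel (\<lambda>\<eta>. F (extend d z \<eta>)) \<noteq> \<infinity>"
    unfolding eq by simp
  then show "AE z in Dm d. L2 lborel (\<lambda>\<eta>. F (extend d z \<eta>))"
    using AE_space
  proof eventually_elim
    case (elim z)
    show ?case using elim(1) slice_inner_measurable[OF Fm elim(2)] by (simp add: L2_iff_nn less_top)
  qed
qed

end

section \<open>The Poisson kernel, and compactly supported profiles with prescribed moments\<close>

lemma poisson_kernel_integral:
  assumes K: "0 < K"
  shows "(\<integral>\<^sup>+x. ennreal (K / (K\<^sup>2 + x\<^sup>2)) \<partial>lborel) = ennreal pi"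
proof -
  have s: "set_integrable lborel (einterval (-\<infinity>) \<infinity>) (\<lambda>x::real. inverse (1 + x\<^sup>2))"
    and i: "interval_lebesgue_integral lborel (-\<infinity>) \<infinity> (\<lambda>x::real. inverse (1 + x\<^sup>2)) = pi"
    using integrable_inverse_1_plus_square LBINT_inverse_1_plus_square by auto
  have 1: "integrable lborel (\<lambda>x::real. inverse (1 + x\<^sup>2))" "(\<integral>x. inverse (1 + x\<^sup>2) \<partial>lborel) = pi"
    using s i by (simp_all add: set_integrable_def interval_lebesgue_integral_def set_lebesgue_integral_def einterval_def)
  have "(\<integral>\<^sup>+x. ennreal (K / (K\<^sup>2 + x\<^sup>2)) \<partial>lborel) = ennreal \<bar>K\<bar> * (\<integral>\<^sup>+x. ennreal (K / (K\<^sup>2 + (0 + K * x)\<^sup>2)) \<partial>lborel)"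
    using K by (intro nn_integral_real_affine) auto
  also have "\<dots> = ennreal K * (\<integral>\<^sup>+x. ennreal (1 / K) * ennreal (inverse (1 + x\<^sup>2)) \<partial>lborel)"
  proof -
    have "K / (K\<^sup>2 + (0 + K * x)\<^sup>2) = 1 / K * inverse (1 + x\<^sup>2)" for x
    proof -
      have "K\<^sup>2 + (0 + K * x)\<^sup>2 = K * K * (1 + x\<^sup>2)" by (simp add: power2_eq_square algebra_simps)
      then show ?thesis using K by (simp add: divide_inverse)
    qed
    then have "ennreal (K / (K\<^sup>2 + (0 + K * x)\<^sup>2)) = ennreal (1 / K) * ennreal (inverse (1 + x\<^sup>2))" for x
      using K ennreal_mult[of "1 / K" "inverse (1 + x\<^sup>2)"] by simp
    then show ?thesis using K by (simp only: abs_of_pos)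
  qed
  also have "\<dots> = ennreal K * (ennreal (1 / K) * ennreal pi)"
    using nn_integral_eq_integral[OF 1(1)] 1(2) by (simp add: nn_integral_cmult)
  also have "\<dots> = ennreal pi" using K by (simp flip: ennreal_mult)
  finally show ?thesis .
qed

text \<open>Iterated backward differences of the indicator of an interval: the moments of order below \<open>N\<close>
  vanish, the one of order \<open>N\<close> does not.\<close>

primrec difference_profile :: "nat \<Rightarrow> real \<Rightarrow> real" where
  "difference_profile 0 x = indicator {0..1} x"
| "difference_profile (Suc N) x = difference_profile N x - difference_profile N (x - 1)"

definition moment :: "(real \<Rightarrow> real) \<Rightarrow> nat \<Rightarrow> real" where
  "moment f i = (\<integral>x. x ^ i * f x \<partial>lborel)"

definition bounded_profile :: "real \<Rightarrow> (real \<Rightarrow> real) \<Rightarrow> bool" where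
  "bounded_profile L f \<longleftrightarrow> f \<in> borel_measurable borel \<and> (\<exists>C. \<forall>x. \<bar>f x\<bar> \<le> C * indicator {0..L} x)"

lemma bounded_profile_moment_integrable:
  assumes "bounded_profile L f"
  shows "integrable lborel (\<lambda>x. x ^ i * f x)"
proof -
  obtain C where C: "\<And>x. \<bar>f x\<bar> \<le> C * indicator {0..L} x" and [measurable]: "f \<in> borel_measurable borel"
    using assms by (auto simp: bounded_profile_def)
  have "integrable lborel (\<lambda>x. C * \<bar>L\<bar> ^ i * indicator {0..L} x)"
    by (intro integrable_mult_right) (simp add: integrable_indicator_iff emeasure_lborel_Icc_eq)
  then show ?thesis
  proof (rule Bochner_Integration.integrable_bound)
    show "AE x in lborel. norm (x ^ i * f x) \<le> norm (C * \<bar>L\<bar> ^ i * indicator {0..L} x)"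
    proof (rule AE_I2)
      fix x
      show "norm (x ^ i * f x) \<le> norm (C * \<bar>L\<bar> ^ i * indicator {0..L} x)"
      proof (cases "x \<in> {0..L}")
        case True
        then have "\<bar>x\<bar> ^ i \<le> \<bar>L\<bar> ^ i" "\<bar>f x\<bar> \<le> \<bar>C\<bar>" using C[of x] by (auto intro!: power_mono)
        then have "\<bar>x\<bar> ^ i * \<bar>f x\<bar> \<le> \<bar>L\<bar> ^ i * \<bar>C\<bar>" by (intro mult_mono) auto
        then show ?thesis using True by (simp add: abs_mult power_abs mult.commute)
      next
        case False
        then show ?thesis using C[of x] by simp
      qed
    qed
  qed measurable
qed

lemma bounded_profile_lincomb:
  assumes "bounded_profile L f" "bounded_profile L g"
  shows "bounded_profile L (\<lambda>x. f x + a * g x)" "moment (\<lambda>x. f x + a * g x) i = moment f i + a * moment g i"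
proof -
  obtain C D where C: "\<And>x. \<bar>f x\<bar> \<le> C * indicator {0..L} x" "\<And>x. \<bar>g x\<bar> \<le> D * indicator {0..L} x"
    and [measurable]: "f \<in> borel_measurable borel" "g \<in> borel_measurable borel"
    using assms by (auto simp: bounded_profile_def)
  have "\<bar>f x + a * g x\<bar> \<le> (C + \<bar>a\<bar> * D) * indicator {0..L} x" for x
  proof -
    have "\<bar>f x + a * g x\<bar> \<le> \<bar>f x\<bar> + \<bar>a\<bar> * \<bar>g x\<bar>" by (metis abs_mult abs_triangle_ineq)
    also have "\<dots> \<le> C * indicator {0..L} x + \<bar>a\<bar> * (D * indicator {0..L} x)"
      using C by (intro add_mono mult_left_mono) auto
    finally show ?thesis by (simp add: algebra_simps)
  qed
  then show "bounded_profile L (\<lambda>x. f x + a * g x)" unfolding bounded_profile_def by (intro conjI exI[of _ "C + \<bar>a\<bar> * D"]) auto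
  have "(\<lambda>x. x ^ i * (f x + a * g x)) = (\<lambda>x. x ^ i * f x + a * (x ^ i * g x))" by (simp add: fun_eq_iff algebra_simps)
  then show "moment (\<lambda>x. f x + a * g x) i = moment f i + a * moment g i"
    unfolding moment_def using bounded_profile_moment_integrable assms by simp
qed

lemma bounded_profile_mono: "bounded_profile L f \<Longrightarrow> L \<le> L' \<Longrightarrow> bounded_profile L' f"
proof -
  assume f: "bounded_profile L f" and L: "L \<le> L'"
  obtain C where C: "\<And>x. \<bar>f x\<bar> \<le> C * indicator {0..L} x" using f by (auto simp: bounded_profile_def)
  have "\<bar>f x\<bar> \<le> \<bar>C\<bar> * indicator {0..L'} x" for x
    using C[of x] L by (cases "x \<in> {0..L}") auto
  then show ?thesis using f by (auto simp: bounded_profile_def)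
qed

text \<open>The shift by 1 expands moments binomially: the i-th moment of the difference is minus
  the sum over l < i of (i choose l) times the l-th moments. If the moments below N vanish, those of
  the difference vanish up to order N, and at order N + 1 only l = N survives, with coefficient N +
  1.\<close>

lemma difference_profile:
  "bounded_profile (real (Suc N)) (difference_profile N)"
  "\<And>i. i < N \<Longrightarrow> moment (difference_profile N) i = 0" "moment (difference_profile N) N \<noteq> 0"
proof (induction N)
  case 0
  {
    case 1
    have "difference_profile 0 = indicator {0..1}" by (simp add: fun_eq_iff)
    then show ?case unfolding bounded_profile_def by (auto intro!: exI[of _ 1])
  next
    case 2
    then show ?case by simp
  next
    case 3
    show ?case by (simp add: moment_def)
  }
next
  case (Suc N)
  let ?p = "difference_profile N"
  note [measurable] = Suc.IH(1)[unfolded bounded_profile_def, THEN conjunct1]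
  note pi = bounded_profile_moment_integrable[OF Suc.IH(1)]
  have sh: "bounded_profile (real (Suc (Suc N))) (\<lambda>x. ?p (x - 1))"
  proof -
    obtain C where C: "\<And>x. \<bar>?p x\<bar> \<le> C * indicator {0..real (Suc N)} x"
      using Suc.IH(1) by (auto simp: bounded_profile_def)
    have "\<bar>?p (x - 1)\<bar> \<le> \<bar>C\<bar> * indicator {0..real (Suc (Suc N))} x" for x
      using C[of "x - 1"] by (cases "x - 1 \<in> {0..real (Suc N)}") auto
    then show ?thesis unfolding bounded_profile_def by (intro conjI exI[of _ "\<bar>C\<bar>"]) auto
  qed
  have eq: "difference_profile (Suc N) = (\<lambda>x. ?p x + (-1) * ?p (x - 1))" by (simp add: fun_eq_iff)
  have bp: "bounded_profile (real (Suc (Suc N))) ?p" by (rule bounded_profile_mono[OF Suc.IH(1)]) simp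
  have m: "moment (difference_profile (Suc N)) i = - (\<Sum>l<i. real (i choose l) * moment ?p l)" for i
  proof -
    have "moment (\<lambda>x. ?p (x - 1)) i = (\<integral>x. (x + 1) ^ i * ?p x \<partial>lborel)"
      unfolding moment_def by (subst lborel_integral_real_affine[of 1 _ 1]) (simp_all add: add.commute)
    also have "\<dots> = (\<integral>x. (\<Sum>l\<le>i. real (i choose l) * (x ^ l * ?p x)) \<partial>lborel)"
      by (simp add: binomial_ring sum_distrib_right mult.assoc)
    also have "\<dots> = (\<Sum>l\<le>i. real (i choose l) * moment ?p l)"
      unfolding moment_def using pi by (subst Bochner_Integration.integral_sum) auto
    also have "\<dots> = (\<Sum>l<i. real (i choose l) * moment ?p l) + moment ?p i"
      by (simp add: lessThan_Suc_atMost[symmetric])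
    finally show ?thesis unfolding eq bounded_profile_lincomb(2)[OF bp sh] by simp
  qed
  {
    case 1
    show ?case unfolding eq by (rule bounded_profile_lincomb(1)[OF bp sh])
  next
    case (2 i)
    then show ?case unfolding m using Suc.IH(2) by (simp add: sum.neutral)
  next
    case 3
    have "(\<Sum>l<Suc N. real (Suc N choose l) * moment ?p l) = real (Suc N) * moment ?p N"
      using Suc.IH(2) by (simp add: sum.neutral)
    then show ?case unfolding m using Suc.IH(3) by simp
  }
qed

text \<open>The dual family grows triangularly. \<open>difference_profile N\<close> has no moments
  below N, so a multiple of it corrects the N-th moment of each old profile and leaves the lower
  ones alone; normalised, it is the new profile.\<close>

lemma dual_profiles:
  "\<exists>\<kappa>. \<forall>j<N. bounded_profile (real N) (\<kappa> j) \<and> (\<forall>i<N. moment (\<kappa> j) i = (if i = j then 1 else 0))"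
proof (induction N)
  case 0
  then show ?case by simp
next
  case (Suc N)
  then obtain \<kappa> where \<kappa>: "\<And>j. j < N \<Longrightarrow> bounded_profile (real N) (\<kappa> j)"
    "\<And>i j. j < N \<Longrightarrow> i < N \<Longrightarrow> moment (\<kappa> j) i = (if i = j then 1 else 0)" by blast
  note p = difference_profile[where N=N]
  define m where "m = moment (difference_profile N) N"
  have m: "m \<noteq> 0" using p(3) by (simp add: m_def)
  define \<kappa>' where "\<kappa>' j = (if j < N then (\<lambda>x. \<kappa> j x + (- moment (\<kappa> j) N / m) * difference_profile N x)
    else (\<lambda>x. 0 + (1 / m) * difference_profile N x))" for j
  have z: "bounded_profile (real (Suc N)) (\<lambda>x. 0)" unfolding bounded_profile_def by (auto intro!: exI[of _ 0])
  have z0: "moment (\<lambda>x. 0) i = 0" for i by (simp add: moment_def)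
  have k: "bounded_profile (real (Suc N)) (\<kappa> j)" if "j < N" for j
    by (rule bounded_profile_mono[OF \<kappa>(1)[OF that]]) simp
  show ?case
  proof (intro exI[of _ \<kappa>'] allI impI conjI)
    fix j assume j: "j < Suc N"
    show "bounded_profile (real (Suc N)) (\<kappa>' j)"
      unfolding \<kappa>'_def
      by (cases "j < N") (simp_all only: simp_thms if_True if_False bounded_profile_lincomb(1)[OF k p(1)] bounded_profile_lincomb(1)[OF z p(1)])
    fix i assume i: "i < Suc N"
    show "moment (\<kappa>' j) i = (if i = j then 1 else 0)"
    proof (cases "j < N")
      case True
      have "moment (\<kappa>' j) i = moment (\<kappa> j) i + (- moment (\<kappa> j) N / m) * moment (difference_profile N) i"
        unfolding \<kappa>'_def using True by (simp only: if_True bounded_profile_lincomb(2)[OF k[OF True] p(1)])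
      moreover have "i < N \<or> i = N" using i by linarith
      ultimately show ?thesis using \<kappa>(2)[OF True, of i] p(2)[of i] m True
        by (elim disjE) (simp_all add: m_def)
    next
      case False
      have "moment (\<kappa>' j) i = moment (\<lambda>x. 0) i + (1 / m) * moment (difference_profile N) i"
        unfolding \<kappa>'_def using False by (simp only: if_False bounded_profile_lincomb(2)[OF z p(1)])
      moreover have "j = N" using j False by simp
      moreover have "i < N \<or> i = N" using i by linarith
      ultimately show ?thesis using p(2)[of i] m
        by (elim disjE) (simp_all add: m_def z0)
    qed
  qed
qed

section \<open>Traces as moments\<close>

text \<open>Conjugate transform of the indicator of [0, h]. Divided by h it tends to 1, the
  transform of the Dirac measure at 0.\<close>

definition window :: "real \<Rightarrow> real \<Rightarrow> complex" where
  "window h \<eta> = (\<integral>y. indicator {0..h} y * cis (\<eta> * y) \<partial>lborel)"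

lemma cis_minus_1_bound: "cmod (cis x - 1) \<le> \<bar>x\<bar>"
  using iexp_approx1[of x 0] by (simp add: cis_conv_exp)

lemma cis_taylor_bound: "cmod (cis x - 1 - \<i> * of_real x) \<le> x\<^sup>2 / 2"
  using iexp_approx1[of x 1] by (simp add: cis_conv_exp power2_eq_square diff_diff_eq)

lemma indicator_interval_integrable:
  "integrable lborel (\<lambda>y. indicator {a..b} y * f y :: complex)"
  if "f \<in> borel_measurable borel" "\<And>y. cmod (f y) \<le> C" for a b C :: real
proof (rule Bochner_Integration.integrable_bound)
  show "integrable lborel (\<lambda>y. C * indicator {a..b} y :: real)"
    by (intro integrable_mult_right) (simp add: integrable_indicator_iff emeasure_lborel_Icc_eq)
  show "(\<lambda>y. indicator {a..b} y * f y) \<in> borel_measurable lborel" using that(1) by measurable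
  show "AE y in lborel. norm (indicator {a..b} y * f y) \<le> norm (C * indicator {a..b} y)"
  proof (rule AE_I2)
    fix y
    have "0 \<le> C" using order_trans[OF norm_ge_zero that(2)] .
    then show "norm (indicator {a..b} y * f y) \<le> norm (C * indicator {a..b} y)"
      using that(2)[of y] by (cases "y \<in> {a..b}") (simp_all add: norm_mult)
  qed
qed

lemma window_bound:
  assumes "0 < h"
  shows "cmod (window h \<eta>) \<le> h" "cmod (window h \<eta> - of_real h) \<le> h * (h * \<bar>\<eta>\<bar>)"
proof -
  have i: "integrable lborel (\<lambda>y. indicator {0..h} y * cis (\<eta> * y))"
    by (rule indicator_interval_integrable[of _ 1]) auto
  have i1: "integrable lborel (\<lambda>y. indicator {0..h} y * 1 :: complex)"
    by (rule indicator_interval_integrable[of _ 1]) auto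
  have ind: "integrable lborel (\<lambda>y. a * indicator {0..h} y :: real)" "(\<integral>y. a * indicator {0..h} y \<partial>lborel) = a * h" for a
    using assms by (auto simp: integrable_indicator_iff emeasure_lborel_Icc_eq)
  have "cmod (window h \<eta>) \<le> (\<integral>y. 1 * indicator {0..h} y \<partial>lborel)"
    unfolding window_def
  proof (rule order_trans[OF integral_norm_bound integral_mono])
    show "integrable lborel (\<lambda>y. norm (indicator {0..h} y * cis (\<eta> * y)))" by (rule integrable_norm[OF i])
    show "norm (indicator {0..h} y * cis (\<eta> * y)) \<le> 1 * indicator {0..h} y" for y by (cases "y \<in> {0..h}") (simp_all add: norm_mult)
  qed (rule ind(1))
  then show "cmod (window h \<eta>) \<le> h" unfolding ind(2) by simp
  have "of_real h = (\<integral>y. indicator {0..h} y * 1 \<partial>lborel :: complex)"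
    using indicator_L1_L2(4)[of "{0..h}" lborel] assms by (simp add: emeasure_lborel_Icc_eq)
  then have "window h \<eta> - of_real h = (\<integral>y. indicator {0..h} y * cis (\<eta> * y) - indicator {0..h} y * 1 \<partial>lborel)"
    unfolding window_def by (simp only: Bochner_Integration.integral_diff[OF i i1])
  also have "cmod \<dots> \<le> (\<integral>y. (h * \<bar>\<eta>\<bar>) * indicator {0..h} y \<partial>lborel)"
  proof (rule order_trans[OF integral_norm_bound integral_mono])
    show "integrable lborel (\<lambda>y. norm (indicator {0..h} y * cis (\<eta> * y) - indicator {0..h} y * 1))"
      by (intro integrable_norm Bochner_Integration.integrable_diff i i1)
    show "norm (indicator {0..h} y * cis (\<eta> * y) - indicator {0..h} y * 1) \<le> (h * \<bar>\<eta>\<bar>) * indicator {0..h} y" for y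
    proof (cases "y \<in> {0..h}")
      case True
      have "cmod (cis (\<eta> * y) - 1) \<le> \<bar>\<eta> * y\<bar>" by (rule cis_minus_1_bound)
      also have "\<dots> \<le> h * \<bar>\<eta>\<bar>" using True by (auto simp: abs_mult mult.commute intro!: mult_right_mono)
      finally show ?thesis using True by simp
    qed simp
  qed (rule ind(1))
  finally show "cmod (window h \<eta> - of_real h) \<le> h * (h * \<bar>\<eta>\<bar>)" unfolding ind(2) by (simp add: mult.commute)
qed

lemma interval_transform:
  "cnj (line_transform (indicator {a..a + h}) \<eta>) = cis (\<eta> * a) * window h \<eta>"
proof -
  have "cnj (line_transform (indicator {a..a + h}) \<eta>) = (\<integral>y. indicator {a..a + h} y * cis (\<eta> * y) \<partial>lborel)"
    unfolding kernel_transform_def Bochner_Integration.integral_cnj[symmetric]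
    by (intro Bochner_Integration.integral_cong) (simp_all add: cis_cnj split: split_indicator)
  also have "\<dots> = (\<integral>y. indicator {a..a + h} (a + 1 * y) * cis (\<eta> * (a + 1 * y)) \<partial>lborel)"
    by (subst lborel_integral_real_affine[of 1 _ a]) simp_all
  also have "\<dots> = (\<integral>y. cis (\<eta> * a) * (indicator {0..h} y * cis (\<eta> * y)) \<partial>lborel)"
    by (intro Bochner_Integration.integral_cong) (auto simp: cis_mult algebra_simps split: split_indicator)
  also have "\<dots> = cis (\<eta> * a) * window h \<eta>" unfolding window_def by (rule integral_mult_right_zero)
  finally show ?thesis .
qed

text \<open>The intervals \<open>[(k + 1) h, (k + 2) h]\<close> lie in \<open>(0, \<infinity>)\<close>, and the \<open>j\<close>-th difference quotients of
  their indicators, divided by \<open>h\<close>, converge to the \<open>j\<close>-th derivative of the Dirac measure at \<open>0\<close>.\<close>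

lemma moment_zero_of_windows:
  fixes \<Phi> :: "real \<Rightarrow> complex"
  assumes P: "integrable lborel \<Phi>" and Pj: "integrable lborel (\<lambda>\<eta>. of_real (\<eta> ^ j) * \<Phi> \<eta>)"
    and z: "\<And>m k. (\<integral>\<eta>. \<Phi> \<eta> * (cis (\<eta> * (real (Suc k) * (1 / real (Suc m)))) * window (1 / real (Suc m)) \<eta>) \<partial>lborel) = 0"
    and w: "\<And>m. window (1 / real (Suc m)) \<in> borel_measurable borel"
  shows "(\<integral>\<eta>. (\<i> * of_real \<eta>) ^ j * \<Phi> \<eta> \<partial>lborel) = 0"
proof -
  define h where "h m = 1 / real (Suc m)" for m
  have h: "0 < h m" for m by (simp add: h_def)
  have h0: "h \<longlonglongrightarrow> 0" unfolding h_def by (rule LIMSEQ_Suc[OF lim_1_over_n])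
  \<comment> \<open>Conjugate transform of the combination of the indicators of [(k+1) h, (k+2) h]
    for k \<le> j with alternating binomial coefficients, divided by h^(j+1). The leading
    \<open>cis\<close> is the shift that keeps the intervals away from 0.\<close>
  define q where "q m \<eta> = cis (\<eta> * h m) * ((cis (\<eta> * h m) - 1) / of_real (h m)) ^ j * (window (h m) \<eta> / of_real (h m))" for m \<eta>
  note [measurable] = w[folded h_def] borel_measurable_integrable[OF P]
  \<comment> \<open>A bound uniform in \<open>m\<close>, so that integrability of \<eta>^j \<Phi>
    gives dominated convergence.\<close>
  have qb: "cmod (q m \<eta>) \<le> \<bar>\<eta>\<bar> ^ j" for m \<eta>
  proof -
    have "cmod ((cis (\<eta> * h m) - 1) / of_real (h m)) \<le> \<bar>\<eta>\<bar>"
      using cis_minus_1_bound[of "\<eta> * h m"] h[of m] by (simp add: norm_divide abs_mult pos_divide_le_eq)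
    moreover have "cmod (window (h m) \<eta> / of_real (h m)) \<le> 1"
      using window_bound(1)[OF h, of m \<eta>] h[of m] by (simp add: norm_divide)
    ultimately have "cmod ((cis (\<eta> * h m) - 1) / of_real (h m)) ^ j * cmod (window (h m) \<eta> / of_real (h m)) \<le> \<bar>\<eta>\<bar> ^ j * 1"
      by (intro mult_mono power_mono) auto
    then show ?thesis by (simp only: q_def norm_mult norm_power norm_cis mult_1 mult_1_right)
  qed
  have ql: "(\<lambda>m. q m \<eta>) \<longlonglongrightarrow> (\<i> * of_real \<eta>) ^ j" for \<eta>
  proof -
    have 1: "(\<lambda>m. cis (\<eta> * h m)) \<longlonglongrightarrow> cis (\<eta> * 0)" by (intro tendsto_cis tendsto_mult tendsto_const h0)
    have b2: "norm ((cis (\<eta> * h m) - 1) / of_real (h m) - \<i> * of_real \<eta>) \<le> h m * (\<eta>\<^sup>2 / 2)" for m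
    proof -
      have "(cis (\<eta> * h m) - 1) / of_real (h m) - \<i> * of_real \<eta> = (cis (\<eta> * h m) - 1 - \<i> * of_real (\<eta> * h m)) / of_real (h m)"
        using h[of m] by (simp add: diff_divide_distrib)
      also have "cmod \<dots> \<le> ((\<eta> * h m)\<^sup>2 / 2) / h m"
      proof -
        have "cmod ((cis (\<eta> * h m) - 1 - \<i> * of_real (\<eta> * h m)) / of_real (h m))
            = cmod (cis (\<eta> * h m) - 1 - \<i> * of_real (\<eta> * h m)) / h m"
          using h[of m] by (simp only: norm_divide norm_of_real abs_of_pos)
        then show ?thesis using divide_right_mono[OF cis_taylor_bound less_imp_le[OF h[of m]]] by (simp only:)
      qed
      also have "\<dots> = h m * (\<eta>\<^sup>2 / 2)" using h[of m] by (simp add: power2_eq_square)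
      finally show ?thesis .
    qed
    have "(\<lambda>m. (cis (\<eta> * h m) - 1) / of_real (h m) - \<i> * of_real \<eta>) \<longlonglongrightarrow> 0"
      by (rule Lim_null_comparison[OF always_eventually[OF allI[OF b2]] tendsto_mult_left_zero[OF h0]])
    then have 2: "(\<lambda>m. (cis (\<eta> * h m) - 1) / of_real (h m)) \<longlonglongrightarrow> \<i> * of_real \<eta>" by (simp only: LIM_zero_iff)
    have b3: "norm (window (h m) \<eta> / of_real (h m) - 1) \<le> h m * \<bar>\<eta>\<bar>" for m
    proof -
      have "window (h m) \<eta> / of_real (h m) - 1 = (window (h m) \<eta> - of_real (h m)) / of_real (h m)"
        using h[of m] by (simp add: diff_divide_distrib)
      then show ?thesis using window_bound(2)[OF h, of m \<eta>] h[of m] by (simp add: norm_divide pos_divide_le_eq mult_ac)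
    qed
    have "(\<lambda>m. window (h m) \<eta> / of_real (h m) - 1) \<longlonglongrightarrow> 0"
      by (rule Lim_null_comparison[OF always_eventually[OF allI[OF b3]] tendsto_mult_left_zero[OF h0]])
    then have 3: "(\<lambda>m. window (h m) \<eta> / of_real (h m)) \<longlonglongrightarrow> 1" by (simp only: LIM_zero_iff)
    have "(\<lambda>m. q m \<eta>) \<longlonglongrightarrow> cis (\<eta> * 0) * (\<i> * of_real \<eta>) ^ j * 1"
      unfolding q_def by (intro tendsto_mult tendsto_power 1 2 3)
    then show ?thesis by simp
  qed
  have "(\<lambda>m. \<integral>\<eta>. q m \<eta> * \<Phi> \<eta> \<partial>lborel) \<longlonglongrightarrow> (\<integral>\<eta>. (\<i> * of_real \<eta>) ^ j * \<Phi> \<eta> \<partial>lborel)"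
  proof (rule integral_dominated_convergence)
    show "integrable lborel (\<lambda>\<eta>. cmod (of_real (\<eta> ^ j) * \<Phi> \<eta>))" by (rule integrable_norm[OF Pj])
    show "AE \<eta> in lborel. (\<lambda>m. q m \<eta> * \<Phi> \<eta>) \<longlonglongrightarrow> (\<i> * of_real \<eta>) ^ j * \<Phi> \<eta>"
      by (intro AE_I2 tendsto_mult ql tendsto_const)
    show "AE \<eta> in lborel. norm (q m \<eta> * \<Phi> \<eta>) \<le> cmod (of_real (\<eta> ^ j) * \<Phi> \<eta>)" for m
      using qb[of m] by (intro AE_I2) (simp add: norm_mult norm_power power_abs mult_right_mono)
    show "(\<lambda>\<eta>. q m \<eta> * \<Phi> \<eta>) \<in> borel_measurable lborel" for m unfolding q_def by measurable
    show "(\<lambda>\<eta>. (\<i> * of_real \<eta>) ^ j * \<Phi> \<eta>) \<in> borel_measurable lborel" by measurable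
  qed
  moreover have "(\<integral>\<eta>. q m \<eta> * \<Phi> \<eta> \<partial>lborel) = 0" for m
  proof -
    \<comment> \<open>Coefficients of the binomial expansion that writes \<open>q m\<close> as a
      combination of the factors whose integrals vanish by assumption.\<close>
    define c where "c k = complex_of_real (real (j choose k)) * (-1) ^ (j - k) / of_real (h m) ^ Suc j" for k
    have eq: "q m \<eta> * \<Phi> \<eta> = (\<Sum>k\<le>j. c k * (\<Phi> \<eta> * (cis (\<eta> * (real (Suc k) * h m)) * window (h m) \<eta>)))" for \<eta>
    proof -
      have p: "cis (\<eta> * (real (Suc k) * h m)) = cis (\<eta> * h m) * cis (\<eta> * h m) ^ k" for k
      proof -
        have "cis (\<eta> * (real (Suc k) * h m)) = cis (real (Suc k) * (\<eta> * h m))" by (simp add: mult_ac)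
        also have "\<dots> = cis (\<eta> * h m) ^ Suc k" by (simp only: Complex.DeMoivre)
        finally show ?thesis by simp
      qed
      have "(cis (\<eta> * h m) - 1) ^ j = (\<Sum>k\<le>j. of_nat (j choose k) * cis (\<eta> * h m) ^ k * (-1) ^ (j - k))"
        using binomial_ring[of "cis (\<eta> * h m)" "-1" j] by simp
      then have "q m \<eta> * \<Phi> \<eta> = (\<Sum>k\<le>j. of_nat (j choose k) * cis (\<eta> * h m) ^ k * (-1) ^ (j - k))
          * (cis (\<eta> * h m) * window (h m) \<eta> * \<Phi> \<eta> / of_real (h m) ^ Suc j)"
        by (simp add: q_def power_divide mult_ac)
      also have "\<dots> = (\<Sum>k\<le>j. c k * (\<Phi> \<eta> * (cis (\<eta> * (real (Suc k) * h m)) * window (h m) \<eta>)))"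
        unfolding sum_distrib_right p by (intro sum.cong) (simp_all add: c_def mult_ac)
      finally show ?thesis .
    qed
    have int: "integrable lborel (\<lambda>\<eta>. \<Phi> \<eta> * (cis (\<eta> * (real (Suc k) * h m)) * window (h m) \<eta>))" for k
    proof (rule Bochner_Integration.integrable_bound[OF integrable_mult_right[OF integrable_norm[OF P], of "h m"]])
      show "AE \<eta> in lborel. norm (\<Phi> \<eta> * (cis (\<eta> * (real (Suc k) * h m)) * window (h m) \<eta>)) \<le> norm (h m * norm (\<Phi> \<eta>))"
      proof (rule AE_I2)
        fix \<eta>
        have "norm (\<Phi> \<eta>) * cmod (window (h m) \<eta>) \<le> norm (\<Phi> \<eta>) * h m"
          by (rule mult_left_mono[OF window_bound(1)[OF h]]) simp
        then show "norm (\<Phi> \<eta> * (cis (\<eta> * (real (Suc k) * h m)) * window (h m) \<eta>)) \<le> norm (h m * norm (\<Phi> \<eta>))"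
          using h[of m] by (simp add: norm_mult mult.commute)
      qed
    qed measurable
    have "(\<integral>\<eta>. q m \<eta> * \<Phi> \<eta> \<partial>lborel) = (\<Sum>k\<le>j. c k * (\<integral>\<eta>. \<Phi> \<eta> * (cis (\<eta> * (real (Suc k) * h m)) * window (h m) \<eta>) \<partial>lborel))"
      unfolding eq using int by (subst Bochner_Integration.integral_sum) simp_all
    also have "\<dots> = 0" using z[where m=m, folded h_def] by simp
    finally show ?thesis .
  qed
  ultimately have "(\<lambda>m. 0) \<longlonglongrightarrow> (\<integral>\<eta>. (\<i> * of_real \<eta>) ^ j * \<Phi> \<eta> \<partial>lborel)" by simp
  from LIMSEQ_unique[OF tendsto_const this] show ?thesis by simp
qed

section \<open>Boundedness of the trace on the Fourier side\<close>

locale trace_setting = periodic T + chg_shape r1 r2 s2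
  for T s2 :: real and r1 r2 :: nat
begin

definition trace_symbol :: "nat \<Rightarrow> nat \<Rightarrow> (point \<Rightarrow> complex) \<Rightarrow> point \<Rightarrow> complex" where
  "trace_symbol d j F z = of_real (1 / (2 * pi)) * (\<integral>\<eta>. (\<i> * of_real \<eta>) ^ j * F (extend d z \<eta>) \<partial>lborel)"

text \<open>Contains no oscillation condition, so that the transform of a smooth function qualifies
  before its time mean is removed.\<close>

definition admissible :: "nat \<Rightarrow> (point \<Rightarrow> complex) \<Rightarrow> bool" where
  "admissible d F \<longleftrightarrow> F \<in> borel_measurable (Dm (Suc d)) \<and>
    L2 (Dm (Suc d)) (chg_weight (Suc d) \<odot> F)"

lemma time_scale_measurable: "(\<lambda>z. time_scale (fst z)) \<in> borel_measurable (Dm d)"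
proof -
  note [measurable] = jap_time_measurable
  show ?thesis unfolding time_scale_def by measurable
qed

lemma chg_weight_measurable: "chg_weight d \<in> borel_measurable (Dm d)"
proof -
  note [measurable] = time_scale_measurable jap_space_measurable[OF order_refl]
  show ?thesis unfolding chg_weight_def[abs_def] by measurable
qed

lemma trace_weight_measurable: "trace_weight d j \<in> borel_measurable (Dm d)"
proof -
  note [measurable] = time_scale_measurable jap_space_measurable[OF order_refl]
  show ?thesis unfolding trace_weight_def[abs_def] by (cases "j < r2") (simp_all only: if_True if_False, measurable)
qed

lemma concentration_measurable: "concentration d j \<in> borel_measurable (Dm d)"
proof -
  note [measurable] = time_scale_measurable jap_space_measurable[OF order_refl]
  show ?thesis unfolding concentration_def[abs_def] radius_def by (cases "j < r2") (simp_all only: if_True if_False, measurable)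
qed

lemma chg_weight_ge_1: "1 \<le> chg_weight d z"
proof -
  have "1 \<le> jap_space d (snd z) ^ r2" "1 \<le> max (time_scale (fst z)) (jap_space d (snd z)) ^ (r1 - r2)"
    using jap_ge_1(2)[of d "snd z"] by (auto intro!: one_le_power simp: le_max_iff_disj)
  then show ?thesis unfolding chg_weight_def using mult_mono[of 1 _ 1] by fastforce
qed

lemma trace_weight_ge_1: "j < r1 \<Longrightarrow> 1 \<le> trace_weight d j z"
proof -
  assume j: "j < r1"
  have J: "1 \<le> jap_space d (snd z)" "1 \<le> max (time_scale (fst z)) (jap_space d (snd z))"
    using jap_ge_1(2)[of d "snd z"] by (auto simp: le_max_iff_disj)
  show ?thesis
  proof (cases "j < r2")
    case True
    have "1 \<le> jap_space d (snd z) powr (real r2 - real j - 1/2)"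
      using J True by (intro ge_one_powr_ge_zero) auto
    moreover have "1 \<le> max (time_scale (fst z)) (jap_space d (snd z)) ^ (r1 - r2)" using J by (intro one_le_power)
    ultimately show ?thesis unfolding trace_weight_def using True mult_mono[of 1 _ 1] by fastforce
  next
    case False
    then show ?thesis unfolding trace_weight_def using J j by (simp add: ge_one_powr_ge_zero)
  qed
qed

text \<open>Carries the weight along, so that the energies of the slices integrate to the energy of
  the weighted transform.\<close>

definition slice :: "nat \<Rightarrow> (point \<Rightarrow> complex) \<Rightarrow> point \<Rightarrow> real \<Rightarrow> complex" where
  "slice d F z \<eta> = of_real (chg_weight (Suc d) (extend d z \<eta>)) * F (extend d z \<eta>)"

lemma slice_nn:
  assumes "admissible d F"
  shows "(\<integral>\<^sup>+z. energy lborel (slice d F z) \<partial>Dm d)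
    = ennreal ((l2_norm (Dm (Suc d)) (chg_weight (Suc d) \<odot> F))\<^sup>2)"
  unfolding slice_def by (rule slice_square_integrable(2)[OF conjunct2[OF assms[unfolded admissible_def]]])

lemma slice_measurable2:
  assumes "admissible d F"
  shows "(\<lambda>(z, \<eta>). slice d F z \<eta>) \<in> borel_measurable (Dm d \<Otimes>\<^sub>M lborel)"
  using slice_compose_measurable[of "\<lambda>\<zeta>. of_real (chg_weight (Suc d) \<zeta>) * F \<zeta>" d borel] assms
  unfolding slice_def admissible_def by auto

lemma slice_L2:
  assumes "admissible d F"
  shows "AE z in Dm d. L2 lborel (slice d F z)"
  unfolding slice_def[abs_def] by (rule slice_square_integrable(1)[OF conjunct2[OF assms[unfolded admissible_def]]])

text \<open>Cauchy-Schwarz against the square root of the Poisson kernel of width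
  \<open>concentration d j z\<close>. The same majorant makes \<eta>^j F integrable on the slice, so
  that the moments are meaningful for almost every tangential frequency.\<close>

lemma slice_bound:
  assumes F: "admissible d F" and j: "j < r1" and s: "L2 lborel (slice d F z)"
    and z: "z \<in> space (Dm d)"
  shows "integrable lborel (\<lambda>\<eta>. of_real (\<eta> ^ j) * F (extend d z \<eta>))"
    "trace_weight d j z * cmod (\<integral>\<eta>. (\<i> * of_real \<eta>) ^ j * F (extend d z \<eta>) \<partial>lborel)
      \<le> sqrt (2 ^ (r1 - r2) * pi) * l2_norm lborel (slice d F z)"
proof -
  define K where "K = concentration d j z"
  have K: "0 < K" using concentration_ge_1[of d j z] by (simp add: K_def)
  define p where "p \<eta> = complex_of_real (sqrt (2 ^ (r1 - r2) * (K / (K\<^sup>2 + \<eta>\<^sup>2))))" for \<eta>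
  have p2: "L2 lborel p" "l2_norm lborel p = sqrt (2 ^ (r1 - r2) * pi)"
  proof -
    have [measurable]: "p \<in> borel_measurable lborel" unfolding p_def by measurable
    have "ennreal ((cmod (p \<eta>))\<^sup>2) = ennreal (2 ^ (r1 - r2)) * ennreal (K / (K\<^sup>2 + \<eta>\<^sup>2))" for \<eta>
    proof -
      have 0: "0 \<le> (2::real) ^ (r1 - r2)" "0 \<le> K / (K\<^sup>2 + \<eta>\<^sup>2)" using K by auto
      have "(cmod (p \<eta>))\<^sup>2 = 2 ^ (r1 - r2) * (K / (K\<^sup>2 + \<eta>\<^sup>2))" using K by (simp add: p_def)
      then show ?thesis by (simp only: ennreal_mult[OF 0])
    qed
    then have "energy lborel p = (\<integral>\<^sup>+\<eta>. ennreal (2 ^ (r1 - r2)) * ennreal (K / (K\<^sup>2 + \<eta>\<^sup>2)) \<partial>lborel)"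
      by (simp only:)
    also have "\<dots> = ennreal (2 ^ (r1 - r2)) * ennreal pi"
      by (subst nn_integral_cmult) (simp_all only: poisson_kernel_integral[OF K], measurable)
    also have "\<dots> = ennreal ((sqrt (2 ^ (r1 - r2) * pi))\<^sup>2)" by (simp add: ennreal_mult[symmetric] del: ennreal_power)
    finally have *: "energy lborel p = ennreal ((sqrt (2 ^ (r1 - r2) * pi))\<^sup>2)" .
    show "L2 lborel p" "l2_norm lborel p = sqrt (2 ^ (r1 - r2) * pi)"
      by (rule l2_normI[OF _ *]; simp)+
  qed
  have tw: "0 < trace_weight d j z" using trace_weight_ge_1[OF j, of d z] by simp
  have pw: "trace_weight d j z * cmod (of_real (\<eta> ^ j) * F (extend d z \<eta>)) \<le> cmod (p \<eta>) * cmod (slice d F z \<eta>)" for \<eta>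
  proof -
    have "(trace_weight d j z * \<bar>\<eta>\<bar> ^ j)\<^sup>2 \<le> (sqrt (2 ^ (r1 - r2) * (K / (K\<^sup>2 + \<eta>\<^sup>2))) * chg_weight (Suc d) (extend d z \<eta>))\<^sup>2"
    proof -
      have 0: "0 \<le> 2 ^ (r1 - r2) * (K / (K\<^sup>2 + \<eta>\<^sup>2))" using K by simp
      have "(\<bar>\<eta>\<bar> ^ j)\<^sup>2 = \<eta> ^ (2 * j)" by (simp add: power_mult[symmetric] mult.commute power_even_abs)
      then have "(trace_weight d j z * \<bar>\<eta>\<bar> ^ j)\<^sup>2 = \<eta> ^ (2 * j) * (trace_weight d j z)\<^sup>2"
        by (simp only: power_mult_distrib mult.commute)
      also have "\<dots> \<le> 2 ^ (r1 - r2) * (K / (K\<^sup>2 + \<eta>\<^sup>2)) * (chg_weight (Suc d) (extend d z \<eta>))\<^sup>2"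
        unfolding K_def by (rule trace_pointwise_bound[OF j])
      also have "\<dots> = (sqrt (2 ^ (r1 - r2) * (K / (K\<^sup>2 + \<eta>\<^sup>2))) * chg_weight (Suc d) (extend d z \<eta>))\<^sup>2"
        by (simp only: power_mult_distrib real_sqrt_pow2[OF 0])
      finally show ?thesis .
    qed
    then have "trace_weight d j z * \<bar>\<eta>\<bar> ^ j \<le> sqrt (2 ^ (r1 - r2) * (K / (K\<^sup>2 + \<eta>\<^sup>2))) * chg_weight (Suc d) (extend d z \<eta>)"
      using K chg_weight_ge_1[of "Suc d" "extend d z \<eta>"] by (intro power2_le_imp_le[OF _ mult_nonneg_nonneg]) auto
    then have "trace_weight d j z * \<bar>\<eta>\<bar> ^ j * cmod (F (extend d z \<eta>))
        \<le> sqrt (2 ^ (r1 - r2) * (K / (K\<^sup>2 + \<eta>\<^sup>2))) * chg_weight (Suc d) (extend d z \<eta>) * cmod (F (extend d z \<eta>))"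
      by (rule mult_right_mono) simp
    moreover have "cmod (p \<eta>) = sqrt (2 ^ (r1 - r2) * (K / (K\<^sup>2 + \<eta>\<^sup>2)))" using K by (simp add: p_def)
    moreover have "cmod (slice d F z \<eta>) = chg_weight (Suc d) (extend d z \<eta>) * cmod (F (extend d z \<eta>))"
      using chg_weight_ge_1[of "Suc d" "extend d z \<eta>"] by (simp add: slice_def norm_mult)
    ultimately show ?thesis by (simp add: norm_mult norm_power mult.assoc)
  qed
  have Fm: "(\<lambda>\<eta>. F (extend d z \<eta>)) \<in> borel_measurable lborel"
    using F z by (intro slice_inner_measurable) (auto simp: admissible_def)
  have ps: "integrable lborel (\<lambda>\<eta>. cmod (p \<eta>) * cmod (slice d F z \<eta>))"
    using integrable_norm[OF L2_mult_integrable[OF p2(1) s]] by (simp add: norm_mult)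
  have "integrable lborel (\<lambda>\<eta>. of_real (trace_weight d j z) * (of_real (\<eta> ^ j) * F (extend d z \<eta>)))"
  proof (rule Bochner_Integration.integrable_bound[OF ps])
    show "(\<lambda>\<eta>. of_real (trace_weight d j z) * (of_real (\<eta> ^ j) * F (extend d z \<eta>))) \<in> borel_measurable lborel"
      using Fm by measurable
    show "AE \<eta> in lborel. norm (of_real (trace_weight d j z) * (of_real (\<eta> ^ j) * F (extend d z \<eta>))) \<le> norm (cmod (p \<eta>) * cmod (slice d F z \<eta>))"
      using pw tw by (intro AE_I2) (simp add: norm_mult)
  qed
  from integrable_mult_right[OF this, of "of_real (1 / trace_weight d j z)"] tw
  show i: "integrable lborel (\<lambda>\<eta>. of_real (\<eta> ^ j) * F (extend d z \<eta>))" by simp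
  have "trace_weight d j z * cmod (\<integral>\<eta>. (\<i> * of_real \<eta>) ^ j * F (extend d z \<eta>) \<partial>lborel)
      \<le> trace_weight d j z * (\<integral>\<eta>. cmod ((\<i> * of_real \<eta>) ^ j * F (extend d z \<eta>)) \<partial>lborel)"
    using tw by (intro mult_left_mono integral_norm_bound) simp
  also have "\<dots> = (\<integral>\<eta>. trace_weight d j z * cmod (of_real (\<eta> ^ j) * F (extend d z \<eta>)) \<partial>lborel)"
    by (simp add: norm_mult norm_power power_abs)
  also have "\<dots> \<le> (\<integral>\<eta>. cmod (p \<eta>) * cmod (slice d F z \<eta>) \<partial>lborel)"
    by (intro integral_mono ps pw integrable_mult_right integrable_norm i)
  also have "\<dots> \<le> l2_norm lborel p * l2_norm lborel (slice d F z)" by (rule l2_cauchy_schwarz_abs[OF p2(1) s])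
  finally show "trace_weight d j z * cmod (\<integral>\<eta>. (\<i> * of_real \<eta>) ^ j * F (extend d z \<eta>) \<partial>lborel)
      \<le> sqrt (2 ^ (r1 - r2) * pi) * l2_norm lborel (slice d F z)" by (simp only: p2(2))
qed

lemma slice_AE:
  assumes "admissible d F"
  shows "AE z in Dm d. z \<in> space (Dm d) \<and> L2 lborel (slice d F z) \<and>
    (\<forall>j<r1. integrable lborel (\<lambda>\<eta>. of_real (\<eta> ^ j) * F (extend d z \<eta>)))"
  using slice_L2[OF assms] AE_space by eventually_elim (use slice_bound(1)[OF assms] in blast)

lemma trace_symbol_measurable:
  assumes F: "F \<in> borel_measurable (Dm (Suc d))"
  shows "trace_symbol d j F \<in> borel_measurable (Dm d)"
proof -
  have 1: "(\<lambda>(z, \<eta>). F (extend d z \<eta>)) \<in> borel_measurable (Dm d \<Otimes>\<^sub>M lborel)"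
    by (rule slice_compose_measurable[OF F])
  have "(\<lambda>p. (\<i> * of_real (snd p)) ^ j * (\<lambda>(z, \<eta>). F (extend d z \<eta>)) p) \<in> borel_measurable (Dm d \<Otimes>\<^sub>M lborel)"
    using 1 by measurable
  then have "(\<lambda>z. \<integral>\<eta>. (\<i> * of_real \<eta>) ^ j * F (extend d z \<eta>) \<partial>lborel) \<in> borel_measurable (Dm d)"
    by (intro lborel.borel_measurable_lebesgue_integral) (simp add: case_prod_beta')
  then show ?thesis unfolding trace_symbol_def[abs_def] by measurable
qed

lemma trace_symbol_L2:
  assumes F: "admissible d F" and j: "j < r1"
  shows "L2 (Dm d) (trace_weight d j \<odot> trace_symbol d j F)"
    "l2_norm (Dm d) (trace_weight d j \<odot> trace_symbol d j F)
      \<le> sqrt (2 ^ (r1 - r2) * pi) * l2_norm (Dm (Suc d)) (chg_weight (Suc d) \<odot> F)"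
proof -
  let ?c = "sqrt (2 ^ (r1 - r2) * pi)" and ?n = "l2_norm (Dm (Suc d)) (chg_weight (Suc d) \<odot> F)"
  let ?h = "\<lambda>z. of_real (trace_weight d j z) * trace_symbol d j F z"
  have m: "?h \<in> borel_measurable (Dm d)"
    using trace_symbol_measurable[of F d j] trace_weight_measurable[of d j] F
    by (intro borel_measurable_times borel_measurable_of_real) (auto simp: admissible_def)
  have "energy (Dm d) ?h
      \<le> (\<integral>\<^sup>+z. ennreal (?c\<^sup>2) * energy lborel (slice d F z) \<partial>Dm d)"
    using slice_AE[OF F]
  proof (intro nn_integral_mono_AE, eventually_elim)
    case (elim z)
    have tw: "0 < trace_weight d j z" using trace_weight_ge_1[OF j, of d z] by simp
    let ?I = "\<integral>\<eta>. (\<i> * of_real \<eta>) ^ j * F (extend d z \<eta>) \<partial>lborel"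
    have "cmod (?h z) = trace_weight d j z * (\<bar>1 / (2 * pi)\<bar> * cmod ?I)"
      unfolding trace_symbol_def norm_mult norm_of_real using tw by simp
    \<comment> \<open>The factor 1/(2 pi) is estimated by 1.\<close>
    also have "\<dots> \<le> trace_weight d j z * (1 * cmod ?I)"
      using tw pi_ge_two by (intro mult_left_mono mult_right_mono) (auto simp: abs_if)
    finally have "cmod (?h z) \<le> trace_weight d j z * cmod ?I" by (simp only: mult_1)
    also have "\<dots> \<le> ?c * l2_norm lborel (slice d F z)"
      using slice_bound(2)[OF F j] elim by simp
    finally have "(cmod (?h z))\<^sup>2 \<le> (?c * l2_norm lborel (slice d F z))\<^sup>2" by (rule power_mono) simp
    then have "ennreal ((cmod (?h z))\<^sup>2) \<le> ennreal (?c\<^sup>2) * ennreal ((l2_norm lborel (slice d F z))\<^sup>2)"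
      by (simp only: power_mult_distrib ennreal_mult[symmetric] zero_le_power2 ennreal_leI)
    then show ?case using nn_integral_l2 elim by metis
  qed
  also have "\<dots> = ennreal (?c\<^sup>2) * ennreal (?n\<^sup>2)"
  proof -
    have mm: "(\<lambda>p. ennreal ((cmod ((\<lambda>(z, \<eta>). slice d F z \<eta>) p))\<^sup>2)) \<in> borel_measurable (Dm d \<Otimes>\<^sub>M lborel)"
      using slice_measurable2[OF F] by measurable
    have "(\<lambda>z. \<integral>\<^sup>+\<eta>. ennreal ((cmod (slice d F z \<eta>))\<^sup>2) \<partial>lborel) \<in> borel_measurable (Dm d)"
      using lborel.borel_measurable_nn_integral_fst[OF mm] by simp
    then show ?thesis by (subst nn_integral_cmult) (simp_all only: slice_nn[OF F])
  qed
  also have "\<dots> = ennreal ((?c * ?n)\<^sup>2)" by (simp only: power_mult_distrib ennreal_mult[symmetric] zero_le_power2)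
  finally have *: "energy (Dm d) ?h \<le> ennreal ((?c * ?n)\<^sup>2)" .
  have c0: "0 \<le> ?c * ?n" by (intro mult_nonneg_nonneg) auto
  show "L2 (Dm d) ?h" "l2_norm (Dm d) ?h \<le> ?c * ?n"
    by (rule l2_norm_leI[OF m * c0])+
qed

lemma admissible_lincomb:
  assumes "admissible d F" "admissible d G"
  shows "admissible d (\<lambda>\<zeta>. F \<zeta> + a * G \<zeta>)"
proof -
  have "(\<lambda>\<zeta>. of_real (chg_weight (Suc d) \<zeta>) * (F \<zeta> + a * G \<zeta>))
      = (\<lambda>\<zeta>. of_real (chg_weight (Suc d) \<zeta>) * F \<zeta> + a * (of_real (chg_weight (Suc d) \<zeta>) * G \<zeta>))"
    by (simp add: fun_eq_iff algebra_simps)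
  then show ?thesis using assms unfolding admissible_def by auto
qed

lemma trace_symbol_lincomb:
  assumes F: "admissible d F" and G: "admissible d G" and j: "j < r1"
  shows "AE z in Dm d. trace_symbol d j (\<lambda>\<zeta>. F \<zeta> + a * G \<zeta>) z = trace_symbol d j F z + a * trace_symbol d j G z"
  using slice_AE[OF F] slice_AE[OF G]
proof eventually_elim
  case (elim z)
  have i: "integrable lborel (\<lambda>\<eta>. (\<i> * of_real \<eta>) ^ j * H (extend d z \<eta>))"
    if "integrable lborel (\<lambda>\<eta>. of_real (\<eta> ^ j) * H (extend d z \<eta>))" for H :: "point \<Rightarrow> complex"
    using integrable_mult_right[OF that, of "\<i> ^ j"] by (simp add: power_mult_distrib mult.assoc)
  have "integrable lborel (\<lambda>\<eta>. (\<i> * of_real \<eta>) ^ j * F (extend d z \<eta>))"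
    "integrable lborel (\<lambda>\<eta>. (\<i> * of_real \<eta>) ^ j * G (extend d z \<eta>))"
    using i elim j by auto
  then have "(\<integral>\<eta>. (\<i> * of_real \<eta>) ^ j * F (extend d z \<eta>) + a * ((\<i> * of_real \<eta>) ^ j * G (extend d z \<eta>)) \<partial>lborel)
      = (\<integral>\<eta>. (\<i> * of_real \<eta>) ^ j * F (extend d z \<eta>) \<partial>lborel) + a * (\<integral>\<eta>. (\<i> * of_real \<eta>) ^ j * G (extend d z \<eta>) \<partial>lborel)"
    by simp
  then show ?case unfolding trace_symbol_def by (simp add: distrib_left mult.left_commute)
qed

text \<open>By Fubini a null set of the dual group meets almost every slice in a null set, so
  moments do not see it.\<close>

lemma trace_symbol_cong:
  assumes "F \<in> borel_measurable (Dm (Suc d))" "G \<in> borel_measurable (Dm (Suc d))"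
    and "AE \<zeta> in Dm (Suc d). F \<zeta> = G \<zeta>"
  shows "AE z in Dm d. trace_symbol d j F z = trace_symbol d j G z"
  using AE_slice[OF assms(3)] AE_space
proof eventually_elim
  case (elim z)
  note [measurable] = slice_inner_measurable[OF assms(1) elim(2)] slice_inner_measurable[OF assms(2) elim(2)]
  have "(\<integral>\<eta>. (\<i> * of_real \<eta>) ^ j * F (extend d z \<eta>) \<partial>lborel) = (\<integral>\<eta>. (\<i> * of_real \<eta>) ^ j * G (extend d z \<eta>) \<partial>lborel)"
    by (rule integral_cong_AE) (measurable, use elim(1) in auto)
  then show ?case by (simp only: trace_symbol_def)
qed

text \<open>The normal variable leaves the time frequency alone: a slice over \<tau> = 0 lies
  entirely in \<tau> = 0.\<close>

lemma trace_symbol_osc: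
  assumes "AE \<zeta> in Dm (Suc d). fst \<zeta> = 0 \<longrightarrow> F \<zeta> = 0"
    and "F \<in> borel_measurable (Dm (Suc d))"
  shows "AE z in Dm d. fst z = 0 \<longrightarrow> trace_symbol d j F z = 0"
  using AE_slice[OF assms(1)] AE_space
proof eventually_elim
  case (elim z)
  show ?case
  proof
    assume 0: "fst z = 0"
    have "(\<integral>\<eta>. (\<i> * of_real \<eta>) ^ j * F (extend d z \<eta>) \<partial>lborel) = 0"
    proof (rule integral_eq_zero_AE)
      show "AE \<eta> in lborel. (\<i> * of_real \<eta>) ^ j * F (extend d z \<eta>) = 0"
        using elim(1) by eventually_elim (simp add: 0 extend_def)
    qed
    then show "trace_symbol d j F z = 0" by (simp add: trace_symbol_def)
  qed
qed

end

section \<open>The trace is determined by the restriction to the half space\<close>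

context periodic
begin

text \<open>Supplies test functions: a function on the boundary times a function of the last
  coordinate, which can be supported away from the boundary.\<close>

lemma product_transform:
  assumes g: "integrable (Gm d) g" "L2 (Gm d) g"
    and \<kappa>: "integrable lborel \<kappa>" "L2 lborel \<kappa>"
  defines "\<psi> \<equiv> \<lambda>w. g (fst w, restrict (snd w) {..<d}) * \<kappa> (snd w d)"
  shows "integrable (Gm (Suc d)) \<psi>" "L2 (Gm (Suc d)) \<psi>"
    "\<zeta> \<in> space (Dm d) \<Longrightarrow>
      kt (Suc d) \<psi> (extend d \<zeta> \<eta>)
      = kt d g \<zeta> * line_transform \<kappa> \<eta>"
proof -
  let ?P = "Gm d \<Otimes>\<^sub>M (lborel :: real measure)" and ?i = "\<lambda>(z, y). (fst z, (snd z)(d := y))"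
  interpret D: sigma_finite_measure "Gm d" by (rule sigma_finite_group_measure)
  interpret P: pair_sigma_finite "Gm d" lborel ..
  note gm [measurable] = L2D[OF g(2)] and cm [measurable] = L2D[OF \<kappa>(2)]
  have im: "?i \<in> ?P \<rightarrow>\<^sub>M Gm (Suc d)"
    unfolding group_measure_def by (rule extend_measurable)
  have restr: "(\<lambda>w. (fst w, restrict (snd w) {..<d})) \<in> Gm (Suc d) \<rightarrow>\<^sub>M Gm d"
  proof -
    have "(\<lambda>f. restrict f {..<d}) \<in> lebesgue_euclid (Suc d) \<rightarrow>\<^sub>M lebesgue_euclid d"
      by (rule measurable_restrict_subset) auto
    then show ?thesis
      unfolding group_measure_def by (intro measurable_Pair measurable_fst measurable_compose[OF measurable_snd])
  qed
  have \<psi>m: "\<psi> \<in> borel_measurable (Gm (Suc d))"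
    unfolding \<psi>_def
  proof (rule borel_measurable_times[OF measurable_compose[OF restr gm] measurable_compose[OF _ cm]])
    show "(\<lambda>w. snd w d) \<in> Gm (Suc d) \<rightarrow>\<^sub>M lborel"
      using group_measure_coord_measurable[of d "Suc d"] by simp
  qed
  have \<psi>i: "\<psi> (?i p) = g (fst p) * \<kappa> (snd p)" if "p \<in> space ?P" for p
  proof -
    have e: "snd (fst p) \<in> euclid d" using that by (auto simp: space_pair_measure space_group_measure)
    have "restrict ((snd (fst p))(d := snd p)) {..<d} = snd (fst p)"
    proof
      fix i show "restrict ((snd (fst p))(d := snd p)) {..<d} i = snd (fst p) i"
        using PiE_arb[OF e, of i] by (cases "i < d") simp_all
    qed
    then show ?thesis by (simp add: \<psi>_def case_prod_beta')
  qed
  have int: "integrable ?P (\<lambda>p. g (fst p) * \<kappa> (snd p))"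
  proof (rule P.Fubini_integrable)
    show "(\<lambda>p. g (fst p) * \<kappa> (snd p)) \<in> borel_measurable ?P" by measurable
    show "integrable (Gm d) (\<lambda>z. \<integral>y. norm (g (fst (z, y)) * \<kappa> (snd (z, y))) \<partial>lborel)"
      using g(1) by (simp add: norm_mult)
    show "AE z in Gm d. integrable lborel (\<lambda>y. g (fst (z, y)) * \<kappa> (snd (z, y)))"
      using \<kappa>(1) by (intro AE_I2) simp
  qed
  show "integrable (Gm (Suc d)) \<psi>"
  proof -
    have "integrable ?P (\<lambda>p. \<psi> (?i p)) \<longleftrightarrow> integrable ?P (\<lambda>p. g (fst p) * \<kappa> (snd p))"
      by (rule Bochner_Integration.integrable_cong[OF refl]) (rule \<psi>i)
    then show ?thesis using int integrable_distr_eq[OF im \<psi>m] unfolding distr_group_measure_Suc by blast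
  qed
  have int2: "integrable ?P (\<lambda>p. (cmod (g (fst p)))\<^sup>2 * (cmod (\<kappa> (snd p)))\<^sup>2)"
  proof (rule P.Fubini_integrable)
    show "(\<lambda>p. (cmod (g (fst p)))\<^sup>2 * (cmod (\<kappa> (snd p)))\<^sup>2) \<in> borel_measurable ?P" by measurable
    show "integrable (Gm d) (\<lambda>z. \<integral>y. norm ((cmod (g (fst (z, y))))\<^sup>2 * (cmod (\<kappa> (snd (z, y))))\<^sup>2) \<partial>lborel)"
      using L2_integrable[OF g(2)] by simp
    show "AE z in Gm d. integrable lborel (\<lambda>y. (cmod (g (fst (z, y))))\<^sup>2 * (cmod (\<kappa> (snd (z, y))))\<^sup>2)"
      using L2_integrable[OF \<kappa>(2)] by (intro AE_I2) simp
  qed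
  have \<psi>2: "(cmod (\<psi> (?i p)))\<^sup>2 = (cmod (g (fst p)))\<^sup>2 * (cmod (\<kappa> (snd p)))\<^sup>2" if "p \<in> space ?P" for p
    unfolding \<psi>i[OF that] norm_mult power_mult_distrib ..
  have "(\<lambda>w. (cmod (\<psi> w))\<^sup>2) \<in> borel_measurable (Gm (Suc d))" using \<psi>m by measurable
  note * = integrable_distr_eq[OF im this]
  have "integrable (Gm (Suc d)) (\<lambda>w. (cmod (\<psi> w))\<^sup>2)"
  proof -
    have "integrable ?P (\<lambda>p. (cmod (\<psi> (?i p)))\<^sup>2) \<longleftrightarrow> integrable ?P (\<lambda>p. (cmod (g (fst p)))\<^sup>2 * (cmod (\<kappa> (snd p)))\<^sup>2)"
      by (rule Bochner_Integration.integrable_cong[OF refl]) (rule \<psi>2)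
    with int2 * show ?thesis unfolding distr_group_measure_Suc by blast
  qed
  then show "L2 (Gm (Suc d)) \<psi>" using \<psi>m by (simp add: square_integrable_def)
  assume \<zeta>: "\<zeta> \<in> space (Dm d)"
  let ?e = "\<lambda>z. group_kernel (Suc d) z (extend d \<zeta> \<eta>)"
  have ie: "extend d \<zeta> \<eta> \<in> space (Dm (Suc d))"
    using \<zeta> measurable_space[OF slice_measurable, of "(\<zeta>, \<eta>)" d] by (simp add: space_pair_measure)
  have em: "(\<lambda>w. \<psi> w * ?e w) \<in> borel_measurable (Gm (Suc d))"
    using \<psi>m G.kernel_measurable1[OF ie] by (rule borel_measurable_times)
  have gz: "integrable (Gm d) (\<lambda>z. g z * group_kernel d z \<zeta>)"
    by (rule G.kernel_transform_integrable[OF g(1) \<zeta>])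
  have ce: "integrable lborel (\<lambda>y. \<kappa> y * line_kernel y \<eta>)"
    by (rule line.kernel_transform_integrable[OF \<kappa>(1)]) simp
  have "kt (Suc d) \<psi> (extend d \<zeta> \<eta>)
      = (\<integral>p. \<psi> (?i p) * ?e (?i p) \<partial>?P)"
    unfolding kernel_transform_def using integral_distr[OF im em] unfolding distr_group_measure_Suc .
  also have "\<dots> = (\<integral>p. (case p of (z, y) \<Rightarrow> g z * group_kernel d z \<zeta> * (\<kappa> y * line_kernel y \<eta>)) \<partial>?P)"
  proof (rule Bochner_Integration.integral_cong[OF refl])
    fix p assume p: "p \<in> space ?P"
    show "\<psi> (?i p) * ?e (?i p) = (case p of (z, y) \<Rightarrow> g z * group_kernel d z \<zeta> * (\<kappa> y * line_kernel y \<eta>))"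
      unfolding \<psi>i[OF p] unfolding case_prod_beta' extend_def group_kernel_Suc by (simp add: mult_ac)
  qed
  also have "\<dots> = (\<integral>z. (\<integral>y. g z * group_kernel d z \<zeta> * (\<kappa> y * line_kernel y \<eta>) \<partial>lborel) \<partial>Gm d)"
  proof (rule P.integral_fst[symmetric, OF P.Fubini_integrable])
    have "(\<lambda>p. \<psi> (?i p) * ?e (?i p)) \<in> borel_measurable ?P" by (rule measurable_compose[OF im em])
    moreover have "\<psi> (?i p) * ?e (?i p) = (case p of (z, y) \<Rightarrow> g z * group_kernel d z \<zeta> * (\<kappa> y * line_kernel y \<eta>))"
      if p: "p \<in> space ?P" for p
      unfolding \<psi>i[OF p] unfolding case_prod_beta' extend_def group_kernel_Suc by (simp add: mult_ac)
    ultimately show "(\<lambda>(z, y). g z * group_kernel d z \<zeta> * (\<kappa> y * line_kernel y \<eta>)) \<in> borel_measurable ?P"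
      using measurable_cong[of ?P "\<lambda>p. \<psi> (?i p) * ?e (?i p)"] by blast
    have "integrable (Gm d) (\<lambda>z. cmod (g z * group_kernel d z \<zeta>) * (\<integral>y. cmod (\<kappa> y * line_kernel y \<eta>) \<partial>lborel))"
      by (rule integrable_mult_left[OF integrable_norm[OF gz]])
    then show "integrable (Gm d) (\<lambda>z. \<integral>y. norm (case (z, y) of (z, y) \<Rightarrow> g z * group_kernel d z \<zeta> * (\<kappa> y * line_kernel y \<eta>)) \<partial>lborel)"
      by (simp add: norm_mult)
    show "AE z in Gm d. integrable lborel (\<lambda>y. case (z, y) of (z, y) \<Rightarrow> g z * group_kernel d z \<zeta> * (\<kappa> y * line_kernel y \<eta>))"
      using integrable_mult_right[OF ce] by (intro AE_I2) simp
  qed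
  also have "\<dots> = (\<integral>z. g z * group_kernel d z \<zeta> * line_transform \<kappa> \<eta> \<partial>Gm d)"
    unfolding kernel_transform_def by (simp only: integral_mult_right_zero)
  also have "\<dots> = kt d g \<zeta> * line_transform \<kappa> \<eta>"
    unfolding kernel_transform_def by (simp only: integral_mult_left_zero)
  finally show "kt (Suc d) \<psi> (extend d \<zeta> \<eta>)
      = kt d g \<zeta> * line_transform \<kappa> \<eta>" .
qed

text \<open>Tested against its own truncation, \<open>k\<close> returns the energy of the
  truncation. Truncations are integrable as well as square integrable, as
  \<open>product_transform\<close> requires.\<close>

lemma orthogonal_imp_zero:
  assumes k: "L2 (Gm d) k"
    and orth: "\<And>m. (\<integral>z. k z * cnj (truncate d (real m) k z) \<partial>Gm d) = 0"
  shows "AE z in Dm d. fourier T d k z = 0"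
proof -
  have "l2_norm (Gm d) (truncate d (real m) k) = 0" for m
  proof -
    have "k z * cnj (truncate d (real m) k z) = of_real ((cmod (truncate d (real m) k z))\<^sup>2)" for z
      unfolding truncate_def by (simp add: complex_norm_square del: of_real_power)
    then have "complex_of_real (\<integral>z. (cmod (truncate d (real m) k z))\<^sup>2 \<partial>Gm d) = 0"
      using orth[of m] by (simp only: integral_complex_of_real)
    then show ?thesis by (simp add: l2_norm_def)
  qed
  moreover have "(\<lambda>m. l2_norm (Gm d) (truncate d (real m) k)) \<longlonglongrightarrow> l2_norm (Gm d) k"
    by (rule l2_norm_tendsto[OF truncate_facts(2)[OF k] k truncate_facts(3)[OF k]])
  ultimately have "l2_norm (Gm d) k = 0" by (simp add: LIMSEQ_const_iff)
  then have "l2_norm (Dm d) (\<lambda>z. of_real T * fourier T d k z) = 0"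
    using G.l2_transform_norm[OF ft_fourier(2)[OF k]] by simp
  then have "AE z in Dm d. of_real T * fourier T d k z = 0"
    using l2_norm_eq_0_iff[OF L2_cmult[OF ft_fourier(1)[OF k]]] by simp
  then show ?thesis using T_pos by simp
qed

text \<open>As a function of the tangential frequency, the pairing with \<kappa> is the transform of
  some \<open>k\<close> in L2 of the boundary group. Parseval is applied to \<open>f\<close> and to
  \<open>g\<close> times the indicator of [a, b], whose product vanishes almost everywhere because a
  > 0; this makes \<open>k\<close> orthogonal to \<open>g\<close>. Taking for \<open>g\<close> the
  truncations of \<open>k\<close> gives k = 0.\<close>

lemma supported_below_orthogonal:
  fixes f :: "point \<Rightarrow> complex" and a b :: real
  assumes f: "L2 (Gm (Suc d)) f"
    and zero: "AE z in Gm (Suc d). 0 < snd z d \<longrightarrow> f z = 0" and a: "0 < a"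
  defines "\<kappa> \<equiv> line_transform (indicator {a..b})"
  shows "AE z in Dm d. (\<integral>\<eta>. fourier T (Suc d) f (extend d z \<eta>) * cnj (\<kappa> \<eta>) \<partial>lborel) = 0"
proof -
  let ?F = "fourier T (Suc d) f"
  define K where "K z = (\<integral>\<eta>. ?F (extend d z \<eta>) * cnj (\<kappa> \<eta>) \<partial>lborel)" for z
  have fin: "{a..b} \<in> sets lborel" "emeasure lborel {a..b} < \<infinity>" by (simp_all add: emeasure_lborel_Icc_eq)
  note ind = indicator_L1_L2(1,2)[OF fin]
  have \<kappa>2: "L2 lborel \<kappa>" unfolding \<kappa>_def by (rule line.kernel_transform_L2(1)[OF ind])
  then have \<kappa>2': "L2 lborel (\<lambda>\<eta>. cnj (\<kappa> \<eta>))" by simp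
  note F2 = ft_fourier(1)[OF f]
  note Fm = L2D[OF F2]
  note sl = slice_square_integrable[OF F2]
  have Km: "K \<in> borel_measurable (Dm d)"
  proof -
    have "(\<lambda>p. (\<lambda>(z, \<eta>). ?F (extend d z \<eta>)) p * cnj (\<kappa> (snd p))) \<in> borel_measurable (Dm d \<Otimes>\<^sub>M lborel)"
      using slice_compose_measurable[OF Fm] L2D[OF \<kappa>2] by measurable
    then show ?thesis unfolding K_def
      by (intro lborel.borel_measurable_lebesgue_integral) (simp add: case_prod_beta')
  qed
  have K2: "L2 (Dm d) K"
  proof (rule l2_norm_leI(1)[OF Km])
    have "energy (Dm d) K
        \<le> (\<integral>\<^sup>+z. ennreal ((l2_norm lborel \<kappa>)\<^sup>2) * energy lborel (\<lambda>\<eta>. ?F (extend d z \<eta>)) \<partial>Dm d)"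
      using sl(1)
    proof (intro nn_integral_mono_AE, eventually_elim)
      case (elim z)
      have "cmod (K z) \<le> l2_norm lborel (\<lambda>\<eta>. ?F (extend d z \<eta>)) * l2_norm lborel (\<lambda>\<eta>. cnj (\<kappa> \<eta>))"
        unfolding K_def by (rule l2_cauchy_schwarz[OF elim(2) \<kappa>2'])
      then have "(cmod (K z))\<^sup>2 \<le> (l2_norm lborel \<kappa> * l2_norm lborel (\<lambda>\<eta>. ?F (extend d z \<eta>)))\<^sup>2"
        by (intro power_mono) (simp_all add: mult.commute)
      then have "ennreal ((cmod (K z))\<^sup>2) \<le> ennreal ((l2_norm lborel \<kappa>)\<^sup>2) * ennreal ((l2_norm lborel (\<lambda>\<eta>. ?F (extend d z \<eta>)))\<^sup>2)"
        by (simp only: power_mult_distrib ennreal_mult[symmetric] zero_le_power2 ennreal_leI)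
      then show ?case by (simp only: nn_integral_l2[OF elim(2)])
    qed
    also have "\<dots> = ennreal ((l2_norm lborel \<kappa>)\<^sup>2) * ennreal ((l2_norm (Dm (Suc d)) ?F)\<^sup>2)"
    proof -
      have m: "(\<lambda>\<zeta>. ennreal ((cmod (?F \<zeta>))\<^sup>2)) \<in> borel_measurable (Dm (Suc d))"
        using Fm by measurable
      have "(\<lambda>z. \<integral>\<^sup>+\<eta>. ennreal ((cmod (?F (extend d z \<eta>)))\<^sup>2) \<partial>lborel) \<in> borel_measurable (Dm d)"
        using lborel.borel_measurable_nn_integral_fst[OF slice_compose_measurable[OF m]] by simp
      then show ?thesis by (subst nn_integral_cmult) (simp_all only: sl(2))
    qed
    also have "\<dots> = ennreal ((l2_norm lborel \<kappa> * l2_norm (Dm (Suc d)) ?F)\<^sup>2)"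
      by (simp only: power_mult_distrib ennreal_mult[symmetric] zero_le_power2)
    finally show "energy (Dm d) K \<le> ennreal ((l2_norm lborel \<kappa> * l2_norm (Dm (Suc d)) ?F)\<^sup>2)" .
  qed (intro mult_nonneg_nonneg l2_norm_nonneg)
  obtain k where "k \<in> group_L2 T d" and kK: "AE z in Dm d. fourier T d k z = K z"
    by (rule fourier_surj[OF K2])
  then have k: "L2 (Gm d) k" by (simp add: group_L2_def)
  have "AE z in Dm d. fourier T d k z = 0"
  proof (rule orthogonal_imp_zero[OF k])
    fix m
    define g where "g = truncate d (real m) k"
    note g = truncate_facts(1,2)[OF k, of "real m", folded g_def]
    define \<psi> where "\<psi> w = g (fst w, restrict (snd w) {..<d}) * indicator {a..b} (snd w d)" for w
    note pt = product_transform[OF g ind, folded \<psi>_def[abs_def] \<kappa>_def]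
    have "AE w in Gm (Suc d). f w * cnj (\<psi> w) = 0"
      using zero by eventually_elim (use a in \<open>auto simp: \<psi>_def indicator_def\<close>)
    then have "(\<integral>w. f w * cnj (\<psi> w) \<partial>Gm (Suc d)) = 0" by (rule integral_eq_zero_AE)
    then have 0: "(\<integral>\<zeta>. ?F \<zeta> * cnj (fourier T (Suc d) \<psi> \<zeta>) \<partial>Dm (Suc d)) = 0"
      using fourier_parseval[OF f pt(2)] by simp
    note f\<psi> = ft_fourier(1)[OF pt(2)]
    have int: "integrable (Dm (Suc d)) (\<lambda>\<zeta>. ?F \<zeta> * cnj (fourier T (Suc d) \<psi> \<zeta>))"
      by (rule L2_mult_integrable[OF F2]) (simp add: f\<psi>)
    have ae: "AE \<zeta> in Dm (Suc d). fourier T (Suc d) \<psi> \<zeta>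
        = of_real (1 / T) * kt (Suc d) \<psi> \<zeta>"
      using fourier_L1[OF pt(1,2)] unfolding fourier_integral_eq .
    have "(\<integral>z. K z * cnj (fourier T d g z) \<partial>Dm d)
        = (\<integral>z. (\<integral>\<eta>. ?F (extend d z \<eta>) * cnj (fourier T (Suc d) \<psi> (extend d z \<eta>)) \<partial>lborel) \<partial>Dm d)"
    proof (rule integral_cong_AE)
      show "(\<lambda>z. K z * cnj (fourier T d g z)) \<in> borel_measurable (Dm d)"
        using Km L2D[OF ft_fourier(1)[OF g(2)]] by measurable
      have "(\<lambda>(z, \<eta>). ?F (extend d z \<eta>) * cnj (fourier T (Suc d) \<psi> (extend d z \<eta>)))
          \<in> borel_measurable (Dm d \<Otimes>\<^sub>M lborel)"
        using slice_compose_measurable[OF borel_measurable_integrable[OF int]] .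
      then show "(\<lambda>z. (\<integral>\<eta>. ?F (extend d z \<eta>) * cnj (fourier T (Suc d) \<psi> (extend d z \<eta>)) \<partial>lborel))
          \<in> borel_measurable (Dm d)"
        by (rule lborel.borel_measurable_lebesgue_integral)
      show "AE z in Dm d. K z * cnj (fourier T d g z)
          = (\<integral>\<eta>. ?F (extend d z \<eta>) * cnj (fourier T (Suc d) \<psi> (extend d z \<eta>)) \<partial>lborel)"
        using AE_slice[OF ae] fourier_L1[OF g] AE_space
      proof eventually_elim
        case (elim z)
        have fg: "fourier T d g z = of_real (1 / T) * kt d g z"
          using elim(2) unfolding fourier_integral_eq .
        have "(\<integral>\<eta>. ?F (extend d z \<eta>) * cnj (fourier T (Suc d) \<psi> (extend d z \<eta>)) \<partial>lborel)
            = (\<integral>\<eta>. ?F (extend d z \<eta>) * cnj (\<kappa> \<eta>) * cnj (fourier T d g z) \<partial>lborel)"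
        proof (rule integral_cong_AE)
          have sm: "(\<lambda>\<eta>. ?F (extend d z \<eta>)) \<in> borel_measurable lborel" by (rule slice_inner_measurable[OF Fm elim(3)])
          then show "(\<lambda>\<eta>. ?F (extend d z \<eta>) * cnj (\<kappa> \<eta>) * cnj (fourier T d g z)) \<in> borel_measurable lborel"
            using L2D[OF \<kappa>2] by measurable
          show "(\<lambda>\<eta>. ?F (extend d z \<eta>) * cnj (fourier T (Suc d) \<psi> (extend d z \<eta>))) \<in> borel_measurable lborel"
            using slice_inner_measurable[OF borel_measurable_integrable[OF int] elim(3)] .
          show "AE \<eta> in lborel. ?F (extend d z \<eta>) * cnj (fourier T (Suc d) \<psi> (extend d z \<eta>))
              = ?F (extend d z \<eta>) * cnj (\<kappa> \<eta>) * cnj (fourier T d g z)"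
            using elim(1) by eventually_elim (simp only: pt(3)[OF elim(3)] fg complex_cnj_mult mult_ac)
        qed
        then show ?case unfolding K_def by (simp only: integral_mult_left_zero)
      qed
    qed
    also have "\<dots> = 0" using integral_slice[OF int] 0 by simp
    finally have 1: "(\<integral>z. K z * cnj (fourier T d g z) \<partial>Dm d) = 0" .
    have "(\<integral>z. fourier T d k z * cnj (fourier T d g z) \<partial>Dm d) = (\<integral>z. K z * cnj (fourier T d g z) \<partial>Dm d)"
    proof (rule integral_cong_AE)
      note [measurable] = Km L2D[OF ft_fourier(1)[OF g(2)]] L2D[OF ft_fourier(1)[OF k]]
      show "(\<lambda>z. fourier T d k z * cnj (fourier T d g z)) \<in> borel_measurable (Dm d)" by measurable
      show "(\<lambda>z. K z * cnj (fourier T d g z)) \<in> borel_measurable (Dm d)" by measurable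
      show "AE z in Dm d. fourier T d k z * cnj (fourier T d g z) = K z * cnj (fourier T d g z)"
        using kK by eventually_elim (simp only:)
    qed
    then have "of_real ((2 * pi) ^ d / T) * (\<integral>z. k z * cnj (g z) \<partial>Gm d) = 0"
      using fourier_parseval[OF k g(2)] unfolding 1 by (simp only:)
    then show "(\<integral>z. k z * cnj (truncate d (real m) k z) \<partial>Gm d) = 0"
      using T_pos unfolding g_def by simp
  qed
  with kK have "AE z in Dm d. K z = 0" by eventually_elim simp
  then show ?thesis unfolding K_def .
qed

end

context trace_setting
begin

lemma window_measurable: "window h \<in> borel_measurable borel"
proof -
  have "(\<lambda>\<eta>. cnj (line_transform (indicator {0..0 + h}) \<eta>)) \<in> borel_measurable lborel"
    by (intro borel_measurable_cnj line.kernel_transform_measurable) simp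
  then show ?thesis unfolding interval_transform by simp
qed

text \<open>Only countably many intervals, indexed by \<open>m\<close> and \<open>k\<close>, enter
  the difference quotients, so their exceptional null sets can be united before the moments are
  computed on a fixed slice.\<close>

lemma trace_symbol_zero:
  assumes f: "L2 (Gm (Suc d)) f"
    and zero: "AE z in Gm (Suc d). 0 < snd z d \<longrightarrow> f z = 0"
    and adm: "admissible d (fourier T (Suc d) f)" and j: "j < r1"
  shows "AE z in Dm d. trace_symbol d j (fourier T (Suc d) f) z = 0"
proof -
  let ?F = "fourier T (Suc d) f"
  let ?h = "\<lambda>m. 1 / real (Suc m)"
  have "AE z in Dm d. (\<integral>\<eta>. ?F (extend d z \<eta>)
      * (cis (\<eta> * (real (Suc k) * ?h m)) * window (?h m) \<eta>) \<partial>lborel) = 0" for m k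
    using supported_below_orthogonal[OF f zero, of "real (Suc k) * ?h m" "real (Suc k) * ?h m + ?h m"]
    unfolding interval_transform by simp
  then have "AE z in Dm d. \<forall>m k. (\<integral>\<eta>. ?F (extend d z \<eta>)
      * (cis (\<eta> * (real (Suc k) * ?h m)) * window (?h m) \<eta>) \<partial>lborel) = 0"
    unfolding AE_all_countable by blast
  with slice_AE[OF adm] show ?thesis
  proof eventually_elim
    case (elim z)
    have 0: "integrable lborel (\<lambda>\<eta>. ?F (extend d z \<eta>))"
    proof -
      have "0 < r1" using r21 by simp
      then have "integrable lborel (\<lambda>\<eta>. of_real (\<eta> ^ 0) * ?F (extend d z \<eta>))" using elim(1) by blast
      then show ?thesis by simp
    qed
    have "integrable lborel (\<lambda>\<eta>. of_real (\<eta> ^ j) * ?F (extend d z \<eta>))" using elim(1) j by blast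
    from moment_zero_of_windows[OF 0 this spec[OF spec[OF elim(2)]] window_measurable]
    show ?case by (simp add: trace_symbol_def)
  qed
qed

end

section \<open>The extension symbol\<close>

lemma scaled_moment:
  assumes f: "bounded_profile L f" and K: "0 < K"
  shows "integrable lborel (\<lambda>\<eta>. \<eta> ^ i * f (\<eta> / K))"
    "(\<integral>\<eta>. \<eta> ^ i * f (\<eta> / K) \<partial>lborel) = K ^ Suc i * moment f i"
proof -
  note fi = bounded_profile_moment_integrable[OF f, of i]
  have c: "1 / K \<noteq> 0" using K by simp
  have e: "(0 + 1 / K * \<eta>) ^ i * f (0 + 1 / K * \<eta>) = (1 / K) ^ i * (\<eta> ^ i * f (\<eta> / K))" for \<eta>
    by (simp add: power_divide)
  have "integrable lborel (\<lambda>\<eta>. (1 / K) ^ i * (\<eta> ^ i * f (\<eta> / K)))"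
    using lborel_integrable_real_affine[OF fi c, of 0] unfolding e .
  from integrable_mult_right[OF this, of "K ^ i"]
  show "integrable lborel (\<lambda>\<eta>. \<eta> ^ i * f (\<eta> / K))" using K by (simp add: power_divide)
  have "moment f i = \<bar>1 / K\<bar> *\<^sub>R (\<integral>\<eta>. (1 / K) ^ i * (\<eta> ^ i * f (\<eta> / K)) \<partial>lborel)"
    unfolding moment_def using lborel_integral_real_affine[OF c, of "\<lambda>x. x ^ i * f x" 0] unfolding e .
  also have "\<dots> = (1 / K) ^ Suc i * (\<integral>\<eta>. \<eta> ^ i * f (\<eta> / K) \<partial>lborel)"
    unfolding integral_mult_right_zero using K by simp
  finally show "(\<integral>\<eta>. \<eta> ^ i * f (\<eta> / K) \<partial>lborel) = K ^ Suc i * moment f i"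
    using K by (simp add: power_divide)
qed

context trace_setting
begin

definition profile :: "nat \<Rightarrow> real \<Rightarrow> real" where
  "profile = (SOME \<kappa>. \<forall>j<r1. bounded_profile (real r1) (\<kappa> j) \<and> (\<forall>i<r1. moment (\<kappa> j) i = (if i = j then 1 else 0)))"

lemma profile:
  "j < r1 \<Longrightarrow> bounded_profile (real r1) (profile j)"
  "j < r1 \<Longrightarrow> i < r1 \<Longrightarrow> moment (profile j) i = (if i = j then 1 else 0)"
  using someI_ex[OF dual_profiles[of r1], folded profile_def] by blast+

text \<open>The constant \<open>2 * pi / \<i> ^ j\<close> undoes those of
  \<open>trace_symbol\<close>, and \<open>K ^ Suc j\<close> is the factor by which a dilation to the
  width \<open>K\<close> multiplies the j-th moment.\<close>

definition extension_term :: "nat \<Rightarrow> nat \<Rightarrow> (point \<Rightarrow> complex) \<Rightarrow> point \<Rightarrow> complex" where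
  "extension_term d j G \<zeta> = (let z = (fst \<zeta>, restrict (snd \<zeta>) {..<d}); K = concentration d j z in
    of_real (2 * pi) / \<i> ^ j * G z * of_real (profile j (snd \<zeta> d / K) / K ^ Suc j))"

definition extension_symbol :: "nat \<Rightarrow> (nat \<Rightarrow> point \<Rightarrow> complex) \<Rightarrow> point \<Rightarrow> complex" where
  "extension_symbol d G \<zeta> = (\<Sum>j<r1. extension_term d j (G j) \<zeta>)"

lemma extension_symbol_lincomb:
  "extension_symbol d (\<lambda>j z. G j z + a * H j z) \<zeta> = extension_symbol d G \<zeta> + a * extension_symbol d H \<zeta>"
  unfolding extension_symbol_def sum_distrib_left sum.distrib[symmetric] extension_term_def Let_def
  by (intro sum.cong refl) (simp only: distrib_left distrib_right mult_ac)

lemma extension_term_measurable: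
  assumes G: "G \<in> borel_measurable (Dm d)" and j: "j < r1"
  shows "extension_term d j G \<in> borel_measurable (Dm (Suc d))"
proof -
  note p = slice_parts_measurable[of d]
  have [measurable]: "(\<lambda>\<zeta>. G (fst \<zeta>, restrict (snd \<zeta>) {..<d})) \<in> borel_measurable (Dm (Suc d))"
    by (rule measurable_compose[OF p(1) G])
  have [measurable]: "(\<lambda>\<zeta>. concentration d j (fst \<zeta>, restrict (snd \<zeta>) {..<d})) \<in> borel_measurable (Dm (Suc d))"
    by (rule measurable_compose[OF p(1) concentration_measurable])
  have [measurable]: "profile j \<in> borel_measurable borel" using profile(1)[OF j] by (simp add: bounded_profile_def)
  note [measurable] = p(2)
  show ?thesis unfolding extension_term_def Let_def by measurable
qed

lemma extension_term_slice:
  assumes "z \<in> space (Dm d)"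
  shows "extension_term d j G (extend d z \<eta>)
    = of_real (2 * pi) / \<i> ^ j * G z * of_real (profile j (\<eta> / concentration d j z) / concentration d j z ^ Suc j)"
  unfolding extension_term_def Let_def slice_parts(2,3)[OF assms] ..

definition profile_bound :: "nat \<Rightarrow> real" where
  "profile_bound j = (SOME B. \<forall>x. \<bar>profile j x\<bar> \<le> B * indicator {0..real r1} x)"

text \<open>Square root of three costs: (2 pi B)^2 for the size of the symbol, B being the bound of
  the profile; (1 + L^2)^r1 for the weight on the support; and L for the length of the support in
  units of the width. Here L = r1, as the profiles live on [0, r1].\<close>

definition extension_const :: "nat \<Rightarrow> real" where
  "extension_const j = sqrt ((2 * pi * profile_bound j)\<^sup>2 * (1 + (real r1)\<^sup>2) ^ r1 * real r1)"

lemma extension_const_nonneg: "0 \<le> extension_const j"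
  by (simp add: extension_const_def)

text \<open>On each slice the powers of the width cancel: the weighted energy density is at most a
  constant times D / K, where D is the squared weighted boundary symbol, on an interval of length K
  L. The resulting bound is free of K.\<close>

lemma extension_term_L2:
  assumes j: "j < r1" and G: "L2 (Dm d) (trace_weight d j \<odot> G)"
    and Gm: "G \<in> borel_measurable (Dm d)"
  shows "L2 (Dm (Suc d)) (chg_weight (Suc d) \<odot> extension_term d j G)"
    "l2_norm (Dm (Suc d)) (chg_weight (Suc d) \<odot> extension_term d j G)
      \<le> extension_const j * l2_norm (Dm d) (trace_weight d j \<odot> G)"
proof -
  define B where "B = profile_bound j"
  have "\<exists>B. \<forall>x. \<bar>profile j x\<bar> \<le> B * indicator {0..real r1} x"
    using profile(1)[OF j] unfolding bounded_profile_def by (rule conjunct2)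
  from someI_ex[OF this] have B: "\<bar>profile j x\<bar> \<le> B * indicator {0..real r1} x" for x
    unfolding B_def profile_bound_def by blast
  define L where "L = real r1"
  have L: "0 \<le> L" by (simp add: L_def)
  define A where "A = (2 * pi * B)\<^sup>2 * (1 + L\<^sup>2) ^ r1"
  have A: "0 \<le> A" by (simp add: A_def)
  have C: "extension_const j = sqrt (A * L)" by (simp add: extension_const_def A_def B_def L_def)
  let ?h = "\<lambda>\<zeta>. of_real (chg_weight (Suc d) \<zeta>) * extension_term d j G \<zeta>"
  let ?n = "l2_norm (Dm d) (trace_weight d j \<odot> G)"
  have m: "?h \<in> borel_measurable (Dm (Suc d))"
    using extension_term_measurable[OF Gm j] chg_weight_measurable[of "Suc d"] by measurable
  have "energy (Dm (Suc d)) ?h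
      = (\<integral>\<^sup>+z. energy lborel (\<lambda>\<eta>. ?h (extend d z \<eta>)) \<partial>Dm d)"
    by (rule nn_integral_slice) (use m in measurable)
  also have "\<dots> \<le> (\<integral>\<^sup>+z. ennreal (A * L) * ennreal ((cmod (of_real (trace_weight d j z) * G z))\<^sup>2) \<partial>Dm d)"
  proof (rule nn_integral_mono)
    fix z assume z: "z \<in> space (Dm d)"
    define K where "K = concentration d j z"
    have K: "0 < K" using concentration_ge_1[of d j z] by (simp add: K_def)
    define D where "D = (cmod (of_real (trace_weight d j z) * G z))\<^sup>2"
    have D: "0 \<le> D" "D = (trace_weight d j z)\<^sup>2 * (cmod (G z))\<^sup>2"
      by (simp_all add: D_def norm_mult power_mult_distrib)
    have pw: "(cmod (?h (extend d z \<eta>)))\<^sup>2 \<le> (A * D / K) * indicator {0..K * L} \<eta>" for \<eta>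
    proof (cases "\<eta> \<in> {0..K * L}")
      case False
      then have "\<eta> / K \<notin> {0..L}" using K by (auto simp: field_simps)
      then have "profile j (\<eta> / K) = 0" using B[of "\<eta> / K"] by (simp add: L_def)
      then show ?thesis using False by (simp add: extension_term_slice[OF z] K_def)
    next
      case True
      let ?w = "chg_weight (Suc d) (extend d z \<eta>)"
      have "\<eta> / K \<in> {0..L}" using True K by (auto simp: field_simps)
      then have "\<bar>profile j (\<eta> / K)\<bar> \<le> B" using B[of "\<eta> / K"] by (simp add: L_def)
      then have kb: "(profile j (\<eta> / K))\<^sup>2 \<le> B\<^sup>2" by (metis abs_ge_zero power2_abs power_mono)
      have "cmod (?h (extend d z \<eta>)) = \<bar>?w\<bar> * (2 * pi * cmod (G z) * (\<bar>profile j (\<eta> / K)\<bar> / K ^ Suc j))"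
        unfolding extension_term_slice[OF z] K_def[symmetric] norm_mult norm_of_real norm_divide norm_power
        using K by (simp add: abs_mult)
      then have "(cmod (?h (extend d z \<eta>)))\<^sup>2 = ?w\<^sup>2 * ((2 * pi)\<^sup>2 * (cmod (G z))\<^sup>2 * ((profile j (\<eta> / K))\<^sup>2 / (K ^ Suc j)\<^sup>2))"
        by (simp only: power_mult_distrib power_divide power2_abs)
      also have "\<dots> \<le> ((1 + L\<^sup>2) ^ r1 * K ^ (2 * j + 1) * (trace_weight d j z)\<^sup>2) * ((2 * pi)\<^sup>2 * (cmod (G z))\<^sup>2 * (B\<^sup>2 / (K ^ Suc j)\<^sup>2))"
      proof (rule mult_mono)
        show "?w\<^sup>2 \<le> (1 + L\<^sup>2) ^ r1 * K ^ (2 * j + 1) * (trace_weight d j z)\<^sup>2"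
          unfolding K_def by (rule extension_pointwise_bound[OF j]) (use True in \<open>auto simp: K_def\<close>)
        show "(2 * pi)\<^sup>2 * (cmod (G z))\<^sup>2 * ((profile j (\<eta> / K))\<^sup>2 / (K ^ Suc j)\<^sup>2) \<le> (2 * pi)\<^sup>2 * (cmod (G z))\<^sup>2 * (B\<^sup>2 / (K ^ Suc j)\<^sup>2)"
          by (intro mult_left_mono divide_right_mono kb) auto
        show "0 \<le> (1 + L\<^sup>2) ^ r1 * K ^ (2 * j + 1) * (trace_weight d j z)\<^sup>2" using K by simp
      qed auto
      also have "\<dots> = A * D * (K ^ (2 * j + 1) / (K ^ Suc j)\<^sup>2)"
        by (simp add: A_def D power_mult_distrib mult_ac)
      also have "K ^ (2 * j + 1) / (K ^ Suc j)\<^sup>2 = 1 / K"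
      proof -
        have "(K ^ Suc j)\<^sup>2 = K * K ^ (2 * j + 1)" by (simp add: power2_eq_square mult_2 power_add)
        then show ?thesis using K by simp
      qed
      finally show ?thesis using True by simp
    qed
    have "energy lborel (\<lambda>\<eta>. ?h (extend d z \<eta>)) \<le> (\<integral>\<^sup>+\<eta>. ennreal (A * D / K) * indicator {0..K * L} \<eta> \<partial>lborel)"
    proof (rule nn_integral_mono)
      fix \<eta>
      show "ennreal ((cmod (?h (extend d z \<eta>)))\<^sup>2) \<le> ennreal (A * D / K) * indicator {0..K * L} \<eta>"
        using ennreal_leI[OF pw[of \<eta>]] by (cases "\<eta> \<in> {0..K * L}") simp_all
    qed
    also have "\<dots> = ennreal (A * D / K) * ennreal (K * L)"
      using K L by (subst nn_integral_cmult_indicator) (simp_all add: emeasure_lborel_Icc_eq)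
    also have "\<dots> = ennreal (A * D / K * (K * L))" using A D K L by (intro ennreal_mult[symmetric]) auto
    also have "A * D / K * (K * L) = A * L * D" using K by simp
    also have "ennreal (A * L * D) = ennreal (A * L) * ennreal D" using A D L by (intro ennreal_mult) auto
    finally show "energy lborel (\<lambda>\<eta>. ?h (extend d z \<eta>)) \<le> ennreal (A * L) * ennreal ((cmod (of_real (trace_weight d j z) * G z))\<^sup>2)"
      unfolding D_def .
  qed
  also have "\<dots> = ennreal (A * L) * energy (Dm d) (\<lambda>z. of_real (trace_weight d j z) * G z)"
    by (intro nn_integral_cmult measurable_compose[OF L2D[OF G]]) measurable
  also have "\<dots> = ennreal ((sqrt (A * L) * ?n)\<^sup>2)"
    using A L by (simp add: nn_integral_l2[OF G] power_mult_distrib ennreal_mult del: ennreal_power)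
  finally have *: "energy (Dm (Suc d)) ?h \<le> ennreal ((sqrt (A * L) * ?n)\<^sup>2)" .
  have 0: "0 \<le> sqrt (A * L) * ?n" using A L by simp
  show "L2 (Dm (Suc d)) ?h" "l2_norm (Dm (Suc d)) ?h \<le> extension_const j * ?n"
    unfolding C by (rule l2_norm_leI[OF m * 0])+
qed

lemma extension_symbol_L2:
  assumes G: "\<And>j. j < r1 \<Longrightarrow> L2 (Dm d) (trace_weight d j \<odot> G j)"
    and Gm: "\<And>j. j < r1 \<Longrightarrow> G j \<in> borel_measurable (Dm d)"
  shows "admissible d (extension_symbol d G)"
    "l2_norm (Dm (Suc d)) (chg_weight (Suc d) \<odot> extension_symbol d G)
      \<le> (\<Sum>j<r1. extension_const j) * (\<Sum>j<r1. l2_norm (Dm d) (trace_weight d j \<odot> G j))"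
proof -
  let ?t = "\<lambda>j \<zeta>. of_real (chg_weight (Suc d) \<zeta>) * extension_term d j (G j) \<zeta>"
  let ?n = "\<lambda>j. l2_norm (Dm d) (trace_weight d j \<odot> G j)"
  have eq: "(chg_weight (Suc d) \<odot> extension_symbol d G) = (\<lambda>\<zeta>. \<Sum>j<r1. ?t j \<zeta>)"
    by (simp add: fun_eq_iff extension_symbol_def sum_distrib_left)
  have t: "L2 (Dm (Suc d)) (?t j)" "l2_norm (Dm (Suc d)) (?t j) \<le> extension_const j * ?n j"
    if j: "j < r1" for j
    using extension_term_L2[OF j G[OF j] Gm[OF j]] .
  have m: "extension_symbol d G \<in> borel_measurable (Dm (Suc d))"
    unfolding extension_symbol_def[abs_def]
  proof (rule borel_measurable_sum)
    fix j assume "j \<in> {..<r1}"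
    then show "extension_term d j (G j) \<in> borel_measurable (Dm (Suc d))"
      using Gm by (intro extension_term_measurable) (simp_all only: lessThan_iff)
  qed
  show "admissible d (extension_symbol d G)"
    unfolding admissible_def eq using m t(1) by (intro conjI L2_sum) (simp_all only: lessThan_iff)
  have "l2_norm (Dm (Suc d)) (\<lambda>\<zeta>. \<Sum>j<r1. ?t j \<zeta>) \<le> (\<Sum>j<r1. l2_norm (Dm (Suc d)) (?t j))"
    using t(1) by (intro l2_norm_sum) (simp_all only: lessThan_iff finite_lessThan)
  also have "\<dots> \<le> (\<Sum>j<r1. extension_const j * ?n j)" using t(2) by (intro sum_mono) (simp only: lessThan_iff)
  also have "\<dots> \<le> (\<Sum>j<r1. extension_const j * (\<Sum>i<r1. ?n i))"
  proof (intro sum_mono mult_left_mono)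
    fix j assume j: "j \<in> {..<r1}"
    show "?n j \<le> (\<Sum>i<r1. ?n i)" by (rule member_le_sum[OF j]) simp_all
    show "0 \<le> extension_const j" by (rule extension_const_nonneg)
  qed
  also have "\<dots> = (\<Sum>j<r1. extension_const j) * (\<Sum>i<r1. ?n i)" by (rule sum_distrib_right[symmetric])
  finally show "l2_norm (Dm (Suc d)) (chg_weight (Suc d) \<odot> extension_symbol d G)
      \<le> (\<Sum>j<r1. extension_const j) * (\<Sum>j<r1. ?n j)" unfolding eq .
qed

text \<open>The widths depend on the index of the term, yet duality survives: a dilation only
  multiplies moments, so the vanishing ones stay zero and the diagonal ones are normalised. The
  identity holds at every point of the dual group, which the almost-everywhere arguments can then
  use freely.\<close>

lemma trace_symbol_extension:
  assumes z: "z \<in> space (Dm d)" and i: "i < r1"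
  shows "trace_symbol d i (extension_symbol d G) z = G i z"
proof -
  define K where "K j = concentration d j z" for j
  have K: "0 < K j" for j using concentration_ge_1[of d j z] by (simp add: K_def)
  define c where "c j = \<i> ^ i * of_real (2 * pi) / \<i> ^ j * G j z / of_real (K j ^ Suc j)" for j
  have e: "(\<i> * of_real \<eta>) ^ i * extension_symbol d G (extend d z \<eta>)
      = (\<Sum>j<r1. c j * of_real (\<eta> ^ i * profile j (\<eta> / K j)))" for \<eta>
    unfolding extension_symbol_def extension_term_slice[OF z] K_def[symmetric] sum_distrib_left
    by (intro sum.cong refl) (simp add: c_def power_mult_distrib mult_ac)
  have m: "(\<integral>\<eta>. of_real (\<eta> ^ i * profile j (\<eta> / K j)) \<partial>lborel) = complex_of_real (if i = j then K j ^ Suc j else 0)"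
    if j: "j < r1" for j
    unfolding integral_complex_of_real scaled_moment(2)[OF profile(1)[OF j] K] profile(2)[OF j i] by simp
  have "(\<integral>\<eta>. (\<i> * of_real \<eta>) ^ i * extension_symbol d G (extend d z \<eta>) \<partial>lborel)
      = (\<Sum>j<r1. c j * (\<integral>\<eta>. of_real (\<eta> ^ i * profile j (\<eta> / K j)) \<partial>lborel))"
    unfolding e integral_mult_right_zero[symmetric]
  proof (rule Bochner_Integration.integral_sum)
    fix j assume "j \<in> {..<r1}"
    then have j: "j < r1" by simp
    show "integrable lborel (\<lambda>\<eta>. c j * of_real (\<eta> ^ i * profile j (\<eta> / K j)))"
      by (rule integrable_mult_right[OF integrable_of_real[OF scaled_moment(1)[OF profile(1)[OF j] K]]])
  qed
  also have "\<dots> = (\<Sum>j<r1. c j * complex_of_real (if i = j then K j ^ Suc j else 0))"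
    using m by (intro sum.cong) (simp_all only: lessThan_iff)
  also have "\<dots> = (\<Sum>j<r1. if i = j then c j * of_real (K j ^ Suc j) else 0)" by (intro sum.cong) auto
  also have "\<dots> = c i * of_real (K i ^ Suc i)" using i by (simp add: sum.delta)
  also have "\<dots> = of_real (2 * pi) * G i z" using K[of i] by (simp add: c_def)
  finally show ?thesis unfolding trace_symbol_def by simp
qed

lemma extension_symbol_osc:
  assumes "\<And>j z. fst z = 0 \<Longrightarrow> G j z = 0" "fst \<zeta> = 0"
  shows "extension_symbol d G \<zeta> = 0"
  unfolding extension_symbol_def extension_term_def Let_def using assms by simp

end

section \<open>Test functions\<close>

text \<open>Points are functions on all of \<open>nat\<close>; with the factor
  \<open>{undefined}\<close> at the indices outside, the cube is a full product of compact sets, and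
  Tychonoff's theorem applies.\<close>

lemma compact_cube: "compact (PiE {..<n::nat} (\<lambda>_. {a..b::real}))"
proof -
  have eq: "PiE {..<n} (\<lambda>_. {a..b}) = PiE UNIV (\<lambda>i. if i < n then {a..b} else {undefined})"
    by (force simp: PiE_def Pi_def extensional_def split: if_splits)
  have "compactin (product_topology (\<lambda>_. euclidean) UNIV) (PiE UNIV (\<lambda>i::nat. if i < n then {a..b} else {undefined::real}))"
    unfolding compactin_PiE by simp
  then show ?thesis by (simp add: eq euclidean_product_topology)
qed

lemma cis_affine_derivative:
  "((\<lambda>s. cis (- (k * s + c))) has_vector_derivative (- (\<i> * of_real k) * cis (- (k * s + c)))) (at s)"
proof -
  have "((\<lambda>w. exp (- \<i> * (of_real k * w + of_real c))) has_field_derivative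
      (- (\<i> * of_real k) * exp (- \<i> * (of_real k * of_real s + of_real c)))) (at (of_real s))"
    by (auto intro!: derivative_eq_intros)
  note d = has_vector_derivative_real_field[OF this]
  have e: "exp (- \<i> * (of_real k * of_real x + of_real c)) = cis (- (k * x + c))" for x
    by (simp add: cis_conv_exp algebra_simps)
  show ?thesis using d unfolding e .
qed

text \<open>Formulated through equality of the boundary values, so that it serves both periodicity
  in time and compact support in space.\<close>

lemma integral_by_parts_zero:
  fixes g g' :: "real \<Rightarrow> complex"
  assumes ab: "a \<le> b" and g: "\<And>s. (g has_vector_derivative g' s) (at s)" and g': "continuous_on UNIV g'"
    and bd: "g b * cis (- (k * b + c)) = g a * cis (- (k * a + c))"
  shows "(\<integral>s. indicator {a..b} s *\<^sub>R (g' s * cis (- (k * s + c)) + g s * (- (\<i> * of_real k) * cis (- (k * s + c)))) \<partial>lborel) = 0"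
proof -
  let ?H = "\<lambda>s. g s * cis (- (k * s + c))" and ?D = "\<lambda>s. g' s * cis (- (k * s + c)) + g s * (- (\<i> * of_real k) * cis (- (k * s + c)))"
  have "((\<lambda>s. g s * cis (- (k * s + c))) has_vector_derivative ?D s) (at s)" for s
    using has_vector_derivative_mult[OF g cis_affine_derivative[of k c]] by (subst add.commute)
  then have d: "(?H has_vector_derivative ?D s) (at s within {a..b})" for s by (rule has_vector_derivative_at_within)
  have gc: "continuous_on UNIV g" using g by (intro continuous_at_imp_continuous_on) (blast intro: has_vector_derivative_continuous)
  have "continuous_on {a..b} ?D"
    by (intro continuous_intros continuous_on_subset[OF g'] continuous_on_subset[OF gc]) auto
  from integral_FTC_Icc[OF ab d this] show ?thesis using bd by simp
qed

lemma L2_sum_bound: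
  assumes f: "\<And>i. i \<in> I \<Longrightarrow> L2 M (f i)" and g: "g \<in> borel_measurable M"
    and b: "\<And>z. z \<in> space M \<Longrightarrow> cmod (g z) \<le> (\<Sum>i\<in>I. cmod (f i z))"
  shows "L2 M g"
proof (rule L2_mono(1)[OF _ g])
  show "L2 M (\<lambda>z. \<Sum>i\<in>I. complex_of_real (cmod (f i z)))"
  proof (rule L2_sum)
    fix i assume "i \<in> I"
    note s = f[OF this]
    show "L2 M (\<lambda>z. complex_of_real (cmod (f i z)))"
      by (rule L2_mono(1)[OF s]) (use L2D[OF s] in auto)
  qed
  show "AE z in M. cmod (g z) \<le> cmod (\<Sum>i\<in>I. complex_of_real (cmod (f i z)))"
  proof (rule AE_I2)
    fix z assume "z \<in> space M"
    have "cmod (\<Sum>i\<in>I. complex_of_real (cmod (f i z))) = (\<Sum>i\<in>I. cmod (f i z))"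
      by (simp add: of_real_sum[symmetric] sum_nonneg del: of_real_sum)
    then show "cmod (g z) \<le> cmod (\<Sum>i\<in>I. complex_of_real (cmod (f i z)))" using b[OF \<open>z \<in> space M\<close>] by simp
  qed
qed

context periodic
begin

lemma update_euclid: "x \<in> euclid n \<Longrightarrow> i < n \<Longrightarrow> x(i := s) \<in> euclid n"
  by (auto simp: PiE_iff extensional_def)

lemma test_functionD:
  assumes "\<phi> \<in> test_functions T n" and x: "x \<in> euclid n"
  shows "\<phi> (t + T, x) = \<phi> (t, x)" "continuous_on (UNIV \<times> euclid n) \<phi>"
    "((\<lambda>s. \<phi> (s, x)) has_vector_derivative time_deriv \<phi> (t, x)) (at t)"
    "i < n \<Longrightarrow> ((\<lambda>s. \<phi> (t, x(i := s))) has_vector_derivative space_deriv i \<phi> (t, x(i := y))) (at y)"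
proof -
  have per: "time_periodic T n \<phi>" and k: "k_smooth n k \<phi>" for k using assms(1) by (auto simp: test_functions_def)
  show "\<phi> (t + T, x) = \<phi> (t, x)" using per x unfolding time_periodic_def by blast
  show "continuous_on (UNIV \<times> euclid n) \<phi>" using k[of 0] by simp
  have "(\<lambda>s. \<phi> (s, x)) differentiable (at t)" using k[of "Suc 0"] x by simp
  then show "((\<lambda>s. \<phi> (s, x)) has_vector_derivative time_deriv \<phi> (t, x)) (at t)"
    by (simp add: time_deriv_def vector_derivative_works)
  assume i: "i < n"
  have "(\<lambda>s. \<phi> (t, (x(i := y))(i := s))) differentiable (at ((x(i := y)) i))"
    using k[of "Suc 0"] update_euclid[OF x i, of y] i unfolding k_smooth.simps by blast
  then show "((\<lambda>s. \<phi> (t, x(i := s))) has_vector_derivative space_deriv i \<phi> (t, x(i := y))) (at y)"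
    by (simp add: space_deriv_def vector_derivative_works)
qed

lemma vector_derivative_const_near:
  assumes "open S" "y \<in> S" "\<And>s. s \<in> S \<Longrightarrow> f s = (0::complex)"
  shows "vector_derivative f (at y) = 0"
proof (rule vector_derivative_at)
  show "(f has_vector_derivative 0) (at y)"
    by (rule has_vector_derivative_transform_within_open[OF has_vector_derivative_const assms(1,2)]) (use assms(3) in simp)
qed

lemma test_functions_time_deriv:
  assumes \<phi>: "\<phi> \<in> test_functions T n"
  shows "time_deriv \<phi> \<in> test_functions T n"
proof -
  have k: "k_smooth n k (time_deriv \<phi>)" for k
  proof -
    have "k_smooth n (Suc k) \<phi>" using \<phi> unfolding test_functions_def by blast
    then show ?thesis by simp
  qed
  have per: "time_periodic T n (time_deriv \<phi>)"
    unfolding time_periodic_def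
  proof (intro allI ballI)
    fix t x assume x: "x \<in> euclid n"
    have e: "(\<lambda>s. \<phi> (s, x)) \<circ> (\<lambda>s. s + T) = (\<lambda>s. \<phi> (s, x))" using test_functionD(1)[OF \<phi> x] by (simp add: fun_eq_iff)
    have "((\<lambda>s. \<phi> (s, x)) has_vector_derivative time_deriv \<phi> (t + T, x)) (at (t + T))" by (rule test_functionD(3)[OF \<phi> x])
    moreover have "((\<lambda>s. s + T) has_vector_derivative 1) (at t)" by (auto intro!: derivative_eq_intros)
    ultimately have "((\<lambda>s. \<phi> (s, x)) \<circ> (\<lambda>s. s + T) has_vector_derivative 1 *\<^sub>R time_deriv \<phi> (t + T, x)) (at t)"
      by (intro vector_diff_chain_at)
    then have "((\<lambda>s. \<phi> (s, x)) has_vector_derivative time_deriv \<phi> (t + T, x)) (at t)" unfolding e by simp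
    from vector_derivative_unique_at[OF this test_functionD(3)[OF \<phi> x]]
    show "time_deriv \<phi> (t + T, x) = time_deriv \<phi> (t, x)" .
  qed
  obtain R where R: "\<And>t x. x \<in> euclid n \<Longrightarrow> \<exists>i<n. R < \<bar>x i\<bar> \<Longrightarrow> \<phi> (t, x) = 0"
    using \<phi> unfolding test_functions_def by blast
  have "time_deriv \<phi> (t, x) = 0" if "x \<in> euclid n" "\<exists>i<n. R < \<bar>x i\<bar>" for t x
    unfolding time_deriv_def prod.case by (rule vector_derivative_const_near[OF open_UNIV]) (simp_all add: R[OF that])
  then show ?thesis using k per unfolding test_functions_def by blast
qed

lemma test_functions_space_deriv:
  assumes \<phi>: "\<phi> \<in> test_functions T n" and i: "i < n"
  shows "space_deriv i \<phi> \<in> test_functions T n"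
proof -
  have k: "k_smooth n k (space_deriv i \<phi>)" for k
  proof -
    have "k_smooth n (Suc k) \<phi>" using \<phi> unfolding test_functions_def by blast
    then show ?thesis using i by simp
  qed
  have per: "time_periodic T n (space_deriv i \<phi>)"
    unfolding time_periodic_def
  proof (intro allI ballI)
    fix t x assume x: "x \<in> euclid n"
    show "space_deriv i \<phi> (t + T, x) = space_deriv i \<phi> (t, x)"
      unfolding space_deriv_def prod.case test_functionD(1)[OF \<phi> update_euclid[OF x i]] ..
  qed
  obtain R where R: "\<And>t x. x \<in> euclid n \<Longrightarrow> \<exists>i<n. R < \<bar>x i\<bar> \<Longrightarrow> \<phi> (t, x) = 0"
    using \<phi> unfolding test_functions_def by blast
  have "space_deriv i \<phi> (t, x) = 0" if x: "x \<in> euclid n" "j < n" "R < \<bar>x j\<bar>" for t x j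
    unfolding space_deriv_def prod.case
  proof (rule vector_derivative_const_near)
    \<comment> \<open>For \<open>j = i\<close> the variable of differentiation is itself the large
      coordinate and must stay in the open set |s| > R; otherwise the large coordinate is untouched
      and every \<open>s\<close> will do.\<close>
    show "open (if j = i then {s. R < \<bar>s\<bar>} else UNIV)" by (auto intro!: open_Collect_less continuous_intros)
    show "x i \<in> (if j = i then {s. R < \<bar>s\<bar>} else UNIV)" using x by (cases "j = i") auto
    fix s assume "s \<in> (if j = i then {s. R < \<bar>s\<bar>} else UNIV)"
    then have "R < \<bar>(x(i := s)) j\<bar>" using x by (auto split: if_splits)
    then show "\<phi> (t, x(i := s)) = 0" using R[OF update_euclid[OF x(1) i]] x(2) by blast
  qed
  then show ?thesis using k per unfolding test_functions_def by blast
qed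

text \<open>The topology is that of functions on all of \<open>nat\<close>. On the space of the
  measure the coordinates outside \<open>{..<n}\<close> are constant, so they are measurable as
  well.\<close>

lemma continuous_group_measurable:
  assumes "continuous_on (UNIV \<times> euclid n) (f :: point \<Rightarrow> complex)"
  shows "f \<in> borel_measurable (Gm n)"
proof -
  have c: "(\<lambda>z. snd z i) \<in> borel_measurable (Gm n)" for i
  proof (cases "i < n")
    case True then show ?thesis by (rule group_measure_coord_measurable)
  next
    case False
    have "(\<lambda>z. snd z i) \<in> borel_measurable (Gm n) \<longleftrightarrow> (\<lambda>_. undefined :: real) \<in> borel_measurable (Gm n)"
    proof (rule measurable_cong)
      fix z assume "z \<in> space (Gm n)"
      then have "snd z \<in> euclid n" by (auto simp: space_group_measure)
      then show "snd z i = undefined" using False by (auto dest: PiE_arb)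
    qed
    then show ?thesis by simp
  qed
  have "(\<lambda>z. (fst z, snd z)) \<in> borel_measurable (Gm n)"
    by (intro borel_measurable_Pair group_measure_fst_measurable measurable_coordinatewise_then_product c)
  then have "(\<lambda>z. (fst z, snd z)) \<in> Gm n \<rightarrow>\<^sub>M restrict_space borel (UNIV \<times> euclid n)"
    by (intro measurable_restrict_space2) (auto simp: space_group_measure)
  from measurable_compose[OF this borel_measurable_continuous_on_restrict[OF assms]] show ?thesis by simp
qed

lemma test_function_bounded:
  assumes \<phi>: "\<phi> \<in> test_functions T n"
  obtains B R where "0 \<le> B" "\<And>t x. x \<in> euclid n \<Longrightarrow> \<exists>i<n. R < \<bar>x i\<bar> \<Longrightarrow> \<phi> (t, x) = 0"
    "\<And>t x. 0 \<le> t \<Longrightarrow> t \<le> T \<Longrightarrow> x \<in> euclid n \<Longrightarrow> cmod (\<phi> (t, x)) \<le> B"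
proof -
  obtain R where R: "\<And>t x. x \<in> euclid n \<Longrightarrow> \<exists>i<n. R < \<bar>x i\<bar> \<Longrightarrow> \<phi> (t, x) = 0"
    using \<phi> unfolding test_functions_def by blast
  let ?K = "{0..T} \<times> PiE {..<n} (\<lambda>_. {-R..R})"
  have sub: "?K \<subseteq> UNIV \<times> euclid n" by (auto simp: PiE_iff)
  have "k_smooth n 0 \<phi>" using \<phi> unfolding test_functions_def by blast
  then have "continuous_on (UNIV \<times> euclid n) \<phi>" by simp
  then have "continuous_on ?K \<phi>" using sub by (rule continuous_on_subset)
  then have "compact (\<phi> ` ?K)" by (intro compact_continuous_image compact_Times compact_Icc compact_cube)
  then obtain B where B: "\<And>z. z \<in> ?K \<Longrightarrow> cmod (\<phi> z) \<le> B"
    using compact_imp_bounded[of "\<phi> ` ?K"] unfolding bounded_iff by blast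
  show thesis
  proof (rule that[of "max B 0" R])
    fix t x assume t: "0 \<le> t" "t \<le> T" and x: "x \<in> euclid n"
    show "cmod (\<phi> (t, x)) \<le> max B 0"
    proof (cases "\<exists>i<n. R < \<bar>x i\<bar>")
      case True then show ?thesis using R[OF x] by simp
    next
      case False
      then have "- R \<le> x i \<and> x i \<le> R" if "i < n" for i using that by (smt (verit))
      then have "(t, x) \<in> ?K" using t x by (simp add: PiE_iff)
      then show ?thesis using B by (meson max.coboundedI1)
    qed
  qed (use R in auto)
qed

lemma bounded_support_L12:
  assumes m: "f \<in> borel_measurable (Gm n)"
    and B: "\<And>t x. 0 \<le> t \<Longrightarrow> t \<le> T \<Longrightarrow> x \<in> euclid n \<Longrightarrow> cmod (f (t, x)) \<le> B"
    and R: "\<And>t x. x \<in> euclid n \<Longrightarrow> \<exists>i<n. R < \<bar>x i\<bar> \<Longrightarrow> f (t, x) = 0"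
  shows "integrable (Gm n) f" "L2 (Gm n) f"
proof -
  let ?A = "{0..<T} \<times> PiE {..<n} (\<lambda>_. {-R..R})"
  note ind = indicator_L1_L2[OF cube_finite[of n R]]
  have b: "cmod (f z) \<le> cmod (of_real B * indicator ?A z :: complex)" if z: "z \<in> space (Gm n)" for z
  proof -
    have z': "fst z \<in> {0..<T} \<and> snd z \<in> euclid n" using z unfolding space_group_measure mem_Times_iff .
    show ?thesis
    proof (cases "z \<in> ?A")
      case True
      have t: "0 \<le> fst z" "fst z \<le> T" using z' by simp_all
      have "cmod (f z) \<le> B" using B[OF t conjunct2[OF z']] unfolding prod.collapse .
      also have "B \<le> cmod (of_real B * indicator ?A z :: complex)"
        unfolding norm_mult norm_of_real indicator_eq_1_iff[THEN iffD2, OF True] by simp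
      finally show ?thesis .
    next
      case False
      have "\<not> (\<forall>i\<in>{..<n}. snd z i \<in> {-R..R})"
      proof
        assume "\<forall>i\<in>{..<n}. snd z i \<in> {-R..R}"
        then have "snd z \<in> PiE {..<n} (\<lambda>_. {-R..R})" using conjunct2[OF z'] unfolding PiE_iff by blast
        then show False using False conjunct1[OF z'] unfolding mem_Times_iff by blast
      qed
      then obtain i where i: "i < n" "\<not> (- R \<le> snd z i \<and> snd z i \<le> R)" unfolding atLeastAtMost_iff lessThan_iff by blast
      from i(2) have "R < \<bar>snd z i\<bar>" by linarith
      with i(1) have "i < n \<and> R < \<bar>snd z i\<bar>" by blast
      then have "f (fst z, snd z) = 0" using R[OF conjunct2[OF z']] by blast
      then have "f z = 0" unfolding prod.collapse .
      then show ?thesis by simp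
    qed
  qed
  show "integrable (Gm n) f"
    by (rule Bochner_Integration.integrable_bound[OF integrable_mult_right[OF ind(1), of "of_real B"] m AE_I2[OF b]])
  show "L2 (Gm n) f"
    by (rule L2_mono(1)[OF L2_cmult[OF ind(2), of "of_real B"] m AE_I2[OF b]])
qed

lemma test_function_L12:
  assumes \<phi>: "\<phi> \<in> test_functions T n"
  shows "integrable (Gm n) \<phi>" "L2 (Gm n) \<phi>"
proof -
  obtain B R where "0 \<le> B" and R: "\<And>t x. x \<in> euclid n \<Longrightarrow> \<exists>i<n. R < \<bar>x i\<bar> \<Longrightarrow> \<phi> (t, x) = 0"
    and B: "\<And>t x. 0 \<le> t \<Longrightarrow> t \<le> T \<Longrightarrow> x \<in> euclid n \<Longrightarrow> cmod (\<phi> (t, x)) \<le> B"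
    by (rule test_function_bounded[OF \<phi>]) (rule that)
  have "k_smooth n 0 \<phi>" using \<phi> unfolding test_functions_def by blast
  then have "\<phi> \<in> borel_measurable (Gm n)" by (intro continuous_group_measurable) simp
  from bounded_support_L12[OF this B R]
  show "integrable (Gm n) \<phi>" "L2 (Gm n) \<phi>" by blast+
qed

lemma test_function_continuous_line:
  assumes \<phi>: "\<phi> \<in> test_functions T n" and x: "x \<in> euclid n"
  shows "continuous_on UNIV (\<lambda>s. \<phi> (s, x))" "i < n \<Longrightarrow> continuous_on UNIV (\<lambda>s. \<phi> (t, x(i := s)))"
proof -
  note c = test_functionD(2)[OF \<phi> x]
  show "continuous_on UNIV (\<lambda>s. \<phi> (s, x))"
    by (intro continuous_on_compose2[OF c] continuous_on_Pair continuous_on_id continuous_on_const) (use x in auto)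
  assume i: "i < n"
  have "continuous_on UNIV (\<lambda>s. (x(i := s)) j)" for j by (cases "j = i") (auto intro: continuous_intros)
  then have "continuous_on UNIV (\<lambda>s. x(i := s))" by (rule continuous_on_coordinatewise_then_product)
  then show "continuous_on UNIV (\<lambda>s. \<phi> (t, x(i := s)))"
    by (rule continuous_on_compose2[OF c continuous_on_Pair[OF continuous_on_const]])
      (intro image_subsetI SigmaI UNIV_I update_euclid[OF x i])
qed

text \<open>In the applications the last integrand is the derivative of \<open>f\<close> times the
  character, so the assumption states that the boundary terms of an integration by parts
  vanish.\<close>

lemma kt_eqI:
  assumes f: "integrable (Gm n) f" and g: "integrable (Gm n) g" and \<zeta>: "\<zeta> \<in> space (Dm n)"
    and z: "(\<integral>w. g w * group_kernel n w \<zeta> + f w * (- (\<i> * of_real k) * group_kernel n w \<zeta>) \<partial>Gm n) = 0"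
  shows "kt n g \<zeta> = \<i> * of_real k * kt n f \<zeta>"
proof -
  note gi = G.kernel_transform_integrable[OF g \<zeta>] and fi = G.kernel_transform_integrable[OF f \<zeta>]
  have e: "f w * (- (\<i> * of_real k) * group_kernel n w \<zeta>) = - (\<i> * of_real k) * (f w * group_kernel n w \<zeta>)" for w
    by (simp add: mult_ac)
  have "(\<integral>w. g w * group_kernel n w \<zeta> + - (\<i> * of_real k) * (f w * group_kernel n w \<zeta>) \<partial>Gm n)
      = kt n g \<zeta> + - (\<i> * of_real k) * kt n f \<zeta>"
    unfolding kernel_transform_def integral_mult_right_zero[symmetric]
    by (rule Bochner_Integration.integral_add[OF gi integrable_mult_right[OF fi]])
  then show ?thesis using z unfolding e by simp
qed

lemma kt_time_deriv:
  assumes \<phi>: "\<phi> \<in> test_functions T n" and \<zeta>: "\<zeta> \<in> space (Dm n)"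
  shows "kt n (time_deriv \<phi>) \<zeta> = \<i> * of_real (fst \<zeta>) * kt n \<phi> \<zeta>"
proof (rule kt_eqI)
  note \<psi> = test_functions_time_deriv[OF \<phi>]
  show f: "integrable (Gm n) \<phi>" and g: "integrable (Gm n) (time_deriv \<phi>)"
    by (rule test_function_L12[OF \<phi>] test_function_L12[OF \<psi>])+
  show "\<zeta> \<in> space (Dm n)" by fact
  define D where "D w = time_deriv \<phi> w * group_kernel n w \<zeta> + \<phi> w * (- (\<i> * of_real (fst \<zeta>)) * group_kernel n w \<zeta>)" for w
  interpret A: sigma_finite_measure "circle T" by (rule sigma_finite_circle)
  interpret B: sigma_finite_measure "lebesgue_euclid n" by (rule sigma_finite_lebesgue_euclid)
  interpret P: pair_sigma_finite "circle T" "lebesgue_euclid n" ..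
  have Di: "integrable (circle T \<Otimes>\<^sub>M lebesgue_euclid n) (\<lambda>(t, x). D (t, x))"
  proof -
    have "D = (\<lambda>w. time_deriv \<phi> w * group_kernel n w \<zeta> + - (\<i> * of_real (fst \<zeta>)) * (\<phi> w * group_kernel n w \<zeta>))"
      by (simp add: D_def fun_eq_iff mult_ac)
    then have "integrable (Gm n) D"
      using G.kernel_transform_integrable[OF g \<zeta>] G.kernel_transform_integrable[OF f \<zeta>]
      by (simp only:) (intro Bochner_Integration.integrable_add integrable_mult_right)
    then show ?thesis by (simp add: group_measure_def)
  qed
  have inner: "(\<integral>t. D (t, x) \<partial>circle T) = 0" if "x \<in> space (lebesgue_euclid n)" for x
  proof -
    have x: "x \<in> euclid n" using that by (simp add: space_PiM)
    define c where "c = (\<Sum>i<n. snd \<zeta> i * x i)"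
    let ?\<tau> = "fst \<zeta>"
    have De: "D (t, x) = time_deriv \<phi> (t, x) * cis (- (?\<tau> * t + c)) + \<phi> (t, x) * (- (\<i> * of_real ?\<tau>) * cis (- (?\<tau> * t + c)))" for t
      by (simp add: D_def group_kernel_def c_def)
    have cm: "(\<lambda>t. D (t, x)) \<in> borel_measurable borel"
      unfolding De by (intro borel_measurable_continuous_onI continuous_intros test_function_continuous_line[OF \<phi> x] test_function_continuous_line[OF \<psi> x])
    have "(\<integral>t. D (t, x) \<partial>circle T) = (\<integral>t. indicator {0..<T} t *\<^sub>R D (t, x) \<partial>lborel)" by (rule integral_circle)
    also have "\<dots> = (\<integral>t. indicator {0..T} t *\<^sub>R D (t, x) \<partial>lborel)"
    proof (rule integral_cong_AE)
      show "AE t in lborel. indicator {0..<T} t *\<^sub>R D (t, x) = indicator {0..T} t *\<^sub>R D (t, x)"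
        using AE_lborel_singleton[of T] by eventually_elim (auto simp: indicator_def)
    qed (use cm in measurable)
    also have "\<dots> = 0"
      unfolding De
    proof (rule integral_by_parts_zero)
      show "0 \<le> T" using T_pos by simp
      show "((\<lambda>s. \<phi> (s, x)) has_vector_derivative time_deriv \<phi> (s, x)) (at s)" for s by (rule test_functionD(3)[OF \<phi> x])
      show "continuous_on UNIV (\<lambda>s. time_deriv \<phi> (s, x))" by (rule test_function_continuous_line(1)[OF \<psi> x])
      \<comment> \<open>At a frequency the exponential is T-periodic up to the constant phase, so
        the boundary values at 0 and T agree.\<close>
      have "?\<tau> \<in> frequencies T" using \<zeta> unfolding space_dual_measure mem_Times_iff by (rule conjunct1)
      then obtain m :: int where "?\<tau> = 2 * pi / T * of_int m" by blast
      then have "?\<tau> * T = 2 * pi * of_int m" using T_pos by simp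
      then have "cis (- (?\<tau> * T + c)) = cis (- c) * cis (- (2 * pi * of_int m))" by (simp add: cis_mult add.commute)
      also have "cis (- (2 * pi * of_int m)) = 1" using cis_multiple_2pi[of "- of_int m"] by simp
      finally show "\<phi> (T, x) * cis (- (?\<tau> * T + c)) = \<phi> (0, x) * cis (- (?\<tau> * 0 + c))"
        using test_functionD(1)[OF \<phi> x, of 0] by simp
    qed
    finally show ?thesis .
  qed
  have "(\<integral>w. D w \<partial>Gm n) = (\<integral>x. (\<integral>t. D (t, x) \<partial>circle T) \<partial>lebesgue_euclid n)"
    using P.integral_snd[OF Di] by (simp add: group_measure_def)
  also have "\<dots> = (\<integral>x. 0 \<partial>lebesgue_euclid n)" by (rule Bochner_Integration.integral_cong[OF refl]) (rule inner)
  finally show "(\<integral>w. time_deriv \<phi> w * group_kernel n w \<zeta> + \<phi> w * (- (\<i> * of_real (fst \<zeta>)) * group_kernel n w \<zeta>) \<partial>Gm n) = 0"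
    by (simp add: D_def)
qed

lemma kt_space_deriv:
  assumes \<phi>: "\<phi> \<in> test_functions T n" and i: "i < n" and \<zeta>: "\<zeta> \<in> space (Dm n)"
  shows "kt n (space_deriv i \<phi>) \<zeta> = \<i> * of_real (snd \<zeta> i) * kt n \<phi> \<zeta>"
proof (rule kt_eqI)
  note \<psi> = test_functions_space_deriv[OF \<phi> i]
  show f: "integrable (Gm n) \<phi>" and g: "integrable (Gm n) (space_deriv i \<phi>)"
    by (rule test_function_L12[OF \<phi>] test_function_L12[OF \<psi>])+
  show "\<zeta> \<in> space (Dm n)" by fact
  define D where "D w = space_deriv i \<phi> w * group_kernel n w \<zeta> + \<phi> w * (- (\<i> * of_real (snd \<zeta> i)) * group_kernel n w \<zeta>)" for w
  interpret A: sigma_finite_measure "circle T" by (rule sigma_finite_circle)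
  interpret B: sigma_finite_measure "lebesgue_euclid n" by (rule sigma_finite_lebesgue_euclid)
  interpret P: pair_sigma_finite "circle T" "lebesgue_euclid n" ..
  interpret L: product_sigma_finite "\<lambda>_::nat. lborel :: real measure" ..
  have Di: "integrable (circle T \<Otimes>\<^sub>M lebesgue_euclid n) (\<lambda>(t, x). D (t, x))"
  proof -
    have "D = (\<lambda>w. space_deriv i \<phi> w * group_kernel n w \<zeta> + - (\<i> * of_real (snd \<zeta> i)) * (\<phi> w * group_kernel n w \<zeta>))"
      by (simp add: D_def fun_eq_iff mult_ac)
    then have "integrable (Gm n) D"
      using G.kernel_transform_integrable[OF g \<zeta>] G.kernel_transform_integrable[OF f \<zeta>]
      by (simp only:) (intro Bochner_Integration.integrable_add integrable_mult_right)
    then show ?thesis by (simp add: group_measure_def)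
  qed
  obtain R where R0: "\<And>t x. x \<in> euclid n \<Longrightarrow> \<exists>i<n. R < \<bar>x i\<bar> \<Longrightarrow> \<phi> (t, x) = 0"
    using \<phi> unfolding test_functions_def by blast
  obtain R' where R1: "\<And>t x. x \<in> euclid n \<Longrightarrow> \<exists>i<n. R' < \<bar>x i\<bar> \<Longrightarrow> space_deriv i \<phi> (t, x) = 0"
    using \<psi> unfolding test_functions_def by blast
  \<comment> \<open>Strictly larger than both support radii, so that \<phi> and its derivative
    vanish at -L, at L and beyond.\<close>
  define L where "L = max 0 (max R R') + 1"
  have L: "0 < L" "R < L" "R' < L" by (auto simp: L_def)
  let ?I = "{..<n} - {i}"
  have ins: "{..<n} = insert i ?I" using i by auto
  have inner: "(\<integral>y. D (t, x(i := y)) \<partial>lborel) = 0" if "x \<in> space (PiM ?I (\<lambda>_. lborel :: real measure))" for t x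
  proof -
    have x: "x(i := y) \<in> euclid n" for y using that i by (auto simp: space_PiM PiE_iff extensional_def)
    have xx: "(x(i := 0))(i := y) = x(i := y)" for y by simp
    define c where "c = fst \<zeta> * t + (\<Sum>k\<in>?I. snd \<zeta> k * x k)"
    let ?\<xi> = "snd \<zeta> i"
    have k: "group_kernel n (t, x(i := y)) \<zeta> = cis (- (?\<xi> * y + c))" for y
    proof -
      have "(\<Sum>k<n. snd \<zeta> k * (x(i := y)) k) = snd \<zeta> i * (x(i := y)) i + (\<Sum>k\<in>?I. snd \<zeta> k * (x(i := y)) k)"
        using i by (intro sum.remove) auto
      also have "(\<Sum>k\<in>?I. snd \<zeta> k * (x(i := y)) k) = (\<Sum>k\<in>?I. snd \<zeta> k * x k)" by (rule sum.cong) auto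
      finally show ?thesis by (simp add: group_kernel_def c_def algebra_simps)
    qed
    have De: "D (t, x(i := y)) = space_deriv i \<phi> (t, x(i := y)) * cis (- (?\<xi> * y + c)) + \<phi> (t, x(i := y)) * (- (\<i> * of_real ?\<xi>) * cis (- (?\<xi> * y + c)))" for y
      unfolding D_def k ..
    have z: "\<phi> (t, x(i := y)) = 0" "space_deriv i \<phi> (t, x(i := y)) = 0" if "L \<le> \<bar>y\<bar>" for y
    proof -
      have "\<exists>j<n. R < \<bar>(x(i := y)) j\<bar>" "\<exists>j<n. R' < \<bar>(x(i := y)) j\<bar>"
        using that L i by (intro exI[of _ i]; simp)+
      then show "\<phi> (t, x(i := y)) = 0" "space_deriv i \<phi> (t, x(i := y)) = 0" using R0[OF x] R1[OF x] by blast+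
    qed
    have "(\<integral>y. D (t, x(i := y)) \<partial>lborel) = (\<integral>y. indicator {-L..L} y *\<^sub>R D (t, x(i := y)) \<partial>lborel)"
    proof (rule Bochner_Integration.integral_cong[OF refl])
      fix y show "D (t, x(i := y)) = indicator {-L..L} y *\<^sub>R D (t, x(i := y))"
      proof (cases "y \<in> {-L..L}")
        case False
        then have "L \<le> \<bar>y\<bar>" by auto
        then show ?thesis unfolding De using z by simp
      qed simp
    qed
    also have "\<dots> = 0"
      unfolding De
    proof (rule integral_by_parts_zero)
      show "- L \<le> L" using L by simp
      show "((\<lambda>s. \<phi> (t, x(i := s))) has_vector_derivative space_deriv i \<phi> (t, x(i := s))) (at s)" for s
        using test_functionD(4)[OF \<phi> x[of 0] i, of t s] unfolding xx .
      show "continuous_on UNIV (\<lambda>s. space_deriv i \<phi> (t, x(i := s)))"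
        using test_function_continuous_line(2)[OF \<psi> x[of 0] i, of t] unfolding xx .
      show "\<phi> (t, x(i := L)) * cis (- (?\<xi> * L + c)) = \<phi> (t, x(i := - L)) * cis (- (?\<xi> * - L + c))"
        using z(1)[of L] z(1)[of "- L"] by simp
    qed
    finally show ?thesis .
  qed
  have "(\<integral>w. D w \<partial>Gm n) = (\<integral>t. (\<integral>x. D (t, x) \<partial>lebesgue_euclid n) \<partial>circle T)"
    using P.integral_fst[OF Di] by (simp add: group_measure_def)
  also have "\<dots> = 0"
  proof (rule integral_eq_zero_AE)
    \<comment> \<open>Integrating one coordinate first requires an integrable section, which is
      available for almost every \<open>t\<close>.\<close>
    show "AE t in circle T. (\<integral>x. D (t, x) \<partial>lebesgue_euclid n) = 0"
      using P.AE_integrable_fst[OF Di]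
    proof eventually_elim
      case (elim t)
      then have "(\<integral>x. D (t, x) \<partial>lebesgue_euclid n) = (\<integral>x. (\<integral>y. D (t, x(i := y)) \<partial>lborel) \<partial>PiM ?I (\<lambda>_. lborel))"
        using L.product_integral_insert[of ?I i "\<lambda>x. D (t, x)"] unfolding ins[symmetric] by simp
      also have "\<dots> = (\<integral>x. 0 \<partial>PiM ?I (\<lambda>_. lborel :: real measure))" by (rule Bochner_Integration.integral_cong[OF refl]) (rule inner)
      finally show ?case by simp
    qed
  qed
  finally show "(\<integral>w. space_deriv i \<phi> w * group_kernel n w \<zeta> + \<phi> w * (- (\<i> * of_real (snd \<zeta> i)) * group_kernel n w \<zeta>) \<partial>Gm n) = 0"
    by (simp add: D_def)
qed

text \<open>Each factor of the weight is traded for a derivative: \<open>jap_time\<close> is at most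
  1 + |\<tau>|, \<open>jap_space\<close> at most 1 plus the sum of the |\<xi> i|, and multiplication
  by a frequency is differentiation up to the factor \<i>. Derivatives of test functions are test
  functions, so the inductions generalise over \<phi>.\<close>

lemma test_function_decay:
  assumes \<phi>: "\<phi> \<in> test_functions T n"
  shows "L2 (Dm n) (\<lambda>\<zeta>. of_real (jap_time (fst \<zeta>) ^ a * jap_space n (snd \<zeta>) ^ b) * kt n \<phi> \<zeta>)"
  using \<phi>
proof (induction b arbitrary: \<phi> a)
  case 0
  then show ?case
  proof (induction a arbitrary: \<phi>)
    case 0
    then show ?case using G.kernel_transform_L2(1)[OF test_function_L12[OF 0]] by simp
  next
    case (Suc a)
    note [measurable] = jap_time_measurable L2D[OF G.kernel_transform_L2(1)[OF test_function_L12[OF Suc.prems]]]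
    \<comment> \<open>Index 0 stands for \<phi>, index 1 for its time derivative.\<close>
    let ?f = "\<lambda>i::nat. \<lambda>\<zeta>. of_real (jap_time (fst \<zeta>) ^ a * jap_space n (snd \<zeta>) ^ 0) * kt n (if i = 0 then \<phi> else time_deriv \<phi>) \<zeta>"
    show ?case
    proof (rule L2_sum_bound[where I="{..<2}" and f="?f"])
      show "L2 (Dm n) (?f i)" for i
        using Suc.IH[OF Suc.prems] Suc.IH[OF test_functions_time_deriv[OF Suc.prems]] by (cases "i = 0") simp_all
      show "(\<lambda>\<zeta>. of_real (jap_time (fst \<zeta>) ^ Suc a * jap_space n (snd \<zeta>) ^ 0) * kt n \<phi> \<zeta>) \<in> borel_measurable (Dm n)"
        unfolding power_0 mult_1_right by measurable
      fix \<zeta> assume \<zeta>: "\<zeta> \<in> space (Dm n)"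
      let ?j = "jap_time (fst \<zeta>)" and ?F = "cmod (kt n \<phi> \<zeta>)"
      have j: "0 \<le> ?j" using jap_ge_1(1)[of "fst \<zeta>"] by simp
      have "?j \<le> 1 + \<bar>fst \<zeta>\<bar>"
        unfolding jap_time_def using sqrt_add_le_add_sqrt[of 1 "(fst \<zeta>)\<^sup>2"] by simp
      then have "?j * (?j ^ a * ?F) \<le> (1 + \<bar>fst \<zeta>\<bar>) * (?j ^ a * ?F)" using j by (intro mult_right_mono) auto
      also have "\<dots> = (\<Sum>i<2. cmod (?f i \<zeta>))"
        using j by (simp add: kt_time_deriv[OF Suc.prems \<zeta>] norm_mult norm_power lessThan_Suc numeral_2_eq_2 algebra_simps)
      finally show "cmod (of_real (?j ^ Suc a * jap_space n (snd \<zeta>) ^ 0) * kt n \<phi> \<zeta>) \<le> (\<Sum>i<2. cmod (?f i \<zeta>))"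
        using j by (simp add: norm_mult norm_power mult.assoc)
    qed
  qed
next
  case (Suc b)
  note [measurable] = jap_time_measurable jap_space_measurable[OF order_refl, of n] L2D[OF G.kernel_transform_L2(1)[OF test_function_L12[OF Suc.prems]]]
  \<comment> \<open>The indices below \<open>n\<close> stand for the space derivatives, the index
    \<open>n\<close> for \<phi> itself.\<close>
  let ?f = "\<lambda>i::nat. \<lambda>\<zeta>. of_real (jap_time (fst \<zeta>) ^ a * jap_space n (snd \<zeta>) ^ b) * kt n (if i < n then space_deriv i \<phi> else \<phi>) \<zeta>"
  show ?case
  proof (rule L2_sum_bound[where I="{..<Suc n}" and f="?f"])
    show "L2 (Dm n) (?f i)" for i
      using Suc.IH[OF Suc.prems, of a] Suc.IH[OF test_functions_space_deriv[OF Suc.prems], of i a] by (cases "i < n") simp_all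
    show "(\<lambda>\<zeta>. of_real (jap_time (fst \<zeta>) ^ a * jap_space n (snd \<zeta>) ^ Suc b) * kt n \<phi> \<zeta>) \<in> borel_measurable (Dm n)"
      by measurable
    fix \<zeta> assume \<zeta>: "\<zeta> \<in> space (Dm n)"
    let ?j = "jap_space n (snd \<zeta>)" and ?W = "cmod (of_real (jap_time (fst \<zeta>) ^ a * jap_space n (snd \<zeta>) ^ b))" and ?F = "cmod (kt n \<phi> \<zeta>)"
    have j: "0 \<le> ?j" using jap_ge_1(2)[of n "snd \<zeta>"] by simp
    have "?j \<le> 1 + (\<Sum>i<n. \<bar>snd \<zeta> i\<bar>)"
      unfolding jap_space_def using sqrt_add_le_add_sqrt[of 1 "\<Sum>i<n. (snd \<zeta> i)\<^sup>2"] L2_set_le_sum_abs[of "snd \<zeta>" "{..<n}"]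
      by (simp add: L2_set_def sum_nonneg)
    then have "?j * (?W * ?F) \<le> (1 + (\<Sum>i<n. \<bar>snd \<zeta> i\<bar>)) * (?W * ?F)" by (intro mult_right_mono) auto
    also have "\<dots> = (\<Sum>i<n. \<bar>snd \<zeta> i\<bar> * (?W * ?F)) + ?W * ?F"
      by (simp add: distrib_right sum_distrib_right)
    also have "\<dots> = (\<Sum>i<Suc n. cmod (?f i \<zeta>))"
    proof -
      have "\<bar>snd \<zeta> i\<bar> * (?W * ?F) = cmod (?f i \<zeta>)" if "i < n" for i
        using that unfolding kt_space_deriv[OF Suc.prems that \<zeta>] norm_mult by (simp add: kt_space_deriv[OF Suc.prems that \<zeta>] norm_mult)
      then have "(\<Sum>i<n. \<bar>snd \<zeta> i\<bar> * (?W * ?F)) = (\<Sum>i<n. cmod (?f i \<zeta>))"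
        by (intro sum.cong refl) (simp only: lessThan_iff)
      moreover have "?W * ?F = cmod (?f n \<zeta>)" unfolding norm_mult by simp
      ultimately show ?thesis by (simp only: sum.lessThan_Suc)
    qed
    finally show "cmod (of_real (jap_time (fst \<zeta>) ^ a * ?j ^ Suc b) * kt n \<phi> \<zeta>) \<le> (\<Sum>i<Suc n. cmod (?f i \<zeta>))"
      using j by (simp add: norm_mult norm_power mult_ac)
  qed
qed

end

section \<open>Weighted decay and traces of smooth functions\<close>

context trace_setting
begin

text \<open>Reduces the weight to the natural powers covered by \<open>test_function_decay\<close>:
  a maximum of two numbers \<ge> 1 is at most their product, and the real exponent \<open>s2\<close>
  is rounded up.\<close>

lemma chg_weight_le: "chg_weight n z \<le> jap_time (fst z) ^ nat \<lceil>s2\<rceil> * jap_space n (snd z) ^ r1"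
proof -
  let ?J = "jap_space n (snd z)" and ?t = "time_scale (fst z)"
  have J: "1 \<le> ?J" "1 \<le> ?t" "1 \<le> jap_time (fst z)" using jap_ge_1 time_scale_ge_1 by auto
  have "max ?t ?J \<le> ?t * ?J"
    using J mult_mono[of 1 ?t ?J ?J] mult_mono[of ?t ?t 1 ?J] by simp
  then have "max ?t ?J ^ (r1 - r2) \<le> (?t * ?J) ^ (r1 - r2)" using J by (intro power_mono) auto
  also have "\<dots> = jap_time (fst z) powr s2 * ?J ^ (r1 - r2)" by (simp only: power_mult_distrib time_scale_power)
  also have "\<dots> \<le> jap_time (fst z) ^ nat \<lceil>s2\<rceil> * ?J ^ (r1 - r2)"
  proof (rule mult_right_mono)
    have "jap_time (fst z) powr s2 \<le> jap_time (fst z) powr real (nat \<lceil>s2\<rceil>)"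
      using J s2 by (intro powr_mono) (auto simp: of_nat_ceiling)
    also have "\<dots> = jap_time (fst z) ^ nat \<lceil>s2\<rceil>" using J by (simp add: powr_realpow)
    finally show "jap_time (fst z) powr s2 \<le> jap_time (fst z) ^ nat \<lceil>s2\<rceil>" .
  qed (use J in simp)
  finally have "chg_weight n z \<le> ?J ^ r2 * (jap_time (fst z) ^ nat \<lceil>s2\<rceil> * ?J ^ (r1 - r2))"
    unfolding chg_weight_def using J by (intro mult_left_mono) auto
  also have "\<dots> = jap_time (fst z) ^ nat \<lceil>s2\<rceil> * (?J ^ r2 * ?J ^ (r1 - r2))" by (simp only: mult_ac)
  also have "?J ^ r2 * ?J ^ (r1 - r2) = ?J ^ r1" using r21 by (simp add: power_add[symmetric])
  finally show ?thesis .
qed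

lemma fourier_test_function:
  assumes \<phi>: "\<phi> \<in> test_functions T n"
  shows "AE \<zeta> in Dm n. fourier T n \<phi> \<zeta> = of_real (1 / T) * kt n \<phi> \<zeta>"
  using fourier_L1[OF test_function_L12[OF \<phi>]] unfolding fourier_integral_eq .

lemma chg_weight_complex_measurable: "(\<lambda>\<zeta>. complex_of_real (chg_weight n \<zeta>)) \<in> borel_measurable (Dm n)"
  by (rule measurable_compose[OF chg_weight_measurable]) simp

lemma test_function_weight:
  assumes \<phi>: "\<phi> \<in> test_functions T n"
  shows "L2 (Dm n) (\<lambda>\<zeta>. of_real (chg_weight n \<zeta>) * (of_real (1 / T) * kt n \<phi> \<zeta>))"
    "L2 (Dm n) (chg_weight n \<odot> fourier T n \<phi>)"
proof -
  have km: "kt n \<phi> \<in> borel_measurable (Dm n)"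
    by (rule G.kernel_transform_measurable[OF L2D[OF test_function_L12(2)[OF \<phi>]]])
  show s: "L2 (Dm n) (\<lambda>\<zeta>. of_real (chg_weight n \<zeta>) * (of_real (1 / T) * kt n \<phi> \<zeta>))"
  proof (rule L2_bound(1)[OF test_function_decay[OF \<phi>, of "nat \<lceil>s2\<rceil>" r1], where C="1 / T"])
    show "(\<lambda>\<zeta>. of_real (chg_weight n \<zeta>) * (of_real (1 / T) * kt n \<phi> \<zeta>)) \<in> borel_measurable (Dm n)"
      by (intro borel_measurable_times chg_weight_complex_measurable km borel_measurable_const)
    show "AE \<zeta> in Dm n. cmod (of_real (chg_weight n \<zeta>) * (of_real (1 / T) * kt n \<phi> \<zeta>))
        \<le> 1 / T * cmod (of_real (jap_time (fst \<zeta>) ^ nat \<lceil>s2\<rceil> * jap_space n (snd \<zeta>) ^ r1) * kt n \<phi> \<zeta>)"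
    proof (rule AE_I2)
      fix \<zeta>
      let ?b = "jap_time (fst \<zeta>) ^ nat \<lceil>s2\<rceil> * jap_space n (snd \<zeta>) ^ r1" and ?w = "chg_weight n \<zeta>"
      have w: "0 \<le> ?w" "?w \<le> ?b" using chg_weight_ge_1[of n \<zeta>] chg_weight_le[of n \<zeta>] by auto
      then have "?w * (1 / T * cmod (kt n \<phi> \<zeta>)) \<le> ?b * (1 / T * cmod (kt n \<phi> \<zeta>))"
        using T_pos by (intro mult_right_mono) auto
      moreover have "cmod (of_real ?w * (of_real (1 / T) * kt n \<phi> \<zeta>)) = ?w * (1 / T * cmod (kt n \<phi> \<zeta>))"
        unfolding norm_mult norm_of_real using w T_pos by (simp only: abs_of_nonneg zero_le_divide_1_iff less_imp_le)
      moreover have "cmod (of_real ?b * kt n \<phi> \<zeta>) = ?b * cmod (kt n \<phi> \<zeta>)"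
        unfolding norm_mult[of "of_real ?b" "kt n \<phi> \<zeta>"] norm_of_real using w by (simp only: abs_of_nonneg order_trans[OF w])
      ultimately show "cmod (of_real ?w * (of_real (1 / T) * kt n \<phi> \<zeta>)) \<le> 1 / T * cmod (of_real ?b * kt n \<phi> \<zeta>)"
        by (simp only: mult.left_commute)
    qed
  qed
  show "L2 (Dm n) (chg_weight n \<odot> fourier T n \<phi>)"
  proof (rule L2_cong_AE[OF s])
    show "(chg_weight n \<odot> fourier T n \<phi>) \<in> borel_measurable (Dm n)"
      by (intro borel_measurable_times chg_weight_complex_measurable
          L2D[OF ft_fourier(1)[OF test_function_L12(2)[OF \<phi>]]])
    show "AE \<zeta> in Dm n. of_real (chg_weight n \<zeta>) * (of_real (1 / T) * kt n \<phi> \<zeta>) = of_real (chg_weight n \<zeta>) * fourier T n \<phi> \<zeta>"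
      using fourier_test_function[OF \<phi>] by eventually_elim (simp only:)
  qed
qed

lemma admissible_test_function:
  assumes \<phi>: "\<phi> \<in> test_functions T (Suc d)"
  shows "admissible d (\<lambda>\<zeta>. of_real (1 / T) * kt (Suc d) \<phi> \<zeta>)" "admissible d (fourier T (Suc d) \<phi>)"
  unfolding admissible_def
  by (intro conjI test_function_weight[OF \<phi>] borel_measurable_times borel_measurable_const
      G.kernel_transform_measurable L2D[OF test_function_L12(2)[OF \<phi>]]
      L2D[OF ft_fourier(1)[OF test_function_L12(2)[OF \<phi>]]])+

lemma test_functions_normal_deriv:
  "\<phi> \<in> test_functions T (Suc d) \<Longrightarrow> (space_deriv d ^^ j) \<phi> \<in> test_functions T (Suc d)"
  by (induction j) (simp_all add: test_functions_space_deriv)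

lemma kt_normal_deriv:
  assumes \<phi>: "\<phi> \<in> test_functions T (Suc d)" and \<zeta>: "\<zeta> \<in> space (Dm (Suc d))"
  shows "kt (Suc d) ((space_deriv d ^^ j) \<phi>) \<zeta> = (\<i> * of_real (snd \<zeta> d)) ^ j * kt (Suc d) \<phi> \<zeta>"
proof (induction j)
  case (Suc j)
  show ?case
    using kt_space_deriv[OF test_functions_normal_deriv[OF \<phi>] lessI \<zeta>, of j] Suc by (simp add: mult_ac)
qed simp

lemma extend_group_measurable:
  "(\<lambda>(z, y). extend d z y) \<in> Gm d \<Otimes>\<^sub>M lborel \<rightarrow>\<^sub>M Gm (Suc d)"
  unfolding extend_def group_measure_def by (rule extend_measurable)

lemma extend_group_space:
  "z \<in> space (Gm d) \<Longrightarrow> extend d z y \<in> space (Gm (Suc d))"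
  "z \<in> space (Dm d) \<Longrightarrow> extend d z y \<in> space (Dm (Suc d))"
  using measurable_space[OF extend_group_measurable, of "(z, y)" d] measurable_space[OF slice_measurable, of "(z, y)" d]
  by (simp_all add: space_pair_measure)

lemma section_measurable:
  assumes "\<psi> \<in> test_functions T (Suc d)"
  shows "(\<lambda>w. \<psi> (extend d w y)) \<in> borel_measurable (Gm d)"
proof -
  have "(\<lambda>w. (w, y)) \<in> Gm d \<rightarrow>\<^sub>M Gm d \<Otimes>\<^sub>M lborel" by measurable
  from measurable_compose[OF measurable_compose[OF this extend_group_measurable]
      L2D[OF test_function_L12(2)[OF assms]]]
  show ?thesis by simp
qed

text \<open>The bounds are uniform in the normal variable \<open>y\<close>, as needed for dominated
  convergence when \<open>y\<close> tends to 0.\<close>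

lemma section_bounded:
  assumes \<psi>: "\<psi> \<in> test_functions T (Suc d)"
  obtains B R where "0 \<le> B"
    "\<And>t x y. 0 \<le> t \<Longrightarrow> t \<le> T \<Longrightarrow> x \<in> euclid d \<Longrightarrow> cmod (\<psi> (extend d (t, x) y)) \<le> B"
    "\<And>t x y. x \<in> euclid d \<Longrightarrow> \<exists>i<d. R < \<bar>x i\<bar> \<Longrightarrow> \<psi> (extend d (t, x) y) = 0"
proof -
  obtain B R where B0: "0 \<le> B" and R: "\<And>t x. x \<in> euclid (Suc d) \<Longrightarrow> \<exists>i<Suc d. R < \<bar>x i\<bar> \<Longrightarrow> \<psi> (t, x) = 0"
    and B: "\<And>t x. 0 \<le> t \<Longrightarrow> t \<le> T \<Longrightarrow> x \<in> euclid (Suc d) \<Longrightarrow> cmod (\<psi> (t, x)) \<le> B"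
    by (rule test_function_bounded[OF \<psi>]) (rule that)
  have ins: "x(d := y) \<in> euclid (Suc d)" if "x \<in> euclid d" for x :: "nat \<Rightarrow> real" and y
    using that by (auto simp: PiE_iff extensional_def)
  have sec_B: "cmod (\<psi> (extend d (t, x) y)) \<le> B" if "0 \<le> t" "t \<le> T" "x \<in> euclid d" for t x y
    unfolding extend_def fst_conv snd_conv by (rule B[OF that(1,2) ins[OF that(3)]])
  have sec_R: "\<psi> (extend d (t, x) y) = 0" if x: "x \<in> euclid d" and "\<exists>i<d. R < \<bar>x i\<bar>" for t x y
  proof -
    from that(2) obtain i where "i < d" "R < \<bar>x i\<bar>" by blast
    then have "\<exists>i<Suc d. R < \<bar>(x(d := y)) i\<bar>" by (intro exI[of _ i]) auto
    then show ?thesis unfolding extend_def fst_conv snd_conv using R[OF ins[OF x]] by blast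
  qed
  show thesis by (rule that[OF B0 sec_B sec_R])
qed

lemma section_L12:
  assumes \<psi>: "\<psi> \<in> test_functions T (Suc d)"
  shows "integrable (Gm d) (\<lambda>w. \<psi> (extend d w y))"
    "L2 (Gm d) (\<lambda>w. \<psi> (extend d w y))"
proof -
  obtain B R where "0 \<le> B"
    and B: "\<And>t x y. 0 \<le> t \<Longrightarrow> t \<le> T \<Longrightarrow> x \<in> euclid d \<Longrightarrow> cmod (\<psi> (extend d (t, x) y)) \<le> B"
    and R: "\<And>t x y. x \<in> euclid d \<Longrightarrow> \<exists>i<d. R < \<bar>x i\<bar> \<Longrightarrow> \<psi> (extend d (t, x) y) = 0"
    by (rule section_bounded[OF \<psi>]) (rule that)
  from bounded_support_L12[OF section_measurable[OF \<psi>] B R]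
  show "integrable (Gm d) (\<lambda>w. \<psi> (extend d w y))"
    "L2 (Gm d) (\<lambda>w. \<psi> (extend d w y))" by blast+
qed

text \<open>Inversion in the normal variable: the partial transform of a test function is continuous in
  that variable, so its value at \<open>0\<close> is recovered from the full transform by Gaussian summation.\<close>

lemma normal_inversion:
  assumes \<psi>: "\<psi> \<in> test_functions T (Suc d)" and z: "z \<in> space (Dm d)"
    and int: "integrable lborel (\<lambda>\<eta>. kt (Suc d) \<psi> (extend d z \<eta>))"
  shows "(\<integral>\<eta>. kt (Suc d) \<psi> (extend d z \<eta>) \<partial>lborel) = 2 * pi * kt d (\<lambda>w. \<psi> (extend d w 0)) z"
proof -
  let ?P = "Gm d \<Otimes>\<^sub>M (lborel :: real measure)" and ?i = "\<lambda>(w, y). extend d w y"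
  interpret D: sigma_finite_measure "Gm d" by (rule sigma_finite_group_measure)
  interpret P: pair_sigma_finite "Gm d" "lborel :: real measure" ..
  note L12 = test_function_L12[OF \<psi>]
  note im = extend_group_measurable[of d]
  obtain B R where B0: "0 \<le> B"
    and sec_B: "\<And>t x y. 0 \<le> t \<Longrightarrow> t \<le> T \<Longrightarrow> x \<in> euclid d \<Longrightarrow> cmod (\<psi> (extend d (t, x) y)) \<le> B"
    and sec_R: "\<And>t x y. x \<in> euclid d \<Longrightarrow> \<exists>i<d. R < \<bar>x i\<bar> \<Longrightarrow> \<psi> (extend d (t, x) y) = 0"
    by (rule section_bounded[OF \<psi>]) (rule that)
  let ?A = "{0..<T} \<times> PiE {..<d} (\<lambda>_. {-R..R})"
  note sec_m = section_measurable[OF \<psi>]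
  \<comment> \<open>The partial transform in time and the tangential variables, as a function of the
    normal variable; its transform on the line is the full transform.\<close>
  define g where "g y = kt d (\<lambda>w. \<psi> (extend d w y)) z" for y
  have pi: "integrable ?P (\<lambda>(w, y). \<psi> (extend d w y))"
  proof -
    have "integrable (distr ?P (Gm (Suc d)) ?i) \<psi>"
      using L12(1) unfolding extend_def distr_group_measure_Suc .
    then show ?thesis
      using integrable_distr_eq[OF im borel_measurable_integrable[OF L12(1)]] by (simp add: case_prod_beta')
  qed
  have pk: "integrable ?P (\<lambda>(w, y). \<psi> (extend d w y) * group_kernel d w z * line_kernel y \<eta>)" for \<eta>
  proof (rule Bochner_Integration.integrable_bound[OF pi])
    have [measurable]: "(\<lambda>w. group_kernel d w z) \<in> borel_measurable (Gm d)" by (rule G.kernel_measurable1[OF z])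
    have [measurable]: "(\<lambda>p. (\<lambda>(w, y). \<psi> (extend d w y)) p) \<in> borel_measurable ?P" using borel_measurable_integrable[OF pi] .
    have "(\<lambda>p. (\<lambda>(w, y). \<psi> (extend d w y)) p * group_kernel d (fst p) z * line_kernel (snd p) \<eta>) \<in> borel_measurable ?P"
      by measurable
    then show "(\<lambda>(w, y). \<psi> (extend d w y) * group_kernel d w z * line_kernel y \<eta>) \<in> borel_measurable ?P"
      by (simp add: case_prod_beta')
    show "AE p in ?P. norm (case p of (w, y) \<Rightarrow> \<psi> (extend d w y) * group_kernel d w z * line_kernel y \<eta>)
        \<le> norm (case p of (w, y) \<Rightarrow> \<psi> (extend d w y))"
      by (intro AE_I2) (simp add: case_prod_beta' norm_mult group_kernel_def)
  qed
  have pk0: "integrable ?P (\<lambda>(w, y). \<psi> (extend d w y) * group_kernel d w z)"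
    using pk[of 0] by (simp add: mult_zero_left)
  have gi: "integrable lborel g"
    using P.integrable_snd[OF pk0] unfolding g_def kernel_transform_def .
  have F: "kt (Suc d) \<psi> (extend d z \<eta>) = line_transform g \<eta>" for \<eta>
  proof -
    let ?e = "\<lambda>w. group_kernel (Suc d) w (extend d z \<eta>)"
    have em: "(\<lambda>w. \<psi> w * ?e w) \<in> borel_measurable (Gm (Suc d))"
      by (rule borel_measurable_times[OF L2D[OF L12(2)] G.kernel_measurable1[OF extend_group_space(2)[OF z]]])
    have "kt (Suc d) \<psi> (extend d z \<eta>) = (\<integral>w. \<psi> w * ?e w \<partial>distr ?P (Gm (Suc d)) ?i)"
      unfolding kernel_transform_def unfolding extend_def distr_group_measure_Suc ..
    also have "\<dots> = (\<integral>p. \<psi> (?i p) * ?e (?i p) \<partial>?P)" by (rule integral_distr[OF im em])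
    also have "\<dots> = (\<integral>p. (case p of (w, y) \<Rightarrow> \<psi> (extend d w y) * group_kernel d w z * line_kernel y \<eta>) \<partial>?P)"
      unfolding case_prod_beta' extend_def group_kernel_Suc mult.assoc ..
    also have "\<dots> = (\<integral>y. (\<integral>w. \<psi> (extend d w y) * group_kernel d w z * line_kernel y \<eta> \<partial>Gm d) \<partial>lborel)"
      by (rule P.integral_snd[OF pk, symmetric])
    also have "\<dots> = line_transform g \<eta>"
      unfolding g_def kernel_transform_def by (simp only: integral_mult_left_zero)
    finally show ?thesis .
  qed
  \<comment> \<open>All sections are supported in one fixed box, whose indicator times
    \<open>B\<close> dominates them; this gives the bound and the continuity at 0.\<close>
  have gB: "cmod (g y) \<le> B * measure (Gm d) ?A"
    and gcont: "(\<lambda>m. g (1 / real (Suc m) * y)) \<longlonglongrightarrow> g 0" for y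
  proof -
    note cA = cube_finite[of d R]
    have Ai: "integrable (Gm d) (\<lambda>w. B * indicator ?A w :: real)"
      using cA by (intro integrable_mult_right) (simp add: integrable_indicator_iff)
    have pt: "cmod (\<psi> (extend d w y) * group_kernel d w z) \<le> B * indicator ?A w"
      if w: "w \<in> space (Gm d)" for w y
    proof -
      have w': "fst w \<in> {0..<T} \<and> snd w \<in> euclid d" using w unfolding space_group_measure mem_Times_iff .
      show ?thesis
      proof (cases "w \<in> ?A")
        case True
        have t: "0 \<le> fst w" "fst w \<le> T" using w' by simp_all
        have "cmod (\<psi> (extend d w y)) \<le> B" using sec_B[OF t conjunct2[OF w']] unfolding prod.collapse .
        then show ?thesis unfolding indicator_eq_1_iff[THEN iffD2, OF True] by (simp add: norm_mult group_kernel_def)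
      next
        case False
        have "\<not> (\<forall>i\<in>{..<d}. snd w i \<in> {-R..R})"
        proof
          assume "\<forall>i\<in>{..<d}. snd w i \<in> {-R..R}"
          then have "snd w \<in> PiE {..<d} (\<lambda>_. {-R..R})" using conjunct2[OF w'] unfolding PiE_iff by blast
          then show False using False conjunct1[OF w'] unfolding mem_Times_iff by blast
        qed
        then obtain i where i: "i < d" "\<not> (- R \<le> snd w i \<and> snd w i \<le> R)" unfolding atLeastAtMost_iff lessThan_iff by blast
        from i(2) have "R < \<bar>snd w i\<bar>" by linarith
        with i(1) have "\<psi> (extend d (fst w, snd w) y) = 0" using sec_R[OF conjunct2[OF w']] by blast
        then have "\<psi> (extend d w y) = 0" unfolding prod.collapse .
        then show ?thesis using B0 by simp
      qed
    qed
    have em: "(\<lambda>w. \<psi> (extend d w y) * group_kernel d w z) \<in> borel_measurable (Gm d)" for y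
      by (rule borel_measurable_times[OF sec_m G.kernel_measurable1[OF z]])
    have "cmod (g y) \<le> (\<integral>w. cmod (\<psi> (extend d w y) * group_kernel d w z) \<partial>Gm d)"
      unfolding g_def kernel_transform_def by (rule integral_norm_bound)
    also have "\<dots> \<le> (\<integral>w. B * indicator ?A w \<partial>Gm d)"
      by (rule integral_mono'[OF Ai]) (use pt B0 in auto)
    also have "\<dots> = B * measure (Gm d) ?A" using cA by simp
    finally show "cmod (g y) \<le> B * measure (Gm d) ?A" .
    show "(\<lambda>m. g (1 / real (Suc m) * y)) \<longlonglongrightarrow> g 0"
      unfolding g_def kernel_transform_def
    proof (rule integral_dominated_convergence[OF em em Ai])
      show "AE w in Gm d. norm (\<psi> (extend d w (1 / real (Suc m) * y)) * group_kernel d w z) \<le> B * indicator ?A w" for m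
        by (rule AE_I2[OF pt])
      show "AE w in Gm d. (\<lambda>m. \<psi> (extend d w (1 / real (Suc m) * y)) * group_kernel d w z) \<longlonglongrightarrow> \<psi> (extend d w 0) * group_kernel d w z"
      proof (rule AE_I2)
        fix w assume w: "w \<in> space (Gm d)"
        have x0: "(snd w)(d := 0) \<in> euclid (Suc d)" using extend_group_space(1)[OF w, of 0] unfolding extend_def space_group_measure by blast
        have "isCont (\<lambda>s. \<psi> (fst w, ((snd w)(d := 0))(d := s))) 0"
          using test_function_continuous_line(2)[OF \<psi> x0 lessI, of "fst w"] by (rule continuous_on_interior) simp
        then have c: "isCont (\<lambda>s. \<psi> (extend d w s)) 0" unfolding extend_def fun_upd_upd .
        show "(\<lambda>m. \<psi> (extend d w (1 / real (Suc m) * y)) * group_kernel d w z) \<longlonglongrightarrow> \<psi> (extend d w 0) * group_kernel d w z"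
          by (intro tendsto_mult tendsto_const isCont_tendsto_compose[OF c tendsto_inverse_Suc_mult])
      qed
    qed
  qed
  let ?e = "\<lambda>m. 1 / real (Suc m)"
  let ?F = "line_transform g"
  have int': "integrable lborel ?F" using int unfolding F .
  \<comment> \<open>The full transform is integrable on this slice and dominates its product with
    the Gaussian cut-off, which tends to 1.\<close>
  have lhs: "(\<lambda>m. \<integral>\<eta>. ?F \<eta> * of_real (exp (- ((?e m * \<eta>)\<^sup>2) / 2)) \<partial>lborel) \<longlonglongrightarrow> (\<integral>\<eta>. ?F \<eta> * of_real 1 \<partial>lborel)"
  proof (rule integral_dominated_convergence[OF _ _ integrable_norm[OF int']])
    note [measurable] = borel_measurable_integrable[OF int']
    show "(\<lambda>\<eta>. ?F \<eta> * of_real (exp (- ((?e m * \<eta>)\<^sup>2) / 2))) \<in> borel_measurable lborel" for m by measurable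
    show "(\<lambda>\<eta>. ?F \<eta> * of_real 1) \<in> borel_measurable lborel" by measurable
    show "AE \<eta> in lborel. (\<lambda>m. ?F \<eta> * of_real (exp (- ((?e m * \<eta>)\<^sup>2) / 2))) \<longlonglongrightarrow> ?F \<eta> * of_real 1"
      by (intro AE_I2 tendsto_mult tendsto_const tendsto_of_real gauss_tendsto_1)
    show "AE \<eta> in lborel. norm (?F \<eta> * of_real (exp (- ((?e m * \<eta>)\<^sup>2) / 2))) \<le> norm (?F \<eta>)" for m
    proof (rule AE_I2)
      fix \<eta> :: real
      have "\<bar>exp (- ((?e m * \<eta>)\<^sup>2) / 2)\<bar> \<le> 1" by simp
      then show "norm (?F \<eta> * of_real (exp (- ((?e m * \<eta>)\<^sup>2) / 2))) \<le> norm (?F \<eta>)"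
        unfolding norm_mult norm_of_real by (intro mult_right_le_one_le) auto
    qed
  qed
  \<comment> \<open>Averages of \<open>g\<close> at scale 1/(m+1) against a probability density tend
    to its value at 0.\<close>
  have rhs: "(\<lambda>m. \<integral>y. g (?e m * y) * of_real (std_normal_density y) \<partial>lborel) \<longlonglongrightarrow> (\<integral>y. g 0 * of_real (std_normal_density y) \<partial>lborel)"
  proof (rule integral_dominated_convergence[where w="\<lambda>y. B * measure (Gm d) ?A * std_normal_density y"])
    note [measurable] = borel_measurable_integrable[OF gi]
    show "(\<lambda>y. g (?e m * y) * of_real (std_normal_density y)) \<in> borel_measurable lborel" for m by measurable
    show "(\<lambda>y. g 0 * of_real (std_normal_density y)) \<in> borel_measurable lborel" by measurable
    show "integrable lborel (\<lambda>y. B * measure (Gm d) ?A * std_normal_density y)"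
      by (rule integrable_mult_right[OF integrable_gauss])
    show "AE y in lborel. (\<lambda>m. g (?e m * y) * of_real (std_normal_density y)) \<longlonglongrightarrow> g 0 * of_real (std_normal_density y)"
      by (intro AE_I2 tendsto_mult tendsto_const gcont)
    show "AE y in lborel. norm (g (?e m * y) * of_real (std_normal_density y)) \<le> B * measure (Gm d) ?A * std_normal_density y" for m
    proof (rule AE_I2)
      fix y :: real
      have "\<bar>std_normal_density y\<bar> = std_normal_density y" by simp
      then show "norm (g (?e m * y) * of_real (std_normal_density y)) \<le> B * measure (Gm d) ?A * std_normal_density y"
        unfolding norm_mult norm_of_real by (simp only:) (rule mult_right_mono[OF gB], simp)
    qed
  qed
  have g0: "(\<integral>y. g 0 * of_real (std_normal_density y) \<partial>lborel) = g 0"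
  proof -
    have "(\<integral>y. std_normal_density y \<partial>lborel) = 1" by simp
    then show ?thesis unfolding integral_mult_right_zero integral_complex_of_real by simp
  qed
  have e: "0 < ?e m" for m by simp
  have "(\<lambda>m. \<integral>\<eta>. ?F \<eta> * of_real (exp (- ((?e m * \<eta>)\<^sup>2) / 2)) \<partial>lborel) \<longlonglongrightarrow> 2 * pi * g 0"
    using tendsto_mult[OF tendsto_const rhs, of "2 * pi"] unfolding gauss_inversion[OF gi e] g0 .
  from LIMSEQ_unique[OF lhs this]
  show "(\<integral>\<eta>. kt (Suc d) \<psi> (extend d z \<eta>) \<partial>lborel) = 2 * pi * kt d (\<lambda>w. \<psi> (extend d w 0)) z"
    unfolding F g_def by simp
qed

lemma normal_trace_eq: "normal_trace (Suc d) j \<phi> = (\<lambda>w. (space_deriv d ^^ j) \<phi> (extend d w 0))"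
  by (simp add: fun_eq_iff normal_trace_def extend_def)

text \<open>On the Fourier side the factor (\<i> \<eta>)^j is the j-th normal derivative, so the
  j-th moment is the inversion formula for that derivative. The integrability which the formula
  needs holds on almost every slice because the transform is admissible.\<close>

lemma trace_symbol_test_function:
  assumes \<phi>: "\<phi> \<in> test_functions T (Suc d)" and j: "j < r1"
  shows "L2 (Gm d) (normal_trace (Suc d) j \<phi>)"
    "AE z in Dm d. trace_symbol d j (fourier T (Suc d) \<phi>) z = fourier T d (normal_trace (Suc d) j \<phi>) z"
proof -
  let ?\<psi> = "(space_deriv d ^^ j) \<phi>" and ?F = "\<lambda>\<zeta>. of_real (1 / T) * kt (Suc d) \<phi> \<zeta>"
  note \<psi> = test_functions_normal_deriv[OF \<phi>, of j]
  note sec = section_L12[OF \<psi>, of 0, folded normal_trace_eq]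
  show "L2 (Gm d) (normal_trace (Suc d) j \<phi>)" by (rule sec)
  note adm = admissible_test_function[OF \<phi>]
  have m: "fourier T (Suc d) \<phi> \<in> borel_measurable (Dm (Suc d))" "?F \<in> borel_measurable (Dm (Suc d))"
    using adm unfolding admissible_def by blast+
  show "AE z in Dm d. trace_symbol d j (fourier T (Suc d) \<phi>) z = fourier T d (normal_trace (Suc d) j \<phi>) z"
    using trace_symbol_cong[OF m fourier_test_function[OF \<phi>], of j] slice_AE[OF adm(1)] fourier_L1[OF sec]
  proof eventually_elim
    case (elim z)
    have z: "z \<in> space (Dm d)" using elim(2) by blast
    have e: "(\<i> * of_real \<eta>) ^ j * ?F (extend d z \<eta>) = of_real (1 / T) * kt (Suc d) ?\<psi> (extend d z \<eta>)" for \<eta>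
      unfolding kt_normal_deriv[OF \<phi> extend_group_space(2)[OF z]] slice_parts(2)[OF z] by (simp only: mult.left_commute)
    have "integrable lborel (\<lambda>\<eta>. of_real (\<eta> ^ j) * ?F (extend d z \<eta>))" using elim(2) j by blast
    from integrable_mult_right[OF this, of "of_real T * \<i> ^ j"]
    have "integrable lborel (\<lambda>\<eta>. of_real T * ((\<i> * of_real \<eta>) ^ j * ?F (extend d z \<eta>)))"
      by (simp only: power_mult_distrib of_real_power mult.assoc)
    then have "integrable lborel (\<lambda>\<eta>. kt (Suc d) ?\<psi> (extend d z \<eta>))" unfolding e using T_pos by simp
    note inv = normal_inversion[OF \<psi> z this]
    have "trace_symbol d j ?F z = of_real (1 / (2 * pi)) * (of_real (1 / T) * (2 * pi * kt d (\<lambda>w. ?\<psi> (extend d w 0)) z))"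
      unfolding trace_symbol_def e integral_mult_right_zero inv ..
    also have "\<dots> = of_real (1 / T) * kt d (\<lambda>w. ?\<psi> (extend d w 0)) z" by simp
    finally have "trace_symbol d j ?F z = fourier T d (normal_trace (Suc d) j \<phi>) z"
      unfolding elim(3) unfolding fourier_integral_eq normal_trace_eq .
    with elim(1) show ?case by (rule trans)
  qed
qed

text \<open>A smooth function of this class oscillates on the closed half space only, while an
  extension in the Sobolev space has to oscillate everywhere. Subtracting the time mean changes
  nothing on the half space and, on the Fourier side, deletes \<tau> = 0; the weighted bound is thus
  inherited from \<phi>.\<close>

lemma half_test_function_extension:
  assumes \<phi>: "\<phi> \<in> half_test_functions_osc T (Suc d)"
  defines "f \<equiv> \<lambda>z. \<phi> z + (-1) * time_mean \<phi> z"
  shows "f \<in> group_L2 T (Suc d)"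
    "L2 (Dm (Suc d)) (chg_weight (Suc d) \<odot> fourier T (Suc d) f)"
    "AE x in lebesgue_euclid (Suc d). (LBINT t:{0..<T}. f (t, x)) = 0" "half_space_eq T (Suc d) \<phi> f"
proof -
  have \<phi>t: "\<phi> \<in> test_functions T (Suc d)" and osc: "\<And>x. x \<in> euclid (Suc d) \<Longrightarrow> 0 \<le> x d \<Longrightarrow> (LBINT t:{0..<T}. \<phi> (t, x)) = 0"
    using \<phi> unfolding half_test_functions_osc_def by auto
  note \<phi>2 = test_function_L12(2)[OF \<phi>t]
  note m2 = time_mean_L2(1)[OF \<phi>2]
  have f2: "L2 (Gm (Suc d)) f"
    unfolding f_def by (intro L2_add \<phi>2 L2_cmult m2)
  have "time_periodic T (Suc d) f"
    unfolding time_periodic_def f_def time_mean_def using test_functionD(1)[OF \<phi>t] by simp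
  with f2 show "f \<in> group_L2 T (Suc d)" by (simp add: group_L2_def)
  have F: "AE \<zeta> in Dm (Suc d). fourier T (Suc d) f \<zeta> = (if fst \<zeta> = 0 then 0 else fourier T (Suc d) \<phi> \<zeta>)"
    using fourier_lincomb[OF \<phi>2 m2, of "-1"] fourier_time_mean[OF \<phi>2] unfolding f_def
    by eventually_elim simp
  show "L2 (Dm (Suc d)) (chg_weight (Suc d) \<odot> fourier T (Suc d) f)"
  proof (rule L2_mono(1)[OF test_function_weight(2)[OF \<phi>t]])
    show "(chg_weight (Suc d) \<odot> fourier T (Suc d) f) \<in> borel_measurable (Dm (Suc d))"
      by (intro borel_measurable_times chg_weight_complex_measurable L2D[OF ft_fourier(1)[OF f2]])
    show "AE \<zeta> in Dm (Suc d). cmod (of_real (chg_weight (Suc d) \<zeta>) * fourier T (Suc d) f \<zeta>)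
        \<le> cmod (of_real (chg_weight (Suc d) \<zeta>) * fourier T (Suc d) \<phi> \<zeta>)"
      using F by eventually_elim simp
  qed
  show "AE x in lebesgue_euclid (Suc d). (LBINT t:{0..<T}. f (t, x)) = 0"
    unfolding oscillation_iff[OF f2] using F by eventually_elim simp
  show "half_space_eq T (Suc d) \<phi> f"
    unfolding half_space_eq_def
  proof (rule AE_I2, rule impI)
    fix z assume z: "z \<in> space (Gm (Suc d))" and p: "0 < snd z (Suc d - 1)"
    have "snd z \<in> euclid (Suc d)" using z unfolding space_group_measure mem_Times_iff by (rule conjunct2)
    then have "(LBINT t:{0..<T}. \<phi> (t, snd z)) = 0" using p by (intro osc) simp_all
    then have "time_mean \<phi> z = 0"
      by (simp add: time_mean_def integral_circle set_lebesgue_integral_def)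
    then show "\<phi> z = f z" by (simp add: f_def)
  qed
qed

end

section \<open>The trace and extension operators\<close>

lemma equivalent_weights:
  fixes v w :: "'a \<Rightarrow> real"
  assumes F: "F \<in> borel_measurable M" and v: "v \<in> borel_measurable M" and w: "w \<in> borel_measurable M"
    and le: "\<And>z. 0 \<le> w z" "\<And>z. w z \<le> v z" "\<And>z. v z \<le> C * w z"
  shows "L2 M (\<lambda>z. of_real (v z) * F z) \<longleftrightarrow> L2 M (\<lambda>z. of_real (w z) * F z)"
    "L2 M (\<lambda>z. of_real (v z) * F z) \<Longrightarrow>
      l2_norm M (\<lambda>z. of_real (w z) * F z) \<le> l2_norm M (\<lambda>z. of_real (v z) * F z)"
    "L2 M (\<lambda>z. of_real (w z) * F z) \<Longrightarrow>
      l2_norm M (\<lambda>z. of_real (v z) * F z) \<le> \<bar>C\<bar> * l2_norm M (\<lambda>z. of_real (w z) * F z)"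
proof -
  have vm: "(\<lambda>z. of_real (v z) * F z) \<in> borel_measurable M" and wm: "(\<lambda>z. of_real (w z) * F z) \<in> borel_measurable M"
    using F v w by measurable
  have 1: "cmod (of_real (w z) * F z) \<le> cmod (of_real (v z) * F z)" for z
    using le(1,2)[of z] unfolding norm_mult norm_of_real by (intro mult_right_mono) auto
  have 2: "cmod (of_real (v z) * F z) \<le> C * cmod (of_real (w z) * F z)" for z
  proof -
    have "\<bar>v z\<bar> \<le> C * \<bar>w z\<bar>" using le[of z] by simp
    then have "\<bar>v z\<bar> * cmod (F z) \<le> C * \<bar>w z\<bar> * cmod (F z)" by (rule mult_right_mono) simp
    then show ?thesis unfolding norm_mult norm_of_real by (simp only: mult.assoc)
  qed
  note a = L2_mono[OF _ wm AE_I2[OF 1]] and b = L2_bound[OF _ vm AE_I2[OF 2]]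
  show "L2 M (\<lambda>z. of_real (v z) * F z) \<longleftrightarrow> L2 M (\<lambda>z. of_real (w z) * F z)"
    using a(1) b(1) by blast
  show "L2 M (\<lambda>z. of_real (v z) * F z) \<Longrightarrow>
      l2_norm M (\<lambda>z. of_real (w z) * F z) \<le> l2_norm M (\<lambda>z. of_real (v z) * F z)" by (rule a(2))
  show "L2 M (\<lambda>z. of_real (w z) * F z) \<Longrightarrow>
      l2_norm M (\<lambda>z. of_real (v z) * F z) \<le> \<bar>C\<bar> * l2_norm M (\<lambda>z. of_real (w z) * F z)" by (rule b(2))
qed

context periodic
begin

lemma fourier_measurable:
  "L2 (Gm n) f \<Longrightarrow> fourier T n f \<in> borel_measurable (Dm n)"
  using ft_fourier(1) L2D by blast

lemma sobolev_oscD: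
  assumes "f \<in> sobolev_osc T n \<mu>"
  shows "f \<in> group_L2 T n" "L2 (Gm n) f"
    "L2 (Dm n) (order_weight n \<mu> \<odot> fourier T n f)"
    "AE \<zeta> in Dm n. fst \<zeta> = 0 \<longrightarrow> fourier T n f \<zeta> = 0"
proof -
  show f: "f \<in> group_L2 T n" "L2 (Gm n) f"
    using assms unfolding sobolev_osc_def sobolev_def group_L2_def by blast+
  show "L2 (Dm n) (order_weight n \<mu> \<odot> fourier T n f)"
    using assms unfolding sobolev_osc_def sobolev_def weighted_fourier_def by blast
  show "AE \<zeta> in Dm n. fst \<zeta> = 0 \<longrightarrow> fourier T n f \<zeta> = 0"
    using assms oscillation_iff[OF f(2)] unfolding sobolev_osc_def by blast
qed

lemma sobolev_oscI:
  assumes "f \<in> group_L2 T n"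
    "L2 (Dm n) (order_weight n \<mu> \<odot> fourier T n f)"
    "AE \<zeta> in Dm n. fst \<zeta> = 0 \<longrightarrow> fourier T n f \<zeta> = 0"
  shows "f \<in> sobolev_osc T n \<mu>"
proof -
  have "L2 (Gm n) f" using assms(1) unfolding group_L2_def by blast
  from oscillation_iff[OF this] assms show ?thesis
    unfolding sobolev_osc_def sobolev_def weighted_fourier_def by blast
qed

lemma sobolev_osc_lincomb:
  assumes f: "f \<in> sobolev_osc T n \<mu>" and g: "g \<in> sobolev_osc T n \<mu>"
  shows "(\<lambda>z. f z + a * g z) \<in> sobolev_osc T n \<mu>"
proof (rule sobolev_oscI)
  note f' = sobolev_oscD[OF f] and g' = sobolev_oscD[OF g]
  have s: "L2 (Gm n) (\<lambda>z. f z + a * g z)"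
    by (intro L2_add L2_cmult f' g')
  moreover have "time_periodic T n (\<lambda>z. f z + a * g z)"
    using f'(1) g'(1) by (simp add: group_L2_def time_periodic_def)
  ultimately show "(\<lambda>z. f z + a * g z) \<in> group_L2 T n" by (simp add: group_L2_def)
  note lc = fourier_lincomb[OF f'(2) g'(2), of a]
  show "AE \<zeta> in Dm n. fst \<zeta> = 0 \<longrightarrow> fourier T n (\<lambda>z. f z + a * g z) \<zeta> = 0"
    using lc f'(4) g'(4) by eventually_elim simp
  show "L2 (Dm n) (\<lambda>\<zeta>. of_real (order_weight n \<mu> \<zeta>) * fourier T n (\<lambda>z. f z + a * g z) \<zeta>)"
  proof (rule L2_cong_AE[OF L2_add[OF f'(3) L2_cmult[OF g'(3), of a]]])
    show "(\<lambda>\<zeta>. of_real (order_weight n \<mu> \<zeta>) * fourier T n (\<lambda>z. f z + a * g z) \<zeta>) \<in> borel_measurable (Dm n)"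
      by (intro borel_measurable_times fourier_measurable[OF s] measurable_compose[OF order_weight_measurable]) simp
    show "AE \<zeta> in Dm n. of_real (order_weight n \<mu> \<zeta>) * fourier T n f \<zeta> + a * (of_real (order_weight n \<mu> \<zeta>) * fourier T n g \<zeta>)
        = of_real (order_weight n \<mu> \<zeta>) * fourier T n (\<lambda>z. f z + a * g z) \<zeta>"
      using lc by eventually_elim (simp add: algebra_simps)
  qed
qed

lemma sobolev_norm_zero:
  assumes f: "L2 (Gm n) f" and z: "AE \<zeta> in Dm n. fourier T n f \<zeta> = 0"
  shows "sobolev_norm T n \<mu> f = 0"
proof -
  have "sobolev_norm T n \<mu> f = l2_norm (Dm n) (\<lambda>_. 0)"
    unfolding sobolev_norm_def weighted_fourier_def
  proof (rule l2_norm_cong_AE)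
    show "(order_weight n \<mu> \<odot> fourier T n f) \<in> borel_measurable (Dm n)"
      by (intro borel_measurable_times fourier_measurable[OF f] measurable_compose[OF order_weight_measurable]) simp
    show "AE \<zeta> in Dm n. of_real (order_weight n \<mu> \<zeta>) * fourier T n f \<zeta> = 0"
      using z by eventually_elim simp
  qed simp
  then show ?thesis by simp
qed

text \<open>A choice among functions that agree almost everywhere on the group; operators defined
  through it are therefore linear only modulo null sets.\<close>

definition fourier_inverse :: "nat \<Rightarrow> (point \<Rightarrow> complex) \<Rightarrow> point \<Rightarrow> complex" where
  "fourier_inverse n g = (SOME f. f \<in> group_L2 T n \<and> (AE \<zeta> in Dm n. fourier T n f \<zeta> = g \<zeta>))"

lemma fourier_inverse:
  assumes "L2 (Dm n) g"
  shows "fourier_inverse n g \<in> group_L2 T n" "L2 (Gm n) (fourier_inverse n g)"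
    "AE \<zeta> in Dm n. fourier T n (fourier_inverse n g) \<zeta> = g \<zeta>"
proof -
  obtain f where "f \<in> group_L2 T n" "AE \<zeta> in Dm n. fourier T n f \<zeta> = g \<zeta>"
    by (rule fourier_surj[OF assms])
  then have "\<exists>f. f \<in> group_L2 T n \<and> (AE \<zeta> in Dm n. fourier T n f \<zeta> = g \<zeta>)" by blast
  from someI_ex[OF this, folded fourier_inverse_def]
  show "fourier_inverse n g \<in> group_L2 T n" "L2 (Gm n) (fourier_inverse n g)"
    "AE \<zeta> in Dm n. fourier T n (fourier_inverse n g) \<zeta> = g \<zeta>"
    unfolding group_L2_def by blast+
qed

end

context trace_setting
begin

abbreviation \<mu> :: "real \<Rightarrow> real" where "\<mu> \<equiv> chg_order r1 r2 s2"
abbreviation \<nu> :: "nat \<Rightarrow> real \<Rightarrow> real" where "\<nu> \<equiv> trace_order r1 r2 s2"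

definition chg_const :: "nat \<Rightarrow> real" where
  "chg_const n = (SOME C. \<forall>z. chg_weight n z \<le> order_weight n \<mu> z \<and> order_weight n \<mu> z \<le> C * chg_weight n z)"

definition trace_const :: "nat \<Rightarrow> nat \<Rightarrow> real" where
  "trace_const n j = (SOME C. \<forall>z. trace_weight n j z \<le> order_weight n (\<nu> j) z \<and> order_weight n (\<nu> j) z \<le> C * trace_weight n j z)"

lemma chg_norm:
  assumes "L2 (Gm n) f"
  shows "L2 (Dm n) (order_weight n \<mu> \<odot> fourier T n f) \<longleftrightarrow>
      L2 (Dm n) (chg_weight n \<odot> fourier T n f)" (is "?A \<longleftrightarrow> ?B")
    "L2 (Dm n) (order_weight n \<mu> \<odot> fourier T n f) \<Longrightarrow>
      l2_norm (Dm n) (chg_weight n \<odot> fourier T n f) \<le> sobolev_norm T n \<mu> f" (is "_ \<Longrightarrow> ?b \<le> ?a")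
    "L2 (Dm n) (chg_weight n \<odot> fourier T n f) \<Longrightarrow>
      sobolev_norm T n \<mu> f \<le> \<bar>chg_const n\<bar> * l2_norm (Dm n) (chg_weight n \<odot> fourier T n f)"
proof -
  have "\<exists>C. \<forall>z. chg_weight n z \<le> order_weight n \<mu> z \<and> order_weight n \<mu> z \<le> C * chg_weight n z"
    using chg_weight_equiv[of n] by blast
  from someI_ex[OF this, folded chg_const_def]
  have C: "chg_weight n z \<le> order_weight n \<mu> z" "order_weight n \<mu> z \<le> chg_const n * chg_weight n z" for z by blast+
  have 0: "0 \<le> chg_weight n z" for z using chg_weight_ge_1[of n z] by simp
  note e = equivalent_weights[OF fourier_measurable[OF assms(1)] order_weight_measurable chg_weight_measurable 0 C]
  show "?A \<longleftrightarrow> ?B" by (rule e(1))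
  show "?A \<Longrightarrow> ?b \<le> ?a" unfolding sobolev_norm_def weighted_fourier_def by (rule e(2))
  show "?B \<Longrightarrow> ?a \<le> \<bar>chg_const n\<bar> * ?b" unfolding sobolev_norm_def weighted_fourier_def by (rule e(3))
qed

lemma trace_norm_equiv:
  assumes "j < r1" and "L2 (Gm n) f"
  shows "L2 (Dm n) (order_weight n (\<nu> j) \<odot> fourier T n f) \<longleftrightarrow>
      L2 (Dm n) (trace_weight n j \<odot> fourier T n f)" (is "?A \<longleftrightarrow> ?B")
    "L2 (Dm n) (order_weight n (\<nu> j) \<odot> fourier T n f) \<Longrightarrow>
      l2_norm (Dm n) (trace_weight n j \<odot> fourier T n f) \<le> sobolev_norm T n (\<nu> j) f" (is "_ \<Longrightarrow> ?b \<le> ?a")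
    "L2 (Dm n) (trace_weight n j \<odot> fourier T n f) \<Longrightarrow>
      sobolev_norm T n (\<nu> j) f \<le> \<bar>trace_const n j\<bar> * l2_norm (Dm n) (trace_weight n j \<odot> fourier T n f)"
proof -
  have "\<exists>C. \<forall>z. trace_weight n j z \<le> order_weight n (\<nu> j) z \<and> order_weight n (\<nu> j) z \<le> C * trace_weight n j z"
    using trace_weight_equiv[OF assms(1), of n] by blast
  from someI_ex[OF this, folded trace_const_def]
  have C: "trace_weight n j z \<le> order_weight n (\<nu> j) z" "order_weight n (\<nu> j) z \<le> trace_const n j * trace_weight n j z" for z by blast+
  have 0: "0 \<le> trace_weight n j z" for z using trace_weight_ge_1[OF assms(1), of n z] by simp
  note e = equivalent_weights[OF fourier_measurable[OF assms(2)] order_weight_measurable trace_weight_measurable 0 C]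
  show "?A \<longleftrightarrow> ?B" by (rule e(1))
  show "?A \<Longrightarrow> ?b \<le> ?a" unfolding sobolev_norm_def weighted_fourier_def by (rule e(2))
  show "?B \<Longrightarrow> ?a \<le> \<bar>trace_const n j\<bar> * ?b" unfolding sobolev_norm_def weighted_fourier_def by (rule e(3))
qed

lemma sobolev_osc_admissible:
  assumes "f \<in> sobolev_osc T (Suc d) \<mu>"
  shows "admissible d (fourier T (Suc d) f)"
    "l2_norm (Dm (Suc d)) (chg_weight (Suc d) \<odot> fourier T (Suc d) f) \<le> sobolev_norm T (Suc d) \<mu> f"
  unfolding admissible_def
  using sobolev_oscD(3)[OF assms] fourier_measurable[OF sobolev_oscD(2)[OF assms]] chg_norm(1,2)[OF sobolev_oscD(2)[OF assms]] by blast+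

abbreviation half_space :: "nat \<Rightarrow> (point \<Rightarrow> complex) set" where "half_space d \<equiv> half_sobolev_osc T (Suc d) \<mu>"
abbreviation half_norm :: "nat \<Rightarrow> (point \<Rightarrow> complex) \<Rightarrow> real" where "half_norm d \<equiv> half_sobolev_norm T (Suc d) \<mu>"
abbreviation whole_space :: "nat \<Rightarrow> (point \<Rightarrow> complex) set" where "whole_space d \<equiv> sobolev_osc T (Suc d) \<mu>"
abbreviation whole_norm :: "nat \<Rightarrow> (point \<Rightarrow> complex) \<Rightarrow> real" where "whole_norm d \<equiv> sobolev_norm T (Suc d) \<mu>"
abbreviation traces :: "nat \<Rightarrow> (nat \<Rightarrow> point \<Rightarrow> complex) set" where "traces d \<equiv> trace_space T (Suc d) r1 r2 s2"
abbreviation traces_norm :: "nat \<Rightarrow> (nat \<Rightarrow> point \<Rightarrow> complex) \<Rightarrow> real" where "traces_norm d \<equiv> trace_norm T (Suc d) r1 r2 s2"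

text \<open>An arbitrary extension, with no claim of linearity or boundedness in \<open>u\<close>.
  That the trace is independent of it is the content of
  \<open>fourier_trace_operator\<close>.\<close>

definition chosen_extension :: "nat \<Rightarrow> (point \<Rightarrow> complex) \<Rightarrow> point \<Rightarrow> complex" where
  "chosen_extension d u = (SOME f. f \<in> whole_space d \<and> half_space_eq T (Suc d) u f)"

definition trace_operator :: "nat \<Rightarrow> (point \<Rightarrow> complex) \<Rightarrow> nat \<Rightarrow> point \<Rightarrow> complex" where
  "trace_operator d u j = fourier_inverse d (trace_symbol d j (fourier T (Suc d) (chosen_extension d u)))"

text \<open>The transform of oscillating data vanishes at \<tau> = 0 only almost everywhere; setting
  it to 0 there makes the extension symbol vanish at every point with \<tau> = 0.\<close>

definition boundary_symbol :: "nat \<Rightarrow> (nat \<Rightarrow> point \<Rightarrow> complex) \<Rightarrow> nat \<Rightarrow> point \<Rightarrow> complex" where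
  "boundary_symbol d g j z = (if fst z = 0 then 0 else fourier T d (g j) z)"

definition extension_operator :: "nat \<Rightarrow> (nat \<Rightarrow> point \<Rightarrow> complex) \<Rightarrow> point \<Rightarrow> complex" where
  "extension_operator d g = fourier_inverse (Suc d) (extension_symbol d (boundary_symbol d g))"

lemma chosen_extension:
  assumes "u \<in> half_space d"
  shows "chosen_extension d u \<in> whole_space d" "half_space_eq T (Suc d) u (chosen_extension d u)"
proof -
  have "\<exists>f. f \<in> whole_space d \<and> half_space_eq T (Suc d) u f"
    using assms unfolding half_sobolev_osc_def by blast
  from someI_ex[OF this, folded chosen_extension_def]
  show "chosen_extension d u \<in> whole_space d" "half_space_eq T (Suc d) u (chosen_extension d u)" by blast+
qed

lemma trace_symbol_square_integrable:
  assumes adm: "admissible d F" and j: "j < r1"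
  shows "L2 (Dm d) (trace_symbol d j F)"
proof (rule L2_mono(1)[OF trace_symbol_L2(1)[OF adm j]])
  show "trace_symbol d j F \<in> borel_measurable (Dm d)"
    using adm unfolding admissible_def by (intro trace_symbol_measurable) blast
  show "AE z in Dm d. cmod (trace_symbol d j F z) \<le> cmod (of_real (trace_weight d j z) * trace_symbol d j F z)"
  proof (rule AE_I2)
    fix z
    have "1 * cmod (trace_symbol d j F z) \<le> \<bar>trace_weight d j z\<bar> * cmod (trace_symbol d j F z)"
      using trace_weight_ge_1[OF j, of d z] by (intro mult_right_mono) auto
    then show "cmod (trace_symbol d j F z) \<le> cmod (of_real (trace_weight d j z) * trace_symbol d j F z)"
      unfolding norm_mult norm_of_real by simp
  qed
qed

text \<open>The difference of two extensions vanishes on the half space, so the moments of its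
  transform are zero. The statement admits every admissible \<open>f\<close>, oscillating or not, so
  that a smooth function can be taken as its own extension.\<close>

lemma fourier_trace_operator:
  assumes u: "u \<in> half_space d" and f: "L2 (Gm (Suc d)) f"
    and adm: "admissible d (fourier T (Suc d) f)" and uf: "half_space_eq T (Suc d) u f" and j: "j < r1"
  shows "AE z in Dm d. fourier T d (trace_operator d u j) z = trace_symbol d j (fourier T (Suc d) f) z"
    "trace_operator d u j \<in> group_L2 T d" "L2 (Gm d) (trace_operator d u j)"
proof -
  let ?p = "chosen_extension d u"
  note p = chosen_extension[OF u]
  note p2 = sobolev_oscD(2)[OF p(1)] and padm = sobolev_osc_admissible(1)[OF p(1)]
  note fi = fourier_inverse[OF trace_symbol_square_integrable[OF padm j], folded trace_operator_def]
  show "trace_operator d u j \<in> group_L2 T d" "L2 (Gm d) (trace_operator d u j)" by (rule fi)+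
  let ?h = "\<lambda>z. f z + (-1) * ?p z" and ?H = "\<lambda>\<zeta>. fourier T (Suc d) f \<zeta> + (-1) * fourier T (Suc d) ?p \<zeta>"
  have h: "L2 (Gm (Suc d)) ?h" by (intro L2_add L2_cmult f p2)
  have z: "AE z in Gm (Suc d). 0 < snd z d \<longrightarrow> ?h z = 0"
    using uf p(2) unfolding half_space_eq_def diff_Suc_1 by eventually_elim simp
  note lc = fourier_lincomb[OF f p2, of "-1"]
  note Hadm = admissible_lincomb[OF adm padm, of "-1"]
  have hm: "fourier T (Suc d) ?h \<in> borel_measurable (Dm (Suc d))" by (rule fourier_measurable[OF h])
  have hadm: "admissible d (fourier T (Suc d) ?h)"
    unfolding admissible_def
  proof (rule conjI[OF hm])
    show "L2 (Dm (Suc d)) (chg_weight (Suc d) \<odot> fourier T (Suc d) ?h)"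
    proof (rule L2_cong_AE)
      show "L2 (Dm (Suc d)) (chg_weight (Suc d) \<odot> ?H)"
        using Hadm unfolding admissible_def by (rule conjunct2)
      show "(chg_weight (Suc d) \<odot> fourier T (Suc d) ?h) \<in> borel_measurable (Dm (Suc d))"
        by (intro borel_measurable_times chg_weight_complex_measurable hm)
      show "AE \<zeta> in Dm (Suc d). of_real (chg_weight (Suc d) \<zeta>) * ?H \<zeta> = of_real (chg_weight (Suc d) \<zeta>) * fourier T (Suc d) ?h \<zeta>"
        using lc by eventually_elim (simp only:)
    qed
  qed
  have Hm: "?H \<in> borel_measurable (Dm (Suc d))" using Hadm unfolding admissible_def by (rule conjunct1)
  show "AE z in Dm d. fourier T d (trace_operator d u j) z = trace_symbol d j (fourier T (Suc d) f) z"
    using fi(3) trace_symbol_zero[OF h z hadm j] trace_symbol_cong[OF hm Hm lc, of j] trace_symbol_lincomb[OF adm padm j, of "-1"]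
    by eventually_elim simp
qed

text \<open>The estimate holds for every extension of \<open>u\<close> with the same constant, so
  that the infimum over the extensions gives the quotient norm.\<close>

lemma trace_operator_bounded:
  "\<exists>C. \<forall>u\<in>half_space d. trace_operator d u \<in> traces d \<and>
    traces_norm d (trace_operator d u) \<le> C * half_norm d u"
proof -
  let ?C = "\<lambda>j. \<bar>trace_const d j\<bar>"
  let ?c = "sqrt (2 ^ (r1 - r2) * pi)"
  define K where "K = (\<Sum>j<r1. ?C j * ?c)"
  have K: "0 \<le> K" unfolding K_def
  proof (rule sum_nonneg)
    fix j assume "j \<in> {..<r1}"
    then show "0 \<le> ?C j * ?c" by simp
  qed
  have key: "trace_operator d u j \<in> sobolev_osc T d (\<nu> j) \<and>
      sobolev_norm T d (\<nu> j) (trace_operator d u j) \<le> ?C j * ?c * whole_norm d f"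
    if u: "u \<in> half_space d" and f: "f \<in> whole_space d" and uf: "half_space_eq T (Suc d) u f" and j: "j < r1" for u f j
  proof -
    let ?g = "trace_operator d u j" and ?t = "trace_symbol d j (fourier T (Suc d) f)"
    note adm = sobolev_osc_admissible[OF f]
    note tr = fourier_trace_operator[OF u sobolev_oscD(2)[OF f] adm(1) uf j]
    have wm: "(\<lambda>\<zeta>. complex_of_real (trace_weight d j \<zeta>)) \<in> borel_measurable (Dm d)"
      by (rule measurable_compose[OF trace_weight_measurable]) simp
    have m: "(trace_weight d j \<odot> fourier T d ?g) \<in> borel_measurable (Dm d)"
      by (rule borel_measurable_times[OF wm fourier_measurable[OF tr(3)]])
    have ae: "AE \<zeta> in Dm d. of_real (trace_weight d j \<zeta>) * ?t \<zeta> = of_real (trace_weight d j \<zeta>) * fourier T d ?g \<zeta>"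
      using tr(1) by eventually_elim (simp only:)
    note tl = trace_symbol_L2[OF adm(1) j]
    have s: "L2 (Dm d) (trace_weight d j \<odot> fourier T d ?g)"
      by (rule L2_cong_AE[OF tl(1) m ae])
    have osc: "AE \<zeta> in Dm d. fst \<zeta> = 0 \<longrightarrow> fourier T d ?g \<zeta> = 0"
      using tr(1) trace_symbol_osc[OF sobolev_oscD(4)[OF f] fourier_measurable[OF sobolev_oscD(2)[OF f]], of j]
      by eventually_elim simp
    have "sobolev_norm T d (\<nu> j) ?g \<le> ?C j * l2_norm (Dm d) (trace_weight d j \<odot> fourier T d ?g)"
      by (rule trace_norm_equiv(3)[OF j tr(3) s])
    also have "\<dots> = ?C j * l2_norm (Dm d) (trace_weight d j \<odot> ?t)"
      using l2_norm_cong_AE[OF L2D[OF tl(1)] m ae] by (simp only:)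
    also have "\<dots> \<le> ?C j * (?c * whole_norm d f)"
      using order_trans[OF tl(2) mult_left_mono[OF adm(2)]] by (intro mult_left_mono) simp_all
    finally show ?thesis using sobolev_oscI[OF tr(2) iffD2[OF trace_norm_equiv(1)[OF j tr(3)] s] osc] by (simp only: mult.assoc)
  qed
  show ?thesis
  proof (intro exI[of _ K] ballI conjI)
    fix u assume u: "u \<in> half_space d"
    show "trace_operator d u \<in> traces d"
      using key[OF u chosen_extension[OF u]] unfolding trace_space_def diff_Suc_1 by blast
    let ?S = "{f \<in> whole_space d. half_space_eq T (Suc d) u f}"
    have le: "traces_norm d (trace_operator d u) \<le> K * whole_norm d f" if "f \<in> ?S" for f
    proof -
      have "traces_norm d (trace_operator d u) \<le> (\<Sum>j<r1. ?C j * ?c * whole_norm d f)"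
        unfolding trace_norm_def diff_Suc_1
      proof (rule sum_mono)
        fix j assume "j \<in> {..<r1}"
        then have j: "j < r1" by simp
        show "sobolev_norm T d (\<nu> j) (trace_operator d u j) \<le> ?C j * ?c * whole_norm d f"
          using key[OF u _ _ j, of f] that by blast
      qed
      then show ?thesis unfolding K_def sum_distrib_right .
    qed
    have ne: "?S \<noteq> {}" using chosen_extension[OF u] by blast
    \<comment> \<open>Passing to the infimum divides by \<open>K\<close>; for \<open>K = 0\<close> a
      single extension already gives the bound.\<close>
    show "traces_norm d (trace_operator d u) \<le> K * half_norm d u"
    proof (cases "K = 0")
      case True
      from ne obtain f where "f \<in> ?S" by blast
      from le[OF this] True show ?thesis by simp
    next
      case False
      then have "0 < K" using K by simp
      have "traces_norm d (trace_operator d u) / K \<le> half_norm d u"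
        unfolding half_sobolev_norm_def
      proof (rule cInf_greatest)
        show "whole_norm d ` ?S \<noteq> {}" using ne by blast
        fix r assume "r \<in> whole_norm d ` ?S"
        then obtain f where "f \<in> ?S" "r = whole_norm d f" by blast
        then show "traces_norm d (trace_operator d u) / K \<le> r"
          using le[of f] \<open>0 < K\<close> by (simp add: pos_divide_le_eq mult.commute)
      qed
      then show ?thesis using \<open>0 < K\<close> by (simp add: pos_divide_le_eq mult.commute)
    qed
  qed
qed

text \<open>The combination of the chosen extensions of \<open>u\<close> and \<open>v\<close> is an
  extension of \<open>w\<close>, and the trace of \<open>w\<close> may be computed from it.\<close>

lemma trace_operator_lincomb:
  assumes u: "u \<in> half_space d" and v: "v \<in> half_space d"
    and w: "\<And>z. w z = u z + a * v z" and j: "j < r1"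
  shows "AE z in Dm d. fourier T d (trace_operator d w j) z = fourier T d (trace_operator d u j) z + a * fourier T d (trace_operator d v j) z"
    "L2 (Gm d) (trace_operator d w j)"
proof -
  note p = chosen_extension[OF u] and q = chosen_extension[OF v]
  let ?p = "chosen_extension d u" and ?q = "chosen_extension d v"
  let ?h = "\<lambda>z. ?p z + a * ?q z"
  note h = sobolev_osc_lincomb[OF p(1) q(1), of a]
  have eq: "half_space_eq T (Suc d) w ?h"
    using p(2) q(2) unfolding half_space_eq_def by eventually_elim (simp add: w)
  then have wV: "w \<in> half_space d" using h unfolding half_sobolev_osc_def by blast
  note h2 = sobolev_oscD(2)[OF h] and p2 = sobolev_oscD(2)[OF p(1)] and q2 = sobolev_oscD(2)[OF q(1)]
  note hadm = sobolev_osc_admissible(1)[OF h] and padm = sobolev_osc_admissible(1)[OF p(1)] and qadm = sobolev_osc_admissible(1)[OF q(1)]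
  note tw = fourier_trace_operator[OF wV h2 hadm eq j] and tu = fourier_trace_operator[OF u p2 padm p(2) j]
    and tv = fourier_trace_operator[OF v q2 qadm q(2) j]
  have Hm: "(\<lambda>\<zeta>. fourier T (Suc d) ?p \<zeta> + a * fourier T (Suc d) ?q \<zeta>) \<in> borel_measurable (Dm (Suc d))"
    using admissible_lincomb[OF padm qadm, of a] unfolding admissible_def by (rule conjunct1)
  show "AE z in Dm d. fourier T d (trace_operator d w j) z = fourier T d (trace_operator d u j) z + a * fourier T d (trace_operator d v j) z"
    using tw(1) tu(1) tv(1) trace_symbol_cong[OF fourier_measurable[OF h2] Hm fourier_lincomb[OF p2 q2], of j] trace_symbol_lincomb[OF padm qadm j, of a]
    by eventually_elim (simp only:)
  show "L2 (Gm d) (trace_operator d w j)" by (rule tw)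
qed

text \<open>The form u + a v covers both laws of linearity: a = 1 is additivity, and v = u with a =
  c - 1 is multiplication by c.\<close>

lemma trace_operator_lincomb_norm:
  assumes u: "u \<in> half_space d" and v: "v \<in> half_space d"
    and w: "\<And>z. w z = u z + a * v z"
    and D: "\<And>j z. D j z = trace_operator d w j z + (-1) * (trace_operator d u j z + a * trace_operator d v j z)"
  shows "traces_norm d D = 0"
proof -
  have "sobolev_norm T d (\<nu> j) (D j) = 0" if j: "j < r1" for j
  proof -
    note lw = trace_operator_lincomb[OF u v w j]
    \<comment> \<open>Trivial combinations, through which the previous lemma gives square
      integrability of the traces of \<open>u\<close> and \<open>v\<close> themselves.\<close>
    have z0: "u z = u z + 0 * v z" "v z = v z + 0 * u z" for z by simp_all
    have u2: "L2 (Gm d) (trace_operator d u j)" by (rule trace_operator_lincomb(2)[OF u v z0(1) j])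
    have v2: "L2 (Gm d) (trace_operator d v j)" by (rule trace_operator_lincomb(2)[OF v u z0(2) j])
    let ?s = "\<lambda>z. trace_operator d u j z + a * trace_operator d v j z"
    have s: "L2 (Gm d) ?s" by (intro L2_add L2_cmult u2 v2)
    have De: "D j = (\<lambda>z. trace_operator d w j z + (-1) * ?s z)" using D by (rule ext)
    show ?thesis
    proof (rule sobolev_norm_zero)
      show "L2 (Gm d) (D j)"
        unfolding De by (intro L2_add L2_cmult lw(2) s)
      show "AE \<zeta> in Dm d. fourier T d (D j) \<zeta> = 0"
        unfolding De using fourier_lincomb[OF lw(2) s, of "-1"] fourier_lincomb[OF u2 v2, of a] lw(1)
        by eventually_elim simp
    qed
  qed
  then show ?thesis unfolding trace_norm_def diff_Suc_1 by simp
qed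

lemma boundary_symbol:
  assumes g: "g \<in> traces d" and j: "j < r1"
  shows "L2 (Dm d) (trace_weight d j \<odot> boundary_symbol d g j)"
    "boundary_symbol d g j \<in> borel_measurable (Dm d)"
    "AE z in Dm d. boundary_symbol d g j z = fourier T d (g j) z"
    "l2_norm (Dm d) (trace_weight d j \<odot> boundary_symbol d g j) \<le> sobolev_norm T d (\<nu> j) (g j)"
proof -
  have gj: "g j \<in> sobolev_osc T d (\<nu> j)" using g j unfolding trace_space_def diff_Suc_1 by blast
  note s = sobolev_oscD[OF gj]
  have tw: "L2 (Dm d) (trace_weight d j \<odot> fourier T d (g j))"
    "l2_norm (Dm d) (trace_weight d j \<odot> fourier T d (g j)) \<le> sobolev_norm T d (\<nu> j) (g j)"
    using trace_norm_equiv(1,2)[OF j s(2)] s(3) by blast+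
  show ae: "AE z in Dm d. boundary_symbol d g j z = fourier T d (g j) z"
    using s(4) by eventually_elim (simp add: boundary_symbol_def)
  note [measurable] = fourier_measurable[OF s(2)] dual_measure_fst_measurable[of T d]
  show m: "boundary_symbol d g j \<in> borel_measurable (Dm d)"
    unfolding boundary_symbol_def[abs_def] by measurable
  have wm: "(\<lambda>\<zeta>. complex_of_real (trace_weight d j \<zeta>)) \<in> borel_measurable (Dm d)"
    by (rule measurable_compose[OF trace_weight_measurable]) simp
  note bm = borel_measurable_times[OF wm m]
  have ae': "AE z in Dm d. of_real (trace_weight d j z) * fourier T d (g j) z = of_real (trace_weight d j z) * boundary_symbol d g j z"
    using ae by eventually_elim (simp only:)
  show "L2 (Dm d) (trace_weight d j \<odot> boundary_symbol d g j)"
    by (rule L2_cong_AE[OF tw(1) bm ae'])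
  show "l2_norm (Dm d) (trace_weight d j \<odot> boundary_symbol d g j) \<le> sobolev_norm T d (\<nu> j) (g j)"
    using l2_norm_cong_AE[OF L2D[OF tw(1)] bm ae'] tw(2) by (simp only:)
qed

lemma admissible_square_integrable:
  assumes "admissible d F"
  shows "L2 (Dm (Suc d)) F"
proof (rule L2_mono(1))
  show "L2 (Dm (Suc d)) (chg_weight (Suc d) \<odot> F)"
    "F \<in> borel_measurable (Dm (Suc d))" using assms unfolding admissible_def by blast+
  show "AE \<zeta> in Dm (Suc d). cmod (F \<zeta>) \<le> cmod (of_real (chg_weight (Suc d) \<zeta>) * F \<zeta>)"
  proof (rule AE_I2)
    fix \<zeta>
    have "1 * cmod (F \<zeta>) \<le> \<bar>chg_weight (Suc d) \<zeta>\<bar> * cmod (F \<zeta>)"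
      using chg_weight_ge_1[of "Suc d" \<zeta>] by (intro mult_right_mono) auto
    then show "cmod (F \<zeta>) \<le> cmod (of_real (chg_weight (Suc d) \<zeta>) * F \<zeta>)" unfolding norm_mult norm_of_real by simp
  qed
qed

text \<open>The bound is for the norm on the whole space, which dominates the quotient norm. The
  formula for the transform is kept because the trace of the extension is computed from it.\<close>

lemma extension_operator_bounded:
  "\<exists>C. \<forall>g\<in>traces d. extension_operator d g \<in> whole_space d \<and>
    (AE \<zeta> in Dm (Suc d). fourier T (Suc d) (extension_operator d g) \<zeta> = extension_symbol d (boundary_symbol d g) \<zeta>) \<and>
    whole_norm d (extension_operator d g) \<le> C * traces_norm d g"
proof -
  define A where "A = (\<Sum>j<r1. extension_const j)"
  have A: "0 \<le> A" unfolding A_def by (rule sum_nonneg) (rule extension_const_nonneg)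
  define C where "C = \<bar>chg_const (Suc d)\<bar>"
  have C: "0 \<le> C" by (simp add: C_def)
  show ?thesis
  proof (intro exI[of _ "C * A"] ballI conjI)
    fix g assume g: "g \<in> traces d"
    let ?G = "boundary_symbol d g" and ?E = "extension_operator d g"
    let ?S = "extension_symbol d ?G"
    note S = extension_symbol_L2[of d ?G, OF boundary_symbol(1,2)[OF g], folded A_def]
    note fi = fourier_inverse[OF admissible_square_integrable[OF S(1)], folded extension_operator_def]
    show ae: "AE \<zeta> in Dm (Suc d). fourier T (Suc d) ?E \<zeta> = ?S \<zeta>" by (rule fi)
    have m: "(chg_weight (Suc d) \<odot> fourier T (Suc d) ?E) \<in> borel_measurable (Dm (Suc d))"
      by (intro borel_measurable_times chg_weight_complex_measurable fourier_measurable[OF fi(2)])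
    have ae': "AE \<zeta> in Dm (Suc d). of_real (chg_weight (Suc d) \<zeta>) * ?S \<zeta> = of_real (chg_weight (Suc d) \<zeta>) * fourier T (Suc d) ?E \<zeta>"
      using ae by eventually_elim (simp only:)
    have Sw: "L2 (Dm (Suc d)) (chg_weight (Suc d) \<odot> ?S)"
      using S(1) unfolding admissible_def by (rule conjunct2)
    have w: "L2 (Dm (Suc d)) (chg_weight (Suc d) \<odot> fourier T (Suc d) ?E)"
      by (rule L2_cong_AE[OF Sw m ae'])
    have osc: "AE \<zeta> in Dm (Suc d). fst \<zeta> = 0 \<longrightarrow> fourier T (Suc d) ?E \<zeta> = 0"
      using ae
    proof eventually_elim
      case (elim \<zeta>)
      have "?S \<zeta> = 0" if "fst \<zeta> = 0" using that by (intro extension_symbol_osc) (simp_all add: boundary_symbol_def)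
      then show ?case unfolding elim by blast
    qed
    show "?E \<in> whole_space d" by (rule sobolev_oscI[OF fi(1) iffD2[OF chg_norm(1)[OF fi(2)] w] osc])
    have "whole_norm d ?E \<le> C * l2_norm (Dm (Suc d)) (chg_weight (Suc d) \<odot> fourier T (Suc d) ?E)"
      unfolding C_def by (rule chg_norm(3)[OF fi(2) w])
    also have "\<dots> = C * l2_norm (Dm (Suc d)) (chg_weight (Suc d) \<odot> ?S)"
      using l2_norm_cong_AE[OF L2D[OF Sw] m ae'] by (simp only:)
    also have "\<dots> \<le> C * (A * traces_norm d g)"
    proof (rule mult_left_mono[OF order_trans[OF S(2)] C])
      have "(\<Sum>j<r1. l2_norm (Dm d) (trace_weight d j \<odot> ?G j)) \<le> traces_norm d g"
        unfolding trace_norm_def diff_Suc_1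
        by (rule sum_mono) (rule boundary_symbol(4)[OF g], simp only: lessThan_iff)
      then show "A * (\<Sum>j<r1. l2_norm (Dm d) (trace_weight d j \<odot> ?G j)) \<le> A * traces_norm d g"
        by (rule mult_left_mono[OF _ A])
    qed
    finally show "whole_norm d ?E \<le> C * A * traces_norm d g" by (simp only: mult.assoc)
  qed
qed

lemma half_space_eq_refl: "half_space_eq T n u u"
  unfolding half_space_eq_def by simp

lemma half_sobolev_norm_le:
  assumes "f \<in> sobolev_osc T n \<kappa>"
  shows "half_sobolev_norm T n \<kappa> f \<le> sobolev_norm T n \<kappa> f" "0 \<le> half_sobolev_norm T n \<kappa> f"
proof -
  let ?S = "sobolev_norm T n \<kappa> ` {h \<in> sobolev_osc T n \<kappa>. half_space_eq T n f h}"
  have f: "sobolev_norm T n \<kappa> f \<in> ?S" using assms half_space_eq_refl by blast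
  have nn: "0 \<le> sobolev_norm T n \<kappa> h" for h unfolding sobolev_norm_def by simp
  have "bdd_below ?S" by (rule bdd_belowI2[OF nn])
  then show "half_sobolev_norm T n \<kappa> f \<le> sobolev_norm T n \<kappa> f" unfolding half_sobolev_norm_def by (rule cInf_lower[OF f])
  show "0 \<le> half_sobolev_norm T n \<kappa> f"
    unfolding half_sobolev_norm_def using f nn by (intro cInf_greatest) blast+
qed

text \<open>As for the trace operator, a single form yields additivity and multiplication by
  scalars.\<close>

lemma extension_operator_lincomb_norm:
  assumes g: "g \<in> traces d" and h: "h \<in> traces d"
    and w: "\<And>j z. w j z = g j z + a * h j z"
    and D: "\<And>z. D z = extension_operator d w z + (-1) * (extension_operator d g z + a * extension_operator d h z)"
  shows "half_norm d D = 0"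
proof -
  have wS: "w \<in> traces d"
    unfolding trace_space_def mem_Collect_eq diff_Suc_1
  proof (intro allI impI)
    fix j assume j: "j < r1"
    have "w j = (\<lambda>z. g j z + a * h j z)" using w by (rule ext)
    then show "w j \<in> sobolev_osc T d (\<nu> j)"
      using g h j sobolev_osc_lincomb unfolding trace_space_def mem_Collect_eq diff_Suc_1 by (simp only:)
  qed
  have E: "extension_operator d k \<in> whole_space d"
    "AE \<zeta> in Dm (Suc d). fourier T (Suc d) (extension_operator d k) \<zeta> = extension_symbol d (boundary_symbol d k) \<zeta>"
    if "k \<in> traces d" for k
    using extension_operator_bounded[of d] that by blast+
  let ?s = "\<lambda>z. extension_operator d g z + a * extension_operator d h z"
  have sS: "?s \<in> whole_space d" by (rule sobolev_osc_lincomb[OF E(1)[OF g] E(1)[OF h]])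
  have De: "D = (\<lambda>z. extension_operator d w z + (-1) * ?s z)" using D by (rule ext)
  have DS: "D \<in> whole_space d" unfolding De by (rule sobolev_osc_lincomb[OF E(1)[OF wS] sS])
  let ?B = "boundary_symbol d"
  let ?b = "\<lambda>j z. ?B g j z + a * ?B h j z"
  \<comment> \<open>The defect of linearity of the boundary symbols, zero almost everywhere. That
    its extension symbol is zero almost everywhere as well is read off from the norm bound
    \<open>extension_symbol_L2\<close>, in place of an argument about preimages of null
    sets.\<close>
  define H where "H j z = ?B w j z + (-1) * ?b j z" for j z
  have Hz: "AE z in Dm d. of_real (trace_weight d j z) * H j z = 0" if j: "j < r1" for j
  proof -
    have gh: "L2 (Gm d) (g j)" "L2 (Gm d) (h j)"
      using g h j sobolev_oscD(2) unfolding trace_space_def mem_Collect_eq diff_Suc_1 by blast+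
    have "w j = (\<lambda>z. g j z + a * h j z)" using w by (rule ext)
    then have "AE z in Dm d. fourier T d (w j) z = fourier T d (g j) z + a * fourier T d (h j) z"
      using fourier_lincomb[OF gh, of a] by (simp only:)
    with boundary_symbol(3)[OF wS j] boundary_symbol(3)[OF g j] boundary_symbol(3)[OF h j]
    show ?thesis unfolding H_def by eventually_elim simp
  qed
  have Hm: "H j \<in> borel_measurable (Dm d)" if j: "j < r1" for j
  proof -
    note [measurable] = boundary_symbol(2)[OF wS j] boundary_symbol(2)[OF g j] boundary_symbol(2)[OF h j]
    show ?thesis unfolding H_def[abs_def] by measurable
  qed
  have wm: "(trace_weight d j \<odot> H j) \<in> borel_measurable (Dm d)" if j: "j < r1" for j
    by (rule borel_measurable_times[OF measurable_compose[OF trace_weight_measurable] Hm[OF j]]) simp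
  have H0: "L2 (Dm d) (trace_weight d j \<odot> H j)"
    "l2_norm (Dm d) (trace_weight d j \<odot> H j) = 0" if j: "j < r1" for j
  proof -
    have z: "AE z in Dm d. 0 = of_real (trace_weight d j z) * H j z" using Hz[OF j] by eventually_elim simp
    show "L2 (Dm d) (trace_weight d j \<odot> H j)"
      by (rule L2_cong_AE[OF L2_zero wm[OF j] z])
    show "l2_norm (Dm d) (trace_weight d j \<odot> H j) = 0"
      using l2_norm_cong_AE[OF borel_measurable_const wm[OF j] z] by simp
  qed
  note Hx = extension_symbol_L2[of d H, OF H0(1) Hm]
  have sw: "L2 (Dm (Suc d)) (chg_weight (Suc d) \<odot> extension_symbol d H)"
    using Hx(1) unfolding admissible_def by (rule conjunct2)
  have "(\<Sum>j<r1. l2_norm (Dm d) (trace_weight d j \<odot> H j)) = 0"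
    by (rule sum.neutral, rule ballI, rule H0(2)) (simp only: lessThan_iff)
  then have "l2_norm (Dm (Suc d)) (chg_weight (Suc d) \<odot> extension_symbol d H) = 0"
    using Hx(2) by (intro antisym l2_norm_nonneg) simp
  then have "AE \<zeta> in Dm (Suc d). of_real (chg_weight (Suc d) \<zeta>) * extension_symbol d H \<zeta> = 0"
    using l2_norm_eq_0_iff[OF sw] by blast
  then have Hs: "AE \<zeta> in Dm (Suc d). extension_symbol d H \<zeta> = 0"
  proof eventually_elim
    case (elim \<zeta>)
    then show ?case using chg_weight_ge_1[of "Suc d" \<zeta>] by auto
  qed
  have sym: "extension_symbol d H \<zeta> = extension_symbol d (?B w) \<zeta> + (-1) * (extension_symbol d (?B g) \<zeta> + a * extension_symbol d (?B h) \<zeta>)" for \<zeta>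
    unfolding H_def[abs_def] extension_symbol_lincomb ..
  have "AE \<zeta> in Dm (Suc d). fourier T (Suc d) D \<zeta> = 0"
    unfolding De
    using fourier_lincomb[OF sobolev_oscD(2)[OF E(1)[OF wS]] sobolev_oscD(2)[OF sS], of "-1"]
      fourier_lincomb[OF sobolev_oscD(2)[OF E(1)[OF g]] sobolev_oscD(2)[OF E(1)[OF h]], of a]
      E(2)[OF wS] E(2)[OF g] E(2)[OF h] Hs
    unfolding sym by eventually_elim simp
  then have "whole_norm d D = 0" by (rule sobolev_norm_zero[OF sobolev_oscD(2)[OF DS]])
  with half_sobolev_norm_le[OF DS] show ?thesis by simp
qed

theorem trace_theorem:
  "\<exists>Tr :: (point \<Rightarrow> complex) \<Rightarrow> nat \<Rightarrow> point \<Rightarrow> complex.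
    bounded_linear_mod (half_space d) (half_norm d)
      (traces d) (traces_norm d) Tr \<and>
    (\<forall>\<phi>\<in>half_test_functions_osc T (Suc d). \<forall>j<r1.
      AE z in Gm (Suc d - 1). Tr \<phi> j z = normal_trace (Suc d) j \<phi> z) \<and>
    (\<exists>E :: (nat \<Rightarrow> point \<Rightarrow> complex) \<Rightarrow> point \<Rightarrow> complex.
      bounded_linear_mod (traces d) (traces_norm d)
        (half_space d) (half_norm d) E \<and>
      (\<forall>g\<in>traces d. \<forall>j<r1.
        AE z in Gm (Suc d - 1). Tr (E g) j z = g j z))"
proof (intro exI[of _ "trace_operator d"] exI[of _ "extension_operator d"] conjI ballI allI impI)
  obtain K where K: "\<And>u. u \<in> half_space d \<Longrightarrow> trace_operator d u \<in> traces d \<and>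
    traces_norm d (trace_operator d u) \<le> K * half_norm d u"
    using trace_operator_bounded[of d] by blast
  obtain L where L: "\<And>g. g \<in> traces d \<Longrightarrow> extension_operator d g \<in> whole_space d \<and>
    (AE \<zeta> in Dm (Suc d). fourier T (Suc d) (extension_operator d g) \<zeta> = extension_symbol d (boundary_symbol d g) \<zeta>) \<and>
    whole_norm d (extension_operator d g) \<le> L * traces_norm d g"
    using extension_operator_bounded[of d] by blast
  have EV: "extension_operator d g \<in> half_space d" if "g \<in> traces d" for g
    using L[OF that] half_space_eq_refl unfolding half_sobolev_osc_def by blast
  show "bounded_linear_mod (half_space d) (half_norm d)
      (traces d) (traces_norm d) (trace_operator d)"
    unfolding bounded_linear_mod_def
  proof (intro conjI ballI allI)
    show "trace_operator d ` half_space d \<subseteq> traces d" using K by blast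
    show "\<exists>C. \<forall>u\<in>half_space d. traces_norm d (trace_operator d u) \<le> C * half_norm d u"
      using K by blast
    fix u assume u: "u \<in> half_space d"
    show "traces_norm d (trace_operator d (u + v) - (trace_operator d u + trace_operator d v)) = 0"
      if v: "v \<in> half_space d" for v
      by (rule trace_operator_lincomb_norm[OF u v, of "u + v" 1]) (simp_all add: algebra_simps)
    show "traces_norm d (trace_operator d (cscale c u) - cscale c (trace_operator d u)) = 0" for c
      by (rule trace_operator_lincomb_norm[OF u u, of "cscale c u" "c - 1"]) (simp_all add: cscale_fun_def cscale_complex_def algebra_simps)
  qed
  show "bounded_linear_mod (traces d) (traces_norm d)
      (half_space d) (half_norm d) (extension_operator d)"
    unfolding bounded_linear_mod_def
  proof (intro conjI ballI allI)
    show "extension_operator d ` traces d \<subseteq> half_space d" using EV by blast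
    show "\<exists>C. \<forall>g\<in>traces d. half_norm d (extension_operator d g) \<le> C * traces_norm d g"
      using L half_sobolev_norm_le(1) order_trans by (intro exI[of _ L] ballI) blast
    fix g assume g: "g \<in> traces d"
    show "half_norm d (extension_operator d (g + h) - (extension_operator d g + extension_operator d h)) = 0"
      if h: "h \<in> traces d" for h
      by (rule extension_operator_lincomb_norm[OF g h, of "g + h" 1]) (simp_all add: algebra_simps)
    show "half_norm d (extension_operator d (cscale c g) - cscale c (extension_operator d g)) = 0" for c
      by (rule extension_operator_lincomb_norm[OF g g, of "cscale c g" "c - 1"]) (simp_all add: cscale_fun_def cscale_complex_def algebra_simps)
  qed
  fix j assume j: "j < r1"
  show "AE z in Gm (Suc d - 1). trace_operator d \<phi> j z = normal_trace (Suc d) j \<phi> z"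
    if \<phi>: "\<phi> \<in> half_test_functions_osc T (Suc d)" for \<phi>
  proof -
    have \<phi>t: "\<phi> \<in> test_functions T (Suc d)" using \<phi> unfolding half_test_functions_osc_def by blast
    note ext = half_test_function_extension[OF \<phi>]
    \<comment> \<open>Two extensions share the work: \<open>?f\<close> oscillates and shows that
      \<phi> lies in the half-space Sobolev space, while the trace is computed from \<phi> itself,
      whose moments are known.\<close>
    let ?f = "\<lambda>z. \<phi> z + (-1) * time_mean \<phi> z"
    have f2: "L2 (Gm (Suc d)) ?f" using ext(1) unfolding group_L2_def by blast
    have "?f \<in> whole_space d"
      using ext(1,2,3) chg_norm(1)[OF f2] unfolding sobolev_osc_def sobolev_def weighted_fourier_def by blast
    then have V: "\<phi> \<in> half_space d" using ext(4) unfolding half_sobolev_osc_def by blast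
    note tr = fourier_trace_operator[OF V test_function_L12(2)[OF \<phi>t] admissible_test_function(2)[OF \<phi>t] half_space_eq_refl j]
    note nt = trace_symbol_test_function[OF \<phi>t j]
    have "AE z in Dm d. fourier T d (trace_operator d \<phi> j) z = fourier T d (normal_trace (Suc d) j \<phi>) z"
      using tr(1) nt(2) by eventually_elim (rule trans)
    from fourier_inj[OF tr(3) nt(1) this] show ?thesis unfolding diff_Suc_1 .
  qed
  show "AE z in Gm (Suc d - 1). trace_operator d (extension_operator d g) j z = g j z"
    if g: "g \<in> traces d" for g
  proof -
    let ?E = "extension_operator d g" and ?S = "extension_symbol d (boundary_symbol d g)"
    have E: "?E \<in> whole_space d" and ES: "AE \<zeta> in Dm (Suc d). fourier T (Suc d) ?E \<zeta> = ?S \<zeta>"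
      using L[OF g] by blast+
    note E2 = sobolev_oscD(2)[OF E]
    note tr = fourier_trace_operator[OF EV[OF g] E2 sobolev_osc_admissible(1)[OF E] half_space_eq_refl j]
    have "admissible d ?S" by (rule extension_symbol_L2(1)[OF boundary_symbol(1,2)[OF g]])
    then have Sm: "?S \<in> borel_measurable (Dm (Suc d))" unfolding admissible_def by (rule conjunct1)
    have gj: "L2 (Gm d) (g j)"
      using g j sobolev_oscD(2) unfolding trace_space_def mem_Collect_eq diff_Suc_1 by blast
    have "AE z in Dm d. fourier T d (trace_operator d ?E j) z = fourier T d (g j) z"
      using tr(1) trace_symbol_cong[OF fourier_measurable[OF E2] Sm ES, of j] boundary_symbol(3)[OF g j] AE_space
    proof eventually_elim
      case (elim z)
      show ?case unfolding elim(1,2) trace_symbol_extension[OF elim(4) j] by (rule elim(3))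
    qed
    from fourier_inj[OF tr(3) gj this] show ?thesis unfolding diff_Suc_1 .
  qed
qed

end

theorem theorem4p5:
  fixes T s2 :: real and n r1 r2 :: nat
  assumes "0 < T" and "1 \<le> n" and "r2 < r1" and "0 \<le> s2"
  shows "\<exists>Tr :: (point \<Rightarrow> complex) \<Rightarrow> nat \<Rightarrow> point \<Rightarrow> complex.
    bounded_linear_mod
      (half_sobolev_osc T n (chg_order r1 r2 s2)) (half_sobolev_norm T n (chg_order r1 r2 s2))
      (trace_space T n r1 r2 s2) (trace_norm T n r1 r2 s2) Tr \<and>
    (\<forall>\<phi>\<in>half_test_functions_osc T n. \<forall>j<r1.
      AE z in group_measure T (n - 1). Tr \<phi> j z = normal_trace n j \<phi> z) \<and>
    (\<exists>E :: (nat \<Rightarrow> point \<Rightarrow> complex) \<Rightarrow> point \<Rightarrow> complex.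
      bounded_linear_mod
        (trace_space T n r1 r2 s2) (trace_norm T n r1 r2 s2)
        (half_sobolev_osc T n (chg_order r1 r2 s2)) (half_sobolev_norm T n (chg_order r1 r2 s2)) E \<and>
      (\<forall>g\<in>trace_space T n r1 r2 s2. \<forall>j<r1.
        AE z in group_measure T (n - 1). Tr (E g) j z = g j z))"
proof -
  interpret trace_setting T s2 r1 r2 using assms by unfold_locales
  obtain d where "n = Suc d" using assms(2) by (cases n) auto
  then show ?thesis using trace_theorem[of d] by (simp only:)
qed

end
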